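(* Let $(\xi_i)_{i\ge 1}$ be independent identically distributed random variables in $\mathbb{R}^d$, $\xi_i\overset{\mathcal D}{=}\xi$, with zero mean and unit variance (covariance matrix equal to the identity), and assume $\mathbb{E}(|\xi|^{2p})<\infty$ for some real $p\ge 4$. For $n\ge 1$ and $t\in[0,1]$ let $$W^{(n)}_t=\frac{1}{n^{1/2}}\left(\xi_1+\dots+\xi_{[tn]}+(nt-[nt])\,\xi_{[nt]+1}\right).$$ Let $\varphi=(\varphi_1,\dots,\varphi_d)$ be a collection of $C^2_b$-bounded functions from $\mathbb{R}^d$ to $\mathbb{R}^e$. Then, as $n\to\infty$, $$\int_0^\cdot\varphi(W^{(n)})\,dW^{(n)}\implies\int_0^\cdot\varphi(B)\circ dB$$ weakly as processes in $C([0,1],\mathbb{R}^e)$ with the uniform topology, where $B$ is a standard $d$-dimensional Brownian motion started at $0$ and $\circ dB$ denotes Stratonovich integration.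
   Context: $[x]$ denotes the integer part of $x$. $\int\varphi(W)\,dW$ means $\sum_{i=1}^d\int\varphi_i(W)\,dW^{i}$, and similarly for $B$; for the piecewise linear path $W^{(n)}$ it is a Riemann–Stieltjes integral. "$C^2_b$-bounded" means twice continuously differentiable and bounded together with all partial derivatives up to order two. $X^n\implies X$ in a metric space $E$ denotes weak convergence: $\mathbb{E}f(X^n)\to\mathbb{E}f(X)$ for all bounded continuous $f:E\to\mathbb{R}$. *)

theory Defs
  imports "HOL-Probability.Probability"
begin

section \<open>Weak convergence in a metric space\<close>

definition metric_borel :: "'e metric \<Rightarrow> 'e measure" where
  "metric_borel E = sigma (mspace E) {U. openin (mtopology_of E) U}"

text \<open>
  Measurability with respect to the Borel sets is part of the definition; in particular the
  random elements take their values in \<open>mspace E\<close>, and the Bochner integrals are not junk values.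
\<close>

definition weakly_converges ::
  "'e metric \<Rightarrow> 'a measure \<Rightarrow> (nat \<Rightarrow> 'a \<Rightarrow> 'e) \<Rightarrow> 'b measure \<Rightarrow> ('b \<Rightarrow> 'e) \<Rightarrow> bool" where
  "weakly_converges E M X N Y \<longleftrightarrow>
     (\<forall>n. X n \<in> measurable M (metric_borel E)) \<and>
     Y \<in> measurable N (metric_borel E) \<and>
     (\<forall>F. continuous_map (mtopology_of E) euclideanreal F \<and> bounded (F ` mspace E) \<longrightarrow>
        (\<lambda>n. \<integral>\<omega>. F (X n \<omega>) \<partial>M) \<longlonglongrightarrow> (\<integral>\<omega>. F (Y \<omega>) \<partial>N))"

text \<open>
  The space \<open>C([0,1], \<real>\<^sup>e)\<close> with the supremum distance. Its elements are extensional functions, so a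
  path given on all of \<open>real\<close> has to be restricted to \<open>{0..1}\<close>; \<open>path_in_C\<close> does this for a process.
\<close>

abbreviation C_unit :: "(real \<Rightarrow> 'v::metric_space) metric" where
  "C_unit \<equiv> cfunspace (top_of_set {0..1}) euclidean_metric"

definition path_in_C :: "(real \<Rightarrow> 'a \<Rightarrow> 'v) \<Rightarrow> 'a \<Rightarrow> real \<Rightarrow> 'v" where
  "path_in_C Z \<omega> = (\<lambda>t\<in>{0..1}. Z t \<omega>)"


section \<open>Riemann--Stieltjes integrals\<close>

definition has_RS_integral ::
  "(real \<Rightarrow> 'v::real_normed_vector) \<Rightarrow> (real \<Rightarrow> real) \<Rightarrow> 'v \<Rightarrow> real \<Rightarrow> real \<Rightarrow> bool" where
  "has_RS_integral f g I a b \<longleftrightarrow>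
     (\<forall>\<epsilon>>0. \<exists>\<delta>>0. \<forall>p. p tagged_division_of {a..b} \<and> (\<forall>(x, K)\<in>p. Sup K - Inf K < \<delta>) \<longrightarrow>
        norm ((\<Sum>(x, K)\<in>p. (g (Sup K) - g (Inf K)) *\<^sub>R f x) - I) < \<epsilon>)"

definition RS_integral ::
  "real \<Rightarrow> real \<Rightarrow> (real \<Rightarrow> 'v::real_normed_vector) \<Rightarrow> (real \<Rightarrow> real) \<Rightarrow> 'v" where
  "RS_integral a b f g = (THE I. has_RS_integral f g I a b)"

lemma has_RS_integral_unique:
  assumes I: "has_RS_integral f g I a b" and J: "has_RS_integral f g J a b"
  shows "I = J"
proof (rule ccontr)
  assume "I \<noteq> J"
  define e where "e = norm (I - J) / 2"
  have "e > 0" using \<open>I \<noteq> J\<close> by (simp add: e_def)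
  let ?S = "\<lambda>p. \<Sum>(x, K)\<in>p. (g (Sup K) - g (Inf K)) *\<^sub>R f x"
  obtain d1 where d1: "d1 > 0" "\<And>p. p tagged_division_of {a..b} \<Longrightarrow>
      \<forall>(x, K)\<in>p. Sup K - Inf K < d1 \<Longrightarrow> norm (?S p - I) < e"
    using I \<open>e > 0\<close> unfolding has_RS_integral_def by meson
  obtain d2 where d2: "d2 > 0" "\<And>p. p tagged_division_of {a..b} \<Longrightarrow>
      \<forall>(x, K)\<in>p. Sup K - Inf K < d2 \<Longrightarrow> norm (?S p - J) < e"
    using J \<open>e > 0\<close> unfolding has_RS_integral_def by meson
  define d where "d = min d1 d2 / 2"
  have "d > 0" using d1(1) d2(1) by (simp add: d_def)
  then obtain p where p: "p tagged_division_of cbox a b" "(\<lambda>x. ball x d) fine p"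
    using fine_division_exists_real[of "\<lambda>x. ball x d" a b] by (auto simp: gauge_def)
  have small: "Sup K - Inf K < 2 * d" if xK: "(x, K) \<in> p" for x K
  proof -
    obtain u v where K: "K = {u..v}"
      using tagged_division_ofD(4)[OF p(1) xK] by auto
    have "x \<in> K" using tagged_division_ofD(2)[OF p(1) xK] .
    then have "u \<le> v" using K by auto
    have "K \<subseteq> ball x d" using p(2) xK by (auto simp: fine_def)
    then have "u \<in> ball x d" "v \<in> ball x d" using K \<open>u \<le> v\<close> by auto
    then show ?thesis using K \<open>u \<le> v\<close> by (auto simp: dist_real_def)
  qed
  have "norm (?S p - I) < e" "norm (?S p - J) < e"
    using d1(2)[of p] d2(2)[of p] p(1) small by (fastforce simp: d_def min_def split: if_splits)+
  then have "norm ((?S p - J) - (?S p - I)) < e + e"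
    using norm_triangle_ineq4[of "?S p - J" "?S p - I"] by linarith
  then show False by (simp add: e_def)
qed


section \<open>The rescaled, linearly interpolated random walk\<close>

definition interpolated_walk ::
  "(nat \<Rightarrow> 'a \<Rightarrow> 'v::real_vector) \<Rightarrow> nat \<Rightarrow> real \<Rightarrow> 'a \<Rightarrow> 'v" where
  "interpolated_walk \<xi> n t \<omega> = (1 / sqrt (real n)) *\<^sub>R
     ((\<Sum>i = 1..nat \<lfloor>real n * t\<rfloor>. \<xi> i \<omega>)
      + (real n * t - real_of_int \<lfloor>real n * t\<rfloor>) *\<^sub>R \<xi> (nat \<lfloor>real n * t\<rfloor> + 1) \<omega>)"

definition covariance_matrix :: "'a measure \<Rightarrow> ('a \<Rightarrow> real^'d) \<Rightarrow> real^'d^'d" where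
  "covariance_matrix M X =
     (\<chi> i j. \<integral>\<omega>. (X \<omega> $ i - (\<integral>\<omega>'. X \<omega>' $ i \<partial>M)) * (X \<omega> $ j - (\<integral>\<omega>'. X \<omega>' $ j \<partial>M)) \<partial>M)"


section \<open>Bounded twice continuously differentiable functions\<close>

text \<open>
  \<open>D i\<close> and \<open>D2 i j\<close> are forced to be the first and second order partial derivatives.
\<close>

definition C2_bounded :: "(real^'d \<Rightarrow> real^'e) \<Rightarrow> bool" where
  "C2_bounded f \<longleftrightarrow>
     (\<exists>(D :: 'd \<Rightarrow> real^'d \<Rightarrow> real^'e) (D2 :: 'd \<Rightarrow> 'd \<Rightarrow> real^'d \<Rightarrow> real^'e).
        (\<forall>x. (f has_derivative (\<lambda>h. \<Sum>i\<in>UNIV. h $ i *\<^sub>R D i x)) (at x)) \<and>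
        (\<forall>i x. (D i has_derivative (\<lambda>h. \<Sum>j\<in>UNIV. h $ j *\<^sub>R D2 i j x)) (at x)) \<and>
        (\<forall>i j. continuous_on UNIV (D2 i j)) \<and>
        bounded (range f) \<and> (\<forall>i. bounded (range (D i))) \<and> (\<forall>i j. bounded (range (D2 i j))))"


section \<open>Brownian motion and the Stratonovich integral\<close>

text \<open>
  Standard Brownian motion started at \<open>0\<close>, with time set \<open>T\<close>. The product of normal densities below
  is the density of the centred Gaussian law with covariance \<open>(t - s) *\<^sub>R mat 1\<close>; the second argument
  of \<open>normal_density\<close> is the standard deviation.
\<close>

definition brownian_motion :: "'b measure \<Rightarrow> real set \<Rightarrow> (real \<Rightarrow> 'b \<Rightarrow> real^'d) \<Rightarrow> bool" where
  "brownian_motion N T B \<longleftrightarrow>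
     prob_space N \<and>
     (\<forall>t\<in>T. B t \<in> borel_measurable N) \<and>
     (AE \<omega> in N. B 0 \<omega> = 0) \<and>
     (AE \<omega> in N. continuous_on T (\<lambda>t. B t \<omega>)) \<and>
     (\<forall>n t. (\<forall>k\<le>n. t k \<in> T) \<and> (\<forall>k<n. t k < t (Suc k)) \<longrightarrow>
        prob_space.indep_vars N (\<lambda>_. borel)
          (\<lambda>(k::nat) \<omega>. B (t (Suc k)) \<omega> - B (t k) \<omega>) {..<n}) \<and>
     (\<forall>s\<in>T. \<forall>t\<in>T. s < t \<longrightarrow>
        distributed N lborel (\<lambda>\<omega>. B t \<omega> - B s \<omega>)
          (\<lambda>x. ennreal (\<Prod>i\<in>UNIV. normal_density 0 (sqrt (t - s)) (x $ i))))"

text \<open>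
  \<open>J\<close> is a continuous version, on the time interval \<open>[0,1]\<close>, of the Stratonovich integral of \<open>Y\<close> with
  respect to the scalar process \<open>X\<close>: at each time, the limit in probability of the symmetric
  (trapezoidal) Riemann sums as the mesh of the partition tends to \<open>0\<close>.
\<close>

definition stratonovich_sum ::
  "(real \<Rightarrow> 'b \<Rightarrow> 'v::real_vector) \<Rightarrow> (real \<Rightarrow> 'b \<Rightarrow> real) \<Rightarrow> real set set \<Rightarrow> 'b \<Rightarrow> 'v" where
  "stratonovich_sum Y X \<D> \<omega> =
     (\<Sum>K\<in>\<D>. (X (Sup K) \<omega> - X (Inf K) \<omega>) *\<^sub>R ((1 / 2) *\<^sub>R (Y (Inf K) \<omega> + Y (Sup K) \<omega>)))"

definition stratonovich_integral ::
  "'b measure \<Rightarrow> (real \<Rightarrow> 'b \<Rightarrow> real^'e) \<Rightarrow> (real \<Rightarrow> 'b \<Rightarrow> real) \<Rightarrow> (real \<Rightarrow> 'b \<Rightarrow> real^'e) \<Rightarrow> bool" where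
  "stratonovich_integral N Y X J \<longleftrightarrow>
     (\<forall>\<omega>\<in>space N. continuous_on {0..1} (\<lambda>t. J t \<omega>)) \<and>
     (\<forall>t\<in>{0..1}. J t \<in> borel_measurable N \<and>
        (\<forall>\<epsilon>>0. \<forall>\<eta>>0. \<exists>\<delta>>0. \<forall>\<D>. \<D> division_of {0..t} \<and> (\<forall>K\<in>\<D>. Sup K - Inf K < \<delta>) \<longrightarrow>
           measure N {\<omega>\<in>space N. norm (stratonovich_sum Y X \<D> \<omega> - J t \<omega>) > \<epsilon>} < \<eta>))"

end

theory Submission
  imports Defs
begin

text \<open>
  By a portmanteau argument it is enough to test against bounded Lipschitz functions of the path. On each
  step of the walk the Riemann--Stieltjes integral is, up to a second-order remainder, the Ito term
  plus half of \<open>\<Sum>i l. \<partial>\<^sub>l \<phi>\<^sub>i (\<eta> i) (\<eta> l)\<close>; replacing the products of the steps by their covariance, which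
  is an orthogonality estimate, shows that for fixed \<open>m\<close> the integral at the times \<open>r / m\<close> is within
  \<open>O(1 / sqrt m)\<close> in probability, uniformly in the number of steps, of the trapezoidal sum over the coarse
  grid of mesh \<open>1 / m\<close>. A fourth-moment maximal inequality for martingale transforms controls the
  oscillation between grid points. The trapezoidal sum is a continuous function of finitely many
  increments of the walk, which Lindeberg's replacement argument compares with those of \<open>B\<close>, and the
  trapezoidal sums of \<open>B\<close> converge to the Stratonovich integral by definition.
\<close>

section \<open>Weak convergence through bounded Lipschitz functions\<close>

text \<open>The delicate point is the order of the choices. Given an error for a Lipschitz
  functional, a number \<open>m\<close> of cells is fixed so that paths may be replaced by their
  linear interpolations; then a refinement \<open>m * p\<close>, so fine that trapezoidal sums are
  close to the integrals at all times \<open>j / m\<close>; only then does the number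
  \<open>n\<close> of steps tend to infinity. Every estimate for the walk must therefore be uniform
  in \<open>n\<close>. This is why the integral along single steps and the trapezoidal sum over
  blocks are not compared directly: each is compared with the Ito sum plus correction on its own
  grid, and these two corrected sums differ by a martingale transform with small coefficients and a
  small drift. All stochastic estimates concern the walk. For \<open>B\<close> the proof draws on
  the law and independence of the increments, on continuity and on the starting point. Fourth
  moments enter because they give each of the \<open>m\<close> cells a bad event of probability of
  order \<open>1 / m ^ 2\<close>, so that a union bound over the cells still tends to 0.\<close>

definition lipschitz_real :: "'e metric \<Rightarrow> real \<Rightarrow> ('e \<Rightarrow> real) \<Rightarrow> bool" where
  "lipschitz_real E k F \<longleftrightarrow> (\<forall>x\<in>mspace E. \<forall>y\<in>mspace E. \<bar>F x - F y\<bar> \<le> k * mdist E x y)"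

lemma space_metric_borel [simp]: "space (metric_borel E) = mspace E"
  by (simp add: metric_borel_def space_measure_of_conv)

lemma openin_mtopology_of_subset: "openin (mtopology_of E) U \<Longrightarrow> U \<subseteq> mspace E"
  using openin_subset by fastforce

lemma openin_mtopology_of_iff:
  "openin (mtopology_of E) U \<longleftrightarrow>
     U \<subseteq> mspace E \<and> (\<forall>x\<in>U. \<exists>r>0. \<forall>y\<in>mspace E. mdist E x y < r \<longrightarrow> y \<in> U)"
proof -
  interpret Metric_space "mspace E" "mdist E" by (rule Metric_space_mspace_mdist)
  show ?thesis
    unfolding mtopology_of_def openin_mtopology subset_iff in_mball
    by (intro conj_cong refl) (simp only: Ball_def, meson)
qed

lemma sets_metric_borel_openin:
  "openin (mtopology_of E) U \<Longrightarrow> U \<in> sets (metric_borel E)"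
  unfolding metric_borel_def
  by (subst sets_measure_of) (auto dest: openin_mtopology_of_subset)

lemma measurable_metric_borelI:
  assumes "\<And>\<omega>. \<omega> \<in> space M \<Longrightarrow> X \<omega> \<in> mspace E"
    and "\<And>U. openin (mtopology_of E) U \<Longrightarrow> X -` U \<inter> space M \<in> sets M"
  shows "X \<in> measurable M (metric_borel E)"
  unfolding metric_borel_def
  by (rule measurable_measure_of) (use assms openin_mtopology_of_subset[of E] in auto)

lemma continuous_map_metric_borel_measurable:
  assumes "continuous_map (mtopology_of E) euclideanreal F"
  shows "F \<in> borel_measurable (metric_borel E)"
proof (rule borel_measurableI)
  fix S :: "real set" assume "open S"
  then have "openin (mtopology_of E) {x \<in> topspace (mtopology_of E). F x \<in> S}"
    by (intro openin_continuous_map_preimage[OF assms]) auto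
  moreover have "{x \<in> topspace (mtopology_of E). F x \<in> S} = F -` S \<inter> space (metric_borel E)"
    by auto
  ultimately show "F -` S \<inter> space (metric_borel E) \<in> sets (metric_borel E)"
    using sets_metric_borel_openin by metis
qed

lemma continuous_map_metric_lower:
  assumes F: "continuous_map (mtopology_of E) euclideanreal F" and x: "x \<in> mspace E" and "e > 0"
  shows "\<exists>r>0. \<forall>y\<in>mspace E. mdist E x y < r \<longrightarrow> F y > F x - e"
proof -
  have "openin (mtopology_of E) {y \<in> topspace (mtopology_of E). F y \<in> {F x - e<..}}"
    by (intro openin_continuous_map_preimage[OF F]) auto
  then have "\<exists>r>0. \<forall>y\<in>mspace E. mdist E x y < r
      \<longrightarrow> y \<in> {y \<in> topspace (mtopology_of E). F y \<in> {F x - e<..}}"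
    using x \<open>e > 0\<close> unfolding openin_mtopology_of_iff by auto
  then show ?thesis by auto
qed

lemma lipschitz_real_continuous_map:
  assumes "lipschitz_real E k F"
  shows "continuous_map (mtopology_of E) euclideanreal F"
  unfolding continuous_map_def
proof (intro conjI allI impI)
  fix U assume "openin euclideanreal U"
  then have U: "open U" by simp
  show "openin (mtopology_of E) {x \<in> topspace (mtopology_of E). F x \<in> U}"
    unfolding openin_mtopology_of_iff
  proof (intro conjI ballI)
    fix x assume "x \<in> {x \<in> topspace (mtopology_of E). F x \<in> U}"
    then have x: "x \<in> mspace E" "F x \<in> U" by auto
    then obtain e where e: "e > 0" "\<And>z. \<bar>z - F x\<bar> < e \<Longrightarrow> z \<in> U"
      using U by (auto simp: open_dist dist_real_def)
    \<comment> \<open>The sign of \<open>k\<close> is not fixed here; the absolute value and the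
      added 1 keep the radius positive.\<close>
    have "y \<in> {x \<in> topspace (mtopology_of E). F x \<in> U}"
      if y: "y \<in> mspace E" "mdist E x y < e / (\<bar>k\<bar> + 1)" for y
    proof -
      have "\<bar>F x - F y\<bar> \<le> k * mdist E x y" using assms x(1) y(1) unfolding lipschitz_real_def by blast
      also have "\<dots> \<le> (\<bar>k\<bar> + 1) * mdist E x y" by (intro mult_right_mono) auto
      also have "\<dots> < e" using y(2) by (simp add: field_simps)
      finally have "\<bar>F y - F x\<bar> < e" by (simp add: abs_minus_commute)
      then show ?thesis using e(2) y(1) by simp
    qed
    moreover have "e / (\<bar>k\<bar> + 1) > 0" using e(1) by simp
    ultimately show "\<exists>r>0. \<forall>y\<in>mspace E. mdist E x y < r
        \<longrightarrow> y \<in> {x \<in> topspace (mtopology_of E). F x \<in> U}" by blast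
  qed auto
qed auto

text \<open>The Pasch-Hausdorff envelope. For bounded \<open>F\<close> and \<open>k \<ge> 0\<close>
  it is the largest \<open>k\<close>-Lipschitz minorant of \<open>F\<close>, and so approximates
  \<open>F\<close> from below.\<close>

definition inf_convolution :: "'e metric \<Rightarrow> ('e \<Rightarrow> real) \<Rightarrow> real \<Rightarrow> 'e \<Rightarrow> real" where
  "inf_convolution E F k x = (INF y\<in>mspace E. F y + k * mdist E x y)"

context
  fixes E :: "'e metric" and F :: "'e \<Rightarrow> real" and C :: real
  assumes bound: "\<And>x. x \<in> mspace E \<Longrightarrow> \<bar>F x\<bar> \<le> C"
begin

lemma inf_convolution_bdd_below:
  assumes "k \<ge> 0"
  shows "bdd_below ((\<lambda>y. F y + k * mdist E x y) ` mspace E)"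
proof (rule bdd_belowI2[of _ "- C"])
  fix y assume "y \<in> mspace E"
  then have "- C \<le> F y" using bound[of y] by linarith
  moreover have "0 \<le> k * mdist E x y" using assms by simp
  ultimately show "- C \<le> F y + k * mdist E x y" by linarith
qed

lemma inf_convolution_le:
  assumes "k \<ge> 0" "x \<in> mspace E"
  shows "inf_convolution E F k x \<le> F x"
  using cINF_lower[OF inf_convolution_bdd_below[OF assms(1), of x] assms(2)]
    mdist_zero[OF assms(2) assms(2)]
  by (simp add: inf_convolution_def)

lemma inf_convolution_abs_le:
  assumes "k \<ge> 0" "x \<in> mspace E"
  shows "\<bar>inf_convolution E F k x\<bar> \<le> C"
proof -
  have "- C \<le> F y + k * mdist E x y" if "y \<in> mspace E" for y
  proof -
    have "- C \<le> F y" using bound[OF that] by linarith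
    moreover have "0 \<le> k * mdist E x y" using assms by simp
    ultimately show ?thesis by linarith
  qed
  then have "- C \<le> inf_convolution E F k x"
    unfolding inf_convolution_def using assms(2) by (intro cINF_greatest) auto
  then show ?thesis using inf_convolution_le[OF assms] bound[OF assms(2)] by linarith
qed

text \<open>By the triangle inequality each competitor \<open>y\<close> gives a
  \<open>k\<close>-Lipschitz function of \<open>x\<close>, and the infimum inherits the
  constant.\<close>

lemma inf_convolution_lipschitz:
  assumes "k \<ge> 0"
  shows "lipschitz_real E k (inf_convolution E F k)"
proof -
  have *: "inf_convolution E F k x \<le> inf_convolution E F k z + k * mdist E x z"
    if x: "x \<in> mspace E" and z: "z \<in> mspace E" for x z
  proof -
    have "inf_convolution E F k x - k * mdist E x z \<le> F y + k * mdist E z y"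
      if y: "y \<in> mspace E" for y
    proof -
      have "inf_convolution E F k x \<le> F y + k * mdist E x y"
        unfolding inf_convolution_def by (rule cINF_lower[OF inf_convolution_bdd_below[OF assms] y])
      also have "k * mdist E x y \<le> k * (mdist E x z + mdist E z y)"
        by (intro mult_left_mono mdist_triangle assms x y z)
      finally show ?thesis by (simp add: algebra_simps)
    qed
    then have "inf_convolution E F k x - k * mdist E x z \<le> inf_convolution E F k z"
      unfolding inf_convolution_def[of _ _ _ z] using x by (intro cINF_greatest) auto
    then show ?thesis by simp
  qed
  show ?thesis unfolding lipschitz_real_def
    using * by (smt (verit) mdist_commute)
qed

text \<open>A competitor at distance at least \<open>r\<close> pays a penalty of at least
  \<open>k * r\<close>, which for large \<open>k\<close> exceeds the oscillation
  \<open>2 * C\<close>. Hence the infimum is decided inside the ball, where \<open>F\<close> is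
  almost as large as at \<open>x\<close>. Lower semicontinuity at \<open>x\<close> is the right
  hypothesis because the lemma also serves for indicators of open sets.\<close>

lemma inf_convolution_tendsto:
  assumes x: "x \<in> mspace E"
    and lsc: "\<And>e. e > 0 \<Longrightarrow> \<exists>r>0. \<forall>y\<in>mspace E. mdist E x y < r \<longrightarrow> F y > F x - e"
  shows "(\<lambda>k. inf_convolution E F (real k) x) \<longlonglongrightarrow> F x"
proof (rule LIMSEQ_I)
  fix e :: real assume "e > 0"
  then obtain r where r: "r > 0" "\<And>y. y \<in> mspace E \<Longrightarrow> mdist E x y < r \<Longrightarrow> F y > F x - e / 2"
    using lsc[of "e / 2"] by auto
  obtain K :: nat where K: "2 * C / r < real K" using reals_Archimedean2 by blast
  have "norm (inf_convolution E F (real k) x - F x) < e" if "k \<ge> K" for k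
  proof -
    have "F x - e / 2 \<le> F y + k * mdist E x y" if y: "y \<in> mspace E" for y
    proof (cases "mdist E x y < r")
      case True
      then show ?thesis using r(2)[OF y] by (smt (verit) mdist_nonneg mult_nonneg_nonneg of_nat_0_le_iff)
    next
      case False
      have "2 * C \<le> K * r" using K r(1) by (simp add: field_simps)
      also have "\<dots> \<le> k * mdist E x y" using False \<open>k \<ge> K\<close> r(1) by (intro mult_mono) auto
      finally have "2 * C \<le> k * mdist E x y" .
      then show ?thesis using bound[OF x] bound[OF y] \<open>e > 0\<close> by linarith
    qed
    then have "F x - e / 2 \<le> inf_convolution E F (real k) x"
      unfolding inf_convolution_def using x by (intro cINF_greatest) auto
    then show ?thesis using inf_convolution_le[OF _ x, of "real k"] \<open>e > 0\<close> by simp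
  qed
  then show "\<exists>K. \<forall>k\<ge>K. norm (inf_convolution E F (real k) x - F x) < e" by blast
qed

end

text \<open>The indicator of an open set is lower semicontinuous, hence the pointwise limit of its
  Lipschitz envelopes. Measurability thus has to be checked for Lipschitz functionals only, which in
  the path space can be done by interpolation.\<close>

lemma measurable_metric_borel_lipschitz:
  assumes X: "\<And>\<omega>. \<omega> \<in> space M \<Longrightarrow> X \<omega> \<in> mspace E"
    and lip: "\<And>F k C. \<lbrakk>lipschitz_real E k F; k \<ge> 0; \<And>x. x \<in> mspace E \<Longrightarrow> \<bar>F x\<bar> \<le> C\<rbrakk>
        \<Longrightarrow> (\<lambda>\<omega>. F (X \<omega>)) \<in> borel_measurable M"
  shows "X \<in> measurable M (metric_borel E)"
proof (rule measurable_metric_borelI[OF X])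
  fix U assume U: "openin (mtopology_of E) U"
  define F :: "'b \<Rightarrow> real" where "F = indicator U"
  have bound: "\<And>x. x \<in> mspace E \<Longrightarrow> \<bar>F x\<bar> \<le> 1" by (simp add: F_def indicator_def)
  note conv = inf_convolution_lipschitz[where F=F, OF bound] inf_convolution_abs_le[where F=F, OF bound]
  have meas: "(\<lambda>\<omega>. inf_convolution E F (real k) (X \<omega>)) \<in> borel_measurable M" for k :: nat
    by (rule lip[of "real k" _ 1]) (use conv in auto)
  have lim: "(\<lambda>k. inf_convolution E F (real k) (X \<omega>)) \<longlonglongrightarrow> F (X \<omega>)"
    if "\<omega> \<in> space M" for \<omega>
  proof (rule inf_convolution_tendsto[OF bound X[OF that]])
    fix e :: real assume "e > 0"
    show "\<exists>r>0. \<forall>y\<in>mspace E. mdist E (X \<omega>) y < r \<longrightarrow> F (X \<omega>) - e < F y"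
    proof (cases "X \<omega> \<in> U")
      case True
      then obtain r where "r > 0" "\<forall>y\<in>mspace E. mdist E (X \<omega>) y < r \<longrightarrow> y \<in> U"
        using U unfolding openin_mtopology_of_iff by blast
      then show ?thesis using \<open>e > 0\<close> True by (intro exI[of _ r]) (auto simp: F_def)
    next
      case False
      then show ?thesis using \<open>e > 0\<close> by (intro exI[of _ 1]) (auto simp: F_def indicator_def)
    qed
  qed auto
  have "(\<lambda>\<omega>. F (X \<omega>)) \<in> borel_measurable M"
    by (rule borel_measurable_LIMSEQ_real[OF lim meas])
  then have "(\<lambda>\<omega>. F (X \<omega>)) -` {0<..} \<inter> space M \<in> sets M" by (rule measurable_sets) simp
  moreover have "(\<lambda>\<omega>. F (X \<omega>)) -` {0<..} \<inter> space M = X -` U \<inter> space M"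
    by (auto simp: F_def indicator_def)
  ultimately show "X -` U \<inter> space M \<in> sets M" by simp
qed

text \<open>Envelopes lie below \<open>F\<close>, so they control only the lower limit of the
  expectations: one envelope has almost the full expectation under \<open>Y\<close>, and its
  convergence pushes up that of \<open>F\<close>. The upper limit follows by applying this to
  \<open>- F\<close>.\<close>

lemma weakly_converges_lipschitz:
  assumes "prob_space M" "prob_space N"
    and X: "\<And>n. X n \<in> measurable M (metric_borel E)"
    and Y: "Y \<in> measurable N (metric_borel E)"
    and lip: "\<And>F k C. \<lbrakk>lipschitz_real E k F; k \<ge> 0; \<And>x. x \<in> mspace E \<Longrightarrow> \<bar>F x\<bar> \<le> C\<rbrakk>
        \<Longrightarrow> (\<lambda>n. \<integral>\<omega>. F (X n \<omega>) \<partial>M) \<longlonglongrightarrow> (\<integral>\<omega>. F (Y \<omega>) \<partial>N)"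
  shows "weakly_converges E M X N Y"
proof -
  interpret M: prob_space M by fact
  interpret N: prob_space N by fact
  note Xsp = measurable_space[OF X, unfolded space_metric_borel]
  note Ysp = measurable_space[OF Y, unfolded space_metric_borel]
  have lower: "\<forall>\<^sub>F n in sequentially. (\<integral>\<omega>. F (X n \<omega>) \<partial>M) > (\<integral>\<omega>. F (Y \<omega>) \<partial>N) - e"
    if F: "continuous_map (mtopology_of E) euclideanreal F" and "bounded (F ` mspace E)" and "e > 0"
    for F e
  proof -
    obtain C where C: "\<And>x. x \<in> mspace E \<Longrightarrow> \<bar>F x\<bar> \<le> C"
      using \<open>bounded (F ` mspace E)\<close> by (auto simp: bounded_iff)
    let ?G = "\<lambda>k::nat. inf_convolution E F (real k)"
    note F_meas = continuous_map_metric_borel_measurable[OF F]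
    have G_meas: "?G k \<in> borel_measurable (metric_borel E)" for k
      by (rule continuous_map_metric_borel_measurable
            [OF lipschitz_real_continuous_map[OF inf_convolution_lipschitz[where F=F, OF C]]]) auto
    have "(\<lambda>k. \<integral>\<omega>. ?G k (Y \<omega>) \<partial>N) \<longlonglongrightarrow> (\<integral>\<omega>. F (Y \<omega>) \<partial>N)"
    proof (rule integral_dominated_convergence[where w="\<lambda>_. C"])
      show "AE \<omega> in N. (\<lambda>k. ?G k (Y \<omega>)) \<longlonglongrightarrow> F (Y \<omega>)"
        using Ysp by (intro AE_I2 inf_convolution_tendsto[OF C] continuous_map_metric_lower[OF F]) auto
      show "AE \<omega> in N. norm (?G k (Y \<omega>)) \<le> C" for k
        using Ysp inf_convolution_abs_le[where F=F, OF C] by (intro AE_I2) auto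
    qed (use measurable_compose[OF Y] F_meas G_meas in auto)
    then have "\<forall>\<^sub>F k in sequentially. (\<integral>\<omega>. ?G k (Y \<omega>) \<partial>N) > (\<integral>\<omega>. F (Y \<omega>) \<partial>N) - e"
      by (rule order_tendstoD) (use \<open>e > 0\<close> in simp)
    then obtain k where k: "(\<integral>\<omega>. ?G k (Y \<omega>) \<partial>N) > (\<integral>\<omega>. F (Y \<omega>) \<partial>N) - e"
      by (auto simp: eventually_sequentially)
    have "(\<lambda>n. \<integral>\<omega>. ?G k (X n \<omega>) \<partial>M) \<longlonglongrightarrow> (\<integral>\<omega>. ?G k (Y \<omega>) \<partial>N)"
      by (rule lip[of "real k" _ C])
        (use inf_convolution_lipschitz[where F=F, OF C] inf_convolution_abs_le[where F=F, OF C] in auto)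
    then have "\<forall>\<^sub>F n in sequentially. (\<integral>\<omega>. ?G k (X n \<omega>) \<partial>M) > (\<integral>\<omega>. F (Y \<omega>) \<partial>N) - e"
      by (rule order_tendstoD) (use k in simp)
    moreover have "(\<integral>\<omega>. ?G k (X n \<omega>) \<partial>M) \<le> (\<integral>\<omega>. F (X n \<omega>) \<partial>M)" for n
    proof (rule integral_mono)
      show "integrable M (\<lambda>\<omega>. ?G k (X n \<omega>))"
        by (rule M.integrable_const_bound[where B=C])
          (use Xsp inf_convolution_abs_le[where F=F, OF C] measurable_compose[OF X G_meas] in auto)
      show "integrable M (\<lambda>\<omega>. F (X n \<omega>))"
        by (rule M.integrable_const_bound[where B=C])
          (use Xsp C measurable_compose[OF X F_meas] in auto)
      show "?G k (X n \<omega>) \<le> F (X n \<omega>)" if "\<omega> \<in> space M" for \<omega>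
        using inf_convolution_le[where F=F, OF C _ Xsp[OF that]] by simp
    qed
    ultimately show ?thesis by (elim eventually_mono) (meson less_le_trans)
  qed
  have "(\<lambda>n. \<integral>\<omega>. F (X n \<omega>) \<partial>M) \<longlonglongrightarrow> (\<integral>\<omega>. F (Y \<omega>) \<partial>N)"
    if F: "continuous_map (mtopology_of E) euclideanreal F" and b: "bounded (F ` mspace E)" for F
  proof (rule order_tendstoI)
    fix a assume "a < (\<integral>\<omega>. F (Y \<omega>) \<partial>N)"
    then show "\<forall>\<^sub>F n in sequentially. a < (\<integral>\<omega>. F (X n \<omega>) \<partial>M)"
      using lower[OF F b, of "(\<integral>\<omega>. F (Y \<omega>) \<partial>N) - a"] by simp
  next
    fix a assume a: "(\<integral>\<omega>. F (Y \<omega>) \<partial>N) < a"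
    have "continuous_map (mtopology_of E) euclideanreal (\<lambda>x. - F x)"
      using F by (rule continuous_map_minus)
    moreover have "bounded ((\<lambda>x. - F x) ` mspace E)" using b by (auto simp: bounded_iff)
    ultimately show "\<forall>\<^sub>F n in sequentially. (\<integral>\<omega>. F (X n \<omega>) \<partial>M) < a"
      using lower[of "\<lambda>x. - F x" "a - (\<integral>\<omega>. F (Y \<omega>) \<partial>N)"] a by simp
  qed
  then show ?thesis using X Y unfolding weakly_converges_def by blast
qed

section \<open>Piecewise linear interpolation\<close>

definition ramp :: "real \<Rightarrow> real" where
  "ramp x = max 0 (min 1 x)"

text \<open>Linear interpolation of \<open>v\<close> at the times \<open>j / m\<close>. Writing it
  as one sum of ramps, and not cell by cell, lets continuity, measurability and integration against
  the path be treated term by term.\<close>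

definition pl :: "nat \<Rightarrow> (nat \<Rightarrow> 'v::real_normed_vector) \<Rightarrow> real \<Rightarrow> 'v" where
  "pl m v t = v 0 + (\<Sum>j<m. ramp (real m * t - real j) *\<^sub>R (v (Suc j) - v j))"

lemma grid_locate:
  assumes "m > 0" "0 \<le> t" "t \<le> 1"
  obtains j where "j < m" "real j / real m \<le> t" "t \<le> real (Suc j) / real m"
proof (cases "t = 1")
  case True
  \<comment> \<open>At \<open>t = 1\<close> the floor would give the index \<open>m\<close>, which
    is no cell; the right end point belongs to the last cell.\<close>
  then show ?thesis using assms by (intro that[of "m - 1"]) (auto simp: field_simps of_nat_diff)
next
  case False
  define j where "j = nat \<lfloor>real m * t\<rfloor>"
  have j: "real j \<le> real m * t" "real m * t < real j + 1"
    using assms unfolding j_def by (auto simp: of_nat_nat)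
  have "real m * t < real m" using assms False by simp
  then have "j < m" using j(1) by linarith
  then show ?thesis using j assms by (intro that[of j]) (auto simp: field_simps)
qed

text \<open>Ramps of earlier cells have reached 1 and telescope to \<open>v j\<close>; those of
  later cells are still 0.\<close>

lemma pl_on_cell:
  assumes "j < m" "real j / real m \<le> t" "t \<le> real (Suc j) / real m"
  shows "pl m v t = v j + (real m * t - real j) *\<^sub>R (v (Suc j) - v j)"
proof -
  have m: "real m > 0" using assms(1) by simp
  have t: "real j \<le> real m * t" "real m * t \<le> real j + 1"
    using assms m by (auto simp: field_simps)
  have split: "{..<m} = {..<j} \<union> {j} \<union> {Suc j..<m}" using assms(1) by auto
  have 1: "(\<Sum>i<j. ramp (real m * t - real i) *\<^sub>R (v (Suc i) - v i)) = (\<Sum>i<j. v (Suc i) - v i)"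
  proof (rule sum.cong[OF refl])
    fix i assume "i \<in> {..<j}"
    then have "real i + 1 \<le> real j" by simp
    then show "ramp (real m * t - real i) *\<^sub>R (v (Suc i) - v i) = v (Suc i) - v i"
      using t by (simp add: ramp_def min_def max_def)
  qed
  have 2: "(\<Sum>i\<in>{Suc j..<m}. ramp (real m * t - real i) *\<^sub>R (v (Suc i) - v i)) = 0"
  proof (rule sum.neutral, intro ballI)
    fix i assume "i \<in> {Suc j..<m}"
    then have "real j + 1 \<le> real i" by simp
    then show "ramp (real m * t - real i) *\<^sub>R (v (Suc i) - v i) = 0"
      using t by (simp add: ramp_def min_def max_def)
  qed
  have 3: "ramp (real m * t - real j) = real m * t - real j" using t by (simp add: ramp_def)
  show ?thesis unfolding pl_def split
    by (subst sum.union_disjoint; (subst sum.union_disjoint)?; (auto simp: 1 2 3 sum_lessThan_telescope)?)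
qed

lemma pl_grid:
  assumes "j \<le> m"
  shows "pl m v (real j / real m) = v j"
proof (cases "j = 0")
  case True
  then show ?thesis by (simp add: pl_def ramp_def)
next
  case False
  then show ?thesis
    using assms by (subst pl_on_cell[of "j - 1"]) (auto simp: field_simps of_nat_diff)
qed

lemma continuous_on_ramp [continuous_intros]:
  "continuous_on S f \<Longrightarrow> continuous_on S (\<lambda>x. ramp (f x))"
  unfolding ramp_def by (intro continuous_intros)

lemma continuous_on_pl: "continuous_on S (pl m v)"
  unfolding pl_def by (intro continuous_intros)

text \<open>On a cell both paths are the same convex combination of their two neighbouring grid
  values.\<close>

lemma pl_norm_le:
  assumes "m > 0" "0 \<le> t" "t \<le> 1" "\<And>j. j \<le> m \<Longrightarrow> norm (v j - w j) \<le> e"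
  shows "norm (pl m v t - pl m w t) \<le> e"
proof -
  obtain j where j: "j < m" "real j / real m \<le> t" "t \<le> real (Suc j) / real m"
    using grid_locate assms(1-3) by blast
  define \<theta> where "\<theta> = real m * t - real j"
  have \<theta>: "0 \<le> \<theta>" "\<theta> \<le> 1" using j assms(1) by (auto simp: \<theta>_def field_simps)
  have "pl m v t - pl m w t = (1 - \<theta>) *\<^sub>R (v j - w j) + \<theta> *\<^sub>R (v (Suc j) - w (Suc j))"
    unfolding pl_on_cell[OF j] \<theta>_def[symmetric] by (simp add: algebra_simps)
  also have "norm \<dots> \<le> (1 - \<theta>) * e + \<theta> * e"
    using \<theta> assms(4)[of j] assms(4)[of "Suc j"] j(1)
    by (intro norm_triangle_le add_mono) (auto intro!: mult_left_mono)
  finally show ?thesis by (simp add: algebra_simps)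
qed

section \<open>Interpolated paths as elements of the path space\<close>

abbreviation pl_C :: "nat \<Rightarrow> (nat \<Rightarrow> 'v::real_normed_vector) \<Rightarrow> real \<Rightarrow> 'v" where
  "pl_C m v \<equiv> restrict (pl m v) {0..1}"

lemma C_unitI:
  fixes z :: "real \<Rightarrow> 'v::real_normed_vector"
  assumes "continuous_on {0..1} z"
  shows "restrict z {0..1} \<in> mspace C_unit"
proof -
  have c: "continuous_on {0..1} (restrict z {0..1})" using assms by (subst continuous_on_cong[OF refl, of _ _ z]) auto
  have "compact (restrict z {0..1} ` {0..1})" using c by (rule compact_continuous_image) simp
  then show ?thesis using c
    by (auto dest: compact_imp_bounded simp: Metric_space.mbounded_def mtopology_of_def)
qed

lemma C_unit_mdist_le:
  fixes z w :: "real \<Rightarrow> 'v::real_normed_vector"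
  assumes "\<And>t. 0 \<le> t \<Longrightarrow> t \<le> 1 \<Longrightarrow> norm (z t - w t) \<le> e"
  shows "mdist C_unit (restrict z {0..1}) (restrict w {0..1}) \<le> e"
proof -
  have "0 \<le> e" using assms[of 0] norm_ge_zero by (metis order_trans order_refl zero_le_one)
  then show ?thesis by (intro mdist_cfunspace_le) (auto simp: assms dist_norm)
qed

text \<open>The path depends on the entries up to \<open>m\<close> alone, so a finite sum of norms
  controls the distance. Continuity for the product topology on sequences is what the later
  approximation by smooth functions requires.\<close>

lemma continuous_on_lipschitz_pl_C:
  fixes F :: "(real \<Rightarrow> 'v::real_normed_vector) \<Rightarrow> real"
  assumes "lipschitz_real C_unit k F" "k \<ge> 0" "m > 0"
  shows "continuous_on UNIV (\<lambda>v. F (pl_C m v))"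
proof -
  have le: "norm (F (pl_C m v) - F (pl_C m w)) \<le> k * (\<Sum>j\<le>m. norm (v j - w j))"
    for v w :: "nat \<Rightarrow> 'v"
  proof -
    have "\<bar>F (pl_C m v) - F (pl_C m w)\<bar> \<le> k * mdist C_unit (pl_C m v) (pl_C m w)"
      using assms(1) C_unitI[OF continuous_on_pl] unfolding lipschitz_real_def by blast
    also have "\<dots> \<le> k * (\<Sum>j\<le>m. norm (v j - w j))"
    proof (intro mult_left_mono assms(2) C_unit_mdist_le pl_norm_le assms(3))
      fix j assume "j \<le> m"
      then show "norm (v j - w j) \<le> (\<Sum>j\<le>m. norm (v j - w j))"
        by (intro member_le_sum) auto
    qed
    finally show ?thesis by simp
  qed
  have "((\<lambda>v. F (pl_C m v)) \<longlongrightarrow> F (pl_C m w)) (at w)" for w :: "nat \<Rightarrow> 'v"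
  proof -
    have "continuous_on UNIV (\<lambda>v::nat \<Rightarrow> 'v. k * (\<Sum>j\<le>m. norm (v j - w j)))"
      by (intro continuous_intros continuous_on_product_coordinates)
    then have "((\<lambda>v. k * (\<Sum>j\<le>m. norm (v j - w j))) \<longlongrightarrow> k * (\<Sum>j\<le>m. norm (w j - w j))) (at w)"
      unfolding continuous_on_def by blast
    then have "((\<lambda>v. k * (\<Sum>j\<le>m. norm (v j - w j))) \<longlongrightarrow> 0) (at w)" by simp
    then have "((\<lambda>v. F (pl_C m v) - F (pl_C m w)) \<longlongrightarrow> 0) (at w)"
      by (intro Lim_null_comparison[OF always_eventually[OF allI[OF le]]])
    then show ?thesis by (rule LIM_zero_cancel)
  qed
  then show ?thesis unfolding continuous_on_def by auto
qed

lemma pl_converges_uniformly: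
  fixes z :: "real \<Rightarrow> 'v::real_normed_vector"
  assumes z: "continuous_on {0..1} z" and "e > 0"
  shows "\<forall>\<^sub>F m in sequentially. \<forall>t\<in>{0..1}. norm (pl m (\<lambda>j. z (real j / real m)) t - z t) \<le> e"
proof -
  have "uniformly_continuous_on {0..1} z"
    using z by (intro compact_uniformly_continuous) auto
  then obtain d where d: "d > 0"
    "\<And>s t. s \<in> {0..1} \<Longrightarrow> t \<in> {0..1} \<Longrightarrow> \<bar>t - s\<bar> < d \<Longrightarrow> norm (z t - z s) < e"
    using \<open>e > 0\<close> unfolding uniformly_continuous_on_def dist_norm real_norm_def by metis
  obtain K :: nat where K: "1 / d < real K" using reals_Archimedean2 by blast
  have "norm (pl m (\<lambda>j. z (real j / real m)) t - z t) \<le> e"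
    if "m \<ge> K" and t: "t \<in> {0..1}" for m t
  proof -
    have m: "m > 0" using K d(1) \<open>m \<ge> K\<close> by (cases m) auto
    have md: "1 / real m < d"
    proof -
      have "1 / d < real m" using K \<open>m \<ge> K\<close> by linarith
      then show ?thesis using d(1) m by (simp add: field_simps)
    qed
    obtain j where j: "j < m" "real j / real m \<le> t" "t \<le> real (Suc j) / real m"
      using grid_locate[OF m] t by auto
    define \<theta> where "\<theta> = real m * t - real j"
    have \<theta>: "0 \<le> \<theta>" "\<theta> \<le> 1" using j m by (auto simp: \<theta>_def field_simps)
    have len: "real (Suc j) / real m = real j / real m + 1 / real m" by (simp add: add_divide_distrib)
    have "real (Suc j) / real m \<le> 1"
      using j(1) by (intro divide_le_eq_1_pos[THEN iffD2]) auto
    then have "\<bar>real j / real m - t\<bar> < d" "\<bar>real (Suc j) / real m - t\<bar> < d"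
      "real j / real m \<in> {0..1}" "real (Suc j) / real m \<in> {0..1}"
      using j(2,3) md m unfolding len by (auto simp: field_simps simp flip: add_divide_distrib)
    then have a: "norm (z (real j / real m) - z t) \<le> e" "norm (z (real (Suc j) / real m) - z t) \<le> e"
      using d(2)[of t] t by (auto intro: less_imp_le)
    have "pl m (\<lambda>j. z (real j / real m)) t - z t
        = (1 - \<theta>) *\<^sub>R (z (real j / real m) - z t) + \<theta> *\<^sub>R (z (real (Suc j) / real m) - z t)"
      unfolding pl_on_cell[OF j] \<theta>_def[symmetric] by (simp add: algebra_simps)
    also have "norm \<dots> \<le> (1 - \<theta>) * e + \<theta> * e"
      using \<theta> a by (intro norm_triangle_le add_mono) (auto intro!: mult_left_mono)
    finally show ?thesis by (simp add: algebra_simps)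
  qed
  then show ?thesis unfolding eventually_sequentially by blast
qed

lemma pl_C_lipschitz_tendsto:
  fixes z :: "real \<Rightarrow> 'v::real_normed_vector"
  assumes F: "lipschitz_real C_unit k F" "k \<ge> 0" and z: "continuous_on {0..1} z"
  shows "(\<lambda>m. F (pl_C m (\<lambda>j. z (real j / real m)))) \<longlonglongrightarrow> F (restrict z {0..1})"
proof (rule LIMSEQ_I)
  fix e :: real assume "e > 0"
  have "\<forall>\<^sub>F m in sequentially.
      \<forall>t\<in>{0..1}. norm (pl m (\<lambda>j. z (real j / real m)) t - z t) \<le> e / (k + 1)"
    using \<open>e > 0\<close> \<open>k \<ge> 0\<close> by (intro pl_converges_uniformly[OF z]) auto
  then have "\<forall>\<^sub>F m in sequentially.
      norm (F (pl_C m (\<lambda>j. z (real j / real m))) - F (restrict z {0..1})) < e"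
  proof eventually_elim
    case (elim m)
    have "norm (F (pl_C m (\<lambda>j. z (real j / real m))) - F (restrict z {0..1}))
        \<le> k * mdist C_unit (pl_C m (\<lambda>j. z (real j / real m))) (restrict z {0..1})"
      using F(1) C_unitI[OF continuous_on_pl] C_unitI[OF z] unfolding lipschitz_real_def real_norm_def
      by blast
    also have "\<dots> \<le> k * (e / (k + 1))"
      using elim by (intro mult_left_mono C_unit_mdist_le F(2)) auto
    also have "\<dots> < e" using \<open>e > 0\<close> \<open>k \<ge> 0\<close> by (simp add: field_simps)
    finally show ?case .
  qed
  then show "\<exists>K. \<forall>m\<ge>K. norm (F (pl_C m (\<lambda>j. z (real j / real m))) - F (restrict z {0..1})) < e"
    by (simp add: eventually_sequentially)
qed

lemma measurable_lipschitz_pl_C: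
  fixes v :: "'a \<Rightarrow> nat \<Rightarrow> 'v::{real_normed_vector, second_countable_topology}"
  assumes F: "lipschitz_real C_unit k F" "k \<ge> 0" "m > 0"
    and "\<And>j. (\<lambda>\<omega>. v \<omega> j) \<in> borel_measurable M"
  shows "(\<lambda>\<omega>. F (pl_C m (v \<omega>))) \<in> borel_measurable M"
  using measurable_coordinatewise_then_product[OF assms(4)]
    borel_measurable_continuous_onI[OF continuous_on_lipschitz_pl_C[OF F]]
  by (rule measurable_compose)

text \<open>A Lipschitz functional of a continuous path is the limit of its values at the
  interpolations, and each of these is a continuous function of finitely many coordinates.\<close>

lemma path_in_C_measurable:
  fixes Z :: "real \<Rightarrow> 'a \<Rightarrow> 'v::{real_normed_vector, second_countable_topology}"
  assumes cont: "\<And>\<omega>. \<omega> \<in> space M \<Longrightarrow> continuous_on {0..1} (\<lambda>t. Z t \<omega>)"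
    and meas: "\<And>t. t \<in> {0..1} \<Longrightarrow> Z t \<in> borel_measurable M"
  shows "path_in_C Z \<in> measurable M (metric_borel C_unit)"
proof (rule measurable_metric_borel_lipschitz)
  show "path_in_C Z \<omega> \<in> mspace C_unit" if "\<omega> \<in> space M" for \<omega>
    unfolding path_in_C_def using C_unitI[OF cont[OF that]] by simp
  fix F :: "(real \<Rightarrow> 'v) \<Rightarrow> real" and k C
  assume F: "lipschitz_real C_unit k F" "k \<ge> 0"
  \<comment> \<open>Measurability of \<open>Z t\<close> is given for times in \<open>[0,1]\<close>
    only, while \<open>measurable_lipschitz_pl_C\<close> asks for it in every entry; hence the
    entries beyond \<open>m\<close> are set to 0.\<close>
  define v where "v m \<omega> j = (if j \<le> m then Z (real j / real m) \<omega> else 0)" for m \<omega> and j :: nat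
  have pl_v: "pl m (v m \<omega>) = pl m (\<lambda>j. Z (real j / real m) \<omega>)" for m \<omega>
    unfolding pl_def v_def by (intro ext arg_cong2[where f="(+)"] sum.cong) auto
  have v_meas: "(\<lambda>\<omega>. v (Suc m) \<omega> j) \<in> borel_measurable M" for m j
    unfolding v_def by (cases "j \<le> Suc m") (auto intro!: meas simp: field_simps)
  show "(\<lambda>\<omega>. F (path_in_C Z \<omega>)) \<in> borel_measurable M"
  proof (rule borel_measurable_LIMSEQ_real)
    show "(\<lambda>\<omega>. F (pl_C (Suc m) (v (Suc m) \<omega>))) \<in> borel_measurable M" for m
      by (rule measurable_lipschitz_pl_C[OF F _ v_meas]) simp
    show "(\<lambda>m. F (pl_C (Suc m) (v (Suc m) \<omega>))) \<longlonglongrightarrow> F (path_in_C Z \<omega>)" if "\<omega> \<in> space M" for \<omega>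
      unfolding pl_v path_in_C_def
      by (rule LIMSEQ_Suc[OF pl_C_lipschitz_tendsto[OF F cont[OF that]]])
  qed
qed

section \<open>Riemann--Stieltjes integrals along piecewise linear paths\<close>

lemma tagged_division_of_realD:
  fixes a b :: real
  assumes "p tagged_division_of {a..b}" "(x, K) \<in> p"
  shows "K = {Inf K..Sup K}" "a \<le> Inf K" "Inf K \<le> x" "x \<le> Sup K" "Sup K \<le> b"
proof -
  obtain u v where K: "K = {u..v}" using tagged_division_ofD(4)[OF assms] by auto
  have x: "x \<in> K" and sub: "K \<subseteq> {a..b}" using tagged_division_ofD(2,3)[OF assms] by auto
  then have "u \<le> v" using K by auto
  then have "Inf K = u" "Sup K = v" using K by auto
  then show "K = {Inf K..Sup K}" "a \<le> Inf K" "Inf K \<le> x" "x \<le> Sup K" "Sup K \<le> b"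
    using x sub K \<open>u \<le> v\<close> by auto
qed

lemma has_RS_integral_eqI: "has_RS_integral f g I a b \<Longrightarrow> RS_integral a b f g = I"
  unfolding RS_integral_def using has_RS_integral_unique by blast

lemma has_RS_integral_cong:
  assumes "has_RS_integral f g I a b"
    and "\<And>s. s \<in> {a..b} \<Longrightarrow> f s = f' s" "\<And>s. s \<in> {a..b} \<Longrightarrow> g s = g' s"
  shows "has_RS_integral f' g' I a b"
proof -
  have "(\<Sum>(x, K)\<in>p. (g' (Sup K) - g' (Inf K)) *\<^sub>R f' x) = (\<Sum>(x, K)\<in>p. (g (Sup K) - g (Inf K)) *\<^sub>R f x)"
    if p: "p tagged_division_of {a..b}" for p
  proof (rule sum.cong[OF refl], clarify)
    fix x K assume "(x, K) \<in> p"
    note D = tagged_division_of_realD[OF p this]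
    show "(g' (Sup K) - g' (Inf K)) *\<^sub>R f' x = (g (Sup K) - g (Inf K)) *\<^sub>R f x"
      using D assms(2)[of x] assms(3)[of "Sup K"] assms(3)[of "Inf K"] by auto
  qed
  then show ?thesis using assms(1) unfolding has_RS_integral_def by (simp cong: conj_cong)
qed

lemma has_RS_integral_const: "has_RS_integral f (\<lambda>_. c) 0 a b"
  unfolding has_RS_integral_def by (auto intro!: exI[of _ 1])

lemma has_RS_integral_cmult_add:
  assumes I: "has_RS_integral f g I a b" and J: "has_RS_integral f h J a b"
  shows "has_RS_integral f (\<lambda>s. c * g s + h s) (c *\<^sub>R I + J) a b"
  unfolding has_RS_integral_def
proof (intro allI impI)
  fix e :: real assume "e > 0"
  define e' where "e' = e / (\<bar>c\<bar> + 1)"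
  have e': "e' > 0" "(\<bar>c\<bar> + 1) * e' = e" using \<open>e > 0\<close> by (auto simp: e'_def)
  let ?S = "\<lambda>g p. \<Sum>(x, K)\<in>p. (g (Sup K) - g (Inf K)) *\<^sub>R f x"
  obtain d1 where d1: "d1 > 0" "\<And>p. p tagged_division_of {a..b} \<Longrightarrow>
      \<forall>(x, K)\<in>p. Sup K - Inf K < d1 \<Longrightarrow> norm (?S g p - I) < e'"
    using I e'(1) unfolding has_RS_integral_def by meson
  obtain d2 where d2: "d2 > 0" "\<And>p. p tagged_division_of {a..b} \<Longrightarrow>
      \<forall>(x, K)\<in>p. Sup K - Inf K < d2 \<Longrightarrow> norm (?S h p - J) < e'"
    using J e'(1) unfolding has_RS_integral_def by meson
  have "norm (?S (\<lambda>s. c * g s + h s) p - (c *\<^sub>R I + J)) < e"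
    if p: "p tagged_division_of {a..b}" "\<forall>(x, K)\<in>p. Sup K - Inf K < min d1 d2" for p
  proof -
    have "?S (\<lambda>s. c * g s + h s) p = c *\<^sub>R ?S g p + ?S h p"
      by (simp add: scaleR_sum_right sum.distrib[symmetric] case_prod_unfold algebra_simps)
    then have "?S (\<lambda>s. c * g s + h s) p - (c *\<^sub>R I + J) = c *\<^sub>R (?S g p - I) + (?S h p - J)"
      by (simp add: algebra_simps)
    also have "norm \<dots> \<le> \<bar>c\<bar> * norm (?S g p - I) + norm (?S h p - J)"
      by (rule norm_triangle_le) simp
    also have "\<dots> < \<bar>c\<bar> * e' + e'"
      using d1(2)[OF p(1)] d2(2)[OF p(1)] p(2)
      by (intro add_le_less_mono mult_left_mono) (fastforce intro: less_imp_le)+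
    finally show ?thesis using e'(2) by (simp add: algebra_simps)
  qed
  then show "\<exists>d>0. \<forall>p. p tagged_division_of {a..b} \<and> (\<forall>(x, K)\<in>p. Sup K - Inf K < d)
      \<longrightarrow> norm (?S (\<lambda>s. c * g s + h s) p - (c *\<^sub>R I + J)) < e"
    using d1(1) d2(1) by (intro exI[of _ "min d1 d2"]) auto
qed

lemma has_RS_integral_sum:
  assumes "finite A" "\<And>k. k \<in> A \<Longrightarrow> has_RS_integral f (g k) (I k) a b"
  shows "has_RS_integral f (\<lambda>s. \<Sum>k\<in>A. c k * g k s) (\<Sum>k\<in>A. c k *\<^sub>R I k) a b"
  using assms
proof (induction A rule: finite_induct)
  case empty
  then show ?case using has_RS_integral_const[of f 0] by simp
next
  case (insert k A)
  then have "has_RS_integral f (\<lambda>s. c k * g k s + (\<Sum>j\<in>A. c j * g j s))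
      (c k *\<^sub>R I k + (\<Sum>j\<in>A. c j *\<^sub>R I j)) a b"
    by (intro has_RS_integral_cmult_add) auto
  then show ?case using insert.hyps by simp
qed

text \<open>The integrator is described by the integrals of a nonnegative density, so that it may
  have corners, as a ramp does. On an interval of small mesh the Stieltjes term and the integral
  differ by at most \<open>e'\<close> times the increment of \<open>g\<close>, and these increments
  telescope.\<close>

lemma has_RS_integral_density:
  fixes f :: "real \<Rightarrow> 'v::banach" and \<rho> g :: "real \<Rightarrow> real"
  assumes "a \<le> b" and f: "continuous_on {a..b} f" and \<rho>: "\<And>s. \<rho> s \<ge> 0"
    and g: "\<And>u v. a \<le> u \<Longrightarrow> u \<le> v \<Longrightarrow> v \<le> b \<Longrightarrow> (\<rho> has_integral (g v - g u)) {u..v}"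
    and int: "(\<lambda>s. \<rho> s *\<^sub>R f s) integrable_on {a..b}"
  shows "has_RS_integral f g (integral {a..b} (\<lambda>s. \<rho> s *\<^sub>R f s)) a b"
  unfolding has_RS_integral_def
proof (intro allI impI)
  fix e :: real assume "e > 0"
  let ?h = "\<lambda>s. \<rho> s *\<^sub>R f s"
  have mono: "0 \<le> g v - g u" if "a \<le> u" "u \<le> v" "v \<le> b" for u v
    by (rule has_integral_nonneg[OF g[OF that]]) (use \<rho> in auto)
  \<comment> \<open>The added 1 covers a constant integrator.\<close>
  define e' where "e' = e / (g b - g a + 1)"
  have e': "e' > 0" "e' * (g b - g a) < e"
    using \<open>e > 0\<close> mono[of a b] \<open>a \<le> b\<close> by (auto simp: e'_def field_simps)
  have "uniformly_continuous_on {a..b} f" using f by (intro compact_uniformly_continuous) auto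
  then obtain d where d: "d > 0"
    "\<And>s t. s \<in> {a..b} \<Longrightarrow> t \<in> {a..b} \<Longrightarrow> \<bar>t - s\<bar> < d \<Longrightarrow> norm (f t - f s) < e'"
    using \<open>e' > 0\<close> unfolding uniformly_continuous_on_def dist_norm real_norm_def by metis
  have "norm ((\<Sum>(x, K)\<in>p. (g (Sup K) - g (Inf K)) *\<^sub>R f x) - integral {a..b} ?h) < e"
    if p: "p tagged_division_of {a..b}" and small: "\<forall>(x, K)\<in>p. Sup K - Inf K < d" for p
  proof -
    have "integral {a..b} ?h = (\<Sum>(x, K)\<in>p. integral K ?h)"
      using integral_combine_tagged_division_topdown[of ?h a b p] int p by simp
    then have "(\<Sum>(x, K)\<in>p. (g (Sup K) - g (Inf K)) *\<^sub>R f x) - integral {a..b} ?h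
        = (\<Sum>(x, K)\<in>p. (g (Sup K) - g (Inf K)) *\<^sub>R f x - integral K ?h)"
      by (simp add: sum_subtractf[symmetric] case_prod_unfold)
    also have "norm \<dots> \<le> (\<Sum>(x, K)\<in>p. e' * (g (Sup K) - g (Inf K)))"
    proof (rule sum_norm_le, clarify)
      fix x K assume xK: "(x, K) \<in> p"
      note D = tagged_division_of_realD[OF p xK]
      let ?u = "Inf K" and ?v = "Sup K"
      have uv: "a \<le> ?u" "?u \<le> ?v" "?v \<le> b" using D(2-5) by linarith+
      have int_K: "?h integrable_on {?u..?v}"
        by (rule integrable_on_subinterval[OF int]) (use uv in auto)
      have 1: "((\<lambda>s. \<rho> s *\<^sub>R f x) has_integral (g ?v - g ?u) *\<^sub>R f x) {?u..?v}"
        by (rule has_integral_scaleR_left[OF g[OF uv]])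
      have 2: "((\<lambda>s. \<rho> s *\<^sub>R f x - ?h s) has_integral
          ((g ?v - g ?u) *\<^sub>R f x - integral {?u..?v} ?h)) {?u..?v}"
        by (intro has_integral_diff 1 integrable_integral int_K)
      have 3: "((\<lambda>s. \<rho> s * e') has_integral (g ?v - g ?u) * e') {?u..?v}"
        using has_integral_mult_left[OF g[OF uv], of e'] by simp
      have "norm (integral {?u..?v} (\<lambda>s. \<rho> s *\<^sub>R f x - ?h s)) \<le> integral {?u..?v} (\<lambda>s. \<rho> s * e')"
      proof (rule integral_norm_bound_integral)
        fix s assume s: "s \<in> {?u..?v}"
        have "\<bar>x - s\<bar> < d" using small xK D(3,4) s by fastforce
        moreover have "s \<in> {a..b}" "x \<in> {a..b}" using D(2-5) s by auto
        ultimately have "norm (f x - f s) \<le> e'" using d(2)[of s x] by (auto intro: less_imp_le)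
        then show "norm (\<rho> s *\<^sub>R f x - ?h s) \<le> \<rho> s * e'"
          using \<rho>[of s] by (simp add: scaleR_diff_right[symmetric] mult_left_mono)
      qed (use 2 3 in auto)
      then show "norm ((g ?v - g ?u) *\<^sub>R f x - integral K ?h) \<le> e' * (g ?v - g ?u)"
        by (simp only: integral_unique[OF 2] integral_unique[OF 3] mult.commute[of e']
            arg_cong[where f="\<lambda>K. integral K ?h", OF D(1)])
    qed
    also have "\<dots> = e' * (g b - g a)"
      using additive_tagged_division_1[OF \<open>a \<le> b\<close> p, of g]
      by (simp add: sum_distrib_left[symmetric] case_prod_unfold)
    finally show ?thesis using e'(2) by linarith
  qed
  then show "\<exists>d>0. \<forall>p. p tagged_division_of {a..b} \<and> (\<forall>(x, K)\<in>p. Sup K - Inf K < d) \<longrightarrow>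
      norm ((\<Sum>(x, K)\<in>p. (g (Sup K) - g (Inf K)) *\<^sub>R f x) - integral {a..b} ?h) < e"
    using d(1) by blast
qed

text \<open>Once \<open>t\<close> has passed cell \<open>k\<close> this is the average of
  \<open>f\<close> along the path over that cell; inside the cell it is the integral so far, divided
  by the full cell length. The \<open>max\<close> shrinks the interval to a point, and the value to
  0, as long as \<open>t\<close> has not reached the cell.\<close>

definition cell_mean :: "('x::real_normed_vector \<Rightarrow> 'v::euclidean_space) \<Rightarrow> nat \<Rightarrow> (nat \<Rightarrow> 'x) \<Rightarrow> nat \<Rightarrow> real \<Rightarrow> 'v" where
  "cell_mean f n x k t = real n *\<^sub>R
     integral {real k / real n..max (real k / real n) (min t (real (Suc k) / real n))} (\<lambda>s. f (pl n x s))"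

definition pl_integral ::
  "('d \<Rightarrow> real^'d \<Rightarrow> 'v::euclidean_space) \<Rightarrow> nat \<Rightarrow> (nat \<Rightarrow> real^'d) \<Rightarrow> real \<Rightarrow> 'v" where
  "pl_integral f n x t =
     (\<Sum>i\<in>UNIV. \<Sum>k<n. ((x (Suc k) - x k) $ i) *\<^sub>R cell_mean (f i) n x k t)"

text \<open>The ramp rises with slope \<open>n\<close> on cell \<open>k\<close> and is constant
  elsewhere, so its increments measure the overlap of the interval with the cell.\<close>

lemma ramp_has_integral:
  assumes "n > 0" "u \<le> v"
  shows "((\<lambda>s. if s \<in> {real k / real n..real (Suc k) / real n} then real n else 0) has_integral
     (ramp (real n * v - real k) - ramp (real n * u - real k))) {u..v}"
proof -
  let ?c = "max (real k / real n) u" and ?d = "min (real (Suc k) / real n) v"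
  have "{real k / real n..real (Suc k) / real n} \<inter> {u..v} = {?c..?d}" by auto
  moreover have "((\<lambda>s. real n) has_integral measure lborel {?c..?d} *\<^sub>R real n) {?c..?d}"
    by (rule has_integral_const_real)
  moreover have "measure lborel {?c..?d} *\<^sub>R real n = ramp (real n * v - real k) - ramp (real n * u - real k)"
  proof -
    have "measure lborel {?c..?d} *\<^sub>R real n = max 0 (?d - ?c) * real n" by (simp add: max_def)
    also have "\<dots> = max 0 (real n * ?d - real n * ?c)"
      using max_mult_distrib_left[of "real n" 0 "?d - ?c"] assms(1)
      by (simp add: right_diff_distrib mult.commute)
    also have "real n * ?d = min (real k + 1) (real n * v)"
      using assms(1) by (simp add: min_mult_distrib_left)
    also have "real n * ?c = max (real k) (real n * u)"
      using assms(1) by (simp add: max_mult_distrib_left)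
    finally have *: "measure lborel {?c..?d} *\<^sub>R real n =
        max 0 (min (real k + 1) (real n * v) - max (real k) (real n * u))" .
    have "real n * u \<le> real n * v" using assms by (intro mult_left_mono) auto
    then show ?thesis unfolding * ramp_def by (auto simp: min_def max_def)
  qed
  ultimately show ?thesis
    by (subst has_integral_restrict_Int) metis
qed

lemma pl_continuous_compose:
  "continuous_on UNIV f \<Longrightarrow> continuous_on S (\<lambda>s. f (pl n x s))"
  using continuous_on_compose2[OF _ continuous_on_pl[of S n x], of UNIV f] by auto

lemma has_RS_integral_ramp:
  fixes f :: "'x::real_normed_vector \<Rightarrow> 'v::euclidean_space"
  assumes "k < n" "0 \<le> t" "continuous_on UNIV f"
  shows "has_RS_integral (\<lambda>s. f (pl n x s)) (\<lambda>s. ramp (real n * s - real k)) (cell_mean f n x k t) 0 t"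
proof -
  let ?c = "real k / real n" and ?d = "real (Suc k) / real n"
  let ?\<rho> = "\<lambda>s. if s \<in> {?c..?d} then real n else 0"
  note cont = pl_continuous_compose[OF assms(3)]
  have Int: "{?c..?d} \<inter> {0..t} = {?c..min t ?d}" using \<open>0 \<le> t\<close> by (auto intro: order_trans[rotated])
  have restrict: "(\<lambda>s. ?\<rho> s *\<^sub>R f (pl n x s)) = (\<lambda>s. if s \<in> {?c..?d} then real n *\<^sub>R f (pl n x s) else 0)"
    by auto
  have "has_RS_integral (\<lambda>s. f (pl n x s)) (\<lambda>s. ramp (real n * s - real k))
      (integral {0..t} (\<lambda>s. ?\<rho> s *\<^sub>R f (pl n x s))) 0 t"
  proof (rule has_RS_integral_density[OF \<open>0 \<le> t\<close> cont])
    show "(\<lambda>s. ?\<rho> s *\<^sub>R f (pl n x s)) integrable_on {0..t}"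
      unfolding restrict integrable_restrict_Int Int
      by (intro integrable_continuous_interval continuous_intros cont)
  qed (use ramp_has_integral assms in auto)
  also have "integral {0..t} (\<lambda>s. ?\<rho> s *\<^sub>R f (pl n x s)) = cell_mean f n x k t"
  proof -
    have "integral {0..t} (\<lambda>s. ?\<rho> s *\<^sub>R f (pl n x s)) = real n *\<^sub>R integral {?c..min t ?d} (\<lambda>s. f (pl n x s))"
      unfolding restrict integral_restrict_Int Int by simp
    \<comment> \<open>If \<open>t\<close> precedes the cell, the interval on the left is empty and
      that on the right is a point; both integrals are 0.\<close>
    also have "integral {?c..min t ?d} (\<lambda>s. f (pl n x s)) = integral {?c..max ?c (min t ?d)} (\<lambda>s. f (pl n x s))"
      by (cases "?c \<le> min t ?d") (auto simp: max_def)
    finally show ?thesis by (simp add: cell_mean_def)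
  qed
  finally show ?thesis .
qed

text \<open>The integrator is expanded into ramps, and the Stieltjes integral is linear in the
  integrator. This replaces the integral of the theorem by a finite sum, with which all estimates
  work.\<close>

lemma RS_integral_pl:
  fixes f :: "'d::finite \<Rightarrow> real^'d \<Rightarrow> 'v::euclidean_space"
  assumes "0 \<le> t" "\<And>i. continuous_on UNIV (f i)"
    and W: "\<And>s. s \<in> {0..t} \<Longrightarrow> W s = pl n x s"
  shows "(\<Sum>i\<in>UNIV. RS_integral 0 t (\<lambda>s. f i (W s)) (\<lambda>s. W s $ i)) = pl_integral f n x t"
  unfolding pl_integral_def
proof (rule sum.cong[OF refl])
  fix i
  let ?I = "\<Sum>k<n. ((x (Suc k) - x k) $ i) *\<^sub>R cell_mean (f i) n x k t"
  have "has_RS_integral (\<lambda>s. f i (pl n x s))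
      (\<lambda>s. \<Sum>k<n. ((x (Suc k) - x k) $ i) * ramp (real n * s - real k)) ?I 0 t"
    by (intro has_RS_integral_sum has_RS_integral_ramp assms) auto
  \<comment> \<open>The constant \<open>x 0 $ i\<close> completes the ramps to the component of the
    path; as an integrator it contributes 0.\<close>
  from has_RS_integral_cmult_add[OF this has_RS_integral_const, of 1 "x 0 $ i"]
  have "has_RS_integral (\<lambda>s. f i (pl n x s)) (\<lambda>s. pl n x s $ i) ?I 0 t"
    by (rule has_RS_integral_cong[THEN back_subst[of "\<lambda>I. has_RS_integral _ _ I 0 t"]])
      (auto simp: pl_def mult.commute)
  then have "has_RS_integral (\<lambda>s. f i (W s)) (\<lambda>s. W s $ i) ?I 0 t"
    by (rule has_RS_integral_cong) (simp_all add: W)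
  then show "RS_integral 0 t (\<lambda>s. f i (W s)) (\<lambda>s. W s $ i) = ?I" by (rule has_RS_integral_eqI)
qed

section \<open>Continuity, bounds and expansion of the cell means\<close>

lemma continuous_on_cell_mean:
  assumes "n > 0" "continuous_on UNIV f"
  shows "continuous_on {0..1} (cell_mean f n x k)"
proof -
  let ?c = "real k / real n" and ?d = "real (Suc k) / real n"
  have 1: "continuous_on {?c..?d} (\<lambda>r. integral {?c..r} (\<lambda>s. f (pl n x s)))"
    by (intro indefinite_integral_continuous_1 integrable_continuous_interval
        pl_continuous_compose assms)
  have 2: "continuous_on {0..1} (\<lambda>t. max ?c (min t ?d))"
    by (intro continuous_on_max continuous_on_min continuous_on_const continuous_on_id)
  have "?c \<le> ?d" by (simp add: divide_right_mono)
  then have "(\<lambda>t. max ?c (min t ?d)) ` {0..1} \<subseteq> {?c..?d}" by auto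
  from continuous_on_compose2[OF 1 2 this]
  have "continuous_on {0..1} (\<lambda>t. integral {?c..max ?c (min t ?d)} (\<lambda>s. f (pl n x s)))" .
  then show ?thesis unfolding cell_mean_def[abs_def] by (rule continuous_on_scaleR[OF continuous_on_const])
qed

lemma continuous_on_pl_integral:
  assumes "\<And>i. continuous_on UNIV (f i)"
  shows "continuous_on {0..1} (pl_integral f n x)"
proof (cases "n = 0")
  case True
  then show ?thesis by (simp add: pl_integral_def[abs_def])
next
  case False
  then show ?thesis
    unfolding pl_integral_def[abs_def]
    by (intro continuous_intros continuous_on_cell_mean assms) auto
qed

lemma cell_mean_eq_0: "n > 0 \<Longrightarrow> t \<le> real k / real n \<Longrightarrow> cell_mean f n x k t = 0"
  by (simp add: cell_mean_def max_def min_def)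

lemma cell_mean_full:
  assumes "n > 0" "real (Suc k) / real n \<le> t"
  shows "cell_mean f n x k t
    = real n *\<^sub>R integral {real k / real n..real (Suc k) / real n} (\<lambda>s. f (pl n x s))"
proof -
  have "real k / real n \<le> real (Suc k) / real n" by (simp add: divide_right_mono)
  then have "max (real k / real n) (min t (real (Suc k) / real n)) = real (Suc k) / real n"
    using assms by (simp add: max_def min_def)
  then show ?thesis by (simp add: cell_mean_def)
qed

lemma cell_mean_norm_le:
  assumes "n > 0" "continuous_on UNIV f" "\<And>y. norm (f y) \<le> L"
  shows "norm (cell_mean f n x k t) \<le> L"
proof -
  let ?c = "real k / real n" and ?d = "max (real k / real n) (min t (real (Suc k) / real n))"
  have L: "L \<ge> 0" using assms(3) norm_ge_zero order_trans by blast
  have "norm (integral {?c..?d} (\<lambda>s. f (pl n x s))) \<le> L * (?d - ?c)"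
    by (rule integral_bound) (use assms in \<open>auto intro!: pl_continuous_compose\<close>)
  also have "\<dots> \<le> L * (1 / real n)"
  proof (intro mult_left_mono L)
    have "real (Suc k) / real n = ?c + 1 / real n" by (simp add: add_divide_distrib)
    moreover have "0 \<le> 1 / real n" by simp
    ultimately show "?d - ?c \<le> 1 / real n" by linarith
  qed
  finally show ?thesis using assms(1) by (simp add: cell_mean_def field_simps)
qed

text \<open>On the cell the path is \<open>x k\<close> plus a fraction of the step, and the fraction
  runs linearly from 0 to 1. Averaging the Taylor expansion replaces the fraction by its mean 1/2:
  this is where the Stratonovich correction comes from.\<close>

lemma cell_mean_taylor:
  fixes f :: "real^'d \<Rightarrow> 'v::euclidean_space"
  assumes "k < n" "continuous_on UNIV f" "real (Suc k) / real n \<le> t"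
    and taylor: "\<And>y v. norm (f (y + v) - f y - (\<Sum>l\<in>UNIV. (v $ l) *\<^sub>R g l y)) \<le> L * norm v ^ 2"
    and "L \<ge> 0"
  shows "norm (cell_mean f n x k t - f (x k)
     - (1/2) *\<^sub>R (\<Sum>l\<in>UNIV. ((x (Suc k) - x k) $ l) *\<^sub>R g l (x k))) \<le> L * norm (x (Suc k) - x k) ^ 2"
proof -
  let ?c = "real k / real n" and ?d = "real (Suc k) / real n" and ?\<delta> = "x (Suc k) - x k"
  have n: "n > 0" using assms(1) by simp
  have cd: "?c \<le> ?d" by (simp add: divide_right_mono)
  have len: "?d - ?c = 1 / real n" by (simp add: add_divide_distrib)
  define D where "D = (\<Sum>l\<in>UNIV. (?\<delta> $ l) *\<^sub>R g l (x k))"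
  have pl: "pl n x s = x k + (real n * s - real k) *\<^sub>R ?\<delta>" if "s \<in> {?c..?d}" for s
    using pl_on_cell[OF assms(1), of s x] that by auto
  have 1: "((\<lambda>s. f (pl n x s)) has_integral integral {?c..?d} (\<lambda>s. f (pl n x s))) {?c..?d}"
    by (intro integrable_integral integrable_continuous_interval pl_continuous_compose assms)
  have "((\<lambda>s. real n * s - real k) has_integral
      ((real n * ?d ^ 2 / 2 - real k * ?d) - (real n * ?c ^ 2 / 2 - real k * ?c))) {?c..?d}"
    using cd
    by (intro fundamental_theorem_of_calculus)
      (auto intro!: derivative_eq_intros simp: has_real_derivative_iff_has_vector_derivative[symmetric])
  also have "(real n * ?d ^ 2 / 2 - real k * ?d) - (real n * ?c ^ 2 / 2 - real k * ?c) = 1 / (2 * real n)"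
    using n by (simp add: field_simps power2_eq_square)
  finally have 2: "((\<lambda>s. (real n * s - real k) *\<^sub>R D) has_integral (1 / (2 * real n)) *\<^sub>R D) {?c..?d}"
    by (rule has_integral_scaleR_left)
  have 3: "((\<lambda>s. f (x k)) has_integral (1 / real n) *\<^sub>R f (x k)) {?c..?d}"
    using has_integral_const_real[of "f (x k)" ?c ?d] cd len by simp
  let ?r = "\<lambda>s. f (pl n x s) - f (x k) - (real n * s - real k) *\<^sub>R D"
  have int: "(?r has_integral (integral {?c..?d} (\<lambda>s. f (pl n x s)) - (1 / real n) *\<^sub>R f (x k)
      - (1 / (2 * real n)) *\<^sub>R D)) {?c..?d}"
    by (intro has_integral_diff 1 2 3)
  have bound: "norm (?r s) \<le> L * norm ?\<delta> ^ 2" if s: "s \<in> {?c..?d}" for s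
  proof -
    define \<theta> where "\<theta> = real n * s - real k"
    have \<theta>: "0 \<le> \<theta>" "\<theta> \<le> 1" using s n by (auto simp: \<theta>_def field_simps)
    have "?r s = f (x k + \<theta> *\<^sub>R ?\<delta>) - f (x k) - (\<Sum>l\<in>UNIV. ((\<theta> *\<^sub>R ?\<delta>) $ l) *\<^sub>R g l (x k))"
      unfolding pl[OF s] \<theta>_def[symmetric] D_def by (simp add: scaleR_sum_right)
    also have "norm \<dots> \<le> L * norm (\<theta> *\<^sub>R ?\<delta>) ^ 2" by (rule taylor)
    also have "\<dots> = L * (\<theta> ^ 2 * norm ?\<delta> ^ 2)" by (simp add: power_mult_distrib)
    also have "\<dots> \<le> L * (1 * norm ?\<delta> ^ 2)"
      using \<theta> \<open>L \<ge> 0\<close> by (intro mult_left_mono mult_right_mono) (auto simp: power_le_one)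
    finally show ?thesis by simp
  qed
  have "norm (integral {?c..?d} (\<lambda>s. f (pl n x s)) - (1 / real n) *\<^sub>R f (x k) - (1 / (2 * real n)) *\<^sub>R D)
      \<le> L * norm ?\<delta> ^ 2 * measure lborel {?c..?d}"
    by (rule has_integral_bound_real[OF _ finite.emptyI int]) (use bound \<open>L \<ge> 0\<close> in auto)
  also have "\<dots> = L * norm ?\<delta> ^ 2 / real n" using cd len by simp
  finally have *: "norm (integral {?c..?d} (\<lambda>s. f (pl n x s)) - (1 / real n) *\<^sub>R f (x k)
      - (1 / (2 * real n)) *\<^sub>R D) \<le> L * norm ?\<delta> ^ 2 / real n" .
  have "cell_mean f n x k t - f (x k) - (1/2) *\<^sub>R D
      = real n *\<^sub>R (integral {?c..?d} (\<lambda>s. f (pl n x s)) - (1 / real n) *\<^sub>R f (x k) - (1 / (2 * real n)) *\<^sub>R D)"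
    unfolding cell_mean_full[OF n assms(3)] using n by (simp add: scaleR_diff_right)
  also have "norm \<dots> \<le> real n * (L * norm ?\<delta> ^ 2 / real n)"
    unfolding norm_scaleR by (simp only: abs_of_nat) (rule mult_left_mono[OF *], simp)
  finally show ?thesis using n by (simp add: D_def)
qed

lemma pl_integral_grid:
  assumes "K \<le> n" "n > 0"
  shows "pl_integral f n x (real K / real n)
    = (\<Sum>k<K. \<Sum>i\<in>UNIV. ((x (Suc k) - x k) $ i) *\<^sub>R cell_mean (f i) n x k 1)"
proof -
  have "(\<Sum>k<n. ((x (Suc k) - x k) $ i) *\<^sub>R cell_mean (f i) n x k (real K / real n))
     = (\<Sum>k<K. ((x (Suc k) - x k) $ i) *\<^sub>R cell_mean (f i) n x k 1)" for i
  proof (rule sum.mono_neutral_cong_right)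
    show "\<forall>k\<in>{..<n} - {..<K}. ((x (Suc k) - x k) $ i) *\<^sub>R cell_mean (f i) n x k (real K / real n) = 0"
      using assms by (auto intro!: cell_mean_eq_0 divide_right_mono)
    show "((x (Suc k) - x k) $ i) *\<^sub>R cell_mean (f i) n x k (real K / real n)
        = ((x (Suc k) - x k) $ i) *\<^sub>R cell_mean (f i) n x k 1" if "k \<in> {..<K}" for k
    proof -
      have "real (Suc k) / real n \<le> real K / real n" "real (Suc k) / real n \<le> 1"
        using that assms by (auto intro!: divide_right_mono simp: divide_le_eq_1)
      then show ?thesis using assms(2) by (simp add: cell_mean_full)
    qed
  qed (use assms in auto)
  then show ?thesis unfolding pl_integral_def by (subst sum.swap) simp
qed

text \<open>Every cell other than \<open>K\<close> is either complete at both times or not yet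
  entered at both, so the two values differ by a single term.\<close>

lemma pl_integral_near_grid:
  assumes "K < n" "real K / real n \<le> t" "t \<le> real (Suc K) / real n"
    and f: "\<And>i. continuous_on UNIV (f i)" "\<And>i y. norm (f i y) \<le> L"
  shows "norm (pl_integral f n x t - pl_integral f n x (real K / real n))
     \<le> (\<Sum>i\<in>UNIV. \<bar>(x (Suc K) - x K) $ i\<bar> * L)"
proof -
  have n: "n > 0" using assms(1) by simp
  have "(\<Sum>k<n. ((x (Suc k) - x k) $ i) *\<^sub>R cell_mean (f i) n x k t)
     = (\<Sum>k<K. ((x (Suc k) - x k) $ i) *\<^sub>R cell_mean (f i) n x k 1)
       + ((x (Suc K) - x K) $ i) *\<^sub>R cell_mean (f i) n x K t" for i
  proof -
    have "(\<Sum>k<n. ((x (Suc k) - x k) $ i) *\<^sub>R cell_mean (f i) n x k t)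
       = (\<Sum>k<Suc K. ((x (Suc k) - x k) $ i) *\<^sub>R cell_mean (f i) n x k t)"
    proof (rule sum.mono_neutral_right)
      show "\<forall>k\<in>{..<n} - {..<Suc K}. ((x (Suc k) - x k) $ i) *\<^sub>R cell_mean (f i) n x k t = 0"
      proof
        fix k assume "k \<in> {..<n} - {..<Suc K}"
        then have "real (Suc K) / real n \<le> real k / real n" by (intro divide_right_mono) auto
        then show "((x (Suc k) - x k) $ i) *\<^sub>R cell_mean (f i) n x k t = 0"
          using n assms(3) cell_mean_eq_0[of n t k "f i" x] by simp
      qed
    qed (use assms(1) in auto)
    moreover have "cell_mean (f i) n x k t = cell_mean (f i) n x k 1" if "k < K" for k
    proof -
      have "real (Suc k) / real n \<le> real K / real n" "real (Suc k) / real n \<le> 1"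
        using that assms(1) by (auto intro!: divide_right_mono simp: divide_le_eq_1)
      then show ?thesis using n assms(2) by (simp add: cell_mean_full)
    qed
    ultimately show ?thesis by simp
  qed
  then have "pl_integral f n x t - pl_integral f n x (real K / real n)
      = (\<Sum>i\<in>UNIV. ((x (Suc K) - x K) $ i) *\<^sub>R cell_mean (f i) n x K t)"
    using assms(1) n
    by (subst pl_integral_grid) (auto simp: pl_integral_def sum.distrib intro: sum.swap)
  also have "norm \<dots> \<le> (\<Sum>i\<in>UNIV. \<bar>(x (Suc K) - x K) $ i\<bar> * L)"
    by (intro sum_norm_le) (auto intro!: mult_left_mono cell_mean_norm_le[OF n] f)
  finally show ?thesis .
qed

lemma interpolated_walk_eq_pl:
  fixes \<xi> :: "nat \<Rightarrow> 'a \<Rightarrow> 'v::real_normed_vector"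
  assumes "0 \<le> t" "t \<le> 1"
  shows "interpolated_walk \<xi> n t \<omega> = pl n (\<lambda>k. (1 / sqrt (real n)) *\<^sub>R (\<Sum>j<k. \<xi> (Suc j) \<omega>)) t"
proof (cases "n = 0")
  case True
  \<comment> \<open>Division by 0 yields 0, so the prefactor \<open>1 / sqrt 0\<close> makes both
    sides vanish.\<close>
  then show ?thesis by (simp add: interpolated_walk_def pl_def)
next
  case False
  then have n: "n > 0" by simp
  let ?x = "\<lambda>k. (1 / sqrt (real n)) *\<^sub>R (\<Sum>j<k. \<xi> (Suc j) \<omega>)"
  have sum: "(\<Sum>i = 1..k. \<xi> i \<omega>) = (\<Sum>j<k. \<xi> (Suc j) \<omega>)" for k
    by (simp only: One_nat_def sum.atLeast1_atMost_eq)
  define j where "j = nat \<lfloor>real n * t\<rfloor>"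
  have fl: "\<lfloor>real n * t\<rfloor> = int j" using assms unfolding j_def by simp
  then have j: "real j \<le> real n * t" "real n * t < real j + 1" by linarith+
  show ?thesis
  proof (cases "j < n")
    case True
    have "real j / real n \<le> t" "t \<le> real (Suc j) / real n" using j n by (auto simp: field_simps)
    note cell = pl_on_cell[OF True this, of ?x]
    show ?thesis
      unfolding cell unfolding interpolated_walk_def fl by (simp only: sum nat_int) (simp add: algebra_simps)
  next
    \<comment> \<open>Here \<open>t = 1\<close>: the floor equals \<open>n\<close>, and the surplus
      step with index \<open>n + 1\<close> has coefficient 0.\<close>
    case False
    have "real n * t \<le> real n" using assms n by simp
    then have "real n * t = real n" "j = n" using False j by linarith+
    then have "t = real n / real n" using n by simp
    then have "pl n ?x t = ?x n" using pl_grid[of n n ?x] by simp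
    then show ?thesis
      unfolding interpolated_walk_def fl \<open>real n * t = real n\<close> \<open>j = n\<close> by (simp only: sum nat_int) simp
  qed
qed

section \<open>Independent steps with unit covariance\<close>

text \<open>Equality of the laws is replaced by common first and second moments and a common bound
  \<open>q\<close> on the fourth moments. The index set is a parameter because the locale is applied
  both to the walk, with all indices, and to the rescaled increments of \<open>B\<close>, of which
  there are \<open>n\<close> at a time.\<close>

locale iid_steps = prob_space M for M :: "'a measure" +
  fixes I :: "nat set" and \<eta> :: "nat \<Rightarrow> 'a \<Rightarrow> real^'d" and q :: real
  assumes indep: "indep_vars (\<lambda>_. borel) \<eta> I"
    and mean: "\<And>k i. k \<in> I \<Longrightarrow> expectation (\<lambda>\<omega>. \<eta> k \<omega> $ i) = 0"
    and cov: "\<And>k i j. k \<in> I \<Longrightarrow> expectation (\<lambda>\<omega>. \<eta> k \<omega> $ i * \<eta> k \<omega> $ j) = (if i = j then 1 else 0)"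
    and integrable_norm4: "\<And>k. k \<in> I \<Longrightarrow> integrable M (\<lambda>\<omega>. norm (\<eta> k \<omega>) ^ 4)"
    and expectation_norm4: "\<And>k. k \<in> I \<Longrightarrow> expectation (\<lambda>\<omega>. norm (\<eta> k \<omega>) ^ 4) \<le> q"
begin

text \<open>The sigma-algebra generated by the steps with index in \<open>A\<close>. The sets
  \<open>{..<k}\<close> give the filtration of the walk, the sets \<open>{k..<k'}\<close> the blocks
  independent of it.\<close>

definition gen :: "nat set \<Rightarrow> 'a measure" where
  "gen A = vimage_algebra (space M) (\<lambda>\<omega>. \<lambda>k\<in>A. \<eta> k \<omega>) (Pi\<^sub>M A (\<lambda>_. borel))"

lemma space_gen [simp]: "space (gen A) = space M"
  by (simp add: gen_def)

lemma measurable_step: "k \<in> I \<Longrightarrow> \<eta> k \<in> borel_measurable M"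
  using indep by (auto simp: indep_vars_def)

lemma measurable_gen_step:
  assumes "k \<in> A"
  shows "\<eta> k \<in> borel_measurable (gen A)"
proof -
  have "(\<lambda>\<omega>. \<lambda>k\<in>A. \<eta> k \<omega>) \<in> measurable (gen A) (Pi\<^sub>M A (\<lambda>_. borel))"
    unfolding gen_def by (rule measurable_vimage_algebra1) (auto simp: space_PiM)
  from measurable_compose[OF this measurable_component_singleton[OF assms]]
  show ?thesis using assms by simp
qed

lemma gen_least:
  assumes "space N = space M" "\<And>k. k \<in> A \<Longrightarrow> \<eta> k \<in> borel_measurable N"
  shows "sets (gen A) \<subseteq> sets N"
  unfolding gen_def
  by (rule sets_image_in_sets) (use assms in \<open>auto intro!: measurable_restrict\<close>)

lemma gen_mono: "A \<subseteq> B \<Longrightarrow> sets (gen A) \<subseteq> sets (gen B)"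
  by (rule gen_least) (auto intro: measurable_gen_step)

lemma sets_gen: "A \<subseteq> I \<Longrightarrow> sets (gen A) \<subseteq> sets M"
  by (rule gen_least) (auto intro: measurable_step)

lemma measurable_gen_mono:
  "U \<in> measurable (gen A) N \<Longrightarrow> A \<subseteq> B \<Longrightarrow> U \<in> measurable (gen B) N"
  using gen_mono[of A B] by (auto simp: measurable_def)

lemma measurable_genD:
  "U \<in> measurable (gen A) N \<Longrightarrow> A \<subseteq> I \<Longrightarrow> U \<in> measurable M N"
  using sets_gen[of A] by (auto simp: measurable_def)

text \<open>Independence of the two tuples of steps is independence of the sigma-algebras that they
  generate, and it passes to the smaller ones generated by \<open>U\<close> and
  \<open>V\<close>.\<close>

lemma indep_var_gen:
  assumes "A \<inter> B = {}" "A \<subseteq> I" "B \<subseteq> I"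
    and U: "U \<in> borel_measurable (gen A)" and V: "V \<in> borel_measurable (gen B)"
  shows "indep_var borel U borel V"
proof -
  have gen_eq: "sets (gen A) = sigma_sets (space M)
      {(\<lambda>\<omega>. \<lambda>k\<in>A. \<eta> k \<omega>) -` S \<inter> space M | S. S \<in> sets (Pi\<^sub>M A (\<lambda>_. borel))}" for A
    by (simp add: gen_def sets_vimage_algebra)
  have ind: "indep_set (sets (gen A)) (sets (gen B))"
    using indep_var_restrict[OF indep assms(1-3)] unfolding indep_var_eq gen_eq by simp
  have sub: "sigma_sets (space M) {W -` S \<inter> space M | S. S \<in> sets borel} \<subseteq> sets (gen A)"
    if "W \<in> borel_measurable (gen A)" for W :: "'a \<Rightarrow> 'z::topological_space" and A
    by (rule sets.sigma_sets_subset[of _ "gen A", simplified]) (use measurable_sets[OF that] in auto)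
  have "indep_set (sigma_sets (space M) {U -` S \<inter> space M | S. S \<in> sets borel})
      (sigma_sets (space M) {V -` S \<inter> space M | S. S \<in> sets borel})"
    using ind sub[OF U] sub[OF V] unfolding indep_sets2_eq by blast
  then show ?thesis
    unfolding indep_var_eq using measurable_genD[OF U] measurable_genD[OF V] assms(2,3) by simp
qed

lemma gen_mult:
  fixes U V :: "'a \<Rightarrow> real"
  assumes "A \<inter> B = {}" "A \<subseteq> I" "B \<subseteq> I"
    and "U \<in> borel_measurable (gen A)" "V \<in> borel_measurable (gen B)"
    and "integrable M U" "integrable M V"
  shows "integrable M (\<lambda>\<omega>. U \<omega> * V \<omega>)"
    and "expectation (\<lambda>\<omega>. U \<omega> * V \<omega>) = expectation U * expectation V"
  using indep_var_integrable[OF indep_var_gen[OF assms(1-5)] assms(6,7)]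
    indep_var_lebesgue_integral[OF indep_var_gen[OF assms(1-5)] assms(6,7)] by simp_all

lemma integrable_norm_power:
  assumes "k \<in> I" "r \<le> 4"
  shows "integrable M (\<lambda>\<omega>. norm (\<eta> k \<omega>) ^ r)"
proof (rule Bochner_Integration.integrable_bound)
  show "integrable M (\<lambda>\<omega>. 1 + norm (\<eta> k \<omega>) ^ 4)" using integrable_norm4[OF assms(1)] by simp
  show "(\<lambda>\<omega>. norm (\<eta> k \<omega>) ^ r) \<in> borel_measurable M" using measurable_step[OF assms(1)] by simp
  have "x ^ r \<le> 1 + x ^ 4" if "x \<ge> 0" for x :: real
  proof (cases "x \<le> 1")
    case True
    then have "x ^ r \<le> 1" using that by (simp add: power_le_one)
    moreover have "0 \<le> x ^ 4" by simp
    ultimately show ?thesis by linarith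
  next
    case False
    then have "x ^ r \<le> x ^ 4" using assms(2) by (intro power_increasing) auto
    then show ?thesis by linarith
  qed
  then show "AE \<omega> in M. norm (norm (\<eta> k \<omega>) ^ r) \<le> norm (1 + norm (\<eta> k \<omega>) ^ 4)"
    by (intro AE_I2) simp
qed

lemma integrable_step: "k \<in> I \<Longrightarrow> integrable M (\<lambda>\<omega>. \<eta> k \<omega> $ i)"
  by (rule Bochner_Integration.integrable_bound[OF integrable_norm_power[of k 1]])
    (auto intro: component_le_norm_cart measurable_compose[OF measurable_step])

lemma integrable_step_mult: "k \<in> I \<Longrightarrow> integrable M (\<lambda>\<omega>. \<eta> k \<omega> $ i * \<eta> k \<omega> $ j)"
  by (rule Bochner_Integration.integrable_bound[OF integrable_norm_power[of k 2]])
    (auto intro!: AE_I2 mult_mono component_le_norm_cart measurable_compose[OF measurable_step]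
        borel_measurable_times simp: abs_mult power2_eq_square)

lemma norm_sq_eq_sum: "norm (x::real^'d) ^ 2 = (\<Sum>i\<in>UNIV. x $ i * x $ i)"
  by (simp add: power2_norm_eq_inner inner_vec_def)

lemma expectation_norm2:
  assumes "k \<in> I"
  shows "expectation (\<lambda>\<omega>. norm (\<eta> k \<omega>) ^ 2) = real CARD('d)"
  unfolding norm_sq_eq_sum
  by (subst Bochner_Integration.integral_sum) (use assms in \<open>auto simp: integrable_step_mult cov\<close>)

lemma q_nonneg:
  assumes "k \<in> I"
  shows "q \<ge> 0"
proof -
  have "0 \<le> expectation (\<lambda>\<omega>. norm (\<eta> k \<omega>) ^ 4)" by (rule Bochner_Integration.integral_nonneg) simp
  then show ?thesis using expectation_norm4[OF assms] by linarith
qed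

lemma expectation_norm3:
  assumes "k \<in> I"
  shows "expectation (\<lambda>\<omega>. norm (\<eta> k \<omega>) ^ 3) \<le> real CARD('d) + q"
proof -
  have "x ^ 3 \<le> x ^ 2 + x ^ 4" if "x \<ge> 0" for x :: real
  proof -
    have "0 \<le> x ^ 2 * ((x - 1) ^ 2 + x)" using that by simp
    then show ?thesis by (simp add: algebra_simps power2_eq_square power3_eq_cube power4_eq_xxxx)
  qed
  then have "expectation (\<lambda>\<omega>. norm (\<eta> k \<omega>) ^ 3)
      \<le> expectation (\<lambda>\<omega>. norm (\<eta> k \<omega>) ^ 2 + norm (\<eta> k \<omega>) ^ 4)"
    by (intro integral_mono integrable_norm_power Bochner_Integration.integrable_add assms) auto
  also have "\<dots> \<le> real CARD('d) + q"
    using expectation_norm2[OF assms] expectation_norm4[OF assms]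
    by (simp add: integrable_norm_power assms)
  finally show ?thesis .
qed

text \<open>The martingale property, in the form in which it is applied throughout: a centred step
  multiplied by a quantity independent of it has mean 0.\<close>

lemma past_mult_step:
  assumes "k \<in> I" "A \<subseteq> I" "k \<notin> A" "U \<in> borel_measurable (gen A)" "integrable M U"
  shows "integrable M (\<lambda>\<omega>. U \<omega> * \<eta> k \<omega> $ i)"
    and "expectation (\<lambda>\<omega>. U \<omega> * \<eta> k \<omega> $ i) = 0"
proof -
  have "(\<lambda>\<omega>. \<eta> k \<omega> $ i) \<in> borel_measurable (gen {k})"
    by (intro measurable_compose[OF measurable_gen_step]) auto
  from gen_mult[OF _ assms(2) _ assms(4) this assms(5) integrable_step]
  show "integrable M (\<lambda>\<omega>. U \<omega> * \<eta> k \<omega> $ i)" "expectation (\<lambda>\<omega>. U \<omega> * \<eta> k \<omega> $ i) = 0"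
    using assms(1,3) mean[OF assms(1)] by auto
qed

lemma past_mult_step_step:
  assumes "k \<in> I" "A \<subseteq> I" "k \<notin> A" "U \<in> borel_measurable (gen A)" "integrable M U"
  shows "integrable M (\<lambda>\<omega>. U \<omega> * (\<eta> k \<omega> $ i * \<eta> k \<omega> $ j))"
    and "expectation (\<lambda>\<omega>. U \<omega> * (\<eta> k \<omega> $ i * \<eta> k \<omega> $ j)) = (if i = j then expectation U else 0)"
proof -
  have "(\<lambda>\<omega>. \<eta> k \<omega> $ i * \<eta> k \<omega> $ j) \<in> borel_measurable (gen {k})"
    by (intro borel_measurable_times measurable_compose[OF measurable_gen_step]) auto
  from gen_mult[OF _ assms(2) _ assms(4) this assms(5) integrable_step_mult]
  show "integrable M (\<lambda>\<omega>. U \<omega> * (\<eta> k \<omega> $ i * \<eta> k \<omega> $ j))"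
    "expectation (\<lambda>\<omega>. U \<omega> * (\<eta> k \<omega> $ i * \<eta> k \<omega> $ j)) = (if i = j then expectation U else 0)"
    using assms(1,3) cov[OF assms(1)] by auto
qed

lemma past_mult_norm2:
  assumes "k \<in> I" "A \<subseteq> I" "k \<notin> A" "U \<in> borel_measurable (gen A)" "integrable M U"
  shows "integrable M (\<lambda>\<omega>. U \<omega> * norm (\<eta> k \<omega>) ^ 2)"
    and "expectation (\<lambda>\<omega>. U \<omega> * norm (\<eta> k \<omega>) ^ 2) = expectation U * real CARD('d)"
  unfolding norm_sq_eq_sum sum_distrib_left
  using past_mult_step_step[OF assms] by (simp_all add: mult.commute)

end

section \<open>Elementary moment inequalities and orthogonality\<close>

lemma (in prob_space) integrable_mult_of_squares:
  fixes U V :: "'a \<Rightarrow> real"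
  assumes [measurable]: "U \<in> borel_measurable M" "V \<in> borel_measurable M"
    and "integrable M (\<lambda>\<omega>. U \<omega> ^ 2)" "integrable M (\<lambda>\<omega>. V \<omega> ^ 2)"
  shows "integrable M (\<lambda>\<omega>. U \<omega> * V \<omega>)"
proof (rule Bochner_Integration.integrable_bound)
  show "integrable M (\<lambda>\<omega>. U \<omega> ^ 2 + V \<omega> ^ 2)" using assms(3,4) by simp
  have "\<bar>u * v\<bar> \<le> u ^ 2 + v ^ 2" for u v :: real
  proof -
    have "0 \<le> (\<bar>u\<bar> - \<bar>v\<bar>) ^ 2" by simp
    then have "2 * (\<bar>u\<bar> * \<bar>v\<bar>) \<le> u ^ 2 + v ^ 2" by (simp add: power2_diff mult.assoc)
    moreover have "0 \<le> \<bar>u\<bar> * \<bar>v\<bar>" by simp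
    ultimately show ?thesis unfolding abs_mult by linarith
  qed
  then show "AE \<omega> in M. norm (U \<omega> * V \<omega>) \<le> norm (U \<omega> ^ 2 + V \<omega> ^ 2)" by (intro AE_I2) simp
qed simp

lemma (in prob_space) integrable_power_le4:
  fixes U :: "'a \<Rightarrow> real"
  assumes [measurable]: "U \<in> borel_measurable M" and "integrable M (\<lambda>\<omega>. U \<omega> ^ 4)" and "r \<le> 4"
  shows "integrable M (\<lambda>\<omega>. U \<omega> ^ r)"
proof (rule Bochner_Integration.integrable_bound)
  show "integrable M (\<lambda>\<omega>. 1 + U \<omega> ^ 4)" using assms(2) by simp
  have "\<bar>x ^ r\<bar> \<le> 1 + x ^ 4" for x :: real
  proof (cases "\<bar>x\<bar> \<le> 1")
    case True
    then have "\<bar>x ^ r\<bar> \<le> 1" by (simp add: power_abs power_le_one)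
    moreover have "0 \<le> x ^ 4" by simp
    ultimately show ?thesis by linarith
  next
    case False
    then have "\<bar>x\<bar> ^ r \<le> \<bar>x\<bar> ^ 4" using assms(3) by (intro power_increasing) auto
    then show ?thesis by (simp add: power_abs)
  qed
  then show "AE \<omega> in M. norm (U \<omega> ^ r) \<le> norm (1 + U \<omega> ^ 4)" by (intro AE_I2) simp
qed simp

text \<open>The variance of the absolute value is nonnegative.\<close>

lemma (in prob_space) expectation_abs_le_sqrt:
  fixes U :: "'a \<Rightarrow> real"
  assumes [measurable]: "U \<in> borel_measurable M" and int: "integrable M (\<lambda>\<omega>. U \<omega> ^ 2)"
    and le: "expectation (\<lambda>\<omega>. U \<omega> ^ 2) \<le> c"
  shows "integrable M U" "expectation (\<lambda>\<omega>. \<bar>U \<omega>\<bar>) \<le> sqrt c"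
proof -
  show U: "integrable M U" using integrable_mult_of_squares[of U "\<lambda>_. 1"] int by simp
  have "0 \<le> expectation (\<lambda>\<omega>. (\<bar>U \<omega>\<bar> - expectation (\<lambda>\<omega>. \<bar>U \<omega>\<bar>)) ^ 2)" by simp
  also have "\<dots> = expectation (\<lambda>\<omega>. \<bar>U \<omega>\<bar> ^ 2) - (expectation (\<lambda>\<omega>. \<bar>U \<omega>\<bar>)) ^ 2"
    by (rule variance_eq) (use U int in auto)
  finally have "(expectation (\<lambda>\<omega>. \<bar>U \<omega>\<bar>)) ^ 2 \<le> c" using le by simp
  then show "expectation (\<lambda>\<omega>. \<bar>U \<omega>\<bar>) \<le> sqrt c" by (rule real_le_rsqrt)
qed

lemma (in prob_space) markov_bound:
  fixes U :: "'a \<Rightarrow> real"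
  assumes "integrable M U" "\<And>\<omega>. \<omega> \<in> space M \<Longrightarrow> 0 \<le> U \<omega>" "c > 0" "expectation U \<le> e"
  shows "prob {\<omega> \<in> space M. U \<omega> \<ge> c} \<le> e / c"
proof -
  have "prob {\<omega> \<in> space M. U \<omega> \<ge> c} \<le> expectation U / c"
    by (rule integral_Markov_inequality_measure[of _ _ "space M"]) (use assms in auto)
  also have "\<dots> \<le> e / c" using assms by (simp add: divide_right_mono)
  finally show ?thesis .
qed

context iid_steps
begin

text \<open>Each \<open>Y j\<close> is centred and independent of everything before
  \<open>K j\<close>, in particular of \<open>Z j\<close> and of the earlier summands. The mixed
  terms therefore vanish and the squares factorise. The map \<open>K\<close> allows the
  \<open>Y j\<close> to depend on whole blocks of steps; the identity gives single steps.\<close>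

lemma orthogonal_sum:
  fixes Z Y :: "nat \<Rightarrow> 'a \<Rightarrow> real" and K :: "nat \<Rightarrow> nat"
  assumes K: "mono K" and I: "{..<K r} \<subseteq> I"
    and Z: "\<And>j. j < r \<Longrightarrow> Z j \<in> borel_measurable (gen {..<K j})"
    and Z2: "\<And>j. j < r \<Longrightarrow> integrable M (\<lambda>\<omega>. Z j \<omega> ^ 2)" "\<And>j. j < r \<Longrightarrow> expectation (\<lambda>\<omega>. Z j \<omega> ^ 2) \<le> a j"
    and Y: "\<And>j. j < r \<Longrightarrow> Y j \<in> borel_measurable (gen {K j..<K (Suc j)})"
    and Y2: "\<And>j. j < r \<Longrightarrow> integrable M (\<lambda>\<omega>. Y j \<omega> ^ 2)" "\<And>j. j < r \<Longrightarrow> expectation (\<lambda>\<omega>. Y j \<omega> ^ 2) \<le> b j"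
    and Y0: "\<And>j. j < r \<Longrightarrow> expectation (Y j) = 0"
  shows "(\<lambda>\<omega>. \<Sum>j<r. Z j \<omega> * Y j \<omega>) \<in> borel_measurable (gen {..<K r})
    \<and> integrable M (\<lambda>\<omega>. (\<Sum>j<r. Z j \<omega> * Y j \<omega>) ^ 2)
    \<and> expectation (\<lambda>\<omega>. (\<Sum>j<r. Z j \<omega> * Y j \<omega>) ^ 2) \<le> (\<Sum>j<r. a j * b j)"
  using I Z Z2 Y Y2 Y0
proof (induction r)
  case 0
  then show ?case by simp
next
  case (Suc r)
  let ?S = "\<lambda>\<omega>. \<Sum>j<r. Z j \<omega> * Y j \<omega>" and ?A = "{..<K r}" and ?B = "{K r..<K (Suc r)}"
  have KS: "K r \<le> K (Suc r)" using K by (simp add: monoD)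
  have AI: "?A \<subseteq> I" and BI: "?B \<subseteq> I" and AB: "?A \<inter> ?B = {}" using Suc.prems(1) KS by auto
  have IH: "?S \<in> borel_measurable (gen ?A)" "integrable M (\<lambda>\<omega>. ?S \<omega> ^ 2)"
    "expectation (\<lambda>\<omega>. ?S \<omega> ^ 2) \<le> (\<Sum>j<r. a j * b j)"
    using Suc.IH[OF AI] Suc.prems(2-) by auto
  have Zr: "Z r \<in> borel_measurable (gen ?A)" and Yr: "Y r \<in> borel_measurable (gen ?B)"
    using Suc.prems(2,5) by auto
  note M = measurable_genD[OF IH(1) AI] measurable_genD[OF Zr AI] measurable_genD[OF Yr BI]
  note [measurable] = M
  have SZ: "integrable M (\<lambda>\<omega>. ?S \<omega> * Z r \<omega>)"
    using M IH(2) Suc.prems(3)[of r] by (intro integrable_mult_of_squares) auto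
  have intY: "integrable M (Y r)"
    using integrable_mult_of_squares[of "Y r" "\<lambda>_. 1"] Suc.prems(6)[of r] M by simp
  have SZm: "(\<lambda>\<omega>. ?S \<omega> * Z r \<omega>) \<in> borel_measurable (gen ?A)"
    using IH(1) Zr by (rule borel_measurable_times)
  note cross = gen_mult[OF AB AI BI SZm Yr SZ intY]
  have Z2m: "(\<lambda>\<omega>. Z r \<omega> ^ 2) \<in> borel_measurable (gen ?A)" "(\<lambda>\<omega>. Y r \<omega> ^ 2) \<in> borel_measurable (gen ?B)"
    using Zr Yr by (auto intro: borel_measurable_power)
  note square = gen_mult[OF AB AI BI Z2m Suc.prems(3)[of r, simplified] Suc.prems(6)[of r, simplified]]
  have eq: "(\<Sum>j<Suc r. Z j \<omega> * Y j \<omega>) ^ 2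
      = ?S \<omega> ^ 2 + 2 * (?S \<omega> * Z r \<omega> * Y r \<omega>) + Z r \<omega> ^ 2 * Y r \<omega> ^ 2" for \<omega>
    by (simp add: power2_sum power_mult_distrib)
  have "integrable M (\<lambda>\<omega>. (\<Sum>j<Suc r. Z j \<omega> * Y j \<omega>) ^ 2)"
    unfolding eq using IH(2) cross(1) square(1) by simp
  moreover have "expectation (\<lambda>\<omega>. (\<Sum>j<Suc r. Z j \<omega> * Y j \<omega>) ^ 2)
      = expectation (\<lambda>\<omega>. ?S \<omega> ^ 2) + expectation (\<lambda>\<omega>. Z r \<omega> ^ 2) * expectation (\<lambda>\<omega>. Y r \<omega> ^ 2)"
    unfolding eq using IH(2) cross square Suc.prems(8)[of r] by simp
  moreover have "expectation (\<lambda>\<omega>. Z r \<omega> ^ 2) * expectation (\<lambda>\<omega>. Y r \<omega> ^ 2) \<le> a r * b r"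
    using Suc.prems(4)[of r] Suc.prems(7)[of r]
    by (intro mult_mono) (auto intro: order_trans[rotated] integral_nonneg_AE)
  moreover have "(\<lambda>\<omega>. \<Sum>j<Suc r. Z j \<omega> * Y j \<omega>) \<in> borel_measurable (gen {..<K (Suc r)})"
    unfolding sum.lessThan_Suc
    by (intro borel_measurable_add borel_measurable_times measurable_gen_mono[OF IH(1)]
        measurable_gen_mono[OF Zr] measurable_gen_mono[OF Yr]) (use KS in auto)
  ultimately show ?case using IH(3) by simp
qed

end

section \<open>Fourth moments of martingale transforms\<close>

text \<open>With \<open>l = L * d\<close>, one more step raises the fourth moment by at most
  \<open>8 * l ^ 4 * d ^ 2 * k + 3 * l ^ 4 * q\<close>. The constant is chosen so that its multiple
  by \<open>(k + 1) ^ 2 - k ^ 2 = 2 * k + 1\<close> dominates this.\<close>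

abbreviation quartic_const :: "nat \<Rightarrow> real \<Rightarrow> real \<Rightarrow> real" where
  "quartic_const d q L \<equiv> (L * real d) ^ 4 * (4 * real d ^ 2 + 3 * q)"

context iid_steps
begin

text \<open>If \<open>Z i j\<close> depends on the steps before \<open>j\<close> only, this is a
  martingale in \<open>k\<close>. The offset \<open>a\<close> lets it start at the beginning of a
  block.\<close>

definition transform :: "nat \<Rightarrow> ('d \<Rightarrow> nat \<Rightarrow> 'a \<Rightarrow> real) \<Rightarrow> nat \<Rightarrow> 'a \<Rightarrow> real" where
  "transform a Z k \<omega> = (\<Sum>j\<in>{a..<a + k}. \<Sum>i\<in>UNIV. Z i j \<omega> * \<eta> j \<omega> $ i)"

lemma transform_0 [simp]: "transform a Z 0 \<omega> = 0"
  by (simp add: transform_def)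

lemma transform_Suc:
  "transform a Z (Suc k) \<omega> = transform a Z k \<omega> + (\<Sum>i\<in>UNIV. Z i (a + k) \<omega> * \<eta> (a + k) \<omega> $ i)"
  by (simp add: transform_def)

context
  fixes a :: nat and Z :: "'d \<Rightarrow> nat \<Rightarrow> 'a \<Rightarrow> real" and L :: real
  assumes Z: "\<And>i j. a \<le> j \<Longrightarrow> Z i j \<in> borel_measurable (gen {..<j})"
    and ZL: "\<And>i j \<omega>. \<bar>Z i j \<omega>\<bar> \<le> L"
begin

text \<open>Induction on \<open>k\<close>. In the powers of \<open>S + Y\<close>, the terms linear
  in the new contribution \<open>Y\<close> have mean 0. The second moment grows linearly, and it
  feeds the mixed quadratic term of the fourth moment, which therefore grows quadratically.\<close>

lemma transform_moments:
  assumes "{..<a + k} \<subseteq> I"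
  shows "transform a Z k \<in> borel_measurable (gen {..<a + k})
    \<and> integrable M (\<lambda>\<omega>. transform a Z k \<omega> ^ 4)
    \<and> expectation (\<lambda>\<omega>. transform a Z k \<omega> ^ 2) \<le> (L * real CARD('d)) ^ 2 * real CARD('d) * real k
    \<and> expectation (\<lambda>\<omega>. transform a Z k \<omega> ^ 4) \<le> quartic_const CARD('d) q L * real k ^ 2"
  using assms
proof (induction k)
  case 0
  then show ?case by (simp add: transform_def[abs_def])
next
  case (Suc k)
  let ?S = "transform a Z k" and ?A = "{..<a + k}" and ?\<eta> = "\<eta> (a + k)" and ?d = "real CARD('d)"
  let ?l = "L * ?d"
  define Y where "Y \<omega> = (\<Sum>i\<in>UNIV. Z i (a + k) \<omega> * ?\<eta> \<omega> $ i)" for \<omega>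
  have AI: "?A \<subseteq> I" and kI: "a + k \<in> I" and kA: "a + k \<notin> ?A" using Suc.prems by auto
  have L: "L \<ge> 0" using ZL[of undefined a undefined] by linarith
  have S: "?S \<in> borel_measurable (gen ?A)" and S4: "integrable M (\<lambda>\<omega>. ?S \<omega> ^ 4)"
    and ES2: "expectation (\<lambda>\<omega>. ?S \<omega> ^ 2) \<le> ?l ^ 2 * ?d * real k"
    and ES4: "expectation (\<lambda>\<omega>. ?S \<omega> ^ 4) \<le> quartic_const CARD('d) q L * real k ^ 2"
    using Suc.IH AI by auto
  note [measurable] = measurable_genD[OF S AI] measurable_step[OF kI]
  have Zk: "Z i (a + k) \<in> borel_measurable (gen ?A)" for i by (rule Z) simp
  note [measurable] = measurable_genD[OF Zk AI]
  have [measurable]: "(\<lambda>\<omega>. ?\<eta> \<omega> $ i) \<in> borel_measurable M" for i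
    by (rule measurable_compose[OF measurable_step[OF kI]]) simp
  have Y_meas [measurable]: "Y \<in> borel_measurable M" unfolding Y_def by measurable
  have Y_le: "\<bar>Y \<omega>\<bar> \<le> ?l * norm (?\<eta> \<omega>)" for \<omega>
  proof -
    have "\<bar>Y \<omega>\<bar> \<le> (\<Sum>i\<in>(UNIV::'d set). L * norm (?\<eta> \<omega>))"
      unfolding Y_def using ZL L component_le_norm_cart
      by (intro order_trans[OF sum_abs] sum_mono) (auto simp: abs_mult intro!: mult_mono)
    then show ?thesis by (simp add: mult_ac)
  qed
  have Y2: "Y \<omega> ^ 2 \<le> ?l ^ 2 * norm (?\<eta> \<omega>) ^ 2" and Y4: "Y \<omega> ^ 4 \<le> ?l ^ 4 * norm (?\<eta> \<omega>) ^ 4" for \<omega>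
    using power_mono[OF Y_le[of \<omega>], of 2] power_mono[OF Y_le[of \<omega>], of 4]
    by (simp_all add: power_mult_distrib power_abs)
  have Sp: "integrable M (\<lambda>\<omega>. ?S \<omega> ^ r)" if "r \<le> 4" for r
    by (rule integrable_power_le4[OF _ S4 that]) simp
  have SY: "integrable M (\<lambda>\<omega>. ?S \<omega> ^ r * Y \<omega>)" "expectation (\<lambda>\<omega>. ?S \<omega> ^ r * Y \<omega>) = 0"
    if "r \<le> 4" for r
  proof -
    have SZ: "integrable M (\<lambda>\<omega>. ?S \<omega> ^ r * Z i (a + k) \<omega>)" for i
    proof (rule Bochner_Integration.integrable_bound)
      show "integrable M (\<lambda>\<omega>. L * ?S \<omega> ^ r)" using Sp[OF that] by simp
      show "AE \<omega> in M. norm (?S \<omega> ^ r * Z i (a + k) \<omega>) \<le> norm (L * ?S \<omega> ^ r)"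
        using ZL L by (intro AE_I2) (auto simp: abs_mult mult.commute intro!: mult_right_mono)
    qed simp
    have "(\<lambda>\<omega>. ?S \<omega> ^ r * Z i (a + k) \<omega>) \<in> borel_measurable (gen ?A)" for i
      by (intro borel_measurable_times borel_measurable_power S Zk)
    note * = past_mult_step[OF kI AI kA this SZ]
    have eq: "?S \<omega> ^ r * Y \<omega> = (\<Sum>i\<in>UNIV. ?S \<omega> ^ r * Z i (a + k) \<omega> * ?\<eta> \<omega> $ i)" for \<omega>
      by (simp add: Y_def sum_distrib_left mult.assoc)
    show "integrable M (\<lambda>\<omega>. ?S \<omega> ^ r * Y \<omega>)" "expectation (\<lambda>\<omega>. ?S \<omega> ^ r * Y \<omega>) = 0"
      unfolding eq using * by simp_all
  qed
  have S2m: "(\<lambda>\<omega>. ?S \<omega> ^ 2) \<in> borel_measurable (gen ?A)" by (intro borel_measurable_power S)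
  note SN = past_mult_norm2[OF kI AI kA S2m Sp[of 2, simplified]]
  have N2: "integrable M (\<lambda>\<omega>. norm (?\<eta> \<omega>) ^ 2)" by (rule integrable_norm_power[OF kI]) simp
  have bound2: "(?S \<omega> + Y \<omega>) ^ 2 \<le> ?S \<omega> ^ 2 + 2 * (?S \<omega> ^ 1 * Y \<omega>) + ?l ^ 2 * norm (?\<eta> \<omega>) ^ 2" for \<omega>
    using Y2[of \<omega>] by (simp add: power2_sum)
  have bound4: "(?S \<omega> + Y \<omega>) ^ 4 \<le> ?S \<omega> ^ 4 + 4 * (?S \<omega> ^ 3 * Y \<omega>)
      + 8 * ?l ^ 2 * (?S \<omega> ^ 2 * norm (?\<eta> \<omega>) ^ 2) + 3 * ?l ^ 4 * norm (?\<eta> \<omega>) ^ 4" for \<omega>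
  proof -
    \<comment> \<open>The cubic term has no sign; this square bounds \<open>4 * S * Y ^ 3\<close> by
      \<open>2 * S ^ 2 * Y ^ 2 + 2 * Y ^ 4\<close>, which raises the coefficients 6 and 1 of the
      binomial expansion to 8 and 3.\<close>
    have "0 \<le> 2 * (Y \<omega>) ^ 2 * (?S \<omega> - Y \<omega>) ^ 2" by simp
    then have "(?S \<omega> + Y \<omega>) ^ 4 \<le> ?S \<omega> ^ 4 + 4 * (?S \<omega> ^ 3 * Y \<omega>) + 8 * (?S \<omega> ^ 2 * Y \<omega> ^ 2) + 3 * Y \<omega> ^ 4"
      by (simp add: algebra_simps power2_eq_square power3_eq_cube power4_eq_xxxx)
    moreover have "?S \<omega> ^ 2 * Y \<omega> ^ 2 \<le> ?S \<omega> ^ 2 * (?l ^ 2 * norm (?\<eta> \<omega>) ^ 2)"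
      by (intro mult_left_mono Y2) simp
    ultimately show ?thesis using Y4[of \<omega>] by (simp add: mult_ac)
  qed
  have T: "transform a Z (Suc k) \<omega> = ?S \<omega> + Y \<omega>" for \<omega> by (simp add: transform_Suc Y_def)
  have N4: "integrable M (\<lambda>\<omega>. norm (?\<eta> \<omega>) ^ 4)" by (rule integrable_norm4[OF kI])
  have int_bound4: "integrable M (\<lambda>\<omega>. ?S \<omega> ^ 4 + 4 * (?S \<omega> ^ 3 * Y \<omega>)
      + 8 * ?l ^ 2 * (?S \<omega> ^ 2 * norm (?\<eta> \<omega>) ^ 2) + 3 * ?l ^ 4 * norm (?\<eta> \<omega>) ^ 4)"
    using S4 SY(1)[of 3] SN(1) N4 by (intro Bochner_Integration.integrable_add integrable_mult_right) auto
  have int4: "integrable M (\<lambda>\<omega>. (?S \<omega> + Y \<omega>) ^ 4)"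
  proof (rule Bochner_Integration.integrable_bound[OF int_bound4])
    show "AE \<omega> in M. norm ((?S \<omega> + Y \<omega>) ^ 4) \<le> norm (?S \<omega> ^ 4 + 4 * (?S \<omega> ^ 3 * Y \<omega>)
      + 8 * ?l ^ 2 * (?S \<omega> ^ 2 * norm (?\<eta> \<omega>) ^ 2) + 3 * ?l ^ 4 * norm (?\<eta> \<omega>) ^ 4)"
      using bound4 by (intro AE_I2) (simp, meson abs_ge_self order_trans)
  qed simp
  have int2: "integrable M (\<lambda>\<omega>. (?S \<omega> + Y \<omega>) ^ 2)"
    by (rule integrable_power_le4[OF _ int4]) auto
  have "expectation (\<lambda>\<omega>. (?S \<omega> + Y \<omega>) ^ 2)
      \<le> expectation (\<lambda>\<omega>. ?S \<omega> ^ 2 + 2 * (?S \<omega> ^ 1 * Y \<omega>) + ?l ^ 2 * norm (?\<eta> \<omega>) ^ 2)"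
    using Sp[of 2] SY(1)[of 1] N2 bound2 int2
    by (intro integral_mono Bochner_Integration.integrable_add integrable_mult_right) auto
  also have "\<dots> = expectation (\<lambda>\<omega>. ?S \<omega> ^ 2) + ?l ^ 2 * ?d"
    using Sp[of 2] SY[of 1] N2 expectation_norm2[OF kI] by simp
  finally have E2: "expectation (\<lambda>\<omega>. (?S \<omega> + Y \<omega>) ^ 2) \<le> ?l ^ 2 * ?d * real (Suc k)"
    using ES2 by (simp add: algebra_simps)
  have "expectation (\<lambda>\<omega>. (?S \<omega> + Y \<omega>) ^ 4)
      \<le> expectation (\<lambda>\<omega>. ?S \<omega> ^ 4 + 4 * (?S \<omega> ^ 3 * Y \<omega>)
      + 8 * ?l ^ 2 * (?S \<omega> ^ 2 * norm (?\<eta> \<omega>) ^ 2) + 3 * ?l ^ 4 * norm (?\<eta> \<omega>) ^ 4)"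
    using bound4 by (intro integral_mono int4 int_bound4) auto
  also have "\<dots> = expectation (\<lambda>\<omega>. ?S \<omega> ^ 4) + 8 * ?l ^ 2 * (expectation (\<lambda>\<omega>. ?S \<omega> ^ 2) * ?d)
      + 3 * ?l ^ 4 * expectation (\<lambda>\<omega>. norm (?\<eta> \<omega>) ^ 4)"
    using S4 SY[of 3] SN N4 by simp
  also have "\<dots> \<le> quartic_const CARD('d) q L * real k ^ 2 + 8 * ?l ^ 2 * ((?l ^ 2 * ?d * real k) * ?d) + 3 * ?l ^ 4 * q"
    using ES2 ES4 expectation_norm4[OF kI] by (intro add_mono mult_left_mono mult_right_mono) auto
  also have "\<dots> \<le> quartic_const CARD('d) q L * real (Suc k) ^ 2"
  proof -
    have "0 \<le> ?l ^ 4 * (4 * ?d ^ 2 + 6 * q * real k)" using q_nonneg[OF kI] L by simp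
    then show ?thesis by (simp add: algebra_simps power2_eq_square power4_eq_xxxx)
  qed
  finally have E4: "expectation (\<lambda>\<omega>. (?S \<omega> + Y \<omega>) ^ 4) \<le> quartic_const CARD('d) q L * real (Suc k) ^ 2" .
  have "transform a Z (Suc k) \<in> borel_measurable (gen {..<a + Suc k})"
    unfolding transform_Suc[abs_def]
    by (intro borel_measurable_add borel_measurable_sum borel_measurable_times
        measurable_gen_mono[OF S] measurable_gen_mono[OF Zk]
        measurable_compose[OF measurable_gen_step]) auto
  then show ?case unfolding T using int4 E2 E4 by blast
qed

end

end

primrec stopped_sum :: "real \<Rightarrow> (nat \<Rightarrow> real) \<Rightarrow> nat \<Rightarrow> real" where
  "stopped_sum c y 0 = 0"
| "stopped_sum c y (Suc k) =
    stopped_sum c y k + (if \<bar>stopped_sum c y k\<bar> \<le> c then y k else 0)"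

text \<open>At every time either the sum has already stopped outside \<open>[- c, c]\<close>, where
  it stays, or no partial sum has left the interval and nothing has been stopped.\<close>

lemma stopped_sum_exceeds:
  assumes "k \<le> b" "\<bar>\<Sum>j<k. y j\<bar> > c"
  shows "\<bar>stopped_sum c y b\<bar> > c"
proof -
  have "\<bar>stopped_sum c y b\<bar> > c \<or>
      (stopped_sum c y b = (\<Sum>j<b. y j) \<and> (\<forall>k\<le>b. \<bar>\<Sum>j<k. y j\<bar> \<le> c))" for b
  proof (induction b)
    case 0
    then show ?case by auto
  next
    case (Suc b)
    then show ?case
    proof
      assume "\<bar>stopped_sum c y b\<bar> > c"
      then show ?thesis by simp
    next
      assume *: "stopped_sum c y b = (\<Sum>j<b. y j) \<and> (\<forall>k\<le>b. \<bar>\<Sum>j<k. y j\<bar> \<le> c)"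
      then have "stopped_sum c y (Suc b) = (\<Sum>j<Suc b. y j)" by auto
      then show ?thesis using * by (auto simp: le_Suc_eq)
    qed
  qed
  then show ?thesis using assms by fastforce
qed

context iid_steps
begin

text \<open>
  Stopping the transform when it first exceeds \<open>c\<close> gives another transform with bounded coefficients,
  so that the fourth moment bound turns into a maximal inequality.
\<close>

lemma transform_maximal:
  assumes Z: "\<And>i j. a \<le> j \<Longrightarrow> Z i j \<in> borel_measurable (gen {..<j})"
    and ZL: "\<And>i j \<omega>. \<bar>Z i j \<omega>\<bar> \<le> L"
    and I: "{..<a + b} \<subseteq> I" and "c > 0"
  shows "{\<omega> \<in> space M. \<exists>k\<le>b. \<bar>transform a Z k \<omega>\<bar> > c} \<in> events"
    and "prob {\<omega> \<in> space M. \<exists>k\<le>b. \<bar>transform a Z k \<omega>\<bar> > c}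
      \<le> quartic_const CARD('d) q L * real b ^ 2 / c ^ 4"
proof -
  have L: "L \<ge> 0" using ZL[of undefined a undefined] by linarith
  have sub: "{..<a + k} \<subseteq> I" if "k \<le> b" for k using I that by auto
  have T_meas: "transform a Z k \<in> borel_measurable M" if "k \<le> b" for k
  proof -
    have "transform a Z k \<in> borel_measurable (gen {..<a + k})"
      using transform_moments[where Z=Z and a=a and k=k and L=L, OF Z ZL sub[OF that]] by blast
    then show ?thesis by (rule measurable_genD[OF _ sub[OF that]])
  qed
  have "{\<omega> \<in> space M. \<exists>k\<le>b. \<bar>transform a Z k \<omega>\<bar> > c}
      = (\<Union>k\<le>b. {\<omega> \<in> space M. \<bar>transform a Z k \<omega>\<bar> > c})" by auto
  also have "\<dots> \<in> events"
  proof (intro sets.finite_UN finite_atMost)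
    fix k assume "k \<in> {..b}"
    then have [measurable]: "transform a Z k \<in> borel_measurable M" by (intro T_meas) simp
    show "{\<omega> \<in> space M. \<bar>transform a Z k \<omega>\<bar> > c} \<in> events" by measurable
  qed
  finally show ev: "{\<omega> \<in> space M. \<exists>k\<le>b. \<bar>transform a Z k \<omega>\<bar> > c} \<in> events" .
  define y where "y \<omega> k = (\<Sum>i\<in>UNIV. Z i (a + k) \<omega> * \<eta> (a + k) \<omega> $ i)" for \<omega> k
  \<comment> \<open>Whether step \<open>j\<close> still counts is decided by the steps before
    \<open>j\<close>, so the modified coefficients depend on the past as required and keep the bound
    \<open>L\<close>.\<close>
  define Z' where "Z' i j \<omega> = (if \<bar>stopped_sum c (y \<omega>) (j - a)\<bar> \<le> c then Z i j \<omega> else 0)" for i j \<omega>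
  have T: "transform a Z k \<omega> = (\<Sum>j<k. y \<omega> j)" for k \<omega>
    by (induction k) (simp_all add: transform_Suc y_def)
  have T': "transform a Z' k \<omega> = stopped_sum c (y \<omega>) k" for k \<omega>
  proof (induction k)
    case (Suc k)
    then show ?case
      by (cases "\<bar>stopped_sum c (y \<omega>) k\<bar> \<le> c")
        (simp_all add: transform_Suc Z'_def y_def[of \<omega> k])
  qed simp
  have stop_meas: "(\<lambda>\<omega>. stopped_sum c (y \<omega>) k) \<in> borel_measurable (gen {..<a + k})" for k
  proof (induction k)
    case (Suc k)
    have S: "(\<lambda>\<omega>. stopped_sum c (y \<omega>) k) \<in> borel_measurable (gen {..<a + Suc k})"
      by (rule measurable_gen_mono[OF Suc]) auto
    moreover have "(\<lambda>\<omega>. y \<omega> k) \<in> borel_measurable (gen {..<a + Suc k})"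
      unfolding y_def
      by (intro borel_measurable_sum borel_measurable_times measurable_gen_mono[OF Z]
          measurable_compose[OF measurable_gen_step]) auto
    ultimately show ?case by simp
  qed simp
  have Z'm: "Z' i j \<in> borel_measurable (gen {..<j})" if "a \<le> j" for i j
    using stop_meas[of "j - a"] Z[OF that, of i] that unfolding Z'_def[abs_def] by simp
  have Z'L: "\<bar>Z' i j \<omega>\<bar> \<le> L" for i j \<omega> using ZL L by (simp add: Z'_def)
  have mom: "integrable M (\<lambda>\<omega>. transform a Z' b \<omega> ^ 4)"
    "expectation (\<lambda>\<omega>. transform a Z' b \<omega> ^ 4) \<le> quartic_const CARD('d) q L * real b ^ 2"
    using transform_moments[where Z=Z' and a=a and k=b and L=L, OF Z'm Z'L I] by blast+
  note markov = markov_bound[OF mom(1) _ _ mom(2), of "c ^ 4"]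
  have "prob {\<omega> \<in> space M. \<exists>k\<le>b. \<bar>transform a Z k \<omega>\<bar> > c}
      \<le> prob {\<omega> \<in> space M. transform a Z' b \<omega> ^ 4 \<ge> c ^ 4}"
  proof (rule finite_measure_mono)
    show "{\<omega> \<in> space M. \<exists>k\<le>b. \<bar>transform a Z k \<omega>\<bar> > c} \<subseteq> {\<omega> \<in> space M. transform a Z' b \<omega> ^ 4 \<ge> c ^ 4}"
    proof clarify
      fix \<omega> k assume "k \<le> b" "\<bar>transform a Z k \<omega>\<bar> > c"
      then have "\<bar>transform a Z' b \<omega>\<bar> > c" unfolding T T' by (rule stopped_sum_exceeds)
      then have "c ^ 4 \<le> \<bar>transform a Z' b \<omega>\<bar> ^ 4" using \<open>c > 0\<close> by (intro power_mono) auto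
      then show "c ^ 4 \<le> transform a Z' b \<omega> ^ 4" by (simp add: power_abs)
    qed
    show "{\<omega> \<in> space M. transform a Z' b \<omega> ^ 4 \<ge> c ^ 4} \<in> events"
      using borel_measurable_integrable[OF mom(1)] by measurable
  qed
  also have "\<dots> \<le> quartic_const CARD('d) q L * real b ^ 2 / c ^ 4"
    using markov \<open>c > 0\<close> by simp
  finally show "prob {\<omega> \<in> space M. \<exists>k\<le>b. \<bar>transform a Z k \<omega>\<bar> > c}
      \<le> quartic_const CARD('d) q L * real b ^ 2 / c ^ 4" .
qed

end

section \<open>The rescaled random walk\<close>

locale iid_walk = iid_steps M UNIV \<eta> q for M :: "'a measure" and \<eta> :: "nat \<Rightarrow> 'a \<Rightarrow> real^'d" and q
begin

definition walk :: "nat \<Rightarrow> nat \<Rightarrow> 'a \<Rightarrow> real^'d" where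
  "walk n k \<omega> = (1 / sqrt (real n)) *\<^sub>R (\<Sum>j<k. \<eta> j \<omega>)"

lemma walk_0 [simp]: "walk n 0 \<omega> = 0"
  by (simp add: walk_def)

lemma walk_Suc: "walk n (Suc k) \<omega> - walk n k \<omega> = (1 / sqrt (real n)) *\<^sub>R \<eta> k \<omega>"
  by (simp add: walk_def scaleR_right_distrib)

lemma walk_diff:
  assumes "k \<le> k'"
  shows "walk n k' \<omega> - walk n k \<omega> = (1 / sqrt (real n)) *\<^sub>R (\<Sum>j\<in>{k..<k'}. \<eta> j \<omega>)"
proof -
  have "{..<k'} = {..<k} \<union> {k..<k'}" using assms by auto
  then have "(\<Sum>j<k'. \<eta> j \<omega>) = (\<Sum>j<k. \<eta> j \<omega>) + (\<Sum>j\<in>{k..<k'}. \<eta> j \<omega>)"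
    by (simp add: sum.union_disjoint ivl_disj_int)
  then show ?thesis by (simp add: walk_def scaleR_right_distrib)
qed

lemma measurable_gen_walk [measurable]: "walk n k \<in> borel_measurable (gen {..<k})"
  unfolding walk_def[abs_def]
  by (intro borel_measurable_scaleR borel_measurable_sum measurable_gen_step) auto

lemma measurable_walk [measurable]: "walk n k \<in> borel_measurable M"
  by (rule measurable_genD[OF measurable_gen_walk]) simp

lemma measurable_walk_component [measurable]: "(\<lambda>\<omega>. walk n k \<omega> $ i) \<in> borel_measurable M"
  by (rule measurable_compose[OF measurable_walk]) simp

lemma measurable_gen_walk_diff:
  assumes "k \<le> k'"
  shows "(\<lambda>\<omega>. walk n k' \<omega> - walk n k \<omega>) \<in> borel_measurable (gen {k..<k'})"
  unfolding walk_diff[OF assms]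
  by (intro borel_measurable_scaleR borel_measurable_sum measurable_gen_step) auto

lemma block_sum_eq_transform:
  "(\<Sum>j\<in>{a..<a + k}. \<eta> j \<omega>) $ i = transform a (\<lambda>i' _ _. if i' = i then 1 else 0) k \<omega>"
  by (simp add: transform_def sum_component if_distrib[of "\<lambda>x. x * _"] cong: if_cong)

text \<open>A component of a block sum is a transform with coefficients 0 and 1, hence the bound
  with \<open>L = 1\<close>.\<close>

lemma block_sum_fourth_moment:
  "integrable M (\<lambda>\<omega>. ((\<Sum>j\<in>{a..<a + k}. \<eta> j \<omega>) $ i) ^ 4)"
  "expectation (\<lambda>\<omega>. ((\<Sum>j\<in>{a..<a + k}. \<eta> j \<omega>) $ i) ^ 4) \<le> quartic_const CARD('d) q 1 * real k ^ 2"
  unfolding block_sum_eq_transform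
  using transform_moments[where Z="\<lambda>i' _ _. if i' = i then 1 else 0" and a=a and k=k and L=1]
  by auto

lemma block_sum_covariance:
  "integrable M (\<lambda>\<omega>. (\<Sum>j\<in>{a..<a + k}. \<eta> j \<omega>) $ i * (\<Sum>j\<in>{a..<a + k}. \<eta> j \<omega>) $ l)
   \<and> expectation (\<lambda>\<omega>. (\<Sum>j\<in>{a..<a + k}. \<eta> j \<omega>) $ i * (\<Sum>j\<in>{a..<a + k}. \<eta> j \<omega>) $ l)
    = (if i = l then real k else 0)"
proof (induction k)
  case (Suc k)
  let ?S = "\<lambda>i \<omega>. (\<Sum>j\<in>{a..<a + k}. \<eta> j \<omega>) $ i"
  have S: "?S i \<in> borel_measurable (gen {..<a + k})" for i
    by (intro measurable_compose[OF borel_measurable_sum[OF measurable_gen_step]]) auto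
  have SM: "?S i \<in> borel_measurable M" for i by (rule measurable_genD[OF S]) simp
  have "integrable M (\<lambda>\<omega>. ?S i \<omega> ^ 1)" for i
    by (rule integrable_power_le4[OF SM block_sum_fourth_moment(1)]) simp
  then have "integrable M (?S i)" for i by simp
  note cross = past_mult_step[OF _ _ _ S this, of "a + k"]
  have eq: "(\<Sum>j\<in>{a..<a + Suc k}. \<eta> j \<omega>) $ i * (\<Sum>j\<in>{a..<a + Suc k}. \<eta> j \<omega>) $ l
    = ?S i \<omega> * ?S l \<omega> + ?S i \<omega> * \<eta> (a + k) \<omega> $ l + ?S l \<omega> * \<eta> (a + k) \<omega> $ i
      + \<eta> (a + k) \<omega> $ i * \<eta> (a + k) \<omega> $ l" for \<omega>
    by (simp add: algebra_simps)
  show ?case unfolding eq using Suc cross cov[of "a + k"] integrable_step_mult[of "a + k"] by simp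
qed simp

text \<open>By Cauchy-Schwarz the fourth power of the norm is at most \<open>d\<close> times the sum
  of the fourth powers of \<open>d\<close> components, each of which contributes one
  \<open>quartic_const\<close>.\<close>

definition incr_const :: real where
  "incr_const = real CARD('d) ^ 2 * quartic_const CARD('d) q 1"

lemma incr_const_nonneg: "incr_const \<ge> 0"
  using q_nonneg[of 0] by (simp add: incr_const_def)

context
  fixes n k k' :: nat
  assumes n: "n > 0" and k: "k \<le> k'"
begin

abbreviation (input) "incr \<omega> \<equiv> walk n k' \<omega> - walk n k \<omega>"
abbreviation (input) "lag \<equiv> (real k' - real k) / real n"

lemma incr_covariance:
  "integrable M (\<lambda>\<omega>. incr \<omega> $ i * incr \<omega> $ l)"
  "expectation (\<lambda>\<omega>. incr \<omega> $ i * incr \<omega> $ l) = (if i = l then lag else 0)"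
proof -
  have "incr \<omega> $ i * incr \<omega> $ l
      = (1 / real n) * ((\<Sum>j\<in>{k..<k'}. \<eta> j \<omega>) $ i * (\<Sum>j\<in>{k..<k'}. \<eta> j \<omega>) $ l)" for \<omega>
    unfolding walk_diff[OF k] using n by (simp add: field_simps del: sum_component)
  then show "integrable M (\<lambda>\<omega>. incr \<omega> $ i * incr \<omega> $ l)"
    "expectation (\<lambda>\<omega>. incr \<omega> $ i * incr \<omega> $ l) = (if i = l then lag else 0)"
    using block_sum_covariance[of k "k' - k" i l] k by (simp_all add: of_nat_diff del: sum_component)
qed

lemma incr_second_moment:
  "integrable M (\<lambda>\<omega>. norm (incr \<omega>) ^ 2)"
  "expectation (\<lambda>\<omega>. norm (incr \<omega>) ^ 2) = real CARD('d) * lag"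
  unfolding norm_sq_eq_sum using incr_covariance by (simp_all del: vector_minus_component)

lemma incr_fourth_moment:
  "integrable M (\<lambda>\<omega>. norm (incr \<omega>) ^ 4)"
  "expectation (\<lambda>\<omega>. norm (incr \<omega>) ^ 4) \<le> incr_const * lag ^ 2"
proof -
  let ?H = "\<lambda>\<omega>. \<Sum>j\<in>{k..<k'}. \<eta> j \<omega>"
  have H: "integrable M (\<lambda>\<omega>. (?H \<omega> $ i) ^ 4)"
    "expectation (\<lambda>\<omega>. (?H \<omega> $ i) ^ 4) \<le> quartic_const CARD('d) q 1 * (real k' - real k) ^ 2" for i
    using block_sum_fourth_moment[of k "k' - k" i] k by (simp_all add: of_nat_diff del: sum_component)
  let ?R = "\<lambda>\<omega>. (1 / real n ^ 2) * (real CARD('d) * (\<Sum>i\<in>UNIV. (?H \<omega> $ i) ^ 4))"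
  have R: "integrable M ?R" using H(1) by (intro integrable_mult_right Bochner_Integration.integrable_sum)
  have le: "norm (incr \<omega>) ^ 4 \<le> ?R \<omega>" for \<omega>
  proof -
    have "norm (incr \<omega>) ^ 4 = (1 / real n ^ 2) * (norm (?H \<omega>) ^ 2) ^ 2"
    proof -
      have "sqrt (real n) ^ (2 * 2) = real n ^ 2" unfolding power_mult by simp
      then have "sqrt (real n) ^ 4 = real n ^ 2" by simp
      moreover have "norm (?H \<omega>) ^ 4 = (norm (?H \<omega>) ^ 2) ^ 2" by simp
      ultimately show ?thesis
        unfolding walk_diff[OF k] by (simp add: power_divide)
    qed
    also have "(norm (?H \<omega>) ^ 2) ^ 2 \<le> real CARD('d) * (\<Sum>i\<in>UNIV. (?H \<omega> $ i) ^ 4)"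
    proof -
      have "(\<Sum>i\<in>UNIV. (?H \<omega> $ i) ^ 2) ^ 2 \<le> (\<Sum>i\<in>UNIV. ((?H \<omega> $ i) ^ 2) ^ 2) * real CARD('d)"
        by (rule sum_squared_le_sum_of_squares)
      then show ?thesis
        unfolding norm_sq_eq_sum power2_eq_square[symmetric] by (simp add: mult.commute del: sum_component)
    qed
    finally show ?thesis by (simp add: mult_left_mono divide_right_mono del: sum_component)
  qed
  show int: "integrable M (\<lambda>\<omega>. norm (incr \<omega>) ^ 4)"
  proof (rule Bochner_Integration.integrable_bound[OF R])
    show "AE \<omega> in M. norm (norm (incr \<omega>) ^ 4) \<le> norm (?R \<omega>)"
    proof (intro AE_I2)
      fix \<omega>
      have "norm (norm (incr \<omega>) ^ 4) = norm (incr \<omega>) ^ 4" by simp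
      also have "\<dots> \<le> ?R \<omega>" by (rule le)
      also have "\<dots> \<le> norm (?R \<omega>)" unfolding real_norm_def by (rule abs_ge_self)
      finally show "norm (norm (incr \<omega>) ^ 4) \<le> norm (?R \<omega>)" .
    qed
  qed simp
  have "expectation (\<lambda>\<omega>. norm (incr \<omega>) ^ 4) \<le> expectation ?R"
    by (rule integral_mono[OF int R le])
  also have "\<dots> = (1 / real n ^ 2) * (real CARD('d) * (\<Sum>i\<in>UNIV. expectation (\<lambda>\<omega>. (?H \<omega> $ i) ^ 4)))"
    using H(1) by (simp del: sum_component)
  also have "\<dots> \<le> (1 / real n ^ 2) * (real CARD('d) * (\<Sum>i\<in>(UNIV::'d set). quartic_const CARD('d) q 1 * (real k' - real k) ^ 2))"
    by (intro mult_left_mono sum_mono H(2)) auto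
  also have "\<dots> = incr_const * lag ^ 2"
    by (simp add: incr_const_def power2_eq_square field_simps)
  finally show "expectation (\<lambda>\<omega>. norm (incr \<omega>) ^ 4) \<le> incr_const * lag ^ 2" .
qed

text \<open>The third moment is interpolated between the second and the fourth; the scale
  \<open>sqrt lag\<close> balances the two terms at order \<open>lag * sqrt lag\<close>. One factor
  is then bounded by \<open>sqrt \<mu>\<close> and the other kept linear, so that summation over
  blocks of total duration at most 1 gives order \<open>sqrt \<mu>\<close>.\<close>

lemma incr_third_moment:
  assumes "lag \<le> \<mu>"
  shows "integrable M (\<lambda>\<omega>. norm (incr \<omega>) ^ 3)"
    and "expectation (\<lambda>\<omega>. norm (incr \<omega>) ^ 3) \<le> (real CARD('d) + incr_const) / 2 * (lag * sqrt \<mu>)"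
proof -
  show int: "integrable M (\<lambda>\<omega>. norm (incr \<omega>) ^ 3)"
    by (rule integrable_power_le4[OF _ incr_fourth_moment(1)]) simp_all
  show "expectation (\<lambda>\<omega>. norm (incr \<omega>) ^ 3) \<le> (real CARD('d) + incr_const) / 2 * (lag * sqrt \<mu>)"
  proof (cases "k = k'")
    case True
    then show ?thesis by simp
  next
    case False
    let ?s = "sqrt lag"
    have lag: "lag > 0" using False k n by simp
    then have s: "?s > 0" "?s ^ 2 = lag" by simp_all
    have le: "x ^ 3 \<le> (s * x ^ 2 + x ^ 4 / s) / 2" if "s > 0" for x s :: real
    proof -
      have "0 \<le> x ^ 2 * (x - s) ^ 2" by simp
      then have "2 * s * x ^ 3 \<le> s ^ 2 * x ^ 2 + x ^ 4"
        by (simp add: algebra_simps power2_eq_square power3_eq_cube power4_eq_xxxx)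
      then show ?thesis using that by (simp add: field_simps power2_eq_square)
    qed
    have "expectation (\<lambda>\<omega>. norm (incr \<omega>) ^ 3)
        \<le> expectation (\<lambda>\<omega>. (?s * norm (incr \<omega>) ^ 2 + norm (incr \<omega>) ^ 4 / ?s) / 2)"
      using incr_second_moment(1) incr_fourth_moment(1) le[OF s(1)]
      by (intro integral_mono int integrable_divide Bochner_Integration.integrable_add integrable_mult_right) auto
    also have "\<dots> = (?s * (real CARD('d) * lag) + expectation (\<lambda>\<omega>. norm (incr \<omega>) ^ 4) / ?s) / 2"
      using incr_second_moment incr_fourth_moment(1) by simp
    also have "\<dots> \<le> (?s * (real CARD('d) * lag) + incr_const * lag ^ 2 / ?s) / 2"
      using incr_fourth_moment(2) s(1) by (intro divide_right_mono add_left_mono) auto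
    also have "incr_const * lag ^ 2 / ?s = incr_const * (lag * ?s)"
    proof -
      have "incr_const * lag ^ 2 / ?s = incr_const * lag * (lag / ?s)" by (simp add: power2_eq_square mult.assoc)
      also have "lag / ?s = ?s" by (rule real_div_sqrt) (use lag in simp)
      finally show ?thesis by (simp only: mult.assoc)
    qed
    also have "(?s * (real CARD('d) * lag) + incr_const * (lag * ?s)) / 2 = (real CARD('d) + incr_const) / 2 * (lag * ?s)"
    proof -
      have "(s * (d * l) + c * (l * s)) / 2 = (d + c) / 2 * (l * s)" for s d l c :: real
        by (simp add: field_simps)
      then show ?thesis .
    qed
    also have "\<dots> \<le> (real CARD('d) + incr_const) / 2 * (lag * sqrt \<mu>)"
      using assms lag incr_const_nonneg by (intro mult_left_mono) auto
    finally show ?thesis .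
  qed
qed

text \<open>The constant subtracted is the mean of the product, so the second moment of the
  difference is a variance and is bounded by the fourth moment of the increment. Centring prepares
  the use of \<open>orthogonal_sum\<close>.\<close>

lemma incr_quadratic_deviation:
  "integrable M (\<lambda>\<omega>. (incr \<omega> $ i * incr \<omega> $ l - (if i = l then lag else 0)) ^ 2)"
  "expectation (\<lambda>\<omega>. (incr \<omega> $ i * incr \<omega> $ l - (if i = l then lag else 0)) ^ 2) \<le> incr_const * lag ^ 2"
  "expectation (\<lambda>\<omega>. incr \<omega> $ i * incr \<omega> $ l - (if i = l then lag else 0)) = 0"
proof -
  let ?X = "\<lambda>\<omega>. incr \<omega> $ i * incr \<omega> $ l" and ?c = "if i = l then lag else 0"
  have X_le: "?X \<omega> ^ 2 \<le> norm (incr \<omega>) ^ 4" for \<omega>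
  proof -
    have "\<bar>?X \<omega>\<bar> \<le> norm (incr \<omega>) * norm (incr \<omega>)"
      unfolding abs_mult by (intro mult_mono component_le_norm_cart) auto
    from power_mono[OF this, of 2] show ?thesis
      by (simp add: power2_eq_square power4_eq_xxxx abs_mult mult_ac del: vector_minus_component)
  qed
  have incr_component: "(\<lambda>\<omega>. incr \<omega> $ i) \<in> borel_measurable M" for i
    unfolding vector_minus_component by measurable
  have X2: "integrable M (\<lambda>\<omega>. ?X \<omega> ^ 2)"
  proof (rule Bochner_Integration.integrable_bound[OF incr_fourth_moment(1)])
    show "(\<lambda>\<omega>. ?X \<omega> ^ 2) \<in> borel_measurable M"
      by (intro borel_measurable_power borel_measurable_times incr_component)
    show "AE \<omega> in M. norm (?X \<omega> ^ 2) \<le> norm (norm (incr \<omega>) ^ 4)"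
      using X_le by (intro AE_I2) (simp del: vector_minus_component)
  qed
  have eq: "(?X \<omega> - ?c) ^ 2 = ?X \<omega> ^ 2 - 2 * ?c * ?X \<omega> + ?c ^ 2" for \<omega> by (simp add: power2_diff)
  show "integrable M (\<lambda>\<omega>. (?X \<omega> - ?c) ^ 2)" unfolding eq using X2 incr_covariance(1)[of i l] by simp
  have "expectation (\<lambda>\<omega>. (?X \<omega> - ?c) ^ 2) = expectation (\<lambda>\<omega>. ?X \<omega> ^ 2) - ?c ^ 2"
    unfolding eq using X2 incr_covariance[of i l] by (simp add: power2_eq_square prob_space del: vector_minus_component)
  also have "\<dots> \<le> expectation (\<lambda>\<omega>. norm (incr \<omega>) ^ 4)"
    using integral_mono[OF X2 incr_fourth_moment(1) X_le] by (smt (verit) zero_le_power2)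
  finally show "expectation (\<lambda>\<omega>. (?X \<omega> - ?c) ^ 2) \<le> incr_const * lag ^ 2"
    using incr_fourth_moment(2) by linarith
  show "expectation (\<lambda>\<omega>. ?X \<omega> - ?c) = 0"
    using incr_covariance[of i l] by (simp add: prob_space del: vector_minus_component)
qed

end

end

section \<open>Second-order expansion of the integral sums\<close>

text \<open>The consequences of \<open>C2_bounded\<close> on which the estimates rest, for one
  component of the values; \<open>g i l\<close> plays the role of the partial derivative of
  \<open>f i\<close> in direction \<open>l\<close>.\<close>

definition regular_coeffs ::
  "real \<Rightarrow> ('d \<Rightarrow> real^'d \<Rightarrow> real) \<Rightarrow> ('d \<Rightarrow> 'd \<Rightarrow> real^'d \<Rightarrow> real) \<Rightarrow> bool" where
  "regular_coeffs L f g \<longleftrightarrow> L \<ge> 0 \<and>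
     (\<forall>i. continuous_on UNIV (f i)) \<and> (\<forall>i l. continuous_on UNIV (g i l)) \<and>
     (\<forall>i y. \<bar>f i y\<bar> \<le> L) \<and> (\<forall>i l y. \<bar>g i l y\<bar> \<le> L) \<and>
     (\<forall>i y v. \<bar>f i (y + v) - f i y\<bar> \<le> L * norm v) \<and>
     (\<forall>i l y v. \<bar>g i l (y + v) - g i l y\<bar> \<le> L * norm v) \<and>
     (\<forall>i y v. \<bar>f i (y + v) - f i y - (\<Sum>l\<in>UNIV. v $ l * g i l y)\<bar> \<le> L * norm v ^ 2)"

definition trapezoid ::
  "('d \<Rightarrow> real^'d \<Rightarrow> 'v::real_vector) \<Rightarrow> (nat \<Rightarrow> real^'d) \<Rightarrow> nat \<Rightarrow> 'v" where
  "trapezoid f w r =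
     (\<Sum>j<r. \<Sum>i\<in>UNIV. ((w (Suc j) - w j) $ i) *\<^sub>R ((1 / 2) *\<^sub>R (f i (w j) + f i (w (Suc j)))))"

text \<open>The Ito sum with its Stratonovich correction; \<open>h j\<close> is the time elapsed during step \<open>j\<close>.\<close>

definition corrected_sum ::
  "('d \<Rightarrow> real^'d \<Rightarrow> real) \<Rightarrow> ('d \<Rightarrow> 'd \<Rightarrow> real^'d \<Rightarrow> real) \<Rightarrow> (nat \<Rightarrow> real^'d) \<Rightarrow> (nat \<Rightarrow> real) \<Rightarrow> nat \<Rightarrow> real" where
  "corrected_sum f g w h r = (\<Sum>j<r. (\<Sum>i\<in>UNIV. f i (w j) * (w (Suc j) - w j) $ i)
     + (\<Sum>i\<in>UNIV. g i i (w j)) * h j / 2)"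

text \<open>A pathwise identity followed by the triangle inequality. The value \<open>p i j\<close>
  may be anything equal to \<open>f i\<close> plus half its differential up to second order, which
  covers both the mean over a cell and the trapezoidal average. The first term of the bound collects
  the remainders; the second is the price of replacing products of increments by their
  covariance.\<close>

lemma expansion_remainder:
  fixes w :: "nat \<Rightarrow> real^'d"
  assumes "\<And>i j. j < r \<Longrightarrow>
      \<bar>p i j - f i (w j) - (\<Sum>l\<in>UNIV. (w (Suc j) - w j) $ l * g i l (w j)) / 2\<bar> \<le> L * norm (w (Suc j) - w j) ^ 2"
  shows "\<bar>(\<Sum>j<r. \<Sum>i\<in>UNIV. (w (Suc j) - w j) $ i * p i j) - corrected_sum f g w h r\<bar>
    \<le> real CARD('d) * L * (\<Sum>j<r. norm (w (Suc j) - w j) ^ 3)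
      + (\<Sum>i\<in>UNIV. \<Sum>l\<in>UNIV. \<bar>\<Sum>j<r. g i l (w j) *
          ((w (Suc j) - w j) $ i * (w (Suc j) - w j) $ l - (if i = l then h j else 0))\<bar>) / 2"
proof -
  define D where "D j = w (Suc j) - w j" for j
  define R where "R i j = p i j - f i (w j) - (\<Sum>l\<in>UNIV. D j $ l * g i l (w j)) / 2" for i j
  define Q where "Q i l j = g i l (w j) * (D j $ i * D j $ l - (if i = l then h j else 0))" for i l j
  have step_eq: "(\<Sum>i\<in>UNIV. D j $ i * p i j) - ((\<Sum>i\<in>UNIV. f i (w j) * D j $ i) + (\<Sum>i\<in>UNIV. g i i (w j)) * h j / 2)
      = (\<Sum>i\<in>UNIV. D j $ i * R i j) + (\<Sum>i\<in>UNIV. \<Sum>l\<in>UNIV. Q i l j) / 2" for j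
  proof -
    have 1: "(\<Sum>l\<in>UNIV. Q i l j) = (\<Sum>l\<in>UNIV. D j $ i * (D j $ l * g i l (w j))) - g i i (w j) * h j" for i
      by (simp add: Q_def right_diff_distrib sum_subtractf if_distrib[of "\<lambda>x. _ * x"] mult_ac cong: if_cong)
    have 2: "D j $ i * R i j = D j $ i * p i j - f i (w j) * D j $ i - (\<Sum>l\<in>UNIV. D j $ i * (D j $ l * g i l (w j))) / 2" for i
      by (simp add: R_def algebra_simps sum_distrib_left)
    show ?thesis unfolding 1 2 by (simp add: sum_subtractf sum_divide_distrib sum_distrib_right diff_divide_distrib)
  qed
  have "(\<Sum>j<r. \<Sum>i\<in>UNIV. D j $ i * p i j) - corrected_sum f g w h r
      = (\<Sum>j<r. \<Sum>i\<in>UNIV. D j $ i * R i j) + (\<Sum>i\<in>UNIV. \<Sum>l\<in>UNIV. \<Sum>j<r. Q i l j) / 2"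
  proof -
    have swap: "(\<Sum>j<r. \<Sum>i\<in>UNIV. \<Sum>l\<in>UNIV. Q i l j) = (\<Sum>i\<in>UNIV. \<Sum>l\<in>UNIV. \<Sum>j<r. Q i l j)"
      by (subst sum.swap, rule sum.cong[OF refl], subst sum.swap, rule refl)
    show ?thesis
      unfolding corrected_sum_def D_def[symmetric] sum_subtractf[symmetric] step_eq swap[symmetric]
      by (simp add: sum.distrib sum_divide_distrib)
  qed
  also have "\<bar>\<dots>\<bar> \<le> (\<Sum>j<r. \<Sum>i\<in>(UNIV::'d set). L * norm (D j) ^ 3) + (\<Sum>i\<in>UNIV. \<Sum>l\<in>UNIV. \<bar>\<Sum>j<r. Q i l j\<bar>) / 2"
  proof (rule order_trans[OF abs_triangle_ineq], rule add_mono)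
    show "\<bar>\<Sum>j<r. \<Sum>i\<in>UNIV. D j $ i * R i j\<bar> \<le> (\<Sum>j<r. \<Sum>i\<in>(UNIV::'d set). L * norm (D j) ^ 3)"
    proof (intro order_trans[OF sum_abs] sum_mono)
      fix i j assume "j \<in> {..<r}"
      then have "\<bar>R i j\<bar> \<le> L * norm (D j) ^ 2" using assms[of j i] unfolding R_def D_def by simp
      then have "\<bar>D j $ i\<bar> * \<bar>R i j\<bar> \<le> norm (D j) * (L * norm (D j) ^ 2)"
        by (intro mult_mono component_le_norm_cart) auto
      then show "\<bar>D j $ i * R i j\<bar> \<le> L * norm (D j) ^ 3"
        by (simp add: abs_mult power2_eq_square power3_eq_cube mult_ac)
    qed
    show "\<bar>(\<Sum>i\<in>UNIV. \<Sum>l\<in>UNIV. \<Sum>j<r. Q i l j) / 2\<bar> \<le> (\<Sum>i\<in>UNIV. \<Sum>l\<in>UNIV. \<bar>\<Sum>j<r. Q i l j\<bar>) / 2"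
      unfolding abs_divide abs_numeral
      by (rule divide_right_mono, rule order_trans[OF sum_abs], rule sum_mono, rule sum_abs) simp
  qed
  finally show ?thesis by (simp add: D_def Q_def sum_distrib_left mult_ac)
qed

section \<open>Division of the steps into blocks\<close>

lemma sum_blocks:
  fixes K :: "nat \<Rightarrow> nat" and F :: "nat \<Rightarrow> 'z::comm_monoid_add"
  assumes "mono K" "K 0 = 0"
  shows "(\<Sum>k<K r. F k) = (\<Sum>j<r. \<Sum>k\<in>{K j..<K (Suc j)}. F k)"
proof (induction r)
  case (Suc r)
  have "K r \<le> K (Suc r)" using assms(1) by (simp add: monoD)
  then have "{..<K (Suc r)} = {..<K r} \<union> {K r..<K (Suc r)}" by auto
  then show ?case using Suc by (simp add: sum.union_disjoint ivl_disj_int)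
qed (simp add: assms)

text \<open>The least \<open>j\<close> with \<open>k < K j\<close> is positive because
  \<open>K 0 = 0\<close>; its predecessor is the block of \<open>k\<close>.\<close>

lemma block_locate:
  fixes K :: "nat \<Rightarrow> nat"
  assumes "K 0 = 0" "k < K r"
  obtains j where "j < r" "K j \<le> k" "k < K (Suc j)"
proof -
  define j where "j = (LEAST j. k < K j)"
  have j: "k < K j" unfolding j_def by (rule LeastI[of _ r]) (rule assms)
  have le: "j \<le> r" unfolding j_def by (rule Least_le) (rule assms)
  obtain i where i: "j = Suc i" using j assms(1) by (cases j) auto
  have "\<not> k < K i" using not_less_Least[of i "\<lambda>j. k < K j"] i j_def by simp
  then show ?thesis using that[of i] i j le by simp
qed

text \<open>The start of the block that contains step \<open>k\<close>. It is deterministic and at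
  most \<open>k\<close>, so coefficients frozen there still depend on the past only.\<close>

definition block_start :: "(nat \<Rightarrow> nat) \<Rightarrow> nat \<Rightarrow> nat" where
  "block_start K k = Max {K j | j. K j \<le> k}"

lemma block_start_eq:
  assumes "mono K" "K j \<le> k" "k < K (Suc j)"
  shows "block_start K k = K j"
  unfolding block_start_def
proof (rule Max_eqI)
  show "finite {K j |j. K j \<le> k}" by (rule finite_subset[of _ "{..k}"]) auto
  show "y \<le> K j" if "y \<in> {K j |j. K j \<le> k}" for y
  proof -
    from that obtain i where i: "y = K i" "K i \<le> k" by auto
    then have "K i < K (Suc j)" using assms(3) by simp
    then have "i < Suc j" using assms(1) by (metis monoD not_less)
    then show ?thesis using i assms(1) by (simp add: monoD)
  qed
qed (use assms in auto)

context iid_walk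
begin

text \<open>The first term comes from the third moments of the increments, the second from the
  \<open>d ^ 2\<close> sums of centred products, each with weight 1/2.\<close>

definition expansion_const :: "real \<Rightarrow> real" where
  "expansion_const L =
    real CARD('d) * L * (real CARD('d) + incr_const) / 2 + real CARD('d) ^ 2 * L * sqrt incr_const / 2"

context
  fixes f :: "'d \<Rightarrow> real^'d \<Rightarrow> real" and g :: "'d \<Rightarrow> 'd \<Rightarrow> real^'d \<Rightarrow> real" and L \<mu> :: real
    and n r :: nat and K :: "nat \<Rightarrow> nat"
  assumes fg: "regular_coeffs L f g" and n: "n > 0"
    and K: "mono K" "K 0 = 0" "K r \<le> n"
    and mesh: "\<And>j. j < r \<Longrightarrow> (real (K (Suc j)) - real (K j)) / real n \<le> \<mu>" and \<mu>: "\<mu> \<ge> 0"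
begin

abbreviation (input) "w \<omega> j \<equiv> walk n (K j) \<omega>"
abbreviation (input) "h j \<equiv> (real (K (Suc j)) - real (K j)) / real n"

lemma K_le: "K j \<le> K (Suc j)"
  using K(1) by (simp add: monoD)

lemma sum_h_le: "(\<Sum>j<r. h j) \<le> 1"
proof -
  have "(\<Sum>j<r. h j) = (real (K r) - real (K 0)) / real n"
    unfolding sum_divide_distrib[symmetric]
    by (rule arg_cong[where f="\<lambda>x. x / real n"]) (rule sum_lessThan_telescope)
  also have "\<dots> \<le> 1" using n K(2,3) by simp
  finally show ?thesis .
qed

lemma regular_measurable:
  "f i \<in> borel_measurable borel" "g i l \<in> borel_measurable borel"
  using fg unfolding regular_coeffs_def by (auto intro: borel_measurable_continuous_onI)

text \<open>Estimating the summands one by one would give a bound of order 1. The centred products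
  are orthogonal, so the second moment is at most a multiple of the sum of the squared durations,
  which is at most \<open>\<mu>\<close> times the total duration.\<close>

lemma sum_quadratic_deviation:
  defines "Q \<equiv> \<lambda>i l \<omega>. \<Sum>j<r. g i l (w \<omega> j) *
      ((w \<omega> (Suc j) - w \<omega> j) $ i * (w \<omega> (Suc j) - w \<omega> j) $ l - (if i = l then h j else 0))"
  shows "integrable M (\<lambda>\<omega>. \<bar>Q i l \<omega>\<bar>)"
    and "expectation (\<lambda>\<omega>. \<bar>Q i l \<omega>\<bar>) \<le> L * sqrt incr_const * sqrt \<mu>"
proof -
  have L: "L \<ge> 0" and gL: "\<bar>g i l y\<bar> \<le> L" for y using fg unfolding regular_coeffs_def by auto
  let ?Z = "\<lambda>j \<omega>. g i l (w \<omega> j)"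
  let ?Y = "\<lambda>j \<omega>. (w \<omega> (Suc j) - w \<omega> j) $ i * (w \<omega> (Suc j) - w \<omega> j) $ l - (if i = l then h j else 0)"
  have Zm: "?Z j \<in> borel_measurable (gen {..<K j})" for j
    by (rule measurable_compose[OF measurable_gen_walk regular_measurable(2)])
  have Z2: "?Z j \<omega> ^ 2 \<le> L ^ 2" for j \<omega> using power_mono[OF gL, of _ 2] by simp
  have intZ: "integrable M (\<lambda>\<omega>. ?Z j \<omega> ^ 2)" for j
    by (rule integrable_const_bound[where B="L ^ 2"])
      (use Z2 measurable_genD[OF Zm] in \<open>auto intro: borel_measurable_power\<close>)
  have EZ: "expectation (\<lambda>\<omega>. ?Z j \<omega> ^ 2) \<le> L ^ 2" for j
    using integral_mono[OF intZ, of "\<lambda>_. L ^ 2"] Z2 by (simp add: prob_space)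
  have Ym: "?Y j \<in> borel_measurable (gen {K j..<K (Suc j)})" for j
    by (intro borel_measurable_diff borel_measurable_times measurable_compose[OF measurable_gen_walk_diff[OF K_le]]) auto
  note Y = incr_quadratic_deviation[OF n K_le]
  have res: "(\<lambda>\<omega>. \<Sum>j<r. ?Z j \<omega> * ?Y j \<omega>) \<in> borel_measurable (gen {..<K r})
    \<and> integrable M (\<lambda>\<omega>. (\<Sum>j<r. ?Z j \<omega> * ?Y j \<omega>) ^ 2)
    \<and> expectation (\<lambda>\<omega>. (\<Sum>j<r. ?Z j \<omega> * ?Y j \<omega>) ^ 2) \<le> (\<Sum>j<r. L ^ 2 * (incr_const * h j ^ 2))"
    by (rule orthogonal_sum[OF K(1) _ Zm intZ EZ Ym Y]) simp
  have "(\<Sum>j<r. L ^ 2 * (incr_const * h j ^ 2)) \<le> (\<Sum>j<r. L ^ 2 * (incr_const * (\<mu> * h j)))"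
  proof (intro sum_mono mult_left_mono incr_const_nonneg)
    fix j assume "j \<in> {..<r}"
    then show "h j ^ 2 \<le> \<mu> * h j"
      unfolding power2_eq_square using mesh K_le n by (intro mult_right_mono) auto
  qed simp
  also have "\<dots> = L ^ 2 * incr_const * \<mu> * (\<Sum>j<r. h j)" by (simp add: sum_distrib_left mult_ac)
  also have "\<dots> \<le> L ^ 2 * incr_const * \<mu> * 1"
    using sum_h_le incr_const_nonneg \<mu> by (intro mult_left_mono) auto
  finally have le: "expectation (\<lambda>\<omega>. Q i l \<omega> ^ 2) \<le> L ^ 2 * incr_const * \<mu>" using res by (simp add: Q_def)
  have Qm: "Q i l \<in> borel_measurable M" using res measurable_genD unfolding Q_def by blast
  have Q2: "integrable M (\<lambda>\<omega>. Q i l \<omega> ^ 2)" using res by (simp add: Q_def)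
  show "integrable M (\<lambda>\<omega>. \<bar>Q i l \<omega>\<bar>)" using expectation_abs_le_sqrt(1)[OF Qm Q2 le] by simp
  show "expectation (\<lambda>\<omega>. \<bar>Q i l \<omega>\<bar>) \<le> L * sqrt incr_const * sqrt \<mu>"
    using expectation_abs_le_sqrt(2)[OF Qm Q2 le] L by (simp add: real_sqrt_mult)
qed

text \<open>The dominating variable is found before the values \<open>p\<close>, so that these may
  be chosen separately for each path.\<close>

lemma expansion_error:
  obtains V where "integrable M V" "\<And>\<omega>. 0 \<le> V \<omega>" "expectation V \<le> expansion_const L * sqrt \<mu>"
    and "\<And>\<omega> p. (\<And>i j. j < r \<Longrightarrow>
      \<bar>p i j - f i (w \<omega> j) - (\<Sum>l\<in>UNIV. (w \<omega> (Suc j) - w \<omega> j) $ l * g i l (w \<omega> j)) / 2\<bar>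
        \<le> L * norm (w \<omega> (Suc j) - w \<omega> j) ^ 2)
      \<Longrightarrow> \<bar>(\<Sum>j<r. \<Sum>i\<in>UNIV. (w \<omega> (Suc j) - w \<omega> j) $ i * p i j) - corrected_sum f g (w \<omega>) h r\<bar> \<le> V \<omega>"
proof -
  have L: "L \<ge> 0" using fg unfolding regular_coeffs_def by auto
  let ?Q = "\<lambda>i l \<omega>. \<bar>\<Sum>j<r. g i l (w \<omega> j) *
      ((w \<omega> (Suc j) - w \<omega> j) $ i * (w \<omega> (Suc j) - w \<omega> j) $ l - (if i = l then h j else 0))\<bar>"
  define V where "V \<omega> = real CARD('d) * L * (\<Sum>j<r. norm (w \<omega> (Suc j) - w \<omega> j) ^ 3)
      + (\<Sum>i\<in>UNIV. \<Sum>l\<in>UNIV. ?Q i l \<omega>) / 2" for \<omega>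
  note third = incr_third_moment[OF n K_le mesh]
  have i1: "integrable M (\<lambda>\<omega>. \<Sum>j<r. norm (w \<omega> (Suc j) - w \<omega> j) ^ 3)"
    using third(1) by (intro Bochner_Integration.integrable_sum) auto
  have i2: "integrable M (\<lambda>\<omega>. \<Sum>i\<in>UNIV. \<Sum>l\<in>UNIV. ?Q i l \<omega>)"
    by (intro Bochner_Integration.integrable_sum sum_quadratic_deviation)
  have intV: "integrable M V" unfolding V_def
    by (intro Bochner_Integration.integrable_add integrable_mult_right integrable_divide i1 i2)
  have e1: "expectation (\<lambda>\<omega>. \<Sum>j<r. norm (w \<omega> (Suc j) - w \<omega> j) ^ 3) \<le> (real CARD('d) + incr_const) / 2 * sqrt \<mu>"
  proof -
    have "expectation (\<lambda>\<omega>. \<Sum>j<r. norm (w \<omega> (Suc j) - w \<omega> j) ^ 3)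
        = (\<Sum>j<r. expectation (\<lambda>\<omega>. norm (w \<omega> (Suc j) - w \<omega> j) ^ 3))"
      using third(1) by (intro Bochner_Integration.integral_sum) auto
    also have "\<dots> \<le> (\<Sum>j<r. (real CARD('d) + incr_const) / 2 * (h j * sqrt \<mu>))"
      using third(2) by (intro sum_mono) auto
    also have "\<dots> = (real CARD('d) + incr_const) / 2 * (sqrt \<mu> * (\<Sum>j<r. h j))"
      by (simp add: sum_distrib_left mult_ac)
    also have "\<dots> \<le> (real CARD('d) + incr_const) / 2 * (sqrt \<mu> * 1)"
      using sum_h_le \<mu> incr_const_nonneg by (intro mult_left_mono) auto
    finally show ?thesis by simp
  qed
  have e2: "expectation (\<lambda>\<omega>. \<Sum>i\<in>UNIV. \<Sum>l\<in>UNIV. ?Q i l \<omega>) \<le> real CARD('d) ^ 2 * (L * sqrt incr_const * sqrt \<mu>)"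
  proof -
    have "expectation (\<lambda>\<omega>. \<Sum>i\<in>UNIV. \<Sum>l\<in>UNIV. ?Q i l \<omega>) = (\<Sum>i\<in>UNIV. \<Sum>l\<in>UNIV. expectation (?Q i l))"
      by (simp add: sum_quadratic_deviation(1) del: vector_minus_component)
    also have "\<dots> \<le> (\<Sum>i\<in>(UNIV::'d set). \<Sum>l\<in>(UNIV::'d set). L * sqrt incr_const * sqrt \<mu>)"
      by (intro sum_mono sum_quadratic_deviation(2))
    finally show ?thesis by (simp add: power2_eq_square mult_ac)
  qed
  have "expectation V = real CARD('d) * L * expectation (\<lambda>\<omega>. \<Sum>j<r. norm (w \<omega> (Suc j) - w \<omega> j) ^ 3)
      + expectation (\<lambda>\<omega>. \<Sum>i\<in>UNIV. \<Sum>l\<in>UNIV. ?Q i l \<omega>) / 2"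
    unfolding V_def using i1 i2 by (subst Bochner_Integration.integral_add) auto
  also have "\<dots> \<le> real CARD('d) * L * ((real CARD('d) + incr_const) / 2 * sqrt \<mu>)
      + (real CARD('d) ^ 2 * (L * sqrt incr_const * sqrt \<mu>)) / 2"
    using L e2 by (intro add_mono mult_left_mono e1) auto
  also have "\<dots> = expansion_const L * sqrt \<mu>" by (simp add: expansion_const_def algebra_simps)
  finally have EV: "expectation V \<le> expansion_const L * sqrt \<mu>" .
  have V0: "0 \<le> V \<omega>" for \<omega>
    unfolding V_def using L by (intro add_nonneg_nonneg mult_nonneg_nonneg sum_nonneg divide_nonneg_nonneg) auto
  show ?thesis
    by (rule that[OF intV V0 EV]) (unfold V_def, rule expansion_remainder)
qed

text \<open>The coarse sum equals a sum over single steps with coefficients frozen at the start of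
  their block. What remains is a martingale transform with coefficients of order
  \<open>sqrt \<mu>\<close>, bounded by orthogonality, and a drift of the same order that carries
  the factor 1/2 of the correction. The weights 1 and 1/2 make up the factor 3/2.\<close>

lemma refinement_error:
  obtains U where "integrable M U" "\<And>\<omega>. 0 \<le> U \<omega>"
    "expectation U \<le> 3 / 2 * (real CARD('d) * (L * sqrt (real CARD('d)))) * sqrt \<mu>"
    and "\<And>\<omega>. \<bar>corrected_sum f g (\<lambda>k. walk n k \<omega>) (\<lambda>_. 1 / real n) (K r)
       - corrected_sum f g (w \<omega>) h r\<bar> \<le> U \<omega>"
proof -
  have L: "L \<ge> 0" and fL: "\<bar>f i (y + v) - f i y\<bar> \<le> L * norm v"
    and gL: "\<bar>g i l (y + v) - g i l y\<bar> \<le> L * norm v" for i l y v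
    using fg unfolding regular_coeffs_def by auto
  define s where "s k = block_start K k" for k
  have s: "s k \<le> k" "(real k - real (s k)) / real n \<le> \<mu>" if k: "k < K r" for k
  proof -
    obtain j where j: "j < r" "K j \<le> k" "k < K (Suc j)" using block_locate[OF K(2) k] by blast
    then have "s k = K j" unfolding s_def using block_start_eq[OF K(1)] by blast
    moreover have "(real k - real (K j)) / real n \<le> h j" using j(3) by (intro divide_right_mono) auto
    ultimately show "s k \<le> k" "(real k - real (s k)) / real n \<le> \<mu>" using j mesh[OF j(1)] by auto
  qed
  let ?Z = "\<lambda>i k \<omega>. f i (walk n k \<omega>) - f i (walk n (s k) \<omega>)"
  let ?Y = "\<lambda>i k \<omega>. (walk n (Suc k) \<omega> - walk n k \<omega>) $ i"
  let ?N = "\<lambda>k \<omega>. norm (walk n k \<omega> - walk n (s k) \<omega>)"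
  define T where "T i \<omega> = (\<Sum>k<K r. ?Z i k \<omega> * ?Y i k \<omega>)" for i \<omega>
  define U where "U \<omega> = (\<Sum>i\<in>UNIV. \<bar>T i \<omega>\<bar>) + real CARD('d) * (L * (\<Sum>k<K r. ?N k \<omega>)) / (2 * real n)" for \<omega>
  have N2: "integrable M (\<lambda>\<omega>. ?N k \<omega> ^ 2)" "expectation (\<lambda>\<omega>. ?N k \<omega> ^ 2) \<le> real CARD('d) * \<mu>" if "k < K r" for k
    using incr_second_moment[OF n s(1)[OF that]] mult_left_mono[OF s(2)[OF that], of "real CARD('d)"] by auto
  have N1: "integrable M (?N k)" "expectation (?N k) \<le> sqrt (real CARD('d)) * sqrt \<mu>" if "k < K r" for k
    using expectation_abs_le_sqrt[OF _ N2[OF that]] by (simp_all add: real_sqrt_mult)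
  have Tres: "T i \<in> borel_measurable (gen {..<K r}) \<and> integrable M (\<lambda>\<omega>. T i \<omega> ^ 2)
    \<and> expectation (\<lambda>\<omega>. T i \<omega> ^ 2) \<le> (\<Sum>k<K r. L ^ 2 * (real CARD('d) * \<mu>) * (1 / real n))" for i
    unfolding T_def
  proof (rule orthogonal_sum[where K="\<lambda>k. k"])
    fix k assume k: "k < K r"
    show Zm: "?Z i k \<in> borel_measurable (gen {..<k})"
      using s(1)[OF k]
      by (intro borel_measurable_diff measurable_compose[OF _ regular_measurable(1)] measurable_gen_walk
          measurable_gen_mono[OF measurable_gen_walk]) auto
    have Zle: "?Z i k \<omega> ^ 2 \<le> L ^ 2 * ?N k \<omega> ^ 2" for \<omega>
      using power_mono[OF fL[of i "walk n (s k) \<omega>" "walk n k \<omega> - walk n (s k) \<omega>"], of 2]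
      by (simp add: power_mult_distrib)
    have intB: "integrable M (\<lambda>\<omega>. L ^ 2 * ?N k \<omega> ^ 2)" using N2(1)[OF k] by simp
    have [measurable]: "?Z i k \<in> borel_measurable M" using measurable_genD[OF Zm] by simp
    show intZ: "integrable M (\<lambda>\<omega>. ?Z i k \<omega> ^ 2)"
      by (rule Bochner_Integration.integrable_bound[OF intB]) (use Zle in auto)
    show "expectation (\<lambda>\<omega>. ?Z i k \<omega> ^ 2) \<le> L ^ 2 * (real CARD('d) * \<mu>)"
      using integral_mono[OF intZ intB Zle] mult_left_mono[OF N2(2)[OF k], of "L ^ 2"] by simp
    show "?Y i k \<in> borel_measurable (gen {k..<Suc k})"
      by (rule measurable_compose[OF measurable_gen_walk_diff]) auto
    show "integrable M (\<lambda>\<omega>. ?Y i k \<omega> ^ 2)" "expectation (\<lambda>\<omega>. ?Y i k \<omega> ^ 2) \<le> 1 / real n"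
      using incr_covariance[OF n, of k "Suc k" i i]
      by (simp_all add: power2_eq_square del: vector_minus_component)
    show "expectation (?Y i k) = 0"
      unfolding walk_Suc using mean[of k i] by simp
  qed (auto simp: mono_def)
  have Tle: "(\<Sum>k<K r. L ^ 2 * (real CARD('d) * \<mu>) * (1 / real n)) \<le> (L * sqrt (real CARD('d)) * sqrt \<mu>) ^ 2"
  proof -
    have "(\<Sum>k<K r. L ^ 2 * (real CARD('d) * \<mu>) * (1 / real n)) = L ^ 2 * (real CARD('d) * \<mu>) * (real (K r) / real n)"
      by simp
    also have "\<dots> \<le> L ^ 2 * (real CARD('d) * \<mu>) * 1"
      using K(3) n \<mu> by (intro mult_left_mono) auto
    finally show ?thesis using \<mu> by (simp add: power_mult_distrib)
  qed
  have Tm: "T i \<in> borel_measurable M" for i using Tres measurable_genD by blast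
  have ET: "integrable M (\<lambda>\<omega>. \<bar>T i \<omega>\<bar>)" "expectation (\<lambda>\<omega>. \<bar>T i \<omega>\<bar>) \<le> L * sqrt (real CARD('d)) * sqrt \<mu>" for i
    using expectation_abs_le_sqrt[OF Tm, of i "(L * sqrt (real CARD('d)) * sqrt \<mu>) ^ 2"] Tres[of i] Tle L \<mu>
    by (auto simp: abs_mult simp del: power_mult_distrib)
  have intN: "integrable M (\<lambda>\<omega>. \<Sum>k<K r. ?N k \<omega>)" using N1(1) by (intro Bochner_Integration.integrable_sum) auto
  have intU: "integrable M U" unfolding U_def
    by (intro Bochner_Integration.integrable_add integrable_divide integrable_mult_right
        Bochner_Integration.integrable_sum ET(1) intN)
  have EN: "expectation (\<lambda>\<omega>. \<Sum>k<K r. ?N k \<omega>) \<le> real n * (sqrt (real CARD('d)) * sqrt \<mu>)"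
  proof -
    have "expectation (\<lambda>\<omega>. \<Sum>k<K r. ?N k \<omega>) = (\<Sum>k<K r. expectation (?N k))"
      using N1(1) by (intro Bochner_Integration.integral_sum) auto
    also have "\<dots> \<le> (\<Sum>k<K r. sqrt (real CARD('d)) * sqrt \<mu>)" using N1(2) by (intro sum_mono) auto
    also have "\<dots> \<le> real n * (sqrt (real CARD('d)) * sqrt \<mu>)"
      using K(3) \<mu> by (simp add: mult_right_mono)
    finally show ?thesis .
  qed
  have "expectation U = (\<Sum>i\<in>UNIV. expectation (\<lambda>\<omega>. \<bar>T i \<omega>\<bar>))
      + real CARD('d) * (L * expectation (\<lambda>\<omega>. \<Sum>k<K r. ?N k \<omega>)) / (2 * real n)"
    unfolding U_def using ET(1) intN
    by (subst Bochner_Integration.integral_add) auto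
  also have "\<dots> \<le> (\<Sum>i\<in>(UNIV::'d set). L * sqrt (real CARD('d)) * sqrt \<mu>)
      + real CARD('d) * (L * (real n * (sqrt (real CARD('d)) * sqrt \<mu>))) / (2 * real n)"
    using L by (intro add_mono sum_mono ET(2) divide_right_mono mult_left_mono EN) auto
  also have "\<dots> = 3 / 2 * (real CARD('d) * (L * sqrt (real CARD('d)))) * sqrt \<mu>"
    using n by (simp add: field_simps)
  finally have EU: "expectation U \<le> 3 / 2 * (real CARD('d) * (L * sqrt (real CARD('d)))) * sqrt \<mu>" .
  have U0: "0 \<le> U \<omega>" for \<omega>
    unfolding U_def using L by (intro add_nonneg_nonneg divide_nonneg_nonneg mult_nonneg_nonneg sum_nonneg) auto
  show ?thesis
  proof (rule that[OF intU U0 EU])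
    fix \<omega>
    define x where "x k = walk n k \<omega>" for k
    let ?c = "\<lambda>y k. (\<Sum>i\<in>UNIV. f i y * (x (Suc k) - x k) $ i) + (\<Sum>i\<in>UNIV. g i i y) * (1 / real n) / 2"
    \<comment> \<open>With coefficients constant on a block, the steps of the block telescope to its
      increment and their durations add up to \<open>h j\<close>.\<close>
    have coarse: "corrected_sum f g (w \<omega>) h r = (\<Sum>k<K r. ?c (x (s k)) k)"
      unfolding sum_blocks[OF K(1,2)] corrected_sum_def
    proof (rule sum.cong[OF refl])
      fix j assume "j \<in> {..<r}"
      have telescope: "(\<Sum>k\<in>{K j..<K (Suc j)}. (x (Suc k) - x k) $ i) = (x (K (Suc j)) - x (K j)) $ i" for i
        using sum_Suc_diff'[OF K_le[of j], of "\<lambda>k. x k $ i"] by simp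
      have "(\<Sum>k\<in>{K j..<K (Suc j)}. ?c (x (s k)) k) = (\<Sum>k\<in>{K j..<K (Suc j)}. ?c (x (K j)) k)"
      proof (rule sum.cong[OF refl])
        fix k assume "k \<in> {K j..<K (Suc j)}"
        then have "s k = K j" unfolding s_def by (intro block_start_eq[OF K(1)]) auto
        then show "?c (x (s k)) k = ?c (x (K j)) k" by simp
      qed
      also have "\<dots> = (\<Sum>i\<in>UNIV. f i (x (K j)) * (\<Sum>k\<in>{K j..<K (Suc j)}. (x (Suc k) - x k) $ i))
          + (\<Sum>i\<in>UNIV. g i i (x (K j))) * h j / 2"
        unfolding sum.distrib
      proof (rule arg_cong2[where f="(+)"])
        show "(\<Sum>k\<in>{K j..<K (Suc j)}. \<Sum>i\<in>UNIV. f i (x (K j)) * (x (Suc k) - x k) $ i)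
            = (\<Sum>i\<in>UNIV. f i (x (K j)) * (\<Sum>k\<in>{K j..<K (Suc j)}. (x (Suc k) - x k) $ i))"
          by (subst sum.swap) (simp add: sum_distrib_left)
        show "(\<Sum>k\<in>{K j..<K (Suc j)}. (\<Sum>i\<in>UNIV. g i i (x (K j))) * (1 / real n) / 2)
            = (\<Sum>i\<in>UNIV. g i i (x (K j))) * h j / 2"
          using K_le[of j] by (simp add: of_nat_diff mult_ac)
      qed
      finally show "(\<Sum>i\<in>UNIV. f i (w \<omega> j) * (w \<omega> (Suc j) - w \<omega> j) $ i) + (\<Sum>i\<in>UNIV. g i i (w \<omega> j)) * h j / 2
          = (\<Sum>k\<in>{K j..<K (Suc j)}. ?c (x (s k)) k)"
        unfolding telescope unfolding x_def by simp
    qed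
    have "corrected_sum f g (\<lambda>k. walk n k \<omega>) (\<lambda>_. 1 / real n) (K r) - corrected_sum f g (w \<omega>) h r
        = (\<Sum>k<K r. ?c (x k) k - ?c (x (s k)) k)"
      unfolding coarse by (simp add: corrected_sum_def x_def sum_subtractf)
    also have "\<dots> = (\<Sum>i\<in>UNIV. T i \<omega>) + (\<Sum>k<K r. (\<Sum>i\<in>UNIV. g i i (x k) - g i i (x (s k))) / (2 * real n))"
    proof -
      have "(\<Sum>i\<in>UNIV. T i \<omega>) = (\<Sum>k<K r. \<Sum>i\<in>UNIV. (f i (x k) - f i (x (s k))) * (x (Suc k) - x k) $ i)"
        unfolding T_def x_def by (rule sum.swap)
      moreover have "?c (x k) k - ?c (x (s k)) k = (\<Sum>i\<in>UNIV. (f i (x k) - f i (x (s k))) * (x (Suc k) - x k) $ i)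
          + (\<Sum>i\<in>UNIV. g i i (x k) - g i i (x (s k))) / (2 * real n)" for k
        by (simp add: left_diff_distrib sum_subtractf diff_divide_distrib mult.commute)
      ultimately show ?thesis by (simp add: sum.distrib)
    qed
    also have "\<bar>\<dots>\<bar> \<le> (\<Sum>i\<in>UNIV. \<bar>T i \<omega>\<bar>) + (\<Sum>k<K r. real CARD('d) * (L * ?N k \<omega>) / (2 * real n))"
    proof (intro order_trans[OF abs_triangle_ineq] add_mono sum_abs order_trans[OF sum_abs] sum_mono)
      fix k
      have "\<bar>\<Sum>i\<in>UNIV. g i i (x k) - g i i (x (s k))\<bar> \<le> (\<Sum>i\<in>(UNIV::'d set). L * ?N k \<omega>)"
        using gL[of _ _ "x (s k)" "x k - x (s k)"] unfolding x_def
        by (intro order_trans[OF sum_abs] sum_mono) simp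
      then show "\<bar>(\<Sum>i\<in>UNIV. g i i (x k) - g i i (x (s k))) / (2 * real n)\<bar> \<le> real CARD('d) * (L * ?N k \<omega>) / (2 * real n)"
        by (simp add: abs_divide divide_right_mono)
    qed
    also have "\<dots> = U \<omega>" unfolding U_def by (simp add: sum_distrib_left sum_divide_distrib)
    finally show "\<bar>corrected_sum f g (\<lambda>k. walk n k \<omega>) (\<lambda>_. 1 / real n) (K r) - corrected_sum f g (w \<omega>) h r\<bar> \<le> U \<omega>" .
  qed
qed

end

end

section \<open>Approximation by coarse trapezoidal sums\<close>

text \<open>The time \<open>j / m\<close> usually falls strictly between two steps of the walk;
  \<open>n * j div m\<close> is the last step not after it.\<close>

lemma grid_index:
  fixes n m :: nat
  assumes "m > 0"
  shows "mono (\<lambda>j. n * j div m)" "n * 0 div m = 0" "j \<le> m \<Longrightarrow> n * j div m \<le> n"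
    "real (n * j div m) \<le> real n * real j / real m" "real n * real j / real m < real (n * j div m) + 1"
proof -
  show "mono (\<lambda>j. n * j div m)" by (auto simp: mono_def intro: div_le_mono)
  show "n * j div m \<le> n" if "j \<le> m"
    using div_le_mono[of "n * j" "n * m" m] that assms by simp
  have "\<lfloor>real (n * j) / real m\<rfloor> = int (n * j div m)" by (rule floor_divide_of_nat_eq)
  then show "real (n * j div m) \<le> real n * real j / real m" "real n * real j / real m < real (n * j div m) + 1"
    by (simp_all add: floor_eq_iff)
qed simp

text \<open>Rounding to whole steps adds at most \<open>1 / n\<close> to the block length
  \<open>1 / m\<close>, and \<open>m \<le> n\<close>.\<close>

lemma grid_index_mesh:
  fixes n m :: nat
  assumes "0 < m" "m \<le> n"
  shows "(real (n * Suc j div m) - real (n * j div m)) / real n \<le> 2 / real m"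
proof -
  have "real (n * Suc j div m) - real (n * j div m) \<le> real n * real (Suc j) / real m - real n * real j / real m + 1"
    using grid_index(4)[OF assms(1), of n "Suc j"] grid_index(5)[OF assms(1), of n j] by linarith
  also have "\<dots> = real n / real m + 1" by (simp add: diff_divide_distrib[symmetric] algebra_simps)
  finally have "(real (n * Suc j div m) - real (n * j div m)) / real n \<le> (real n / real m + 1) / real n"
    by (rule divide_right_mono) simp
  also have "\<dots> = 1 / real m + 1 / real n" using assms by (simp add: add_divide_distrib)
  also have "1 / real n \<le> 1 / real m" using assms by (intro divide_left_mono) auto
  finally show ?thesis by simp
qed

lemma sum_abs_components_le: "(\<Sum>i\<in>UNIV. \<bar>(v::real^'d) $ i\<bar>) \<le> real CARD('d) * norm v"
  using sum_mono[of UNIV "\<lambda>i. \<bar>v $ i\<bar>" "\<lambda>_. norm v"] component_le_norm_cart[of v] by auto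

context iid_walk
begin

text \<open>Two expansions, on the fine and on the coarse grid, give the term with factor 2. The
  factor 5/2 is 3/2 for the refinement plus 1 for the unfinished step at time \<open>r / m\<close>,
  and \<open>sqrt 2\<close> comes from the mesh bound \<open>2 / m\<close>.\<close>

definition approx_const :: "real \<Rightarrow> real" where
  "approx_const L = (2 * expansion_const L + 5 / 2 * (real CARD('d) * (L * sqrt (real CARD('d))))) * sqrt 2"

text \<open>Four comparisons lead from the integral to the trapezoidal sum: to the last full step
  (\<open>S\<close>), to the corrected sum over single steps (\<open>V1\<close>), to the one over
  blocks (\<open>U\<close>), and to the trapezoidal sum (\<open>V2\<close>). Markov's inequality is
  applied once, to the sum of the four errors.\<close>

lemma coarse_approximation:
  assumes fg: "regular_coeffs L f g" and m: "0 < m" "m \<le> n" and r: "r \<le> m" and e: "e > 0"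
  obtains B where "B \<in> events" "prob B \<le> approx_const L / (e * sqrt (real m))"
    "\<And>\<omega>. \<omega> \<in> space M - B \<Longrightarrow> \<bar>pl_integral f n (\<lambda>k. walk n k \<omega>) (real r / real m)
        - trapezoid f (\<lambda>j. walk n (n * j div m) \<omega>) r\<bar> \<le> e"
proof -
  have n: "n > 0" using m by simp
  define K where "K j = n * j div m" for j
  define \<mu> where "\<mu> = 2 / real m"
  have \<mu>: "\<mu> \<ge> 0" "1 / real n \<le> \<mu>"
  proof -
    have "1 / real n \<le> 1 / real m" using m by (intro divide_left_mono) auto
    also have "\<dots> \<le> \<mu>" by (simp add: \<mu>_def divide_right_mono)
    finally show "1 / real n \<le> \<mu>" .
  qed (simp add: \<mu>_def)
  note K = grid_index[where n=n and m=m, OF m(1), folded K_def]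
  have mesh: "(real (K (Suc j)) - real (K j)) / real n \<le> \<mu>" for j
    unfolding K_def \<mu>_def by (rule grid_index_mesh[OF m])
  have L: "L \<ge> 0" and fc: "continuous_on UNIV (f i)" and fL: "\<bar>f i y\<bar> \<le> L"
    and taylor: "\<bar>f i (y + v) - f i y - (\<Sum>l\<in>UNIV. v $ l * g i l y)\<bar> \<le> L * norm v ^ 2" for i y v
    using fg unfolding regular_coeffs_def by auto
  have mesh1: "(real (Suc k) - real k) / real n \<le> \<mu>" for k using \<mu>(2) by simp
  \<comment> \<open>The fine grid has blocks of a single step, and \<open>K r\<close> of
    them.\<close>
  obtain V1 where V1: "integrable M V1" "\<And>\<omega>. 0 \<le> V1 \<omega>" "expectation V1 \<le> expansion_const L * sqrt \<mu>"
    and V1': "\<And>\<omega> p. (\<And>i j. j < K r \<Longrightarrow>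
      \<bar>p i j - f i (walk n j \<omega>) - (\<Sum>l\<in>UNIV. (walk n (Suc j) \<omega> - walk n j \<omega>) $ l * g i l (walk n j \<omega>)) / 2\<bar>
        \<le> L * norm (walk n (Suc j) \<omega> - walk n j \<omega>) ^ 2)
      \<Longrightarrow> \<bar>(\<Sum>j<K r. \<Sum>i\<in>UNIV. (walk n (Suc j) \<omega> - walk n j \<omega>) $ i * p i j)
        - corrected_sum f g (\<lambda>k. walk n k \<omega>) (\<lambda>j. (real (Suc j) - real j) / real n) (K r)\<bar> \<le> V1 \<omega>"
    by (rule expansion_error[where f=f and g=g and L=L and n=n and r="K r" and K="\<lambda>k. k" and \<mu>=\<mu>])
      (use fg n K(3)[OF r] mesh1 \<mu>(1) in \<open>auto simp: mono_def\<close>)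
  obtain V2 where V2: "integrable M V2" "\<And>\<omega>. 0 \<le> V2 \<omega>" "expectation V2 \<le> expansion_const L * sqrt \<mu>"
    and V2': "\<And>\<omega> p. (\<And>i j. j < r \<Longrightarrow>
      \<bar>p i j - f i (walk n (K j) \<omega>) - (\<Sum>l\<in>UNIV. (walk n (K (Suc j)) \<omega> - walk n (K j) \<omega>) $ l * g i l (walk n (K j) \<omega>)) / 2\<bar>
        \<le> L * norm (walk n (K (Suc j)) \<omega> - walk n (K j) \<omega>) ^ 2)
      \<Longrightarrow> \<bar>(\<Sum>j<r. \<Sum>i\<in>UNIV. (walk n (K (Suc j)) \<omega> - walk n (K j) \<omega>) $ i * p i j)
        - corrected_sum f g (\<lambda>j. walk n (K j) \<omega>) (\<lambda>j. (real (K (Suc j)) - real (K j)) / real n) r\<bar> \<le> V2 \<omega>"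
    by (rule expansion_error[where f=f and g=g and L=L and n=n and r=r and K=K and \<mu>=\<mu>])
      (use fg n K(1,2) K(3)[OF r] mesh \<mu>(1) in auto)
  obtain U where U: "integrable M U" "\<And>\<omega>. 0 \<le> U \<omega>"
    "expectation U \<le> 3 / 2 * (real CARD('d) * (L * sqrt (real CARD('d)))) * sqrt \<mu>"
    and U': "\<And>\<omega>. \<bar>corrected_sum f g (\<lambda>k. walk n k \<omega>) (\<lambda>_. 1 / real n) (K r)
       - corrected_sum f g (\<lambda>j. walk n (K j) \<omega>) (\<lambda>j. (real (K (Suc j)) - real (K j)) / real n) r\<bar> \<le> U \<omega>"
    by (rule refinement_error[where f=f and g=g and L=L and n=n and r=r and K=K and \<mu>=\<mu>])
      (use fg n K(1,2) K(3)[OF r] mesh \<mu>(1) in auto)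
  \<comment> \<open>This bounds the contribution of the step in progress at time
    \<open>r / m\<close>.\<close>
  define S where "S \<omega> = real CARD('d) * L * norm (walk n (Suc (K r)) \<omega> - walk n (K r) \<omega>)" for \<omega>
  note second = incr_second_moment[OF n, of "K r" "Suc (K r)"]
  have E1: "integrable M (\<lambda>\<omega>. norm (walk n (Suc (K r)) \<omega> - walk n (K r) \<omega>))"
    "expectation (\<lambda>\<omega>. norm (walk n (Suc (K r)) \<omega> - walk n (K r) \<omega>)) \<le> sqrt (real CARD('d)) * sqrt \<mu>"
  proof -
    have "expectation (\<lambda>\<omega>. norm (walk n (Suc (K r)) \<omega> - walk n (K r) \<omega>) ^ 2) \<le> real CARD('d) * \<mu>"
      using second(2) mult_left_mono[OF \<mu>(2), of "real CARD('d)"] by simp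
    from expectation_abs_le_sqrt[OF _ second(1) this]
    show "integrable M (\<lambda>\<omega>. norm (walk n (Suc (K r)) \<omega> - walk n (K r) \<omega>))"
      "expectation (\<lambda>\<omega>. norm (walk n (Suc (K r)) \<omega> - walk n (K r) \<omega>)) \<le> sqrt (real CARD('d)) * sqrt \<mu>"
      by (simp_all add: real_sqrt_mult)
  qed
  have S: "integrable M S" "\<And>\<omega>. 0 \<le> S \<omega>" "expectation S \<le> real CARD('d) * L * (sqrt (real CARD('d)) * sqrt \<mu>)"
    unfolding S_def using E1 L by (auto intro: mult_left_mono)
  let ?R = "\<lambda>\<omega>. V1 \<omega> + V2 \<omega> + U \<omega> + S \<omega>"
  have R: "integrable M ?R" using V1(1) V2(1) U(1) S(1) by simp
  have "expectation ?R = expectation V1 + expectation V2 + expectation U + expectation S"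
    using V1(1) V2(1) U(1) S(1) by simp
  also have "\<dots> \<le> expansion_const L * sqrt \<mu> + expansion_const L * sqrt \<mu>
      + 3 / 2 * (real CARD('d) * (L * sqrt (real CARD('d)))) * sqrt \<mu>
      + real CARD('d) * L * (sqrt (real CARD('d)) * sqrt \<mu>)"
    by (intro add_mono V1 V2 U S)
  also have "\<dots> = approx_const L / sqrt (real m)"
  proof -
    have "E * u + E * u + 3 / 2 * (d * (L * t)) * u + d * L * (t * u) = (2 * E + 5 / 2 * (d * (L * t))) * u"
      for E u d t :: real by (simp add: algebra_simps)
    from this[of "expansion_const L" "sqrt \<mu>" "real CARD('d)" "sqrt (real CARD('d))"]
    show ?thesis
      unfolding approx_const_def by (simp only: \<mu>_def real_sqrt_divide times_divide_eq_right)
  qed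
  finally have ER: "expectation ?R \<le> approx_const L / sqrt (real m)" .
  define B where "B = {\<omega> \<in> space M. ?R \<omega> \<ge> e}"
  show ?thesis
  proof (rule that[of B])
    show "B \<in> events" unfolding B_def using borel_measurable_integrable[OF R] by measurable
    have "prob B \<le> approx_const L / sqrt (real m) / e"
      unfolding B_def by (rule markov_bound[OF R _ e ER]) (simp add: V1(2) V2(2) U(2) S(2))
    then show "prob B \<le> approx_const L / (e * sqrt (real m))" by (simp add: mult.commute)
    fix \<omega> assume "\<omega> \<in> space M - B"
    then have Re: "?R \<omega> \<le> e" by (auto simp: B_def)
    define x where "x k = walk n k \<omega>" for k
    have 1: "\<bar>pl_integral f n x (real (K r) / real n)
        - corrected_sum f g x (\<lambda>_. 1 / real n) (K r)\<bar> \<le> V1 \<omega>"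
    proof -
      have "\<bar>cell_mean (f i) n x j 1 - f i (x j) - (\<Sum>l\<in>UNIV. (x (Suc j) - x j) $ l * g i l (x j)) / 2\<bar>
          \<le> L * norm (x (Suc j) - x j) ^ 2" if "j < K r" for i j
      proof -
        have "j < n" using that K(3)[OF r] by simp
        moreover have "real (Suc j) / real n \<le> 1" using \<open>j < n\<close> by (simp add: divide_le_eq_1)
        ultimately show ?thesis
          using cell_mean_taylor[of j n "f i" 1 "g i" L x] fc L taylor by simp
      qed
      from V1'[of "\<lambda>i j. cell_mean (f i) n x j 1" \<omega>, folded x_def, OF this]
      show ?thesis
        unfolding pl_integral_grid[OF K(3)[OF r] n] by simp
    qed
    have 2: "\<bar>trapezoid f (\<lambda>j. x (K j)) r
        - corrected_sum f g (\<lambda>j. x (K j)) (\<lambda>j. (real (K (Suc j)) - real (K j)) / real n) r\<bar> \<le> V2 \<omega>"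
    proof -
      have "\<bar>(f i (x (K j)) + f i (x (K (Suc j)))) / 2 - f i (x (K j))
           - (\<Sum>l\<in>UNIV. (x (K (Suc j)) - x (K j)) $ l * g i l (x (K j))) / 2\<bar>
          \<le> L * norm (x (K (Suc j)) - x (K j)) ^ 2" for i j
      proof -
        have "(f i (x (K j)) + f i (x (K (Suc j)))) / 2 - f i (x (K j))
           - (\<Sum>l\<in>UNIV. (x (K (Suc j)) - x (K j)) $ l * g i l (x (K j))) / 2
          = (f i (x (K j) + (x (K (Suc j)) - x (K j))) - f i (x (K j))
           - (\<Sum>l\<in>UNIV. (x (K (Suc j)) - x (K j)) $ l * g i l (x (K j)))) / 2" by (simp add: field_simps)
        also have "\<bar>\<dots>\<bar> \<le> L * norm (x (K (Suc j)) - x (K j)) ^ 2 / 2"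
          unfolding abs_divide abs_numeral by (rule divide_right_mono[OF taylor]) simp
        also have "\<dots> \<le> L * norm (x (K (Suc j)) - x (K j)) ^ 2" using L by simp
        finally show ?thesis .
      qed
      from V2'[of "\<lambda>i j. (f i (x (K j)) + f i (x (K (Suc j)))) / 2" \<omega>, folded x_def, OF this]
      show ?thesis unfolding trapezoid_def by simp
    qed
    have 3: "\<bar>pl_integral f n x (real r / real m) - pl_integral f n x (real (K r) / real n)\<bar> \<le> S \<omega>"
    proof (cases "K r < n")
      case True
      have "real (K r) / real n \<le> real r / real m" "real r / real m \<le> real (Suc (K r)) / real n"
        using K(4)[of r] K(5)[of r] m n by (auto simp: field_simps)
      from pl_integral_near_grid[OF True this, of f L x]
      have "\<bar>pl_integral f n x (real r / real m) - pl_integral f n x (real (K r) / real n)\<bar>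
          \<le> (\<Sum>i\<in>UNIV. \<bar>(x (Suc (K r)) - x (K r)) $ i\<bar>) * L"
        using fc fL by (simp add: sum_distrib_right)
      also have "\<dots> \<le> real CARD('d) * norm (x (Suc (K r)) - x (K r)) * L"
        by (intro mult_right_mono sum_abs_components_le L)
      finally show ?thesis by (simp add: S_def x_def mult_ac)
    next
      \<comment> \<open>The last step is reached only for \<open>r = m\<close>, and then both times
        equal 1.\<close>
      case False
      then have "K r = n" using K(3)[OF r] by simp
      then have "real n \<le> real n * real r / real m" using K(4)[of r] by simp
      then have "real m \<le> real r" using m n by (simp add: field_simps)
      then have "r = m" using r by simp
      then show ?thesis using \<open>K r = n\<close> n m S(2) by simp
    qed
    show "\<bar>pl_integral f n (\<lambda>k. walk n k \<omega>) (real r / real m)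
        - trapezoid f (\<lambda>j. walk n (n * j div m) \<omega>) r\<bar> \<le> e"
      using 1 2 3 U'[of \<omega>] Re unfolding x_def K_def by linarith
  qed
qed

end

section \<open>Equicontinuity\<close>

text \<open>The integral differs pathwise from the Ito sum by a multiple of the quadratic variation,
  since each cell mean differs from the value at the left end by a multiple of the step. No
  cancellation is required here; the oscillation of the Ito sum is left to the maximal
  inequality.\<close>

lemma pl_integral_increment:
  fixes x :: "nat \<Rightarrow> real^'d"
  assumes fg: "regular_coeffs L f g" and "K \<le> k" "k \<le> n" and n: "n > 0"
  shows "\<bar>pl_integral f n x (real k / real n) - pl_integral f n x (real K / real n)
      - (\<Sum>l\<in>{K..<k}. \<Sum>i\<in>UNIV. f i (x l) * (x (Suc l) - x l) $ i)\<bar>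
    \<le> real CARD('d) * (real CARD('d) + 2) * L * (\<Sum>l\<in>{K..<k}. norm (x (Suc l) - x l) ^ 2)"
proof -
  have L: "L \<ge> 0" and fc: "continuous_on UNIV (f i)" and fL: "\<bar>f i y\<bar> \<le> L" and gL: "\<bar>g i l y\<bar> \<le> L"
    and taylor: "\<bar>f i (y + v) - f i y - (\<Sum>l\<in>UNIV. v $ l * g i l y)\<bar> \<le> L * norm v ^ 2" for i l y v
    using fg unfolding regular_coeffs_def by auto
  let ?d = "real CARD('d)"
  have cell: "\<bar>cell_mean (f i) n x l 1 - f i (x l)\<bar> \<le> (?d + 2) * L * norm (x (Suc l) - x l)" if "l < k" for l i
  \<comment> \<open>For a short step the quadratic Taylor remainder is absorbed into a linear term;
    for a long one the trivial bound \<open>2 * L\<close> suffices.\<close>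
  proof (cases "norm (x (Suc l) - x l) \<le> 1")
    case True
    let ?v = "x (Suc l) - x l"
    have "l < n" using that \<open>k \<le> n\<close> by simp
    moreover have "real (Suc l) / real n \<le> 1" using \<open>l < n\<close> by (simp add: divide_le_eq_1)
    ultimately have "\<bar>cell_mean (f i) n x l 1 - f i (x l) - (\<Sum>j\<in>UNIV. ?v $ j * g i j (x l)) / 2\<bar> \<le> L * norm ?v ^ 2"
      using cell_mean_taylor[of l n "f i" 1 "g i" L x] fc L taylor by simp
    moreover have "\<bar>(\<Sum>j\<in>UNIV. ?v $ j * g i j (x l)) / 2\<bar> \<le> ?d * L * norm ?v"
    proof -
      have "\<bar>\<Sum>j\<in>UNIV. ?v $ j * g i j (x l)\<bar> \<le> (\<Sum>j\<in>(UNIV::'d set). norm ?v * L)"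
        using gL by (intro order_trans[OF sum_abs] sum_mono)
          (simp only: abs_mult, intro mult_mono component_le_norm_cart, auto)
      then have "\<bar>\<Sum>j\<in>UNIV. ?v $ j * g i j (x l)\<bar> \<le> ?d * L * norm ?v" by (simp add: mult_ac)
      moreover have "0 \<le> ?d * L * norm ?v" using L by simp
      ultimately show ?thesis unfolding abs_divide by linarith
    qed
    moreover have "L * norm ?v ^ 2 \<le> 2 * L * norm ?v"
    proof -
      have "norm ?v ^ 2 \<le> 1 * norm ?v" unfolding power2_eq_square using True by (rule mult_right_mono) simp
      moreover have "0 \<le> norm ?v" by simp
      ultimately have "norm ?v ^ 2 \<le> 2 * norm ?v" by linarith
      then have "L * norm ?v ^ 2 \<le> L * (2 * norm ?v)" by (rule mult_left_mono) (rule L)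
      then show ?thesis by simp
    qed
    ultimately show ?thesis by (simp add: algebra_simps)
  next
    case False
    have "\<bar>cell_mean (f i) n x l 1\<bar> \<le> L" using cell_mean_norm_le[OF n fc, of i L x l 1] fL by simp
    then have "\<bar>cell_mean (f i) n x l 1 - f i (x l)\<bar> \<le> 2 * L * 1" using fL[of i "x l"] by linarith
    also have "\<dots> \<le> (?d + 2) * L * norm (x (Suc l) - x l)"
      using False L by (intro mult_mono) auto
    finally show ?thesis .
  qed
  have split: "{..<k} = {..<K} \<union> {K..<k}" using \<open>K \<le> k\<close> by auto
  have "pl_integral f n x (real k / real n) - pl_integral f n x (real K / real n)
      = (\<Sum>l\<in>{K..<k}. \<Sum>i\<in>UNIV. (x (Suc l) - x l) $ i * cell_mean (f i) n x l 1)"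
    using assms(2,3)
    by (simp add: pl_integral_grid[OF _ n] split sum.union_disjoint ivl_disj_int del: vector_minus_component)
  then have "pl_integral f n x (real k / real n) - pl_integral f n x (real K / real n)
      - (\<Sum>l\<in>{K..<k}. \<Sum>i\<in>UNIV. f i (x l) * (x (Suc l) - x l) $ i)
      = (\<Sum>l\<in>{K..<k}. \<Sum>i\<in>UNIV. (x (Suc l) - x l) $ i * (cell_mean (f i) n x l 1 - f i (x l)))"
    by (simp add: sum_subtractf right_diff_distrib mult.commute del: vector_minus_component)
  also have "\<bar>\<dots>\<bar> \<le> (\<Sum>l\<in>{K..<k}. \<Sum>i\<in>(UNIV::'d set). norm (x (Suc l) - x l) * ((?d + 2) * L * norm (x (Suc l) - x l)))"
  proof (intro order_trans[OF sum_abs] sum_mono)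
    fix l i assume "l \<in> {K..<k}"
    then show "\<bar>(x (Suc l) - x l) $ i * (cell_mean (f i) n x l 1 - f i (x l))\<bar>
        \<le> norm (x (Suc l) - x l) * ((?d + 2) * L * norm (x (Suc l) - x l))"
      unfolding abs_mult by (intro mult_mono component_le_norm_cart cell) auto
  qed
  finally show ?thesis by (simp add: sum_distrib_left power2_eq_square mult_ac)
qed

text \<open>The three contributions of size \<open>e\<close> are the Ito sum, the quadratic
  variation and the step in progress at time \<open>s\<close>. The squared steps are summed up to
  and including index \<open>n * Suc j div m\<close> because \<open>s\<close> may lie in that
  step.\<close>

lemma pl_integral_oscillation:
  fixes x :: "nat \<Rightarrow> real^'d"
  assumes fg: "regular_coeffs L f g" and m: "0 < m" and n: "0 < n" and j: "j < m"
    and transform: "\<And>k. n * j div m \<le> k \<Longrightarrow> k \<le> n * Suc j div m \<Longrightarrow>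
      \<bar>\<Sum>l\<in>{n * j div m..<k}. \<Sum>i\<in>UNIV. f i (x l) * (x (Suc l) - x l) $ i\<bar> \<le> e"
    and Q: "(\<Sum>l\<in>{n * j div m..n * Suc j div m}. norm (x (Suc l) - x l) ^ 2) \<le> c"
    and c: "real CARD('d) * (real CARD('d) + 2) * L * c \<le> e" "real CARD('d) * L * sqrt c \<le> e"
    and s: "real j / real m \<le> s" "s \<le> real (Suc j) / real m"
  shows "\<bar>pl_integral f n x s - pl_integral f n x (real (n * j div m) / real n)\<bar> \<le> 3 * e"
proof -
  have L: "L \<ge> 0" and fc: "continuous_on UNIV (f i)" and fL: "\<bar>f i y\<bar> \<le> L" for i y
    using fg unfolding regular_coeffs_def by auto
  let ?K = "n * j div m" and ?K' = "n * Suc j div m"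
  have "real (Suc j) / real m \<le> 1" using j m by (simp add: divide_le_eq_1)
  then have s01: "0 \<le> s" "s \<le> 1" using s by (auto intro: order_trans[rotated])
  define k where "k = nat \<lfloor>real n * s\<rfloor>"
  have k_int: "int k = \<lfloor>real n * s\<rfloor>" using s01 by (simp add: k_def)
  have ks: "real k \<le> real n * s" "real n * s < real k + 1" using k_int by linarith+
  have "\<lfloor>real (n * j) / real m\<rfloor> \<le> \<lfloor>real n * s\<rfloor>"
    using s(1) n by (intro floor_mono) (simp add: mult_left_mono flip: times_divide_eq_right)
  then have Kk: "?K \<le> k" unfolding floor_divide_of_nat_eq k_int[symmetric] by simp
  have "real n * s \<le> real n * (real (Suc j) / real m)" by (rule mult_left_mono[OF s(2)]) simp
  then have "\<lfloor>real n * s\<rfloor> \<le> \<lfloor>real (n * Suc j) / real m\<rfloor>"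
    by (intro floor_mono) (simp only: of_nat_mult times_divide_eq_right)
  then have kK: "k \<le> ?K'" unfolding floor_divide_of_nat_eq k_int[symmetric] by simp
  have "real n * s \<le> real n" using s01 n by simp
  then have kn: "k \<le> n" using ks(1) by linarith
  have Qk: "(\<Sum>l\<in>{?K..<k}. norm (x (Suc l) - x l) ^ 2) \<le> c"
    using kK by (intro order_trans[OF sum_mono2 Q]) auto
  have "\<bar>pl_integral f n x (real k / real n) - pl_integral f n x (real ?K / real n)\<bar>
      \<le> e + real CARD('d) * (real CARD('d) + 2) * L * (\<Sum>l\<in>{?K..<k}. norm (x (Suc l) - x l) ^ 2)"
    using pl_integral_increment[OF fg Kk kn n, of x] transform[OF Kk kK] by linarith
  also have "\<dots> \<le> e + real CARD('d) * (real CARD('d) + 2) * L * c"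
    using Qk L by (intro add_left_mono mult_left_mono) auto
  also have "\<dots> \<le> 2 * e" using c(1) by simp
  finally have 1: "\<bar>pl_integral f n x (real k / real n) - pl_integral f n x (real ?K / real n)\<bar> \<le> 2 * e" .
  have dk: "norm (x (Suc k) - x k) ^ 2 \<le> c"
    using Kk kK by (intro order_trans[OF member_le_sum Q]) auto
  have "c \<ge> 0" using dk by (rule order_trans[rotated]) simp
  then have e: "e \<ge> 0" using c(2) L by (intro order_trans[OF _ c(2)]) auto
  have 2: "\<bar>pl_integral f n x s - pl_integral f n x (real k / real n)\<bar> \<le> e"
  proof (cases "k < n")
    case True
    have "real k / real n \<le> s" "s \<le> real (Suc k) / real n" using ks n by (auto simp: field_simps)
    from pl_integral_near_grid[OF True this, of f L x]
    have "\<bar>pl_integral f n x s - pl_integral f n x (real k / real n)\<bar>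
        \<le> (\<Sum>i\<in>UNIV. \<bar>(x (Suc k) - x k) $ i\<bar>) * L"
      using fc fL by (simp add: sum_distrib_right)
    also have "\<dots> \<le> real CARD('d) * norm (x (Suc k) - x k) * L"
      by (intro mult_right_mono sum_abs_components_le L)
    also have "\<dots> \<le> real CARD('d) * sqrt c * L"
      using real_le_rsqrt[OF dk] L by (intro mult_right_mono mult_left_mono) auto
    also have "\<dots> \<le> e" using c(2) by (simp add: mult_ac)
    finally show ?thesis .
  next
    case False
    then have "k = n" using kn by simp
    then have "real n \<le> real n * s" using ks by simp
    then have "s = 1" using n s01 by simp
    then show ?thesis using \<open>k = n\<close> n e by simp
  qed
  show ?thesis using 1 2 by linarith
qed

context iid_walk
begin

text \<open>On one cell both the Ito sum and the quadratic variation are small except with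
  probability of order \<open>1 / m ^ 2\<close>, by the fourth-moment maximal inequality and by
  Markov's inequality for the square. Summing over the \<open>m\<close> cells leaves order
  \<open>1 / m\<close>, uniformly in \<open>n\<close>.\<close>

lemma oscillation_bound:
  assumes fg: "regular_coeffs L f g" and e: "e > 0"
  obtains C where "\<And>n m. 0 < m \<Longrightarrow> m \<le> n \<Longrightarrow> \<exists>B\<in>events. prob B \<le> C / real m \<and>
    (\<forall>\<omega>\<in>space M - B. \<forall>t\<in>{0..1}. \<bar>pl_integral f n (\<lambda>k. walk n k \<omega>) t
      - pl m (\<lambda>j. pl_integral f n (\<lambda>k. walk n k \<omega>) (real j / real m)) t\<bar> \<le> e)"
proof -
  have L: "L \<ge> 0" and fc: "continuous_on UNIV (f i)" and fL: "\<bar>f i y\<bar> \<le> L" for i y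
    using fg unfolding regular_coeffs_def by auto
  let ?d = "real CARD('d)"
  \<comment> \<open>Within a cell any value is within \<open>3 * e1\<close> of that at the start of
    the block, so two values are within \<open>6 * e1 = e\<close> of each other.\<close>
  define e1 where "e1 = e / 6"
  have e1: "e1 > 0" using e by (simp add: e1_def)
  \<comment> \<open>The two entries of the minimum secure the two conditions that
    \<open>pl_integral_oscillation\<close> imposes on the bound for the quadratic variation; each
    added 1 avoids division by 0.\<close>
  define c where "c = min (e1 / (?d * (?d + 2) * L + 1)) ((e1 / (?d * L + 1)) ^ 2)"
  have dL: "?d * (?d + 2) * L \<ge> 0" "?d * L \<ge> 0" using L by auto
  have c: "c > 0" "?d * (?d + 2) * L * c \<le> e1" "?d * L * sqrt c \<le> e1"
  proof -
    show "c > 0" using e1 dL by (auto simp: c_def intro!: divide_pos_pos)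
    have "?d * (?d + 2) * L * c \<le> ?d * (?d + 2) * L * (e1 / (?d * (?d + 2) * L + 1))"
      by (rule mult_left_mono[OF _ dL(1)]) (simp add: c_def)
    also have "\<dots> \<le> e1"
    proof -
      have "a * (e1 / (a + 1)) \<le> e1" if "a \<ge> 0" for a using that e1 by (simp add: field_simps)
      then show ?thesis using dL(1) by blast
    qed
    finally show "?d * (?d + 2) * L * c \<le> e1" .
    have "sqrt c \<le> sqrt ((e1 / (?d * L + 1)) ^ 2)" by (rule real_sqrt_le_mono) (simp add: c_def)
    also have "\<dots> = e1 / (?d * L + 1)" using e1 dL(2) by (intro real_sqrt_unique) auto
    finally have "?d * L * sqrt c \<le> ?d * L * (e1 / (?d * L + 1))" by (rule mult_left_mono[OF _ dL(2)])
    also have "\<dots> \<le> e1"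
    proof -
      have "a * (e1 / (a + 1)) \<le> e1" if "a \<ge> 0" for a using that e1 by (simp add: field_simps)
      then show ?thesis using dL(2) by blast
    qed
    finally show "?d * L * sqrt c \<le> e1" .
  qed
  \<comment> \<open>The factors 4 and 9 are the squares in the bounds \<open>2 / m\<close> for the
    duration of a block and \<open>3 / m\<close> for a block with one additional step.\<close>
  define C where "C = 4 * quartic_const CARD('d) q L / e1 ^ 4 + 9 * q / c ^ 2"
  show ?thesis
  proof (rule that[of C])
    fix n m :: nat assume m: "0 < m" "m \<le> n"
    then have n: "n > 0" by simp
    let ?K = "\<lambda>j. n * j div m"
    let ?b = "\<lambda>j. ?K (Suc j) - ?K j"
    let ?Z = "\<lambda>i l \<omega>. f i (walk n l \<omega>)"
    have K_le: "?K j \<le> ?K (Suc j)" for j using monoD[OF grid_index(1)[OF m(1), of n], of j "Suc j"] by simp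
    have b: "real (?b j) / real n \<le> 2 / real m" "real (?b j + 1) / real n \<le> 3 / real m" for j
    proof -
      show *: "real (?b j) / real n \<le> 2 / real m"
        using grid_index_mesh[OF m, of j] K_le[of j] by (simp only: of_nat_diff)
      have "1 / real n \<le> 1 / real m" using m by (intro divide_left_mono) auto
      then show "real (?b j + 1) / real n \<le> 3 / real m" using * by (simp add: add_divide_distrib)
    qed
    define B1 where "B1 j = {\<omega> \<in> space M. \<exists>k\<le>?b j. \<bar>transform (?K j) ?Z k \<omega>\<bar> > e1 * sqrt (real n)}" for j
    define Q where "Q j \<omega> = (\<Sum>l\<in>{?K j..?K (Suc j)}. norm (walk n (Suc l) \<omega> - walk n l \<omega>) ^ 2)" for j \<omega>
    define B2 where "B2 j = {\<omega> \<in> space M. Q j \<omega> ^ 2 \<ge> c ^ 2}" for j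
    have c0: "e1 * sqrt (real n) > 0" using e1 n by simp
    have Zm: "?Z i l \<in> borel_measurable (gen {..<l})" for i l
      by (rule measurable_compose[OF measurable_gen_walk borel_measurable_continuous_onI[OF fc]])
    note max = transform_maximal[where a="?K j" and b="?b j" and Z="?Z" and L=L for j, OF Zm fL _ c0, folded B1_def]
    have B1: "B1 j \<in> events" "prob (B1 j) \<le> 4 * quartic_const CARD('d) q L / e1 ^ 4 / real m ^ 2" for j
    proof -
      show "B1 j \<in> events" using max(1)[of j] by simp
      have "prob (B1 j) \<le> quartic_const CARD('d) q L * real (?b j) ^ 2 / (e1 * sqrt (real n)) ^ 4"
        using max(2)[of j] by simp
      also have "(e1 * sqrt (real n)) ^ 4 = e1 ^ 4 * real n ^ 2"
      proof -
        have "sqrt (real n) ^ (2 * 2) = real n ^ 2" unfolding power_mult by simp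
        then show ?thesis by (simp add: power_mult_distrib)
      qed
      also have "quartic_const CARD('d) q L * real (?b j) ^ 2 / (e1 ^ 4 * real n ^ 2)
          = quartic_const CARD('d) q L / e1 ^ 4 * (real (?b j) / real n) ^ 2" by (simp add: power_divide)
      also have "\<dots> \<le> quartic_const CARD('d) q L / e1 ^ 4 * (2 / real m) ^ 2"
        using b(1)[of j] e1 L q_nonneg[of 0] by (intro mult_left_mono power_mono) auto
      also have "\<dots> = 4 * quartic_const CARD('d) q L / e1 ^ 4 / real m ^ 2"
      proof -
        have "a / b * (2 / c) ^ 2 = 4 * a / b / c ^ 2" for a b c :: real by (simp add: power_divide)
        then show ?thesis .
      qed
      finally show "prob (B1 j) \<le> 4 * quartic_const CARD('d) q L / e1 ^ 4 / real m ^ 2" .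
    qed
    have B2: "B2 j \<in> events" "prob (B2 j) \<le> 9 * q / c ^ 2 / real m ^ 2" for j
    proof -
      let ?A = "{?K j..?K (Suc j)}"
      have cardA: "card ?A = ?b j + 1" using K_le[of j] by simp
      have four: "norm (walk n (Suc l) \<omega> - walk n l \<omega>) ^ 4 = norm (\<eta> l \<omega>) ^ 4 / real n ^ 2" for l \<omega>
      proof -
        have "sqrt (real n) ^ (2 * 2) = real n ^ 2" unfolding power_mult by simp
        then show ?thesis unfolding walk_Suc by (simp add: power_mult_distrib power_divide)
      qed
      let ?R = "\<lambda>\<omega>. (\<Sum>l\<in>?A. norm (\<eta> l \<omega>) ^ 4 / real n ^ 2) * real (?b j + 1)"
      have R: "integrable M ?R"
        using integrable_norm4 by (intro integrable_mult_left Bochner_Integration.integrable_sum integrable_divide) auto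
      have le: "Q j \<omega> ^ 2 \<le> ?R \<omega>" for \<omega>
        using sum_squared_le_sum_of_squares[of "\<lambda>l. norm (walk n (Suc l) \<omega> - walk n l \<omega>) ^ 2" ?A]
        unfolding cardA Q_def by (simp only: power_mult[symmetric]) (simp add: four)
      have Qm: "(\<lambda>\<omega>. Q j \<omega> ^ 2) \<in> borel_measurable M" unfolding Q_def by measurable
      have int: "integrable M (\<lambda>\<omega>. Q j \<omega> ^ 2)"
      proof (rule Bochner_Integration.integrable_bound[OF R Qm])
        show "AE \<omega> in M. norm (Q j \<omega> ^ 2) \<le> norm (?R \<omega>)"
          using order_trans[OF le abs_ge_self] by (intro AE_I2) (simp only: real_norm_def abs_power2)
      qed
      have "expectation (\<lambda>\<omega>. Q j \<omega> ^ 2) \<le> expectation ?R" by (rule integral_mono[OF int R le])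
      also have "\<dots> = (\<Sum>l\<in>?A. expectation (\<lambda>\<omega>. norm (\<eta> l \<omega>) ^ 4) / real n ^ 2) * real (?b j + 1)"
        using integrable_norm4 by simp
      also have "\<dots> \<le> (\<Sum>l\<in>?A. q / real n ^ 2) * real (?b j + 1)"
        by (intro mult_right_mono sum_mono divide_right_mono expectation_norm4) auto
      also have "\<dots> = q * (real (?b j + 1) / real n) ^ 2"
        unfolding sum_constant cardA by (simp add: power2_eq_square)
      also have "\<dots> \<le> q * (3 / real m) ^ 2"
        using b(2)[of j] q_nonneg[of 0] by (intro mult_left_mono power_mono) auto
      finally have EQ: "expectation (\<lambda>\<omega>. Q j \<omega> ^ 2) \<le> q * (3 / real m) ^ 2" .
      have c2: "c ^ 2 > 0" using c(1) by simp
      show "B2 j \<in> events" unfolding B2_def using Qm by measurable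
      have "prob (B2 j) \<le> q * (3 / real m) ^ 2 / c ^ 2"
        unfolding B2_def by (rule markov_bound[OF int _ c2 EQ]) simp
      then show "prob (B2 j) \<le> 9 * q / c ^ 2 / real m ^ 2" by (simp add: power_divide mult_ac)
    qed
    define B where "B = (\<Union>j<m. B1 j \<union> B2 j)"
    show "\<exists>B\<in>events. prob B \<le> C / real m \<and>
      (\<forall>\<omega>\<in>space M - B. \<forall>t\<in>{0..1}. \<bar>pl_integral f n (\<lambda>k. walk n k \<omega>) t
        - pl m (\<lambda>j. pl_integral f n (\<lambda>k. walk n k \<omega>) (real j / real m)) t\<bar> \<le> e)"
    proof (intro bexI[of _ B] conjI ballI)
      show "B \<in> events" unfolding B_def using B1(1) B2(1) by auto
      have "prob B \<le> (\<Sum>j<m. prob (B1 j \<union> B2 j))"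
        unfolding B_def using B1(1) B2(1) by (intro measure_UNION_le) auto
      also have "\<dots> \<le> (\<Sum>j<m. prob (B1 j) + prob (B2 j))"
        using B1(1) B2(1) by (intro sum_mono measure_Un_le) auto
      also have "\<dots> \<le> (\<Sum>j<m. 4 * quartic_const CARD('d) q L / e1 ^ 4 / real m ^ 2 + 9 * q / c ^ 2 / real m ^ 2)"
        by (intro sum_mono add_mono B1(2) B2(2))
      also have "\<dots> = C / real m"
      proof -
        have "(\<Sum>j<m. a / real m ^ 2 + b / real m ^ 2) = (a + b) / real m" for a b :: real
          using m(1) by (simp add: add_divide_distrib[symmetric] power2_eq_square)
        then show ?thesis unfolding C_def .
      qed
      finally show "prob B \<le> C / real m" .
      fix \<omega> t assume \<omega>: "\<omega> \<in> space M - B" and t: "t \<in> {0..1::real}"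
      define x where "x k = walk n k \<omega>" for k
      obtain j where j: "j < m" "real j / real m \<le> t" "t \<le> real (Suc j) / real m"
        using grid_locate[OF m(1)] t by auto
      have B1j: "\<omega> \<notin> B1 j" and B2j: "\<omega> \<notin> B2 j" using \<omega> j(1) by (auto simp: B_def)
      have tr: "\<bar>\<Sum>l\<in>{?K j..<k}. \<Sum>i\<in>UNIV. f i (x l) * (x (Suc l) - x l) $ i\<bar> \<le> e1"
        if k: "?K j \<le> k" "k \<le> ?K (Suc j)" for k
      proof -
        have "(\<Sum>l\<in>{?K j..<k}. \<Sum>i\<in>UNIV. f i (x l) * (x (Suc l) - x l) $ i)
            = (1 / sqrt (real n)) * transform (?K j) ?Z (k - ?K j) \<omega>"
          using k(1) unfolding x_def walk_Suc transform_def by (simp add: sum_distrib_left)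
        moreover have "\<bar>transform (?K j) ?Z (k - ?K j) \<omega>\<bar> \<le> e1 * sqrt (real n)"
        proof -
          have "k - ?K j \<le> ?b j" using k(2) by (rule diff_le_mono)
          then show ?thesis using B1j \<omega> unfolding B1_def by (auto simp: not_less)
        qed
        ultimately have "\<bar>\<Sum>l\<in>{?K j..<k}. \<Sum>i\<in>UNIV. f i (x l) * (x (Suc l) - x l) $ i\<bar>
            \<le> (1 / sqrt (real n)) * (e1 * sqrt (real n))"
          by (simp only: abs_mult) (intro mult_mono, auto)
        then show ?thesis using n by simp
      qed
      have Qc: "(\<Sum>l\<in>{?K j..?K (Suc j)}. norm (x (Suc l) - x l) ^ 2) \<le> c"
      proof -
        have "Q j \<omega> ^ 2 < c ^ 2" using B2j \<omega> by (auto simp: B2_def not_le)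
        then have "Q j \<omega> < c" using c(1) by (intro power2_less_imp_less[of "Q j \<omega>" c]) auto
        then show ?thesis by (simp add: Q_def x_def)
      qed
      let ?I = "pl_integral f n x"
      have osc: "\<bar>?I s - ?I (real (?K j) / real n)\<bar> \<le> 3 * e1"
        if "real j / real m \<le> s" "s \<le> real (Suc j) / real m" for s
        by (rule pl_integral_oscillation[OF fg m(1) n j(1) tr Qc c(2,3) that])
      have mono: "real j / real m \<le> real (Suc j) / real m" by (simp add: divide_right_mono)
      have I: "\<bar>?I t - ?I (real j / real m)\<bar> \<le> e" "\<bar>?I t - ?I (real (Suc j) / real m)\<bar> \<le> e"
        using osc[OF j(2,3)] osc[of "real j / real m"] osc[of "real (Suc j) / real m"] mono
        unfolding e1_def by linarith+
      define \<theta> where "\<theta> = real m * t - real j"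
      have \<theta>: "0 \<le> \<theta>" "\<theta> \<le> 1" using j m(1) by (auto simp: \<theta>_def field_simps)
      have "?I t - pl m (\<lambda>j. ?I (real j / real m)) t
          = (1 - \<theta>) * (?I t - ?I (real j / real m)) + \<theta> * (?I t - ?I (real (Suc j) / real m))"
        unfolding pl_on_cell[OF j] \<theta>_def[symmetric] by (simp add: algebra_simps)
      also have "\<bar>\<dots>\<bar> \<le> (1 - \<theta>) * e + \<theta> * e"
        using \<theta> I by (intro order_trans[OF abs_triangle_ineq] add_mono)
          (auto simp: abs_mult intro!: mult_left_mono)
      finally show "\<bar>pl_integral f n (\<lambda>k. walk n k \<omega>) t
          - pl m (\<lambda>j. pl_integral f n (\<lambda>k. walk n k \<omega>) (real j / real m)) t\<bar> \<le> e"
        unfolding x_def by (simp add: algebra_simps)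
    qed
  qed
qed

end

section \<open>Smooth test functions on sequences\<close>

text \<open>
  \<open>a\<close> and \<open>b\<close> are the first and second order Taylor coefficients for moving a single entry of the sequence.
\<close>

definition taylor3_with ::
  "real \<Rightarrow> (nat \<Rightarrow> 'd \<Rightarrow> (nat \<Rightarrow> real^'d) \<Rightarrow> real) \<Rightarrow> (nat \<Rightarrow> 'd \<Rightarrow> 'd \<Rightarrow> (nat \<Rightarrow> real^'d) \<Rightarrow> real)
    \<Rightarrow> ((nat \<Rightarrow> real^'d) \<Rightarrow> real) \<Rightarrow> bool" where
  "taylor3_with C a b f \<longleftrightarrow> C \<ge> 0 \<and> continuous_on UNIV f \<and>
     (\<forall>j i. continuous_on UNIV (a j i)) \<and> (\<forall>j i l. continuous_on UNIV (b j i l)) \<and>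
     (\<forall>x. \<bar>f x\<bar> \<le> C) \<and> (\<forall>j i x. \<bar>a j i x\<bar> \<le> C) \<and> (\<forall>j i l x. \<bar>b j i l x\<bar> \<le> C) \<and>
     (\<forall>j x v. \<bar>f (x(j := x j + v)) - f x - (\<Sum>i\<in>UNIV. a j i x * v $ i)
        - (\<Sum>i\<in>UNIV. \<Sum>l\<in>UNIV. b j i l x * (v $ i * v $ l)) / 2\<bar> \<le> C * norm v ^ 3)"

definition taylor3 :: "((nat \<Rightarrow> real^'d) \<Rightarrow> real) \<Rightarrow> bool" where
  "taylor3 f \<longleftrightarrow> (\<exists>C a b. taylor3_with C a b f)"

lemma taylor3_withD:
  assumes "taylor3_with C a b f"
  shows "C \<ge> 0" "continuous_on UNIV f" "continuous_on UNIV (a j i)" "continuous_on UNIV (b j i l)"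
    "\<bar>f x\<bar> \<le> C" "\<bar>a j i x\<bar> \<le> C" "\<bar>b j i l x\<bar> \<le> C"
    "\<bar>f (x(j := x j + v)) - f x - (\<Sum>i\<in>UNIV. a j i x * v $ i)
        - (\<Sum>i\<in>UNIV. \<Sum>l\<in>UNIV. b j i l x * (v $ i * v $ l)) / 2\<bar> \<le> C * norm v ^ 3"
  using assms unfolding taylor3_with_def by simp_all

lemma taylor3_const: "taylor3 (\<lambda>_. c)"
  unfolding taylor3_def
  by (rule exI[of _ "\<bar>c\<bar>"], rule exI[of _ "\<lambda>_ _ _. 0"], rule exI[of _ "\<lambda>_ _ _ _. 0"])
    (simp add: taylor3_with_def)

lemma taylor3_add:
  fixes f g :: "(nat \<Rightarrow> real^'d) \<Rightarrow> real"
  assumes "taylor3 f" "taylor3 g"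
  shows "taylor3 (\<lambda>x. f x + g x)"
proof -
  obtain C a b where f: "taylor3_with C a b f" using assms(1) by (auto simp: taylor3_def)
  obtain C' a' b' where g: "taylor3_with C' a' b' g" using assms(2) by (auto simp: taylor3_def)
  have "taylor3_with (C + C') (\<lambda>j i x. a j i x + a' j i x) (\<lambda>j i l x. b j i l x + b' j i l x) (\<lambda>x. f x + g x)"
    unfolding taylor3_with_def
  proof (intro conjI allI)
    fix j :: nat and x :: "nat \<Rightarrow> real^'d" and v :: "real^'d"
    let ?R = "\<lambda>f a b. f (x(j := x j + v)) - f x - (\<Sum>i\<in>UNIV. a j i x * v $ i)
        - (\<Sum>i\<in>UNIV. \<Sum>l\<in>UNIV. b j i l x * (v $ i * v $ l)) / 2"
    have "(\<Sum>i\<in>UNIV. (a j i x + a' j i x) * v $ i) = (\<Sum>i\<in>UNIV. a j i x * v $ i) + (\<Sum>i\<in>UNIV. a' j i x * v $ i)"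
      by (simp add: sum.distrib distrib_right)
    moreover have "(\<Sum>i\<in>UNIV. \<Sum>l\<in>UNIV. (b j i l x + b' j i l x) * (v $ i * v $ l))
        = (\<Sum>i\<in>UNIV. \<Sum>l\<in>UNIV. b j i l x * (v $ i * v $ l)) + (\<Sum>i\<in>UNIV. \<Sum>l\<in>UNIV. b' j i l x * (v $ i * v $ l))"
      by (simp add: sum.distrib distrib_right)
    moreover have "\<bar>?R f a b\<bar> \<le> C * norm v ^ 3" "\<bar>?R g a' b'\<bar> \<le> C' * norm v ^ 3"
      by (rule taylor3_withD[OF f], rule taylor3_withD[OF g])
    ultimately show "\<bar>f (x(j := x j + v)) + g (x(j := x j + v)) - (f x + g x)
        - (\<Sum>i\<in>UNIV. (a j i x + a' j i x) * v $ i)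
        - (\<Sum>i\<in>UNIV. \<Sum>l\<in>UNIV. (b j i l x + b' j i l x) * (v $ i * v $ l)) / 2\<bar> \<le> (C + C') * norm v ^ 3"
      unfolding distrib_right[of C] add_divide_distrib by linarith
  qed (use f g in \<open>auto simp: taylor3_with_def intro!: continuous_on_add order_trans[OF abs_triangle_ineq] add_mono\<close>)
  then show ?thesis by (auto simp: taylor3_def)
qed

lemma taylor_product_bound:
  fixes F G f g A A' B B' c s :: real
  assumes s: "s \<ge> 0" and "\<bar>f\<bar> \<le> c" "\<bar>g\<bar> \<le> c" "\<bar>F\<bar> \<le> c" "\<bar>G\<bar> \<le> c"
    and A: "\<bar>A\<bar> \<le> c * s" "\<bar>A'\<bar> \<le> c * s" and B: "\<bar>B\<bar> \<le> c * s ^ 2" "\<bar>B'\<bar> \<le> c * s ^ 2"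
    and R: "\<bar>F - f - A - B / 2\<bar> \<le> c * s ^ 3" "\<bar>G - g - A' - B' / 2\<bar> \<le> c * s ^ 3"
  shows "\<bar>F * G - f * g - (f * A' + g * A) - (f * B' + g * B + 2 * A * A') / 2\<bar> \<le> 8 * c ^ 2 * s ^ 3"
proof -
  have c: "c \<ge> 0" using assms(2) by linarith
  show ?thesis
  proof (cases "s \<le> 1")
    case True
    define R1 where "R1 = F - f - A - B / 2"
    define R2 where "R2 = G - g - A' - B' / 2"
    have s32: "s ^ 3 \<le> s ^ 2" "s ^ 2 \<le> s"
      using s True by (auto simp: power2_eq_square power3_eq_cube mult_left_le mult_right_le_one_le)
    have Rb: "\<bar>R1\<bar> \<le> c * s ^ 3" "\<bar>R2\<bar> \<le> c * s ^ 3" using R by (simp_all add: R1_def R2_def)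
    have E: "\<bar>B / 2 + R1\<bar> \<le> c * (3 / 2) * s ^ 2" "\<bar>B' / 2 + R2\<bar> \<le> c * (3 / 2) * s ^ 2"
    proof -
      have "c * (3 / 2) * s ^ 2 = 3 / 2 * (c * s ^ 2)" by simp
      then show "\<bar>B / 2 + R1\<bar> \<le> c * (3 / 2) * s ^ 2" "\<bar>B' / 2 + R2\<bar> \<le> c * (3 / 2) * s ^ 2"
        using Rb B mult_left_mono[OF s32(1) c] by linarith+
    qed
    have E2: "\<bar>A' + (B' / 2 + R2)\<bar> \<le> c * (5 / 2) * s"
    proof -
      have "c * (3 / 2) * s ^ 2 = 3 / 2 * (c * s ^ 2)" "c * (5 / 2) * s = 5 / 2 * (c * s)" by simp_all
      then show ?thesis using E(2) A(2) mult_left_mono[OF s32(2) c] by linarith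
    qed
    have "F * G - f * g - (f * A' + g * A) - (f * B' + g * B + 2 * A * A') / 2
        = f * R2 + g * R1 + A * (B' / 2 + R2) + (B / 2 + R1) * (A' + (B' / 2 + R2))"
      unfolding R1_def R2_def by (simp add: field_simps)
    also have "\<bar>\<dots>\<bar> \<le> \<bar>f * R2\<bar> + \<bar>g * R1\<bar> + \<bar>A * (B' / 2 + R2)\<bar> + \<bar>(B / 2 + R1) * (A' + (B' / 2 + R2))\<bar>"
    proof -
      have "\<bar>p + q + r + t\<bar> \<le> \<bar>p\<bar> + \<bar>q\<bar> + \<bar>r\<bar> + \<bar>t\<bar>" for p q r t :: real by linarith
      then show ?thesis .
    qed
    also have "\<dots> \<le> c * (c * s ^ 3) + c * (c * s ^ 3) + (c * s) * (c * (3 / 2) * s ^ 2)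
        + (c * (3 / 2) * s ^ 2) * (c * (5 / 2) * s)"
      unfolding abs_mult by (intro add_mono mult_mono Rb E E2 A assms(2,3); use c s in simp)
    also have "\<dots> = (29 / 4) * c ^ 2 * s ^ 3" by (simp add: power2_eq_square power3_eq_cube)
    also have "\<dots> \<le> 8 * c ^ 2 * s ^ 3" using s by (intro mult_right_mono) auto
    finally show ?thesis .
  next
    case False
    have s3: "1 \<le> s ^ 3" "s \<le> s ^ 3" "s ^ 2 \<le> s ^ 3"
      using False power_increasing[of 0 3 s] power_increasing[of 1 3 s] power_increasing[of 2 3 s] by auto
    have cc: "c * c * x \<le> c * c * s ^ 3" if "x \<le> s ^ 3" for x using that c by (intro mult_left_mono) auto
    have "\<bar>F * G - f * g - (f * A' + g * A) - (f * B' + g * B + 2 * A * A') / 2\<bar>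
        \<le> \<bar>F * G\<bar> + \<bar>f * g\<bar> + \<bar>f * A'\<bar> + \<bar>g * A\<bar> + \<bar>f * B'\<bar> / 2 + \<bar>g * B\<bar> / 2 + \<bar>A * A'\<bar>"
    proof -
      have "\<bar>p - q - (r + t) - (u + w + 2 * z) / 2\<bar> \<le> (\<bar>p\<bar> + \<bar>q\<bar>) + (\<bar>r\<bar> + \<bar>t\<bar>) + (\<bar>u\<bar> + \<bar>w\<bar>) / 2 + \<bar>z\<bar>"
        for p q r t u w z :: real
      proof -
        have "\<bar>p - q\<bar> \<le> \<bar>p\<bar> + \<bar>q\<bar>" "\<bar>r + t\<bar> \<le> \<bar>r\<bar> + \<bar>t\<bar>" "\<bar>u + w\<bar> \<le> \<bar>u\<bar> + \<bar>w\<bar>" by linarith+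
        moreover have "\<bar>x - y - (v + 2 * z) / 2\<bar> \<le> X + Y + V / 2 + Z"
          if "\<bar>x\<bar> \<le> X" "\<bar>y\<bar> \<le> Y" "\<bar>v\<bar> \<le> V" "\<bar>z\<bar> \<le> Z" for x y v X Y V Z :: real
          using that unfolding abs_le_iff by (simp add: add_divide_distrib)
        ultimately show ?thesis by blast
      qed
      from this[of "F * G" "f * g" "f * A'" "g * A" "f * B'" "g * B" "A * A'"]
      have "\<bar>F * G - f * g - (f * A' + g * A) - (f * B' + g * B + 2 * (A * A')) / 2\<bar>
          \<le> \<bar>F * G\<bar> + \<bar>f * g\<bar> + \<bar>f * A'\<bar> + \<bar>g * A\<bar> + \<bar>f * B'\<bar> / 2 + \<bar>g * B\<bar> / 2 + \<bar>A * A'\<bar>"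
        by (simp only: add_divide_distrib add.assoc)
      then show ?thesis unfolding mult.assoc .
    qed
    also have "\<dots> \<le> c * c + c * c + c * (c * s) + c * (c * s) + c * (c * s ^ 2) / 2 + c * (c * s ^ 2) / 2 + (c * s) * (c * s)"
      unfolding abs_mult by (intro add_mono mult_mono divide_right_mono A B assms(2-5); use c s in simp)
    also have "\<dots> = c * c * 1 + c * c * 1 + c * c * s + c * c * s + c * c * s ^ 2 + c * c * s ^ 2"
      by (simp add: power2_eq_square)
    also have "\<dots> \<le> c * c * s ^ 3 + c * c * s ^ 3 + c * c * s ^ 3 + c * c * s ^ 3 + c * c * s ^ 3 + c * c * s ^ 3"
      by (intro add_mono cc s3)
    also have "\<dots> \<le> 8 * c ^ 2 * s ^ 3"
    proof -
      have "0 \<le> c * c * s ^ 3" using c s by simp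
      then show ?thesis unfolding power2_eq_square by linarith
    qed
    finally show ?thesis .
  qed
qed

lemma taylor3_mult:
  fixes f g :: "(nat \<Rightarrow> real^'d) \<Rightarrow> real"
  assumes "taylor3 f" "taylor3 g"
  shows "taylor3 (\<lambda>x. f x * g x)"
proof -
  obtain C1 a b where f1: "taylor3_with C1 a b f" using assms(1) by (auto simp: taylor3_def)
  obtain C2 a' b' where g1: "taylor3_with C2 a' b' g" using assms(2) by (auto simp: taylor3_def)
  define C where "C = C1 + C2"
  let ?d = "real CARD('d)"
  have C12: "C1 \<ge> 0" "C2 \<ge> 0" using f1 g1 by (auto simp: taylor3_with_def)
  have up: "taylor3_with C a b f" if "taylor3_with D a b f" "D \<le> C" for D a b and f :: "(nat \<Rightarrow> real^'d) \<Rightarrow> real"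
  proof -
    have "D * norm v ^ 3 \<le> C * norm v ^ 3" for v :: "real^'d"
      using that(2) by (intro mult_right_mono) auto
    then show ?thesis using that unfolding taylor3_with_def by (meson order_trans)
  qed
  have f: "taylor3_with C a b f" and g: "taylor3_with C a' b' g"
    using up[OF f1] up[OF g1] C12 by (auto simp: C_def)
  \<comment> \<open>A common bound for the functions themselves and, after summation over one or two
    indices, for the linear and quadratic terms.\<close>
  define c where "c = C * (?d ^ 2 + ?d + 1)"
  have C: "C \<ge> 0" "C \<le> c"
    using f mult_left_mono[of 1 "?d ^ 2 + ?d + 1" C] by (auto simp: taylor3_with_def c_def)
  have linear: "\<bar>\<Sum>i\<in>UNIV. a j i x * v $ i\<bar> \<le> c * norm v" if "taylor3_with C a b f"
    for j x and v :: "real^'d" and a b and f :: "(nat \<Rightarrow> real^'d) \<Rightarrow> real"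
  proof -
    have "\<bar>\<Sum>i\<in>UNIV. a j i x * v $ i\<bar> \<le> (\<Sum>i\<in>(UNIV::'d set). C * norm v)"
      using that C(1) component_le_norm_cart[of v] unfolding taylor3_with_def
      by (intro order_trans[OF sum_abs] sum_mono) (auto simp: abs_mult intro!: mult_mono)
    also have "\<dots> = (C * ?d) * norm v" by simp
    also have "\<dots> \<le> c * norm v" unfolding c_def using C(1) by (intro mult_right_mono mult_left_mono) auto
    finally show ?thesis .
  qed
  have quadratic: "\<bar>\<Sum>i\<in>UNIV. \<Sum>l\<in>UNIV. b j i l x * (v $ i * v $ l)\<bar> \<le> c * norm v ^ 2" if "taylor3_with C a b f"
    for j x and v :: "real^'d" and a b and f :: "(nat \<Rightarrow> real^'d) \<Rightarrow> real"
  proof -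
    have bC: "\<bar>b j i l x\<bar> \<le> C" for i l using that unfolding taylor3_with_def by blast
    have "\<bar>\<Sum>i\<in>UNIV. \<Sum>l\<in>UNIV. b j i l x * (v $ i * v $ l)\<bar> \<le> (\<Sum>i\<in>(UNIV::'d set). \<Sum>l\<in>(UNIV::'d set). C * (norm v * norm v))"
    proof (intro order_trans[OF sum_abs] sum_mono)
      fix i l :: 'd
      show "\<bar>b j i l x * (v $ i * v $ l)\<bar> \<le> C * (norm v * norm v)"
        unfolding abs_mult by (intro mult_mono bC component_le_norm_cart) (use C in auto)
    qed
    also have "\<dots> = (C * ?d ^ 2) * norm v ^ 2" by (simp add: power2_eq_square)
    also have "\<dots> \<le> c * norm v ^ 2" unfolding c_def using C(1) by (intro mult_right_mono mult_left_mono) auto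
    finally show ?thesis .
  qed
  let ?a = "\<lambda>j i x. f x * a' j i x + g x * a j i x"
  \<comment> \<open>The cross term is not symmetric in \<open>i\<close> and \<open>l\<close>; it is
    correct after summation against the symmetric \<open>v $ i * v $ l\<close>.\<close>
  let ?b = "\<lambda>j i l x. f x * b' j i l x + g x * b j i l x + 2 * a j i x * a' j l x"
  have bound: "\<bar>f x\<bar> \<le> c" "\<bar>g x\<bar> \<le> c" "\<bar>a j i x\<bar> \<le> c" "\<bar>a' j i x\<bar> \<le> c" "\<bar>b j i l x\<bar> \<le> c" "\<bar>b' j i l x\<bar> \<le> c" for x j i l
    using f g C(2) unfolding taylor3_with_def by (meson order_trans)+
  have c: "c \<ge> 0" using C by simp
  have prod2: "\<bar>u * w\<bar> \<le> c * c" if "\<bar>u\<bar> \<le> c" "\<bar>w\<bar> \<le> c" for u w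
    unfolding abs_mult using that c by (intro mult_mono) auto
  have "taylor3_with (8 * c ^ 2) ?a ?b (\<lambda>x. f x * g x)"
    unfolding taylor3_with_def
  proof (intro conjI allI)
    fix j x and v :: "real^'d"
    define A where "A = (\<Sum>i\<in>UNIV. a j i x * v $ i)"
    define A' where "A' = (\<Sum>i\<in>UNIV. a' j i x * v $ i)"
    define B where "B = (\<Sum>i\<in>UNIV. \<Sum>l\<in>UNIV. b j i l x * (v $ i * v $ l))"
    define B' where "B' = (\<Sum>i\<in>UNIV. \<Sum>l\<in>UNIV. b' j i l x * (v $ i * v $ l))"
    have "(\<Sum>i\<in>UNIV. ?a j i x * v $ i) = f x * A' + g x * A"
      by (simp add: A_def A'_def sum_distrib_left sum.distrib algebra_simps)
    moreover have "(\<Sum>i\<in>UNIV. \<Sum>l\<in>UNIV. ?b j i l x * (v $ i * v $ l)) = f x * B' + g x * B + 2 * A * A'"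
    proof -
      have "2 * A * A' = (\<Sum>i\<in>UNIV. \<Sum>l\<in>UNIV. 2 * a j i x * a' j l x * (v $ i * v $ l))"
        unfolding A_def A'_def mult.assoc sum_product by (simp add: sum_distrib_left mult_ac)
      then show ?thesis by (simp add: B_def B'_def sum_distrib_left sum.distrib algebra_simps)
    qed
    moreover have "\<bar>f (x(j := x j + v)) * g (x(j := x j + v)) - f x * g x
        - (f x * A' + g x * A) - (f x * B' + g x * B + 2 * A * A') / 2\<bar> \<le> 8 * c ^ 2 * norm v ^ 3"
    proof (rule taylor_product_bound)
      have "\<bar>f (x(j := x j + v)) - f x - A - B / 2\<bar> \<le> C * norm v ^ 3"
        "\<bar>g (x(j := x j + v)) - g x - A' - B' / 2\<bar> \<le> C * norm v ^ 3"
        unfolding A_def A'_def B_def B'_def by (rule taylor3_withD[OF f], rule taylor3_withD[OF g])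
      moreover have "C * norm v ^ 3 \<le> c * norm v ^ 3" using C(2) by (intro mult_right_mono) auto
      ultimately show "\<bar>f (x(j := x j + v)) - f x - A - B / 2\<bar> \<le> c * norm v ^ 3"
        "\<bar>g (x(j := x j + v)) - g x - A' - B' / 2\<bar> \<le> c * norm v ^ 3" by linarith+
    qed (auto simp: A_def A'_def B_def B'_def intro: bound linear[OF f] linear[OF g] quadratic[OF f] quadratic[OF g])
    ultimately show "\<bar>f (x(j := x j + v)) * g (x(j := x j + v)) - f x * g x - (\<Sum>i\<in>UNIV. ?a j i x * v $ i)
        - (\<Sum>i\<in>UNIV. \<Sum>l\<in>UNIV. ?b j i l x * (v $ i * v $ l)) / 2\<bar> \<le> 8 * c ^ 2 * norm v ^ 3"
      by simp
  next
    have cc: "0 \<le> c * c" using c by simp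
    show "\<bar>f x * g x\<bar> \<le> 8 * c ^ 2" for x
      using prod2[OF bound(1,2), of x x] cc by (simp add: power2_eq_square)
    show "\<bar>?a j i x\<bar> \<le> 8 * c ^ 2" for j i x
      using prod2[OF bound(1,4), of x j i x] prod2[OF bound(2,3), of x j i x] cc
      unfolding power2_eq_square by linarith
    show "\<bar>?b j i l x\<bar> \<le> 8 * c ^ 2" for j i l x
      using prod2[OF bound(1,6), of x j i l x] prod2[OF bound(2,5), of x j i l x]
        prod2[OF bound(3,4), of j i x j l x] cc
      unfolding power2_eq_square mult.assoc by linarith
  qed (use f g in \<open>auto simp: taylor3_with_def intro!: continuous_intros\<close>)
  then show ?thesis by (auto simp: taylor3_def)
qed

text \<open>Taylor's formula with third-order remainder: the third derivative
  \<open>(6 * u ^ 2 - 2) / (1 + u ^ 2) ^ 3\<close> is at most 6 in absolute value, which cancels the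
  factorial.\<close>

lemma arctan_taylor:
  fixes t s :: real
  shows "\<bar>arctan (t + s) - arctan t - s / (1 + t ^ 2) + t * s ^ 2 / (1 + t ^ 2) ^ 2\<bar> \<le> \<bar>s\<bar> ^ 3"
proof (cases "s = 0")
  case False
  have pos: "1 + u ^ 2 \<noteq> 0" "1 + u ^ 2 > 0" for u :: real
    using zero_le_power2[of u] by linarith+
  define diff where "diff m = (if m = 0 then arctan else if m = 1 then (\<lambda>u. inverse (1 + u ^ 2))
    else if m = 2 then (\<lambda>u. - 2 * u / (1 + u ^ 2) ^ 2) else (\<lambda>u. (6 * u ^ 2 - 2) / (1 + u ^ 2) ^ 3))" for m :: nat
  have d1: "DERIV (\<lambda>u. inverse (1 + u ^ 2)) u :> - 2 * u / (1 + u ^ 2) ^ 2" for u :: real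
    using pos[of u] by (auto intro!: derivative_eq_intros simp: field_simps power2_eq_square)
  have d2: "DERIV (\<lambda>u. - 2 * u / (1 + u ^ 2) ^ 2) u :> (6 * u ^ 2 - 2) / (1 + u ^ 2) ^ 3" for u :: real
  proof -
    have "DERIV (\<lambda>u. - 2 * u / (1 + u ^ 2) ^ 2) u :>
        ((- 2) * (1 + u ^ 2) ^ 2 - (- 2 * u) * (2 * (1 + u ^ 2) * (2 * u))) / ((1 + u ^ 2) ^ 2 * (1 + u ^ 2) ^ 2)"
      by (rule DERIV_divide) (use pos[of u] in \<open>auto intro!: derivative_eq_intros\<close>)
    also have "((- 2) * (1 + u ^ 2) ^ 2 - (- 2 * u) * (2 * (1 + u ^ 2) * (2 * u))) / ((1 + u ^ 2) ^ 2 * (1 + u ^ 2) ^ 2)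
        = (6 * u ^ 2 - 2) / (1 + u ^ 2) ^ 3"
    proof -
      define y where "y = 1 + u ^ 2"
      have u: "u * u = y - 1" by (simp add: y_def power2_eq_square)
      have "y \<noteq> 0" using pos by (simp add: y_def)
      have "(- 2) * y ^ 2 - (- 2 * u) * (2 * y * (2 * u)) = - 2 * y * y + 8 * y * (u * u)"
        by (simp add: power2_eq_square)
      also have "\<dots> = y * (6 * (u * u) - 2)" unfolding u by (simp add: algebra_simps)
      finally have "(- 2) * y ^ 2 - (- 2 * u) * (2 * y * (2 * u)) = y * (6 * (u * u) - 2)" .
      then show ?thesis
        unfolding y_def[symmetric] using \<open>y \<noteq> 0\<close>
        by (simp add: power2_eq_square power3_eq_cube)
    qed
    finally show ?thesis .
  qed
  have "\<forall>m u. m < 3 \<and> min t (t + s) \<le> u \<and> u \<le> max t (t + s) \<longrightarrow> DERIV (diff m) u :> diff (Suc m) u"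
  proof (intro allI impI)
    fix m :: nat and u assume "m < 3 \<and> min t (t + s) \<le> u \<and> u \<le> max t (t + s)"
    then consider "m = 0" | "m = 1" | "m = 2" by linarith
    then show "DERIV (diff m) u :> diff (Suc m) u"
      by cases (use DERIV_arctan[of u] d1[of u] d2[of u] in \<open>simp_all add: diff_def numeral_2_eq_2\<close>)
  qed
  from Taylor[of 3 diff arctan "min t (t + s)" "max t (t + s)" t "t + s", OF _ _ this]
  obtain u where "arctan (t + s) = (\<Sum>m<3. diff m t / fact m * s ^ m) + diff 3 u / fact 3 * s ^ 3"
    using False by (auto simp: diff_def)
  then have "arctan (t + s) - arctan t - s / (1 + t ^ 2) + t * s ^ 2 / (1 + t ^ 2) ^ 2
      = (6 * u ^ 2 - 2) / (1 + u ^ 2) ^ 3 / 6 * s ^ 3"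
  proof -
    assume taylor: "arctan (t + s) = (\<Sum>m<3. diff m t / fact m * s ^ m) + diff 3 u / fact 3 * s ^ 3"
    have "(\<Sum>m<3. diff m t / fact m * s ^ m) = arctan t + inverse (1 + t ^ 2) * s + - 2 * t / (1 + t ^ 2) ^ 2 / 2 * s ^ 2"
      unfolding numeral_3_eq_3 by (simp add: diff_def power2_eq_square)
    moreover have "diff 3 u / fact 3 * s ^ 3 = (6 * u ^ 2 - 2) / (1 + u ^ 2) ^ 3 / 6 * s ^ 3"
      by (simp add: diff_def fact_numeral)
    moreover have "inverse (1 + t ^ 2) * s = s / (1 + t ^ 2)" by (simp add: divide_inverse mult.commute)
    moreover have "- 2 * t / (1 + t ^ 2) ^ 2 / 2 * s ^ 2 = - (t * s ^ 2 / (1 + t ^ 2) ^ 2)" by simp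
    ultimately show ?thesis using taylor by linarith
  qed
  also have "\<bar>\<dots>\<bar> \<le> 1 * \<bar>s\<bar> ^ 3"
  proof -
    have "\<bar>6 * u ^ 2 - 2\<bar> \<le> 6 * (1 + u ^ 2)" by (simp add: abs_le_iff)
    also have "\<dots> \<le> 6 * (1 + u ^ 2) ^ 3"
      using power_increasing[of 1 3 "1 + u ^ 2"] by simp
    finally have le: "\<bar>6 * u ^ 2 - 2\<bar> \<le> 6 * (1 + u ^ 2) ^ 3" .
    have "(1 + u ^ 2) ^ 3 > 0" using pos(2)[of u] by (rule zero_less_power)
    then have "\<bar>(6 * u ^ 2 - 2) / (1 + u ^ 2) ^ 3 / 6\<bar> \<le> 1"
      using le by (simp only: abs_divide abs_numeral abs_of_pos) (simp add: divide_le_eq mult.commute)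
    then show ?thesis unfolding abs_mult power_abs by (intro mult_right_mono) auto
  qed
  finally show ?thesis by simp
qed simp

text \<open>Coordinates themselves are unbounded. Their arctangents are bounded with bounded
  derivatives and still separate points, so they can generate the approximating algebra.\<close>

lemma taylor3_arctan: "taylor3 (\<lambda>x::nat \<Rightarrow> real^'d. arctan (x j0 $ i0))"
proof -
  let ?a = "\<lambda>j i (x::nat \<Rightarrow> real^'d). if j = j0 \<and> i = i0 then 1 / (1 + (x j0 $ i0) ^ 2) else 0"
  let ?b = "\<lambda>j i l (x::nat \<Rightarrow> real^'d). if j = j0 \<and> i = i0 \<and> l = i0 then - 2 * x j0 $ i0 / (1 + (x j0 $ i0) ^ 2) ^ 2 else 0"
  have pos: "1 + u ^ 2 \<noteq> 0" "1 + u ^ 2 > 0" "1 + u ^ 2 \<ge> 1" for u :: real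
    using zero_le_power2[of u] by linarith+
  have coord: "continuous_on UNIV (\<lambda>x::nat \<Rightarrow> real^'d. x j0 $ i0)"
    by (intro continuous_on_component continuous_on_product_coordinates)
  have "taylor3_with 2 ?a ?b (\<lambda>x. arctan (x j0 $ i0))"
    unfolding taylor3_with_def
  proof (intro conjI allI)
    show "continuous_on UNIV (\<lambda>x::nat \<Rightarrow> real^'d. arctan (x j0 $ i0))" by (intro continuous_intros coord)
    show "continuous_on UNIV (?a j i)" for j i
    proof (cases "j = j0 \<and> i = i0")
      case True
      have "continuous_on UNIV (\<lambda>x::nat \<Rightarrow> real^'d. 1 / (1 + (x j0 $ i0) ^ 2))"
        by (intro continuous_on_divide continuous_on_add continuous_on_power continuous_on_const coord) (simp add: pos)
      then show ?thesis using True by simp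
    qed auto
    show "continuous_on UNIV (?b j i l)" for j i l
    proof (cases "j = j0 \<and> i = i0 \<and> l = i0")
      case True
      have "continuous_on UNIV (\<lambda>x::nat \<Rightarrow> real^'d. - 2 * x j0 $ i0 / (1 + (x j0 $ i0) ^ 2) ^ 2)"
        by (intro continuous_on_divide continuous_on_mult continuous_on_add continuous_on_power continuous_on_const coord)
          (simp add: pos)
      then show ?thesis using True by simp
    qed auto
    show "\<bar>arctan (x j0 $ i0)\<bar> \<le> 2" for x :: "nat \<Rightarrow> real^'d"
      using arctan_bounded[of "x j0 $ i0"] pi_less_4 by (simp add: abs_le_iff)
    show "\<bar>?a j i x\<bar> \<le> 2" for j i and x :: "nat \<Rightarrow> real^'d"
      using pos(3)[of "x j0 $ i0"] by (auto simp: divide_le_eq)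
    show "\<bar>?b j i l x\<bar> \<le> 2" for j i l and x :: "nat \<Rightarrow> real^'d"
    proof -
      define u where "u = x j0 $ i0"
      have "\<bar>u\<bar> \<le> 1 + u ^ 2"
        using sum_squares_bound[of 1 "\<bar>u\<bar>"] abs_ge_zero[of u] by simp
      also have "\<dots> \<le> (1 + u ^ 2) ^ 2" using pos(3)[of u] power_increasing[of 1 2 "1 + u ^ 2"] by simp
      finally have "\<bar>- 2 * u / (1 + u ^ 2) ^ 2\<bar> \<le> 2" by (simp add: abs_mult divide_le_eq pos)
      then show ?thesis by (simp add: u_def)
    qed
    fix j and x :: "nat \<Rightarrow> real^'d" and v :: "real^'d"
    show "\<bar>arctan ((x(j := x j + v)) j0 $ i0) - arctan (x j0 $ i0) - (\<Sum>i\<in>UNIV. ?a j i x * v $ i)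
        - (\<Sum>i\<in>UNIV. \<Sum>l\<in>UNIV. ?b j i l x * (v $ i * v $ l)) / 2\<bar> \<le> 2 * norm v ^ 3"
    proof (cases "j = j0")
      case True
      define t where "t = x j0 $ i0"
      define s where "s = v $ i0"
      have "(\<Sum>i\<in>UNIV. ?a j i x * v $ i) = s / (1 + t ^ 2)"
        using True by (simp add: t_def s_def if_distrib[of "\<lambda>y. y * _"] cong: if_cong)
      moreover have "(\<Sum>i\<in>UNIV. \<Sum>l\<in>UNIV. ?b j i l x * (v $ i * v $ l)) = (- 2 * t / (1 + t ^ 2) ^ 2) * (s * s)"
      proof -
        have "(\<Sum>l\<in>UNIV. ?b j i l x * (v $ i * v $ l))
            = (if i = i0 then (- 2 * t / (1 + t ^ 2) ^ 2) * (s * s) else 0)" for i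
          using True by (cases "i = i0") (simp_all add: t_def s_def if_distrib[of "\<lambda>y. y * _"] cong: if_cong)
        then show ?thesis by simp
      qed
      moreover have "arctan ((x(j := x j + v)) j0 $ i0) = arctan (t + s)" using True by (simp add: t_def s_def)
      ultimately have "\<bar>arctan ((x(j := x j + v)) j0 $ i0) - arctan (x j0 $ i0) - (\<Sum>i\<in>UNIV. ?a j i x * v $ i)
        - (\<Sum>i\<in>UNIV. \<Sum>l\<in>UNIV. ?b j i l x * (v $ i * v $ l)) / 2\<bar> \<le> \<bar>s\<bar> ^ 3"
        using arctan_taylor[of t s] by (simp add: t_def[symmetric] power2_eq_square)
      also have "\<dots> \<le> norm v ^ 3" unfolding s_def by (intro power_mono component_le_norm_cart) auto
      also have "\<dots> \<le> 2 * norm v ^ 3" by simp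
      finally show ?thesis .
    qed simp
  qed simp
  then show ?thesis by (auto simp: taylor3_def)
qed

section \<open>Truncation and uniform approximation\<close>

definition clamp_entries :: "real \<Rightarrow> (nat \<Rightarrow> real^'d) \<Rightarrow> nat \<Rightarrow> real^'d" where
  "clamp_entries R x = (\<lambda>j. \<chi> i. max (- R) (min R (x j $ i)))"

lemma clamp_entries_eq: "(\<And>j i. \<bar>x j $ i\<bar> \<le> R) \<Longrightarrow> clamp_entries R x = x"
  by (auto simp: clamp_entries_def fun_eq_iff vec_eq_iff abs_le_iff min_def max_def) (smt (verit))+

lemma continuous_on_entrywise:
  assumes "continuous_on UNIV \<tau>"
  shows "continuous_on UNIV (\<lambda>x::nat \<Rightarrow> real^'d. (\<lambda>j. \<chi> i. \<tau> (x j $ i)))"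
proof (rule continuous_on_coordinatewise_then_product)
  fix j
  have "continuous_on UNIV (\<lambda>x::nat \<Rightarrow> real^'d. \<tau> (x j $ i))" for i
    by (rule continuous_on_compose2[OF assms]) (auto intro!: continuous_on_component continuous_on_product_coordinates)
  then show "continuous_on UNIV (\<lambda>x::nat \<Rightarrow> real^'d. \<chi> i. \<tau> (x j $ i))" by (rule continuous_on_vec_lambda)
qed

text \<open>
  The arctangent maps the space of sequences into a compact cube on which the Stone-Weierstrass theorem
  applies; since \<open>G\<close> is evaluated at clamped arguments it extends continuously to the closed cube, so that
  the approximation is uniform on the whole space.
\<close>

lemma taylor3_dense:
  fixes G :: "(nat \<Rightarrow> real^'d) \<Rightarrow> real"
  assumes G: "continuous_on UNIV G" and "e > 0" and R: "R > 0"
  obtains f where "taylor3 f" "\<And>x. \<bar>G (clamp_entries R x) - f x\<bar> < e"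
proof -
  define r where "r = arctan R"
  have r: "0 < r" "r < pi / 2" using R arctan_ubound[of R] by (auto simp: r_def)
  \<comment> \<open>A left inverse of the arctangent up to truncation at \<open>R\<close>. Since
    \<open>r < pi / 2\<close>, the tangent is evaluated away from its poles, so
    \<open>\<tau>\<close> is continuous on the whole line.\<close>
  define \<tau> where "\<tau> s = tan (max (- r) (min r s))" for s
  have \<tau>_cont: "continuous_on UNIV \<tau>"
  proof -
    have "continuous_on {-r..r} tan"
      by (rule continuous_at_imp_continuous_on)
        (use r in \<open>auto intro!: continuous_intros isCont_tan simp: cos_gt_zero_pi less_imp_neq[symmetric]\<close>)
    then show ?thesis
      unfolding \<tau>_def by (rule continuous_on_compose2) (use r in \<open>auto intro!: continuous_intros\<close>)
  qed
  have \<tau>_arctan: "\<tau> (arctan s) = max (- R) (min R s)" for s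
  proof -
    have "max (- r) (min r (arctan s)) = arctan (max (- R) (min R s))"
      unfolding r_def by (auto simp: min_def max_def arctan_minus arctan_le_iff simp flip: arctan_minus)
    then show ?thesis by (simp add: \<tau>_def tan_arctan)
  qed
  \<comment> \<open>An infinite product of closed cubes, compact by Tychonoff's theorem. Its
    boundary values are not arctangents, which is why \<open>\<tau>\<close> has to be continuous
    there as well.\<close>
  let ?U = "PiE UNIV (\<lambda>_::nat. cbox (\<chi> i. - (pi / 2)) (\<chi> i. pi / 2) :: (real^'d) set)"
  let ?arc = "\<lambda>x::nat \<Rightarrow> real^'d. (\<lambda>j. \<chi> i. arctan (x j $ i))"
  \<comment> \<open>The algebra lives on the cube; smoothness is demanded only after pulling back
    along the arctangent.\<close>
  let ?RR = "{p. continuous_on ?U p \<and> taylor3 (\<lambda>x. p (?arc x))}"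
  interpret function_ring_on ?RR ?U
  proof
    have "compactin (product_topology (\<lambda>_. euclidean) UNIV) ?U"
      unfolding compactin_PiE by auto
    then show "compact ?U" unfolding euclidean_product_topology by simp
    show "\<exists>p\<in>?RR. p x \<noteq> p y" if "x \<noteq> y" for x y :: "nat \<Rightarrow> real^'d"
    proof -
      obtain j i where "x j $ i \<noteq> y j $ i" using \<open>x \<noteq> y\<close> by (auto simp: fun_eq_iff vec_eq_iff)
      moreover have "(\<lambda>x. x j $ i) \<in> ?RR"
      proof -
        have "continuous_on UNIV (\<lambda>x::nat \<Rightarrow> real^'d. x j $ i)"
          by (intro continuous_on_component continuous_on_product_coordinates)
        then have "continuous_on ?U (\<lambda>x. x j $ i)" by (rule continuous_on_subset) auto
        moreover have "taylor3 (\<lambda>x. ?arc x j $ i)" using taylor3_arctan[of j i] by simp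
        ultimately show ?thesis by blast
      qed
      ultimately show ?thesis by (intro bexI[of _ "\<lambda>x. x j $ i"])
    qed
    show "(\<lambda>_. c) \<in> ?RR" for c by (simp add: taylor3_const)
    show "(\<lambda>x. p x + p' x) \<in> ?RR" "(\<lambda>x. p x * p' x) \<in> ?RR" if "p \<in> ?RR" "p' \<in> ?RR" for p p'
      using that taylor3_add[of "\<lambda>x. p (?arc x)" "\<lambda>x. p' (?arc x)"]
        taylor3_mult[of "\<lambda>x. p (?arc x)" "\<lambda>x. p' (?arc x)"]
      by (simp_all add: continuous_on_add continuous_on_mult)
  qed simp
  have "continuous_on ?U (\<lambda>u. G (\<lambda>j. \<chi> i. \<tau> (u j $ i)))"
  proof -
    have "continuous_on UNIV (\<lambda>u::nat \<Rightarrow> real^'d. G (\<lambda>j. \<chi> i. \<tau> (u j $ i)))"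
      by (rule continuous_on_compose2[OF G continuous_on_entrywise[OF \<tau>_cont] subset_UNIV])
    then show ?thesis by (rule continuous_on_subset) simp
  qed
  then obtain p where p: "p \<in> ?RR" "\<And>u. u \<in> ?U \<Longrightarrow> \<bar>G (\<lambda>j. \<chi> i. \<tau> (u j $ i)) - p u\<bar> < e"
    using Stone_Weierstrass_basic[OF _ \<open>e > 0\<close>] by blast
  show ?thesis
  proof (rule that[of "\<lambda>x. p (?arc x)"])
    show "taylor3 (\<lambda>x. p (?arc x))" using p(1) by blast
    fix x
    have "?arc x \<in> ?U"
      using arctan_bounded by (auto simp: mem_box_cart less_imp_le)
    from p(2)[OF this] show "\<bar>G (clamp_entries R x) - p (?arc x)\<bar> < e"
      by (simp add: \<tau>_arctan clamp_entries_def)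
  qed
qed

section \<open>Replacement of the steps\<close>

lemma abs_integral_diff_le:
  fixes U V :: "'a \<Rightarrow> real"
  assumes "integrable M U" "integrable M V" "integrable M W" "\<And>\<omega>. \<omega> \<in> space M \<Longrightarrow> \<bar>U \<omega> - V \<omega>\<bar> \<le> W \<omega>"
  shows "\<bar>(\<integral>\<omega>. U \<omega> \<partial>M) - (\<integral>\<omega>. V \<omega> \<partial>M)\<bar> \<le> (\<integral>\<omega>. W \<omega> \<partial>M)"
proof -
  have "(\<integral>\<omega>. U \<omega> \<partial>M) - (\<integral>\<omega>. V \<omega> \<partial>M) = (\<integral>\<omega>. U \<omega> - V \<omega> \<partial>M)"
    using assms(1,2) by simp
  also have "\<bar>\<dots>\<bar> \<le> (\<integral>\<omega>. \<bar>U \<omega> - V \<omega>\<bar> \<partial>M)" by (rule integral_abs_bound)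
  also have "\<dots> \<le> (\<integral>\<omega>. W \<omega> \<partial>M)" using assms by (intro integral_mono) auto
  finally show ?thesis .
qed

context iid_steps
begin

text \<open>The step is independent of \<open>X\<close>, so up to third order its law enters through
  the mean and the covariance only. The comparison value contains no trace of the step and is
  therefore the same for any other step with these moments.\<close>

lemma lindeberg_step:
  fixes X :: "'a \<Rightarrow> nat \<Rightarrow> real^'d"
  assumes f: "taylor3_with C a b f" and A: "A \<subseteq> I" "k \<in> I" "k \<notin> A" and s: "s \<ge> 0"
    and X: "\<And>j. (\<lambda>\<omega>. X \<omega> j) \<in> borel_measurable (gen A)"
  shows "\<bar>expectation (\<lambda>\<omega>. f ((X \<omega>)(j := X \<omega> j + s *\<^sub>R \<eta> k \<omega>)))
     - expectation (\<lambda>\<omega>. f (X \<omega>) + s ^ 2 / 2 * (\<Sum>i\<in>UNIV. b j i i (X \<omega>)))\<bar> \<le> C * (real CARD('d) + q) * s ^ 3"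
proof -
  have XA: "X \<in> borel_measurable (gen A)" by (rule measurable_coordinatewise_then_product[OF X])
  have mA: "(\<lambda>\<omega>. h (X \<omega>)) \<in> borel_measurable (gen A)" if "continuous_on UNIV h" for h :: "_ \<Rightarrow> real"
    by (rule measurable_compose[OF XA borel_measurable_continuous_onI[OF that]])
  have intA: "integrable M (\<lambda>\<omega>. h (X \<omega>))" if "continuous_on UNIV h" "\<And>x. \<bar>h x\<bar> \<le> C" for h :: "_ \<Rightarrow> real"
    by (rule integrable_const_bound[where B=C]) (use that measurable_genD[OF mA A(1)] in auto)
  note D = taylor3_withD[OF f]
  let ?\<eta> = "\<eta> k"
  let ?lin = "\<lambda>\<omega>. \<Sum>i\<in>UNIV. a j i (X \<omega>) * (s *\<^sub>R ?\<eta> \<omega>) $ i"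
  let ?quad = "\<lambda>\<omega>. \<Sum>i\<in>UNIV. \<Sum>l\<in>UNIV. b j i l (X \<omega>) * ((s *\<^sub>R ?\<eta> \<omega>) $ i * (s *\<^sub>R ?\<eta> \<omega>) $ l)"
  have lin_eq: "?lin \<omega> = (\<Sum>i\<in>UNIV. s * (a j i (X \<omega>) * ?\<eta> \<omega> $ i))" for \<omega> by (simp add: mult_ac)
  have quad_eq: "?quad \<omega> = (\<Sum>i\<in>UNIV. \<Sum>l\<in>UNIV. s ^ 2 * (b j i l (X \<omega>) * (?\<eta> \<omega> $ i * ?\<eta> \<omega> $ l)))" for \<omega>
    by (simp add: mult_ac power2_eq_square)
  note step1 = past_mult_step[OF A(2) A(1) A(3) mA[OF D(3)] intA[OF D(3) D(6)]]
  note step2 = past_mult_step_step[OF A(2) A(1) A(3) mA[OF D(4)] intA[OF D(4) D(7)]]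
  have int_lin: "integrable M ?lin" unfolding lin_eq using step1(1) by simp
  have int_quad: "integrable M ?quad" unfolding quad_eq using step2(1) by simp
  have E_lin: "expectation ?lin = 0" unfolding lin_eq using step1 by simp
  have E_quad: "expectation ?quad = s ^ 2 * (\<Sum>i\<in>UNIV. expectation (\<lambda>\<omega>. b j i i (X \<omega>)))"
    unfolding quad_eq
    by (simp add: step2 sum_distrib_left if_distrib[of "\<lambda>x. _ * x"] cong: if_cong)
  have int_f: "integrable M (\<lambda>\<omega>. f (X \<omega>))" by (rule intA[OF D(2) D(5)])
  have int_b: "integrable M (\<lambda>\<omega>. \<Sum>i\<in>UNIV. b j i i (X \<omega>))"
    by (intro Bochner_Integration.integrable_sum intA[OF D(4) D(7)])
  have "expectation (\<lambda>\<omega>. f (X \<omega>) + ?lin \<omega> + ?quad \<omega> / 2)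
      = expectation (\<lambda>\<omega>. f (X \<omega>)) + s ^ 2 / 2 * (\<Sum>i\<in>UNIV. expectation (\<lambda>\<omega>. b j i i (X \<omega>)))"
    using int_f int_lin int_quad E_lin E_quad
    by (subst Bochner_Integration.integral_add) (auto simp del: vector_scaleR_component)
  also have "\<dots> = expectation (\<lambda>\<omega>. f (X \<omega>) + s ^ 2 / 2 * (\<Sum>i\<in>UNIV. b j i i (X \<omega>)))"
    using int_f int_b intA[OF D(4) D(7)] by simp
  finally have eq: "expectation (\<lambda>\<omega>. f (X \<omega>) + s ^ 2 / 2 * (\<Sum>i\<in>UNIV. b j i i (X \<omega>)))
      = expectation (\<lambda>\<omega>. f (X \<omega>) + ?lin \<omega> + ?quad \<omega> / 2)" by simp
  have X': "(\<lambda>\<omega>. (X \<omega>)(j := X \<omega> j + s *\<^sub>R ?\<eta> \<omega>)) \<in> borel_measurable M"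
  proof (rule measurable_coordinatewise_then_product)
    fix i
    note [measurable] = measurable_step[OF A(2)] measurable_genD[OF X A(1)]
    show "(\<lambda>\<omega>. ((X \<omega>)(j := X \<omega> j + s *\<^sub>R ?\<eta> \<omega>)) i) \<in> borel_measurable M"
      by (cases "i = j") simp_all
  qed
  have int1: "integrable M (\<lambda>\<omega>. f ((X \<omega>)(j := X \<omega> j + s *\<^sub>R ?\<eta> \<omega>)))"
    by (rule integrable_const_bound[where B=C])
      (use D(5) measurable_compose[OF X' borel_measurable_continuous_onI[OF D(2)]] in auto)
  have "\<bar>expectation (\<lambda>\<omega>. f ((X \<omega>)(j := X \<omega> j + s *\<^sub>R ?\<eta> \<omega>)))
     - expectation (\<lambda>\<omega>. f (X \<omega>) + ?lin \<omega> + ?quad \<omega> / 2)\<bar> \<le> expectation (\<lambda>\<omega>. C * s ^ 3 * norm (?\<eta> \<omega>) ^ 3)"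
  proof (rule abs_integral_diff_le[OF int1])
    show "integrable M (\<lambda>\<omega>. f (X \<omega>) + ?lin \<omega> + ?quad \<omega> / 2)"
      by (intro Bochner_Integration.integrable_add int_f int_lin integrable_divide int_quad)
    show "integrable M (\<lambda>\<omega>. C * s ^ 3 * norm (?\<eta> \<omega>) ^ 3)"
      using integrable_norm_power[OF A(2), of 3] by simp
    fix \<omega>
    have "\<bar>f ((X \<omega>)(j := X \<omega> j + s *\<^sub>R ?\<eta> \<omega>)) - f (X \<omega>) - ?lin \<omega> - ?quad \<omega> / 2\<bar> \<le> C * norm (s *\<^sub>R ?\<eta> \<omega>) ^ 3"
      by (rule D(8))
    moreover have "C * norm (s *\<^sub>R ?\<eta> \<omega>) ^ 3 = C * s ^ 3 * norm (?\<eta> \<omega>) ^ 3"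
      using s by (simp add: power_mult_distrib)
    ultimately show "\<bar>f ((X \<omega>)(j := X \<omega> j + s *\<^sub>R ?\<eta> \<omega>)) - (f (X \<omega>) + ?lin \<omega> + ?quad \<omega> / 2)\<bar> \<le> C * s ^ 3 * norm (?\<eta> \<omega>) ^ 3"
      by linarith
  qed
  also have "expectation (\<lambda>\<omega>. C * s ^ 3 * norm (?\<eta> \<omega>) ^ 3) = C * s ^ 3 * expectation (\<lambda>\<omega>. norm (?\<eta> \<omega>) ^ 3)"
    by simp
  also have "\<dots> \<le> C * s ^ 3 * (real CARD('d) + q)"
    using D(1) s by (intro mult_left_mono expectation_norm3[OF A(2)]) auto
  finally show ?thesis unfolding eq by (simp add: mult_ac)
qed

end

text \<open>The steps are distributed over the entries by \<open>\<beta>\<close>, so that exchanging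
  one step moves a single entry, the situation of \<open>taylor3_with\<close>.\<close>

definition allotted_sum :: "(nat \<Rightarrow> nat) \<Rightarrow> real \<Rightarrow> (nat \<Rightarrow> 'a \<Rightarrow> 'v::real_vector) \<Rightarrow> nat set \<Rightarrow> 'a \<Rightarrow> nat \<Rightarrow> 'v" where
  "allotted_sum \<beta> s \<eta> A \<omega> j = s *\<^sub>R (\<Sum>l\<in>{l\<in>A. \<beta> l = j}. \<eta> l \<omega>)"

lemma allotted_sum_insert:
  assumes "finite A" "k \<notin> A"
  shows "allotted_sum \<beta> s \<eta> (insert k A) \<omega>
    = (allotted_sum \<beta> s \<eta> A \<omega>)(\<beta> k := allotted_sum \<beta> s \<eta> A \<omega> (\<beta> k) + s *\<^sub>R \<eta> k \<omega>)"
proof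
  fix j
  have "{l \<in> insert k A. \<beta> l = j} = (if \<beta> k = j then insert k {l \<in> A. \<beta> l = j} else {l \<in> A. \<beta> l = j})"
    by auto
  then show "allotted_sum \<beta> s \<eta> (insert k A) \<omega> j
    = ((allotted_sum \<beta> s \<eta> A \<omega>)(\<beta> k := allotted_sum \<beta> s \<eta> A \<omega> (\<beta> k) + s *\<^sub>R \<eta> k \<omega>)) j"
    using assms by (simp add: allotted_sum_def scaleR_right_distrib add.commute)
qed

lemma (in iid_steps) measurable_gen_allotted_sum:
  "finite A \<Longrightarrow> (\<lambda>\<omega>. allotted_sum \<beta> s \<eta> A \<omega> j) \<in> borel_measurable (gen A)"
  unfolding allotted_sum_def
  by (intro borel_measurable_scaleR borel_measurable_sum measurable_gen_step) auto

lemma atLeastLessThan_subset_lessThan: "{k..<n} \<subseteq> {..<n::nat}"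
  by auto

text \<open>On the product of the two spaces the steps are exchanged one at a time. Two successive
  hybrids agree except in step \<open>k\<close>, and both are compared with the value from which
  that step has been averaged out; each of the \<open>n\<close> exchanges costs order
  \<open>s ^ 3\<close>.\<close>

lemma lindeberg_exchange:
  fixes \<eta> :: "nat \<Rightarrow> 'a \<Rightarrow> real^'d" and \<theta> :: "nat \<Rightarrow> 'b \<Rightarrow> real^'d"
  assumes M: "iid_steps M {..<n} \<eta> q" and N: "iid_steps N {..<n} \<theta> q'"
    and f: "taylor3_with C a b f" and s: "s \<ge> 0"
  shows "\<bar>(\<integral>\<omega>. f (allotted_sum \<beta> s \<eta> {..<n} \<omega>) \<partial>M) - (\<integral>\<omega>. f (allotted_sum \<beta> s \<theta> {..<n} \<omega>) \<partial>N)\<bar>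
    \<le> real n * (C * (2 * real CARD('d) + q + q') * s ^ 3)"
proof -
  interpret M: iid_steps M "{..<n}" \<eta> q by (rule M)
  interpret N: iid_steps N "{..<n}" \<theta> q' by (rule N)
  interpret MN: pair_prob_space M N ..
  define S where "S k = allotted_sum \<beta> s \<eta> {..<k}" for k
  define Y where "Y k = allotted_sum \<beta> s \<theta> {k..<n}" for k
  \<comment> \<open>The hybrid takes the first \<open>k\<close> steps from \<open>\<eta>\<close> and
    the others from \<open>\<theta>\<close>.\<close>
  define T where "T k = (\<integral>\<omega>'. (\<integral>\<omega>. f (\<lambda>j. S k \<omega> j + Y k \<omega>' j) \<partial>M) \<partial>N)" for k
  note D = taylor3_withD[OF f]
  have Sm: "(\<lambda>\<omega>. S k \<omega> j) \<in> borel_measurable (M.gen {..<k})" for k j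
    unfolding S_def by (rule M.measurable_gen_allotted_sum) simp
  have Ym: "(\<lambda>\<omega>. Y k \<omega> j) \<in> borel_measurable (N.gen {k..<n})" for k j
    unfolding Y_def by (rule N.measurable_gen_allotted_sum) simp
  have SM: "(\<lambda>\<omega>. S k \<omega> j) \<in> borel_measurable M" if "k \<le> n" for k j
    by (rule M.measurable_genD[OF Sm]) (use that in auto)
  have YN: "(\<lambda>\<omega>. Y k \<omega> j) \<in> borel_measurable N" for k j by (rule N.measurable_genD[OF Ym]) auto
  have joint: "(\<lambda>\<omega>. h (\<lambda>j. S k (fst \<omega>) j + Y k' (snd \<omega>) j)) \<in> borel_measurable (M \<Otimes>\<^sub>M N)"
    if "k \<le> n" "continuous_on UNIV h" for k k' and h :: "(nat \<Rightarrow> real^'d) \<Rightarrow> real"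
  proof (rule measurable_compose[OF measurable_coordinatewise_then_product borel_measurable_continuous_onI[OF that(2)]])
    fix j
    note [measurable] = SM[OF that(1)] YN
    show "(\<lambda>\<omega>. S k (fst \<omega>) j + Y k' (snd \<omega>) j) \<in> borel_measurable (M \<Otimes>\<^sub>M N)" by measurable
  qed
  have int_joint: "integrable (M \<Otimes>\<^sub>M N) (\<lambda>\<omega>. h (\<lambda>j. S k (fst \<omega>) j + Y k' (snd \<omega>) j))"
    if "k \<le> n" "continuous_on UNIV h" "\<And>x. \<bar>h x\<bar> \<le> B" for k k' B and h :: "(nat \<Rightarrow> real^'d) \<Rightarrow> real"
    by (rule MN.P.integrable_const_bound[where B=B]) (use that joint in auto)
  have fubini: "(\<integral>\<omega>'. (\<integral>\<omega>. h (\<lambda>j. S k \<omega> j + Y k' \<omega>' j) \<partial>M) \<partial>N) = (\<integral>\<omega>. (\<integral>\<omega>'. h (\<lambda>j. S k \<omega> j + Y k' \<omega>' j) \<partial>N) \<partial>M)"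
    "integrable N (\<lambda>\<omega>'. \<integral>\<omega>. h (\<lambda>j. S k \<omega> j + Y k' \<omega>' j) \<partial>M)"
    "integrable M (\<lambda>\<omega>. \<integral>\<omega>'. h (\<lambda>j. S k \<omega> j + Y k' \<omega>' j) \<partial>N)"
    if "k \<le> n" "continuous_on UNIV h" "\<And>x. \<bar>h x\<bar> \<le> B" for k k' B and h :: "(nat \<Rightarrow> real^'d) \<Rightarrow> real"
  proof -
    have int: "integrable (M \<Otimes>\<^sub>M N) (case_prod (\<lambda>\<omega> \<omega>'. h (\<lambda>j. S k \<omega> j + Y k' \<omega>' j)))"
      using int_joint[OF that] by (simp add: case_prod_unfold)
    show "(\<integral>\<omega>'. (\<integral>\<omega>. h (\<lambda>j. S k \<omega> j + Y k' \<omega>' j) \<partial>M) \<partial>N) = (\<integral>\<omega>. (\<integral>\<omega>'. h (\<lambda>j. S k \<omega> j + Y k' \<omega>' j) \<partial>N) \<partial>M)"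
      by (rule MN.Fubini_integral[OF int])
    show "integrable N (\<lambda>\<omega>'. \<integral>\<omega>. h (\<lambda>j. S k \<omega> j + Y k' \<omega>' j) \<partial>M)" by (rule MN.integrable_snd[OF int])
    show "integrable M (\<lambda>\<omega>. \<integral>\<omega>'. h (\<lambda>j. S k \<omega> j + Y k' \<omega>' j) \<partial>N)" by (rule MN.integrable_fst[OF int])
  qed
  have diff: "\<bar>T (Suc k) - T k\<bar> \<le> C * (2 * real CARD('d) + q + q') * s ^ 3" if k: "k < n" for k
  proof -
    let ?i = "\<beta> k"
    \<comment> \<open>The comparison value common to both exchanges; it involves the covariance of
      the missing step but not its law.\<close>
    define H where "H x = f x + s ^ 2 / 2 * (\<Sum>i\<in>UNIV. b ?i i i x)" for x
    have Hc: "continuous_on UNIV H" unfolding H_def by (intro continuous_intros D)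
    have HB: "\<bar>H x\<bar> \<le> C + s ^ 2 / 2 * (real CARD('d) * C)" for x
    proof -
      have "\<bar>\<Sum>i\<in>UNIV. b ?i i i x\<bar> \<le> (\<Sum>i\<in>(UNIV::'d set). C)"
        by (intro order_trans[OF sum_abs] sum_mono D(7))
      then have "\<bar>s ^ 2 / 2 * (\<Sum>i\<in>UNIV. b ?i i i x)\<bar> \<le> s ^ 2 / 2 * (real CARD('d) * C)"
        unfolding abs_mult by (intro mult_mono) auto
      then show ?thesis unfolding H_def using D(5)[of x] by linarith
    qed
    have S_Suc: "S (Suc k) \<omega> = (S k \<omega>)(?i := S k \<omega> ?i + s *\<^sub>R \<eta> k \<omega>)" for \<omega>
      unfolding S_def lessThan_Suc by (rule allotted_sum_insert) auto
    have "{k..<n} = insert k {Suc k..<n}" using k by auto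
    then have Y_k: "Y k \<omega> = (Y (Suc k) \<omega>)(?i := Y (Suc k) \<omega> ?i + s *\<^sub>R \<theta> k \<omega>)" for \<omega>
      unfolding Y_def by (simp add: allotted_sum_insert)
    let ?E = "\<integral>\<omega>'. (\<integral>\<omega>. H (\<lambda>j. S k \<omega> j + Y (Suc k) \<omega>' j) \<partial>M) \<partial>N"
    have kn: "k \<le> n" "Suc k \<le> n" using k by auto
    have 1: "\<bar>T (Suc k) - ?E\<bar> \<le> C * (real CARD('d) + q) * s ^ 3"
    proof -
      have "\<bar>T (Suc k) - ?E\<bar> \<le> (\<integral>\<omega>'. C * (real CARD('d) + q) * s ^ 3 \<partial>N)"
        unfolding T_def
      proof (rule abs_integral_diff_le)
        fix \<omega>'
        let ?X = "\<lambda>\<omega>. (\<lambda>j. S k \<omega> j + Y (Suc k) \<omega>' j)"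
        have upd: "(\<lambda>j. S (Suc k) \<omega> j + Y (Suc k) \<omega>' j) = (?X \<omega>)(?i := ?X \<omega> ?i + s *\<^sub>R \<eta> k \<omega>)" for \<omega>
          unfolding S_Suc by (auto simp: fun_eq_iff)
        have "(\<lambda>\<omega>. ?X \<omega> j) \<in> borel_measurable (M.gen {..<k})" for j
          by (intro borel_measurable_add Sm) simp
        from M.lindeberg_step[where X="?X" and k=k and j="?i", OF f _ _ _ s this]
        show "\<bar>(\<integral>\<omega>. f (\<lambda>j. S (Suc k) \<omega> j + Y (Suc k) \<omega>' j) \<partial>M) - (\<integral>\<omega>. H (?X \<omega>) \<partial>M)\<bar>
            \<le> C * (real CARD('d) + q) * s ^ 3"
          unfolding upd H_def using k by auto
      qed (use fubini(2)[OF kn(2) D(2) D(5)] fubini(2)[OF kn(1) Hc HB] in auto)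
      then show ?thesis by (simp add: N.prob_space)
    qed
    \<comment> \<open>Here the step of \<open>\<theta>\<close> is averaged out, so the order of
      integration is reversed: \<open>\<omega>\<close> is fixed and \<open>lindeberg_step\<close> is
      applied on \<open>N\<close>.\<close>
    have 2: "\<bar>T k - ?E\<bar> \<le> C * (real CARD('d) + q') * s ^ 3"
    proof -
      have "\<bar>(\<integral>\<omega>. (\<integral>\<omega>'. f (\<lambda>j. S k \<omega> j + Y k \<omega>' j) \<partial>N) \<partial>M) - (\<integral>\<omega>. (\<integral>\<omega>'. H (\<lambda>j. S k \<omega> j + Y (Suc k) \<omega>' j) \<partial>N) \<partial>M)\<bar>
          \<le> (\<integral>\<omega>. C * (real CARD('d) + q') * s ^ 3 \<partial>M)"
      proof (rule abs_integral_diff_le)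
        fix \<omega>
        let ?X = "\<lambda>\<omega>'. (\<lambda>j. S k \<omega> j + Y (Suc k) \<omega>' j)"
        have upd: "(\<lambda>j. S k \<omega> j + Y k \<omega>' j) = (?X \<omega>')(?i := ?X \<omega>' ?i + s *\<^sub>R \<theta> k \<omega>')" for \<omega>'
          unfolding Y_k by (auto simp: fun_eq_iff)
        have "(\<lambda>\<omega>'. ?X \<omega>' j) \<in> borel_measurable (N.gen {Suc k..<n})" for j
          by (intro borel_measurable_add Ym) simp
        from N.lindeberg_step[where X="?X" and k=k and j="?i", OF f atLeastLessThan_subset_lessThan _ _ s this]
        show "\<bar>(\<integral>\<omega>'. f (\<lambda>j. S k \<omega> j + Y k \<omega>' j) \<partial>N) - (\<integral>\<omega>'. H (?X \<omega>') \<partial>N)\<bar> \<le> C * (real CARD('d) + q') * s ^ 3"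
          unfolding upd H_def using k by auto
      qed (use fubini(3)[OF kn(1) D(2) D(5)] fubini(3)[OF kn(1) Hc HB] in auto)
      then show ?thesis
        unfolding T_def fubini(1)[OF kn(1) D(2) D(5)] fubini(1)[OF kn(1) Hc HB] by (simp add: M.prob_space)
    qed
    have "C * (2 * real CARD('d) + q + q') * s ^ 3 = C * (real CARD('d) + q) * s ^ 3 + C * (real CARD('d) + q') * s ^ 3"
      by (simp add: algebra_simps)
    then show ?thesis using 1 2 by linarith
  qed
  have "T n - T 0 = (\<Sum>k<n. T (Suc k) - T k)" by (simp add: sum_lessThan_telescope)
  also have "\<bar>\<dots>\<bar> \<le> (\<Sum>k<n. C * (2 * real CARD('d) + q + q') * s ^ 3)"
    by (intro order_trans[OF sum_abs] sum_mono diff) simp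
  finally have main: "\<bar>T n - T 0\<bar> \<le> real n * (C * (2 * real CARD('d) + q + q') * s ^ 3)" by simp
  have "T n = (\<integral>\<omega>. f (allotted_sum \<beta> s \<eta> {..<n} \<omega>) \<partial>M)"
  proof -
    have "Y n \<omega> j = 0" for \<omega> j by (simp add: Y_def allotted_sum_def)
    then show ?thesis by (simp add: T_def S_def N.prob_space)
  qed
  moreover have "T 0 = (\<integral>\<omega>. f (allotted_sum \<beta> s \<theta> {..<n} \<omega>) \<partial>N)"
  proof -
    have "S 0 \<omega> j = 0" for \<omega> j by (simp add: S_def allotted_sum_def)
    then show ?thesis by (simp add: T_def Y_def M.prob_space lessThan_atLeast0)
  qed
  ultimately show ?thesis using main by simp
qed

section \<open>Gaussian increments\<close>

lemma Basis_vec_real: "(Basis :: (real^'d) set) = range (\<lambda>i. axis i 1)"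
  by (auto simp: Basis_vec_def)

lemma nn_integral_lborel_vec_prod:
  fixes g :: "'d::finite \<Rightarrow> real \<Rightarrow> ennreal"
  assumes "\<And>i. g i \<in> borel_measurable borel"
  shows "(\<integral>\<^sup>+x. (\<Prod>i\<in>UNIV. g i (x $ i)) \<partial>(lborel :: (real^'d) measure)) = (\<Prod>i\<in>UNIV. \<integral>\<^sup>+x. g i x \<partial>lborel)"
proof -
  have inj: "inj (\<lambda>i::'d. axis i (1::real))" by (auto simp: inj_def axis_eq_axis)
  have "(\<integral>\<^sup>+x. (\<Prod>b\<in>Basis. g (axis_index b) (x \<bullet> b)) \<partial>(lborel :: (real^'d) measure))
      = (\<Prod>b\<in>(Basis::(real^'d) set). \<integral>\<^sup>+x. g (axis_index b) x \<partial>lborel)"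
    by (rule nn_integral_lborel_prod) (auto intro: assms)
  then show ?thesis
    unfolding Basis_vec_real prod.reindex[OF inj] by (simp add: o_def axis_index_axis inner_axis)
qed

text \<open>The integral of the product density over a box factorises. Boxes with one nontrivial
  side identify the marginals, and the general box formula then states independence.\<close>

lemma (in prob_space) gaussian_vector:
  fixes X :: "'a \<Rightarrow> real^'d"
  assumes X: "distributed M lborel X (\<lambda>x. ennreal (\<Prod>i\<in>UNIV. normal_density 0 \<sigma> (x $ i)))" and \<sigma>: "\<sigma> > 0"
  shows "distributed M lborel (\<lambda>\<omega>. X \<omega> $ i) (normal_density 0 \<sigma>)"
    and "indep_vars (\<lambda>_. borel) (\<lambda>i \<omega>. X \<omega> $ i) UNIV"
proof -
  have Xm [measurable]: "X \<in> borel_measurable M" using distributed_measurable[OF X] by simp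
  have Xi [measurable]: "(\<lambda>\<omega>. X \<omega> $ i) \<in> borel_measurable M" for i
    by (rule measurable_compose[OF Xm]) simp
  let ?P = "\<lambda>A. \<integral>\<^sup>+x. ennreal (normal_density 0 \<sigma> x) * indicator A x \<partial>lborel"
  have P_UNIV: "?P UNIV = 1"
  proof -
    have "emeasure (density lborel (normal_density 0 \<sigma>)) (space (density lborel (normal_density 0 \<sigma>))) = 1"
      using prob_space.emeasure_space_1[OF prob_space_normal_density[OF \<sigma>, of 0]] .
    then show ?thesis by (simp add: emeasure_density)
  qed
  have box: "emeasure M (\<Inter>i. (\<lambda>\<omega>. X \<omega> $ i) -` A i \<inter> space M) = (\<Prod>i\<in>UNIV. ?P (A i))"
    if A [measurable]: "\<And>i. A i \<in> sets borel" for A :: "'d \<Rightarrow> real set"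
  proof -
    let ?B = "{x::real^'d. \<forall>i. x $ i \<in> A i}"
    have B: "?B \<in> sets borel"
    proof -
      have "?B = (\<Inter>i. (\<lambda>x. x $ i) -` A i \<inter> space borel)" by auto
      also have "\<dots> \<in> sets borel" by (intro sets.countable_INT'' measurable_sets[OF _ A] borel_measurable_continuous_onI continuous_intros) auto
      finally show ?thesis .
    qed
    have "(\<Inter>i. (\<lambda>\<omega>. X \<omega> $ i) -` A i \<inter> space M) = X -` ?B \<inter> space M" by auto
    then have "emeasure M (\<Inter>i. (\<lambda>\<omega>. X \<omega> $ i) -` A i \<inter> space M)
        = (\<integral>\<^sup>+x. ennreal (\<Prod>i\<in>UNIV. normal_density 0 \<sigma> (x $ i)) * indicator ?B x \<partial>lborel)"
      using distributed_emeasure[OF X, of ?B] B by simp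
    also have "\<dots> = (\<integral>\<^sup>+x. (\<Prod>i\<in>UNIV. ennreal (normal_density 0 \<sigma> (x $ i)) * indicator (A i) (x $ i)) \<partial>(lborel :: (real^'d) measure))"
    proof (rule nn_integral_cong)
      fix x :: "real^'d"
      have "(\<Prod>i\<in>UNIV. indicator (A i) (x $ i) :: ennreal) = indicator ?B x"
        by (auto simp: indicator_def prod_eq_1_iff)
      then show "ennreal (\<Prod>i\<in>UNIV. normal_density 0 \<sigma> (x $ i)) * indicator ?B x
          = (\<Prod>i\<in>UNIV. ennreal (normal_density 0 \<sigma> (x $ i)) * indicator (A i) (x $ i))"
        by (simp add: prod.distrib prod_ennreal)
    qed
    also have "\<dots> = (\<Prod>i\<in>UNIV. ?P (A i))"
      by (rule nn_integral_lborel_vec_prod) measurable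
    finally show ?thesis .
  qed
  have single: "emeasure M ((\<lambda>\<omega>. X \<omega> $ i) -` A \<inter> space M) = ?P A" if A: "A \<in> sets borel" for i A
  proof -
    \<comment> \<open>All sides of the box except the \<open>i\<close>-th are the whole line and
      contribute the factor 1.\<close>
    have "(\<Inter>j. (\<lambda>\<omega>. X \<omega> $ j) -` (if j = i then A else UNIV) \<inter> space M) = (\<lambda>\<omega>. X \<omega> $ i) -` A \<inter> space M"
      by (auto split: if_splits)
    moreover have "(\<Prod>j\<in>(UNIV::'d set). ?P (if j = i then A else UNIV)) = ?P A"
      using P_UNIV by (subst prod.remove[of _ i]) (auto simp: prod.neutral)
    ultimately show ?thesis using box[of "\<lambda>j. if j = i then A else UNIV"] A by simp
  qed
  show "distributed M lborel (\<lambda>\<omega>. X \<omega> $ i) (normal_density 0 \<sigma>)"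
    unfolding distributed_def
  proof (intro conjI measure_eqI)
    fix A assume "A \<in> sets (distr M lborel (\<lambda>\<omega>. X \<omega> $ i))"
    then show "emeasure (distr M lborel (\<lambda>\<omega>. X \<omega> $ i)) A = emeasure (density lborel (normal_density 0 \<sigma>)) A"
      using single[of A i] by (simp add: emeasure_distr emeasure_density)
  qed auto
  show "indep_vars (\<lambda>_. borel) (\<lambda>i \<omega>. X \<omega> $ i) UNIV"
  proof (subst indep_vars_finite[where E="\<lambda>_. sets borel"])
    show "sets borel = sigma_sets (space (borel::real measure)) (sets borel)"
      using sets.sigma_sets_eq[of "borel::real measure"] by simp
    show "\<forall>A\<in>UNIV \<rightarrow> sets borel. prob (\<Inter>j\<in>UNIV. (\<lambda>\<omega>. X \<omega> $ j) -` A j \<inter> space M)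
        = (\<Prod>j\<in>UNIV. prob ((\<lambda>\<omega>. X \<omega> $ j) -` A j \<inter> space M))"
    proof
      fix A :: "'d \<Rightarrow> real set" assume "A \<in> UNIV \<rightarrow> sets borel"
      then have A: "\<And>i. A i \<in> sets borel" by auto
      have "ennreal (prob (\<Inter>j\<in>UNIV. (\<lambda>\<omega>. X \<omega> $ j) -` A j \<inter> space M))
          = (\<Prod>j\<in>UNIV. ennreal (prob ((\<lambda>\<omega>. X \<omega> $ j) -` A j \<inter> space M)))"
        unfolding emeasure_eq_measure[symmetric] using box[OF A] single[OF A] by simp
      then show "prob (\<Inter>j\<in>UNIV. (\<lambda>\<omega>. X \<omega> $ j) -` A j \<inter> space M)
          = (\<Prod>j\<in>UNIV. prob ((\<lambda>\<omega>. X \<omega> $ j) -` A j \<inter> space M))"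
        by (simp add: prod_ennreal prod_nonneg)
    qed
  qed (auto intro: sets.Int_stable sets.space_closed[THEN subsetD] simp: sets.sets_into_space)
qed

text \<open>For the last bound, Cauchy-Schwarz reduces the norm to \<open>d\<close> times a sum of
  \<open>d\<close> fourth powers, each of mean \<open>3 * \<sigma> ^ 4\<close>.\<close>

lemma (in prob_space) gaussian_vector_moments:
  fixes X :: "'a \<Rightarrow> real^'d"
  assumes X: "distributed M lborel X (\<lambda>x. ennreal (\<Prod>i\<in>UNIV. normal_density 0 \<sigma> (x $ i)))" and \<sigma>: "\<sigma> > 0"
  shows "expectation (\<lambda>\<omega>. X \<omega> $ i) = 0"
    and "expectation (\<lambda>\<omega>. X \<omega> $ i * X \<omega> $ j) = (if i = j then \<sigma> ^ 2 else 0)"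
    and "integrable M (\<lambda>\<omega>. norm (X \<omega>) ^ 4)"
    and "expectation (\<lambda>\<omega>. norm (X \<omega>) ^ 4) \<le> 3 * real CARD('d) ^ 2 * \<sigma> ^ 4"
proof -
  note comp = gaussian_vector[OF X \<sigma>]
  have Xm [measurable]: "X \<in> borel_measurable M" using distributed_measurable[OF X] by simp
  have int: "integrable M (\<lambda>\<omega>. (X \<omega> $ i) ^ k)" for i k
    using distributed_integrable[OF comp(1), of "\<lambda>x. x ^ k" i] integrable_normal_moment[OF \<sigma>, of 0 k]
    by simp
  have E: "expectation (\<lambda>\<omega>. (X \<omega> $ i) ^ k) = (\<integral>x. normal_density 0 \<sigma> x * (x - 0) ^ k \<partial>lborel)" for i k
    using distributed_integral[OF comp(1), of "\<lambda>x. x ^ k" i] by simp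
  have E1: "expectation (\<lambda>\<omega>. X \<omega> $ i) = 0" for i
    using E[of i 1] integral_normal_moment_odd[OF \<sigma>, of 0 0] by simp
  have E2: "expectation (\<lambda>\<omega>. (X \<omega> $ i) ^ 2) = \<sigma> ^ 2" for i
    using E[of i 2] integral_normal_moment_even[OF \<sigma>, of 0 1] \<sigma> by simp
  have E4: "expectation (\<lambda>\<omega>. (X \<omega> $ i) ^ 4) = 3 * \<sigma> ^ 4" for i
  proof -
    have "fact (2 * 2) / ((2 / \<sigma>\<^sup>2) ^ 2 * fact 2) = 3 * \<sigma> ^ 4"
      using \<sigma> by (simp add: fact_numeral power_divide power2_eq_square power4_eq_xxxx)
    then show ?thesis using E[of i 4] integral_normal_moment_even[OF \<sigma>, of 0 2] by simp
  qed
  show "expectation (\<lambda>\<omega>. X \<omega> $ i) = 0" by (rule E1)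
  show "expectation (\<lambda>\<omega>. X \<omega> $ i * X \<omega> $ j) = (if i = j then \<sigma> ^ 2 else 0)"
  proof (cases "i = j")
    case True
    then show ?thesis using E2[of j] by (simp add: power2_eq_square)
  next
    case False
    have "indep_vars (\<lambda>_. borel) (\<lambda>i \<omega>. X \<omega> $ i) {i, j}"
      by (rule indep_vars_subset[OF comp(2)]) simp
    from indep_vars_lebesgue_integral[OF _ this] show ?thesis using int[of _ 1] E1 False by simp
  qed
  let ?R = "\<lambda>\<omega>. real CARD('d) * (\<Sum>i\<in>UNIV. (X \<omega> $ i) ^ 4)"
  have R: "integrable M ?R" using int by (intro integrable_mult_right Bochner_Integration.integrable_sum)
  have le: "norm (X \<omega>) ^ 4 \<le> ?R \<omega>" for \<omega>
  proof -
    have "norm (X \<omega>) ^ 4 = (norm (X \<omega>) ^ 2) ^ 2" by simp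
    also have "norm (X \<omega>) ^ 2 = (\<Sum>i\<in>UNIV. (X \<omega> $ i) ^ 2)"
      unfolding power2_norm_eq_inner by (simp add: inner_vec_def power2_eq_square)
    also have "\<dots> ^ 2 \<le> (\<Sum>i\<in>UNIV. ((X \<omega> $ i) ^ 2) ^ 2) * real CARD('d)"
      by (rule sum_squared_le_sum_of_squares)
    finally show ?thesis by (simp add: mult.commute)
  qed
  show int4: "integrable M (\<lambda>\<omega>. norm (X \<omega>) ^ 4)"
  proof (rule Bochner_Integration.integrable_bound[OF R])
    have "norm (norm (X \<omega>) ^ 4) \<le> norm (?R \<omega>)" for \<omega>
      using order_trans[OF le[of \<omega>] abs_ge_self] by simp
    then show "AE \<omega> in M. norm (norm (X \<omega>) ^ 4) \<le> norm (?R \<omega>)" by simp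
  qed simp
  have "expectation (\<lambda>\<omega>. norm (X \<omega>) ^ 4) \<le> expectation ?R" by (rule integral_mono[OF int4 R le])
  also have "\<dots> = 3 * real CARD('d) ^ 2 * \<sigma> ^ 4"
    using int E4 by (simp add: power2_eq_square)
  finally show "expectation (\<lambda>\<omega>. norm (X \<omega>) ^ 4) \<le> 3 * real CARD('d) ^ 2 * \<sigma> ^ 4" .
qed

text \<open>The factor \<open>sqrt n\<close> normalises the covariance of an increment over time
  \<open>1 / n\<close>, and the Gaussian fourth moment then has a bound independent of
  \<open>n\<close>.\<close>

lemma brownian_increments_iid:
  fixes B :: "real \<Rightarrow> 'b \<Rightarrow> real^'d"
  assumes B: "brownian_motion N {0..1} B" and n: "n > 0"
  shows "iid_steps N {..<n} (\<lambda>k \<omega>. sqrt (real n) *\<^sub>R (B (real (Suc k) / real n) \<omega> - B (real k / real n) \<omega>))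
    (3 * real CARD('d) ^ 2)"
proof -
  interpret N: prob_space N using B by (simp add: brownian_motion_def)
  let ?X = "\<lambda>k \<omega>. B (real (Suc k) / real n) \<omega> - B (real k / real n) \<omega>"
  have grid: "real k / real n \<in> {0..1}" if "k \<le> n" for k using that n by simp
  have "\<forall>k\<le>n. real k / real n \<in> {0..1}" "\<forall>k<n. real k / real n < real (Suc k) / real n"
    using grid n by (auto intro!: divide_strict_right_mono)
  moreover have incr: "\<And>n t. \<lbrakk>\<forall>k\<le>n. t k \<in> {0..1}; \<forall>k<n. t k < t (Suc k)\<rbrakk>
      \<Longrightarrow> N.indep_vars (\<lambda>_. borel) (\<lambda>k \<omega>. B (t (Suc k)) \<omega> - B (t k) \<omega>) {..<n}"
    using B unfolding brownian_motion_def by simp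
  ultimately have indep: "N.indep_vars (\<lambda>_. borel) ?X {..<n}"
    using incr[of n "\<lambda>k. real k / real n"] by blast
  have dist: "distributed N lborel (?X k) (\<lambda>x. ennreal (\<Prod>i\<in>UNIV. normal_density 0 (1 / sqrt (real n)) (x $ i)))"
    if "k < n" for k
  proof -
    have "real (Suc k) / real n - real k / real n = 1 / real n" by (simp add: diff_divide_distrib[symmetric])
    moreover have "distributed N lborel (?X k) (\<lambda>x. ennreal (\<Prod>i\<in>UNIV.
        normal_density 0 (sqrt (real (Suc k) / real n - real k / real n)) (x $ i)))"
    proof -
      have "real k / real n < real (Suc k) / real n" using n by (intro divide_strict_right_mono) auto
      moreover have "real k / real n \<in> {0..1}" "real (Suc k) / real n \<in> {0..1}"
        by (rule grid, use that in simp)+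
      ultimately show ?thesis using B unfolding brownian_motion_def by blast
    qed
    ultimately show ?thesis by (simp add: real_sqrt_divide)
  qed
  have pos: "1 / sqrt (real n) > 0" using n by simp
  note mom = N.gaussian_vector_moments[OF dist pos]
  show ?thesis
  proof
    show "N.indep_vars (\<lambda>_. borel) (\<lambda>k \<omega>. sqrt (real n) *\<^sub>R ?X k \<omega>) {..<n}"
      by (rule N.indep_vars_compose2[OF indep]) simp
    fix k assume "k \<in> {..<n}"
    then have k: "k < n" by simp
    show "N.expectation (\<lambda>\<omega>. (sqrt (real n) *\<^sub>R ?X k \<omega>) $ i) = 0" for i
      using mom(1)[OF k, of i] by (simp del: vector_minus_component)
    show "N.expectation (\<lambda>\<omega>. (sqrt (real n) *\<^sub>R ?X k \<omega>) $ i * (sqrt (real n) *\<^sub>R ?X k \<omega>) $ j) = (if i = j then 1 else 0)" for i j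
    proof -
      have scale: "(sqrt (real n) *\<^sub>R ?X k \<omega>) $ i * (sqrt (real n) *\<^sub>R ?X k \<omega>) $ j = real n * (?X k \<omega> $ i * ?X k \<omega> $ j)" for \<omega>
        by (simp del: vector_minus_component)
      show ?thesis
        unfolding scale using mom(2)[OF k, of i j] n by (simp add: power_divide del: vector_minus_component)
    qed
    have four: "norm (sqrt (real n) *\<^sub>R ?X k \<omega>) ^ 4 = real n ^ 2 * norm (?X k \<omega>) ^ 4" for \<omega>
    proof -
      have "sqrt (real n) ^ (2 * 2) = real n ^ 2" unfolding power_mult by simp
      then show ?thesis by (simp add: power_mult_distrib)
    qed
    show "integrable N (\<lambda>\<omega>. norm (sqrt (real n) *\<^sub>R ?X k \<omega>) ^ 4)" unfolding four using mom(3)[OF k] by simp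
    have "N.expectation (\<lambda>\<omega>. norm (sqrt (real n) *\<^sub>R ?X k \<omega>) ^ 4) = real n ^ 2 * N.expectation (\<lambda>\<omega>. norm (?X k \<omega>) ^ 4)"
      unfolding four by simp
    also have "\<dots> \<le> real n ^ 2 * (3 * real CARD('d) ^ 2 * (1 / sqrt (real n)) ^ 4)"
      by (intro mult_left_mono mom(4)[OF k]) simp
    also have "(1 / sqrt (real n)) ^ 4 = 1 / real n ^ 2"
    proof -
      have "sqrt (real n) ^ (2 * 2) = real n ^ 2" unfolding power_mult by simp
      then show ?thesis by (simp add: power_divide)
    qed
    finally show "N.expectation (\<lambda>\<omega>. norm (sqrt (real n) *\<^sub>R ?X k \<omega>) ^ 4) \<le> 3 * real CARD('d) ^ 2"
      using n by simp
  qed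
qed

section \<open>Central limit theorem for the block increments\<close>

text \<open>Padding with zeros makes the \<open>m\<close> increments a sequence, the domain of the
  smooth test functions.\<close>

definition block_incr :: "nat \<Rightarrow> (nat \<Rightarrow> 'v::real_vector) \<Rightarrow> nat \<Rightarrow> 'v" where
  "block_incr m w j = (if j < m then w (Suc j) - w j else 0)"

lemma sum_block_incr: "j \<le> m \<Longrightarrow> (\<Sum>l<j. block_incr m w l) = w j - w 0"
proof -
  assume "j \<le> m"
  then have "(\<Sum>l<j. block_incr m w l) = (\<Sum>l<j. w (Suc l) - w l)"
    by (intro sum.cong) (auto simp: block_incr_def)
  then show ?thesis by (simp add: sum_lessThan_telescope)
qed

text \<open>The least \<open>j\<close> with \<open>l < K (Suc j)\<close> is the block of step
  \<open>l\<close>, so each entry of the allotted sum collects one block, and the increments of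
  \<open>w\<close> in it telescope.\<close>

lemma allotted_sum_blocks:
  fixes K :: "nat \<Rightarrow> nat"
  assumes K: "mono K" "K 0 = 0" "K m = n"
    and v: "\<And>k. k < n \<Longrightarrow> s *\<^sub>R \<eta> k \<omega> = w (Suc k) - w k"
  shows "allotted_sum (\<lambda>l. LEAST j. l < K (Suc j)) s \<eta> {..<n} \<omega> = block_incr m (\<lambda>j. w (K j))"
proof
  fix j
  define \<beta> where "\<beta> l = (LEAST j. l < K (Suc j))" for l
  have \<beta>_eq: "\<beta> l = i" if "K i \<le> l" "l < K (Suc i)" for l i
  unfolding \<beta>_def
  proof (rule Least_equality)
    show "l < K (Suc i)" by (rule that(2))
    fix i' assume "l < K (Suc i')"
    then have "K i < K (Suc i')" using that(1) by simp
    then show "i \<le> i'" using K(1) by (metis monoD not_less not_less_eq_eq)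
  qed
  have block: "\<beta> l < m \<and> K (\<beta> l) \<le> l \<and> l < K (Suc (\<beta> l))" if l: "l < n" for l
  proof -
    obtain i where i: "i < m" "K i \<le> l" "l < K (Suc i)"
      using block_locate[of K l m] l K(2,3) by auto
    then show ?thesis using \<beta>_eq[OF i(2,3)] by simp
  qed
  have "allotted_sum \<beta> s \<eta> {..<n} \<omega> j = block_incr m (\<lambda>j. w (K j)) j"
  proof (cases "j < m")
    case True
    have "K (Suc j) \<le> n" using monoD[OF K(1), of "Suc j" m] True K(3) by simp
    have set: "{l \<in> {..<n}. \<beta> l = j} = {K j..<K (Suc j)}"
    proof (rule set_eqI)
      fix l
      show "l \<in> {l \<in> {..<n}. \<beta> l = j} \<longleftrightarrow> l \<in> {K j..<K (Suc j)}"
      proof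
        assume "l \<in> {l \<in> {..<n}. \<beta> l = j}"
        then show "l \<in> {K j..<K (Suc j)}" using block[of l] by simp
      next
        assume "l \<in> {K j..<K (Suc j)}"
        then show "l \<in> {l \<in> {..<n}. \<beta> l = j}" using \<beta>_eq[of j l] \<open>K (Suc j) \<le> n\<close> by simp
      qed
    qed
    have le: "K j \<le> K (Suc j)" using K(1) by (simp add: monoD)
    have "allotted_sum \<beta> s \<eta> {..<n} \<omega> j = (\<Sum>l\<in>{K j..<K (Suc j)}. w (Suc l) - w l)"
      unfolding allotted_sum_def set scaleR_sum_right
      using v \<open>K (Suc j) \<le> n\<close> by (intro sum.cong) auto
    also have "\<dots> = w (K (Suc j)) - w (K j)" by (rule sum_Suc_diff'[OF le])
    finally show ?thesis using True by (simp add: block_incr_def)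
  next
    case False
    then have empty: "{l \<in> {..<n}. \<beta> l = j} = {}" using block by auto
    show ?thesis using False unfolding allotted_sum_def block_incr_def empty by simp
  qed  then show "allotted_sum (\<lambda>l. LEAST j. l < K (Suc j)) s \<eta> {..<n} \<omega> j = block_incr m (\<lambda>j. w (K j)) j"
    by (simp add: \<beta>_def[abs_def])
qed

lemma continuous_on_clamp_entries: "continuous_on UNIV (clamp_entries R :: (nat \<Rightarrow> real^'d) \<Rightarrow> _)"
  unfolding clamp_entries_def[abs_def] by (rule continuous_on_entrywise) (intro continuous_intros)

lemma tendsto_coordinatewise:
  fixes x :: "nat \<Rightarrow> nat \<Rightarrow> 'v::topological_space"
  assumes "\<And>j. (\<lambda>n. x n j) \<longlonglongrightarrow> y j"
  shows "x \<longlonglongrightarrow> y"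
proof -
  have "limitin (product_topology (\<lambda>_. euclidean) UNIV) x y sequentially"
    unfolding limitin_componentwise using assms by simp
  then show ?thesis by (simp add: euclidean_product_topology)
qed

context iid_walk
begin

lemma block_incr_measurable:
  "(\<lambda>\<omega>. block_incr m (\<lambda>j. walk n (K j) \<omega>)) \<in> borel_measurable M"
proof (rule measurable_coordinatewise_then_product)
  show "(\<lambda>\<omega>. block_incr m (\<lambda>j. walk n (K j) \<omega>) j) \<in> borel_measurable M" for j
    unfolding block_incr_def by (cases "j < m") auto
qed

text \<open>Truncation changes \<open>G\<close> only if some increment exceeds \<open>R\<close>, and
  then by at most \<open>2 * C\<close>. The second moments of the increments add up to
  \<open>d\<close>, so the bound follows in the manner of Chebyshev, independently of
  \<open>n\<close> and \<open>m\<close>.\<close>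

lemma block_incr_tail:
  fixes G :: "(nat \<Rightarrow> real^'d) \<Rightarrow> real"
  assumes G: "continuous_on UNIV G" "\<And>x. \<bar>G x\<bar> \<le> C" and "0 < m" "0 < n" "R > 0"
  shows "\<bar>expectation (\<lambda>\<omega>. G (block_incr m (\<lambda>j. walk n (n * j div m) \<omega>)))
    - expectation (\<lambda>\<omega>. G (clamp_entries R (block_incr m (\<lambda>j. walk n (n * j div m) \<omega>))))\<bar>
    \<le> 2 * C * real CARD('d) / R ^ 2"
proof -
  let ?K = "\<lambda>j. n * j div m"
  let ?X = "\<lambda>\<omega>. block_incr m (\<lambda>j. walk n (?K j) \<omega>)"
  let ?W = "\<lambda>\<omega>. 2 * C / R ^ 2 * (\<Sum>j<m. norm (walk n (?K (Suc j)) \<omega> - walk n (?K j) \<omega>) ^ 2)"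
  have C: "C \<ge> 0" using G(2)[of undefined] by linarith
  have K_le: "?K j \<le> ?K (Suc j)" for j using monoD[OF grid_index(1)[OF \<open>0 < m\<close>, of n], of j "Suc j"] by simp
  note second = incr_second_moment[OF \<open>0 < n\<close> K_le]
  have int: "integrable M (\<lambda>\<omega>. H (?X \<omega>))" if "continuous_on UNIV H" "\<And>x. \<bar>H x\<bar> \<le> C" for H :: "_ \<Rightarrow> real"
    by (rule integrable_const_bound[where B=C])
      (use that measurable_compose[OF block_incr_measurable borel_measurable_continuous_onI[OF that(1)]] in auto)
  have Gc: "continuous_on UNIV (\<lambda>x. G (clamp_entries R x))"
    by (rule continuous_on_compose2[OF G(1) continuous_on_clamp_entries subset_UNIV])
  have intW: "integrable M ?W" using second(1) by (intro integrable_mult_right Bochner_Integration.integrable_sum)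
  have "\<bar>expectation (\<lambda>\<omega>. G (?X \<omega>)) - expectation (\<lambda>\<omega>. G (clamp_entries R (?X \<omega>)))\<bar> \<le> expectation ?W"
  proof (rule abs_integral_diff_le[OF int[OF G] int[OF Gc G(2)] intW])
    fix \<omega>
    show "\<bar>G (?X \<omega>) - G (clamp_entries R (?X \<omega>))\<bar> \<le> ?W \<omega>"
    proof (cases "\<forall>j i. \<bar>?X \<omega> j $ i\<bar> \<le> R")
      case True
      then have "clamp_entries R (?X \<omega>) = ?X \<omega>" by (intro clamp_entries_eq) auto
      then show ?thesis using C by (simp add: sum_nonneg)
    next
      case False
      then obtain j i where ji: "\<bar>?X \<omega> j $ i\<bar> > R" by (auto simp: not_le)
      then have j: "j < m" using \<open>R > 0\<close> by (auto simp: block_incr_def split: if_splits)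
      have "R \<le> norm (?X \<omega> j)" using ji component_le_norm_cart[of "?X \<omega> j" i] by linarith
      then have "R ^ 2 \<le> norm (?X \<omega> j) ^ 2" using \<open>R > 0\<close> by (intro power_mono) auto
      also have "\<dots> \<le> (\<Sum>j<m. norm (walk n (?K (Suc j)) \<omega> - walk n (?K j) \<omega>) ^ 2)"
        using member_le_sum[of j "{..<m}" "\<lambda>j. norm (walk n (?K (Suc j)) \<omega> - walk n (?K j) \<omega>) ^ 2"] j
        by (simp add: block_incr_def)
      finally have "2 * C / R ^ 2 * R ^ 2 \<le> ?W \<omega>" using C by (intro mult_left_mono) auto
      moreover have "2 * C / R ^ 2 * R ^ 2 = 2 * C" using \<open>R > 0\<close> by simp
      moreover have "\<bar>G (?X \<omega>) - G (clamp_entries R (?X \<omega>))\<bar> \<le> 2 * C"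
        using G(2)[of "?X \<omega>"] G(2)[of "clamp_entries R (?X \<omega>)"] by linarith
      ultimately show ?thesis by linarith
    qed
  qed
  also have "expectation ?W = 2 * C / R ^ 2 * (\<Sum>j<m. real CARD('d) * ((real (?K (Suc j)) - real (?K j)) / real n))"
    using second by simp
  also have "(\<Sum>j<m. real CARD('d) * ((real (?K (Suc j)) - real (?K j)) / real n)) = real CARD('d) * ((\<Sum>j<m. real (?K (Suc j)) - real (?K j)) / real n)"
    by (simp add: sum_distrib_left sum_divide_distrib)
  also have "(\<Sum>j<m. real (?K (Suc j)) - real (?K j)) = real (?K m) - real (?K 0)"
    by (rule sum_lessThan_telescope)
  also have "(real (?K m) - real (?K 0)) / real n = 1" using \<open>0 < m\<close> \<open>0 < n\<close> by simp
  finally show ?thesis by simp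
qed

text \<open>There are \<open>n\<close> exchanges at the scale \<open>1 / sqrt n\<close>, each of
  order its cube. For the exchange both sides must consist of \<open>n\<close> steps; hence
  \<open>B\<close> is sampled at multiples of \<open>1 / n\<close> rather than at the times
  \<open>j / m\<close>.\<close>

lemma block_clt_smooth:
  fixes B :: "real \<Rightarrow> 'b \<Rightarrow> real^'d"
  assumes B: "brownian_motion N {0..1} B" and m: "m > 0" and f: "taylor3 f"
  shows "(\<lambda>n. expectation (\<lambda>\<omega>. f (block_incr m (\<lambda>j. walk n (n * j div m) \<omega>)))
    - (\<integral>\<omega>. f (block_incr m (\<lambda>j. B (real (n * j div m) / real n) \<omega>)) \<partial>N)) \<longlonglongrightarrow> 0"
proof -
  obtain C a b where f: "taylor3_with C a b f" using f by (auto simp: taylor3_def)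
  define c where "c = C * (2 * real CARD('d) + q + 3 * real CARD('d) ^ 2)"
  have bound: "norm (expectation (\<lambda>\<omega>. f (block_incr m (\<lambda>j. walk n (n * j div m) \<omega>)))
    - (\<integral>\<omega>. f (block_incr m (\<lambda>j. B (real (n * j div m) / real n) \<omega>)) \<partial>N)) \<le> c / sqrt (real n)" if n: "n > 0" for n
  proof -
    let ?K = "\<lambda>j. n * j div m" and ?s = "1 / sqrt (real n)"
    let ?\<theta> = "\<lambda>k \<omega>. sqrt (real n) *\<^sub>R (B (real (Suc k) / real n) \<omega> - B (real k / real n) \<omega>)"
    have K: "mono ?K" "?K 0 = 0" "?K m = n" using grid_index(1)[OF m] m by auto
    have MI: "iid_steps M {..<n} \<eta> q"
      by unfold_locales (use indep_vars_subset[OF indep] mean cov integrable_norm4 expectation_norm4 in auto)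
    let ?\<beta> = "\<lambda>l. LEAST j. l < ?K (Suc j)"
    have 1: "allotted_sum ?\<beta> ?s \<eta> {..<n} \<omega> = block_incr m (\<lambda>j. walk n (?K j) \<omega>)" for \<omega>
      using allotted_sum_blocks[OF K, of ?s \<eta> \<omega> "\<lambda>k. walk n k \<omega>"] by (simp add: walk_Suc)
    have 2: "allotted_sum ?\<beta> ?s ?\<theta> {..<n} \<omega> = block_incr m (\<lambda>j. B (real (?K j) / real n) \<omega>)" for \<omega>
      using allotted_sum_blocks[OF K, of ?s ?\<theta> \<omega> "\<lambda>k. B (real k / real n) \<omega>"] n by simp
    have "\<bar>(\<integral>\<omega>. f (allotted_sum ?\<beta> ?s \<eta> {..<n} \<omega>) \<partial>M) - (\<integral>\<omega>. f (allotted_sum ?\<beta> ?s ?\<theta> {..<n} \<omega>) \<partial>N)\<bar>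
        \<le> real n * (C * (2 * real CARD('d) + q + 3 * real CARD('d) ^ 2) * ?s ^ 3)"
      by (rule lindeberg_exchange[OF MI brownian_increments_iid[OF B n] f]) simp
    also have "\<dots> = c / sqrt (real n)"
    proof -
      have "real n * ?s ^ 3 = ?s"
        using n by (simp add: power3_eq_cube power_divide)
      moreover have "real n * (x * ?s ^ 3) = x * (real n * ?s ^ 3)" for x by (rule mult.left_commute)
      ultimately show ?thesis unfolding c_def by (simp only: times_divide_eq_right mult_1_right)
    qed
    finally show ?thesis unfolding 1 2 by simp
  qed
  have lim: "(\<lambda>n. c / sqrt (real n)) \<longlonglongrightarrow> 0"
    by (intro tendsto_divide_0[OF tendsto_const] filterlim_at_top_imp_at_infinity
        filterlim_compose[OF sqrt_at_top filterlim_real_sequentially])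
  show ?thesis
    by (rule Lim_null_comparison[OF eventually_mono[OF eventually_gt_at_top[of 0] bound] lim])
qed

text \<open>For a general \<open>G\<close> the increments are truncated, \<open>G\<close> is
  approximated uniformly by a smooth function, and the truncation is removed for \<open>B\<close> by
  dominated convergence. Continuity of the paths of \<open>B\<close> moves the sampling times to
  \<open>j / m\<close>.\<close>

lemma block_clt:
  fixes B :: "real \<Rightarrow> 'b \<Rightarrow> real^'d" and G :: "(nat \<Rightarrow> real^'d) \<Rightarrow> real"
  assumes B: "brownian_motion N {0..1} B" and m: "m > 0"
    and G: "continuous_on UNIV G" "\<And>x. \<bar>G x\<bar> \<le> C"
  shows "(\<lambda>n. expectation (\<lambda>\<omega>. G (block_incr m (\<lambda>j. walk n (n * j div m) \<omega>))))
    \<longlonglongrightarrow> (\<integral>\<omega>. G (block_incr m (\<lambda>j. B (real j / real m) \<omega>)) \<partial>N)"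
proof -
  interpret N: prob_space N using B by (simp add: brownian_motion_def)
  have Bm: "B t \<in> borel_measurable N" if "t \<in> {0..1}" for t
    using B that by (simp add: brownian_motion_def)
  have Bc: "AE \<omega> in N. continuous_on {0..1} (\<lambda>t. B t \<omega>)" using B by (simp add: brownian_motion_def)
  define Xn where "Xn n \<omega> = block_incr m (\<lambda>j. walk n (n * j div m) \<omega>)" for n \<omega>
  define Yn where "Yn n \<omega> = block_incr m (\<lambda>j. B (real (n * j div m) / real n) \<omega>)" for n \<omega>
  define Y where "Y \<omega> = block_incr m (\<lambda>j. B (real j / real m) \<omega>)" for \<omega>
  have unit: "real (n * j div m) / real n \<in> {0..1}" if "j \<le> m" for n j
    using grid_index(3)[OF m that, of n] by (cases "n = 0") (simp_all add: divide_le_eq_1)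
  have unit': "real j / real m \<in> {0..1}" if "j \<le> m" for j using that m by simp
  have Yn_meas: "Yn n \<in> borel_measurable N" for n
  proof (rule measurable_coordinatewise_then_product)
    show "(\<lambda>\<omega>. Yn n \<omega> j) \<in> borel_measurable N" for j
      unfolding Yn_def block_incr_def
      by (cases "j < m") (auto intro!: borel_measurable_diff Bm unit simp del: atLeastAtMost_iff mult_Suc_right)
  qed
  have Y_meas: "Y \<in> borel_measurable N"
  proof (rule measurable_coordinatewise_then_product)
    show "(\<lambda>\<omega>. Y \<omega> j) \<in> borel_measurable N" for j
      unfolding Y_def block_incr_def
      by (cases "j < m") (auto intro!: borel_measurable_diff Bm unit' simp del: atLeastAtMost_iff of_nat_Suc)
  qed
  have grid_lim: "(\<lambda>n. real (n * j div m) / real n) \<longlonglongrightarrow> real j / real m" for j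
  proof -
    have "norm (real (n * j div m) / real n - real j / real m) \<le> 1 / real n" if "n > 0" for n
    proof -
      have "real j / real m = (real n * real j / real m) / real n" using that by simp
      then have "real (n * j div m) / real n - real j / real m = (real (n * j div m) - real n * real j / real m) / real n"
        by (simp add: diff_divide_distrib)
      then show ?thesis
        using grid_index(4,5)[OF m, of n j] that by (simp add: abs_divide divide_right_mono)
    qed
    then have "(\<lambda>n. real (n * j div m) / real n - real j / real m) \<longlonglongrightarrow> 0"
      by (intro Lim_null_comparison[OF _ lim_1_over_n]) (auto simp: eventually_sequentially intro!: exI[of _ 1])
    then show ?thesis by (rule LIM_zero_cancel)
  qed
  have lim_Yn: "(\<lambda>n. \<integral>\<omega>. h (Yn n \<omega>) \<partial>N) \<longlonglongrightarrow> (\<integral>\<omega>. h (Y \<omega>) \<partial>N)"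
    if h: "continuous_on UNIV h" "\<And>x. \<bar>h x\<bar> \<le> C" for h :: "_ \<Rightarrow> real"
  proof (rule integral_dominated_convergence[where w="\<lambda>_. C"])
    show "AE \<omega> in N. (\<lambda>n. h (Yn n \<omega>)) \<longlonglongrightarrow> h (Y \<omega>)"
    using Bc
    proof eventually_elim
      case (elim \<omega>)
      have lim: "(\<lambda>n. B (real (n * j div m) / real n) \<omega>) \<longlonglongrightarrow> B (real j / real m) \<omega>" if "j \<le> m" for j
        by (rule continuous_on_tendsto_compose[OF elim grid_lim]) (use unit unit' that in \<open>auto simp del: atLeastAtMost_iff\<close>)
      have "(\<lambda>n. Yn n \<omega>) \<longlonglongrightarrow> Y \<omega>"
      proof (rule tendsto_coordinatewise)
        show "(\<lambda>n. Yn n \<omega> j) \<longlonglongrightarrow> Y \<omega> j" for j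
          unfolding Yn_def Y_def block_incr_def
          by (cases "j < m") (auto intro!: tendsto_diff lim simp del: of_nat_Suc mult_Suc_right)
      qed
      then show ?case by (rule continuous_on_tendsto_compose[OF h(1)]) auto
    qed
    show "(\<lambda>\<omega>. h (Y \<omega>)) \<in> borel_measurable N" "(\<lambda>\<omega>. h (Yn n \<omega>)) \<in> borel_measurable N" for n
      using measurable_compose[OF _ borel_measurable_continuous_onI[OF h(1)]] Y_meas Yn_meas by blast+
  qed (use h(2) in auto)
  have Gc: "continuous_on UNIV (\<lambda>x. G (clamp_entries R x))" for R
    by (rule continuous_on_compose2[OF G(1) continuous_on_clamp_entries subset_UNIV])
  have lim_R: "(\<lambda>R. \<integral>\<omega>. G (clamp_entries (real R) (Y \<omega>)) \<partial>N) \<longlonglongrightarrow> (\<integral>\<omega>. G (Y \<omega>) \<partial>N)"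
  proof (rule integral_dominated_convergence[where w="\<lambda>_. C"])
    have "(\<lambda>R. G (clamp_entries (real R) (Y \<omega>))) \<longlonglongrightarrow> G (Y \<omega>)" for \<omega>
    proof -
      \<comment> \<open>For each path only \<open>m\<close> entries can be nonzero, so large
        truncation levels have no effect.\<close>
      obtain R0 :: nat where R0: "(\<Sum>j<m. norm (Y \<omega> j)) < real R0" using reals_Archimedean2 by blast
      have "clamp_entries (real R) (Y \<omega>) = Y \<omega>" if "R \<ge> R0" for R
      proof (rule clamp_entries_eq)
        fix j i
        show "\<bar>Y \<omega> j $ i\<bar> \<le> real R"
        proof (cases "j < m")
          case True
          have "\<bar>Y \<omega> j $ i\<bar> \<le> norm (Y \<omega> j)" by (rule component_le_norm_cart)
          also have "\<dots> \<le> (\<Sum>j<m. norm (Y \<omega> j))" using True by (intro member_le_sum) auto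
          finally show ?thesis using R0 that by linarith
        qed (simp add: Y_def block_incr_def)
      qed
      then have "\<forall>\<^sub>F R in sequentially. G (clamp_entries (real R) (Y \<omega>)) = G (Y \<omega>)"
        unfolding eventually_sequentially by (intro exI[of _ R0]) simp
      then show ?thesis by (rule tendsto_eventually)
    qed
    then show "AE \<omega> in N. (\<lambda>R. G (clamp_entries (real R) (Y \<omega>))) \<longlonglongrightarrow> G (Y \<omega>)" by simp
    show "(\<lambda>\<omega>. G (Y \<omega>)) \<in> borel_measurable N"
      by (rule measurable_compose[OF Y_meas borel_measurable_continuous_onI[OF G(1)]])
    show "(\<lambda>\<omega>. G (clamp_entries (real R) (Y \<omega>))) \<in> borel_measurable N" for R
      by (rule measurable_compose[OF Y_meas borel_measurable_continuous_onI[OF Gc]])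
  qed (use G(2) in auto)
  have C: "C \<ge> 0" using G(2)[of undefined] by linarith
  show ?thesis
    unfolding Xn_def[symmetric] Y_def[symmetric]
  proof (rule LIMSEQ_I)
    fix e :: real assume "e > 0"
    \<comment> \<open>Six errors: truncation of the walk, its smoothing, the exchange, the smoothing
      for \<open>B\<close>, the change of sampling times, and the truncation of
      \<open>B\<close>.\<close>
    define e' where "e' = e / 6"
    have e': "e' > 0" using \<open>e > 0\<close> by (simp add: e'_def)
    have "(\<lambda>R. 2 * C * real CARD('d) / real R ^ 2) \<longlonglongrightarrow> 0"
      by (intro tendsto_divide_0[OF tendsto_const] filterlim_at_top_imp_at_infinity filterlim_pow_at_top
          filterlim_real_sequentially) simp
    then have "\<forall>\<^sub>F R in sequentially. 2 * C * real CARD('d) / real R ^ 2 < e'"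
      using e' by (rule order_tendstoD(2))
    moreover have "\<forall>\<^sub>F R in sequentially. dist (\<integral>\<omega>. G (clamp_entries (real R) (Y \<omega>)) \<partial>N) (\<integral>\<omega>. G (Y \<omega>) \<partial>N) < e'"
      using lim_R e' by (rule tendstoD)
    moreover have "\<forall>\<^sub>F R::nat in sequentially. R > 0" by (rule eventually_gt_at_top)
    ultimately have "\<forall>\<^sub>F R in sequentially. 0 < R \<and> 2 * C * real CARD('d) / real R ^ 2 < e' \<and>
        \<bar>(\<integral>\<omega>. G (clamp_entries (real R) (Y \<omega>)) \<partial>N) - (\<integral>\<omega>. G (Y \<omega>) \<partial>N)\<bar> < e'"
      by eventually_elim (simp add: dist_real_def)
    then obtain R :: nat where R: "R > 0" "2 * C * real CARD('d) / real R ^ 2 < e'"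
        "\<bar>(\<integral>\<omega>. G (clamp_entries (real R) (Y \<omega>)) \<partial>N) - (\<integral>\<omega>. G (Y \<omega>) \<partial>N)\<bar> < e'"
      using eventually_happens'[OF sequentially_bot] by blast
    obtain f where f: "taylor3 f" "\<And>x. \<bar>G (clamp_entries (real R) x) - f x\<bar> < e'"
      using taylor3_dense[OF G(1) e', of "real R"] R(1) by auto
    have fc: "continuous_on UNIV f" and fB: "\<exists>D. \<forall>x. \<bar>f x\<bar> \<le> D"
      using f(1) unfolding taylor3_def taylor3_with_def by auto
    then obtain D where D: "\<And>x. \<bar>f x\<bar> \<le> D" by blast
    have Xn_meas: "Xn n \<in> borel_measurable M" for n unfolding Xn_def by (rule block_incr_measurable)
    have close_M: "\<bar>expectation (\<lambda>\<omega>. G (clamp_entries (real R) (Xn n \<omega>))) - expectation (\<lambda>\<omega>. f (Xn n \<omega>))\<bar> \<le> e'" for n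
    proof -
      have "\<bar>expectation (\<lambda>\<omega>. G (clamp_entries (real R) (Xn n \<omega>))) - expectation (\<lambda>\<omega>. f (Xn n \<omega>))\<bar> \<le> expectation (\<lambda>_. e')"
      proof (rule abs_integral_diff_le)
        show "integrable M (\<lambda>\<omega>. G (clamp_entries (real R) (Xn n \<omega>)))"
          by (rule integrable_const_bound[where B=C])
            (use G(2) measurable_compose[OF Xn_meas borel_measurable_continuous_onI[OF Gc]] in auto)
        show "integrable M (\<lambda>\<omega>. f (Xn n \<omega>))"
          by (rule integrable_const_bound[where B=D])
            (use D measurable_compose[OF Xn_meas borel_measurable_continuous_onI[OF fc]] in auto)
      qed (use f(2) in \<open>auto intro: less_imp_le\<close>)
      then show ?thesis by (simp add: prob_space)
    qed
    have close_N: "\<bar>(\<integral>\<omega>. G (clamp_entries (real R) (Yn n \<omega>)) \<partial>N) - (\<integral>\<omega>. f (Yn n \<omega>) \<partial>N)\<bar> \<le> e'" for n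
    proof -
      have "\<bar>(\<integral>\<omega>. G (clamp_entries (real R) (Yn n \<omega>)) \<partial>N) - (\<integral>\<omega>. f (Yn n \<omega>) \<partial>N)\<bar> \<le> (\<integral>\<omega>. e' \<partial>N)"
      proof (rule abs_integral_diff_le)
        show "integrable N (\<lambda>\<omega>. G (clamp_entries (real R) (Yn n \<omega>)))"
          by (rule N.integrable_const_bound[where B=C])
            (use G(2) measurable_compose[OF Yn_meas borel_measurable_continuous_onI[OF Gc]] in auto)
        show "integrable N (\<lambda>\<omega>. f (Yn n \<omega>))"
          by (rule N.integrable_const_bound[where B=D])
            (use D measurable_compose[OF Yn_meas borel_measurable_continuous_onI[OF fc]] in auto)
      qed (use f(2) in \<open>auto intro: less_imp_le\<close>)
      then show ?thesis by (simp add: N.prob_space)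
    qed
    have "\<forall>\<^sub>F n in sequentially. dist (expectation (\<lambda>\<omega>. f (Xn n \<omega>)) - (\<integral>\<omega>. f (Yn n \<omega>) \<partial>N)) 0 < e'"
      unfolding Xn_def Yn_def by (rule tendstoD[OF block_clt_smooth[OF B m f(1)] e'])
    moreover have "\<forall>\<^sub>F n in sequentially. dist (\<integral>\<omega>. G (clamp_entries (real R) (Yn n \<omega>)) \<partial>N) (\<integral>\<omega>. G (clamp_entries (real R) (Y \<omega>)) \<partial>N) < e'"
      by (rule tendstoD[OF lim_Yn[OF Gc G(2)] e'])
    moreover have "\<forall>\<^sub>F n::nat in sequentially. n > 0" by (rule eventually_gt_at_top)
    ultimately have "\<forall>\<^sub>F n in sequentially. norm (expectation (\<lambda>\<omega>. G (Xn n \<omega>)) - (\<integral>\<omega>. G (Y \<omega>) \<partial>N)) < e"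
    proof eventually_elim
      case (elim n)
      have "\<bar>expectation (\<lambda>\<omega>. G (Xn n \<omega>)) - expectation (\<lambda>\<omega>. G (clamp_entries (real R) (Xn n \<omega>)))\<bar> < e'"
        using block_incr_tail[OF G m elim(3), of "real R"] R(1,2) unfolding Xn_def by simp
      then show ?case
        using close_M[of n] close_N[of n] elim(1,2) R(3) unfolding dist_real_def real_norm_def e'_def by linarith
    qed
    then show "\<exists>no. \<forall>n\<ge>no. norm (expectation (\<lambda>\<omega>. G (Xn n \<omega>)) - (\<integral>\<omega>. G (Y \<omega>) \<partial>N)) < e"
      by (simp add: eventually_sequentially)
  qed
qed

end

section \<open>Regularity of the coefficients\<close>

text \<open>The mean value inequality turns bounds on derivatives into Lipschitz constants. Applied
  once more to \<open>f\<close> minus its linearisation at \<open>y\<close>, the Lipschitz bound for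
  the gradient gives the quadratic remainder.\<close>

lemma C2_bounded_taylor:
  fixes f :: "real^'d \<Rightarrow> real^'e"
  assumes "C2_bounded f"
  obtains L D where "L \<ge> 0" "continuous_on UNIV f" "\<And>l. continuous_on UNIV (D l)"
    "\<And>y. norm (f y) \<le> L" "\<And>l y. norm (D l y) \<le> L"
    "\<And>y v. norm (f (y + v) - f y) \<le> L * norm v" "\<And>l y v. norm (D l (y + v) - D l y) \<le> L * norm v"
    "\<And>y v. norm (f (y + v) - f y - (\<Sum>l\<in>UNIV. v $ l *\<^sub>R D l y)) \<le> L * norm v ^ 2"
proof -
  obtain D and D2 :: "'d \<Rightarrow> 'd \<Rightarrow> real^'d \<Rightarrow> real^'e" where
    f': "\<And>x. (f has_derivative (\<lambda>h. \<Sum>i\<in>UNIV. h $ i *\<^sub>R D i x)) (at x)"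
    and D': "\<And>i x. (D i has_derivative (\<lambda>h. \<Sum>j\<in>UNIV. h $ j *\<^sub>R D2 i j x)) (at x)"
    and "bounded (range f)" "\<And>i. bounded (range (D i))" "\<And>i j. bounded (range (D2 i j))"
    using assms unfolding C2_bounded_def by blast
  obtain a where a: "\<And>y. norm (f y) \<le> a" using \<open>bounded (range f)\<close> by (auto simp: bounded_iff)
  obtain b where b: "\<And>i y. norm (D i y) \<le> b i"
    using \<open>\<And>i. bounded (range (D i))\<close> unfolding bounded_iff by (metis rangeI)
  obtain c where c: "\<And>i j y. norm (D2 i j y) \<le> c i j"
    using \<open>\<And>i j. bounded (range (D2 i j))\<close> unfolding bounded_iff by (metis rangeI)
  have b0: "b i \<ge> 0" and c0: "c i j \<ge> 0" for i j
    using b[of i undefined] c[of i j undefined] norm_ge_zero order_trans by blast+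
  have a0: "a \<ge> 0" using a[of undefined] norm_ge_zero order_trans by blast
  have lin: "norm (\<Sum>l\<in>UNIV. h $ l *\<^sub>R u l) \<le> (\<Sum>l\<in>UNIV. d l) * norm h" if "\<And>l. norm (u l) \<le> d l"
    for h :: "real^'d" and u :: "'d \<Rightarrow> real^'e" and d
  proof -
    have "norm (\<Sum>l\<in>UNIV. h $ l *\<^sub>R u l) \<le> (\<Sum>l\<in>UNIV. norm h * d l)"
      by (intro sum_norm_le) (simp add: mult_mono component_le_norm_cart that)
    then show ?thesis by (simp add: sum_distrib_left[symmetric] mult.commute)
  qed
  have onorm_D: "onorm (\<lambda>h. \<Sum>j\<in>UNIV. h $ j *\<^sub>R D2 i j x) \<le> (\<Sum>j\<in>UNIV. c i j)" for i x
    by (rule onorm_le, rule lin, rule c)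
  have onorm_f: "onorm (\<lambda>h. \<Sum>i\<in>UNIV. h $ i *\<^sub>R D i x) \<le> (\<Sum>i\<in>UNIV. b i)" for x
    by (rule onorm_le, rule lin, rule b)
  have D_lip: "norm (D i (y + v) - D i y) \<le> (\<Sum>j\<in>UNIV. c i j) * norm v" for i y v
  proof -
    have "norm (D i (y + v) - D i y) \<le> (\<Sum>j\<in>UNIV. c i j) * norm (y + v - y)"
      by (rule differentiable_bound[OF convex_UNIV, where f'="\<lambda>x h. \<Sum>j\<in>UNIV. h $ j *\<^sub>R D2 i j x"])
        (auto intro: D' onorm_D)
    then show ?thesis by simp
  qed
  have f_lip: "norm (f (y + v) - f y) \<le> (\<Sum>i\<in>UNIV. b i) * norm v" for y v
  proof -
    have "norm (f (y + v) - f y) \<le> (\<Sum>i\<in>UNIV. b i) * norm (y + v - y)"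
      by (rule differentiable_bound[OF convex_UNIV, where f'="\<lambda>x h. \<Sum>i\<in>UNIV. h $ i *\<^sub>R D i x"])
        (auto intro: f' onorm_f)
    then show ?thesis by simp
  qed
  let ?c = "\<Sum>i\<in>UNIV. \<Sum>j\<in>UNIV. c i j"
  have taylor: "norm (f (y + v) - f y - (\<Sum>l\<in>UNIV. v $ l *\<^sub>R D l y)) \<le> ?c * norm v ^ 2" for y v
  proof -
    let ?f' = "\<lambda>x h. \<Sum>i\<in>UNIV. h $ i *\<^sub>R D i x"
    have "norm (f (y + v) - f y - ?f' y (y + v - y)) \<le> norm (y + v - y) * (?c * norm v)"
    \<comment> \<open>On the ball of radius \<open>norm v\<close> the gradient differs from that at
      \<open>y\<close> by at most a multiple of \<open>norm v\<close>.\<close>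
    proof (rule differentiable_bound_linearization[where S="cball y (norm v)" and f'="?f'"])
      show "y + t *\<^sub>R (y + v - y) \<in> cball y (norm v)" if "t \<in> {0..1}" for t
        using that by (simp add: dist_norm mult_left_le_one_le)
      show "(f has_derivative ?f' x) (at x within cball y (norm v))" for x
        by (rule has_derivative_at_withinI[OF f'])
      show "onorm (?f' x - ?f' y) \<le> ?c * norm v" if x: "x \<in> cball y (norm v)" for x
      proof (rule onorm_le)
        fix h
        have Dx: "norm (D i x - D i y) \<le> (\<Sum>j\<in>UNIV. c i j) * norm v" for i
        proof -
          have "norm (D i x - D i y) \<le> (\<Sum>j\<in>UNIV. c i j) * norm (x - y)" using D_lip[of i y "x - y"] by simp
          also have "\<dots> \<le> (\<Sum>j\<in>UNIV. c i j) * norm v"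
            using x c0 by (intro mult_left_mono sum_nonneg) (auto simp: dist_norm norm_minus_commute)
          finally show ?thesis .
        qed
        have "(?f' x - ?f' y) h = (\<Sum>i\<in>UNIV. h $ i *\<^sub>R (D i x - D i y))"
          by (simp add: scaleR_diff_right sum_subtractf)
        also have "norm \<dots> \<le> (\<Sum>i\<in>UNIV. (\<Sum>j\<in>UNIV. c i j) * norm v) * norm h" by (rule lin[OF Dx])
        finally show "norm ((?f' x - ?f' y) h) \<le> ?c * norm v * norm h" by (simp add: sum_distrib_right)
      qed
    qed simp
    then show ?thesis by (simp add: power2_eq_square mult_ac)
  qed
  \<comment> \<open>The summands are nonnegative bounds, so one constant dominates each of
    them.\<close>
  define L where "L = a + (\<Sum>i\<in>UNIV. b i) + ?c"
  have sums: "(\<Sum>i\<in>UNIV. b i) \<ge> 0" "?c \<ge> 0" using b0 c0 by (auto intro!: sum_nonneg)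
  have bi: "b i \<le> (\<Sum>i\<in>UNIV. b i)" for i using b0 by (intro member_le_sum) auto
  have ci: "(\<Sum>j\<in>UNIV. c i j) \<le> ?c" for i
    using c0 by (intro member_le_sum[of i UNIV "\<lambda>i. \<Sum>j\<in>UNIV. c i j"]) (auto intro!: sum_nonneg)
  have le: "a \<le> L" "(\<Sum>i\<in>UNIV. b i) \<le> L" "?c \<le> L" "(\<Sum>j\<in>UNIV. c i j) \<le> L" "b i \<le> L" for i
    using a0 sums bi[of i] ci[of i] by (simp_all add: L_def)
  have r1: "L \<ge> 0" using a0 le(1) by linarith
  have r2: "continuous_on UNIV f" by (rule has_derivative_continuous_on[OF has_derivative_at_withinI[OF f']])
  have r3: "continuous_on UNIV (D l)" for l by (rule has_derivative_continuous_on[OF has_derivative_at_withinI[OF D']])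
  have r4: "norm (f y) \<le> L" for y using a[of y] le(1) by linarith
  have r5: "norm (D l y) \<le> L" for l y using b[of l y] le(5)[of l] by linarith
  have r6: "norm (f (y + v) - f y) \<le> L * norm v" for y v
    by (rule order_trans[OF f_lip mult_right_mono[OF le(2)]]) simp
  have r7: "norm (D l (y + v) - D l y) \<le> L * norm v" for l y v
    by (rule order_trans[OF D_lip mult_right_mono[OF le(4)]]) simp
  have r8: "norm (f (y + v) - f y - (\<Sum>l\<in>UNIV. v $ l *\<^sub>R D l y)) \<le> L * norm v ^ 2" for y v
    by (rule order_trans[OF taylor mult_right_mono[OF le(3)]]) simp
  show ?thesis by (rule that[of L D, OF r1 r2 r3 r4 r5 r6 r7 r8])
qed

text \<open>The constants of the finitely many functions are added, and each norm bound is inherited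
  by every component of the values.\<close>

lemma C2_bounded_regular_coeffs:
  fixes \<phi> :: "'d \<Rightarrow> real^'d \<Rightarrow> real^'e"
  assumes "\<And>i. C2_bounded (\<phi> i)"
  obtains L g where "\<And>c. regular_coeffs L (\<lambda>i y. \<phi> i y $ c) (\<lambda>i l y. g i l y $ c)"
proof -
  define P where "P i L D \<longleftrightarrow> L \<ge> 0 \<and> continuous_on UNIV (\<phi> i) \<and> (\<forall>l. continuous_on UNIV (D l)) \<and>
    (\<forall>y. norm (\<phi> i y) \<le> L) \<and> (\<forall>l y. norm (D l y) \<le> L) \<and>
    (\<forall>y v. norm (\<phi> i (y + v) - \<phi> i y) \<le> L * norm v) \<and> (\<forall>l y v. norm (D l (y + v) - D l y) \<le> L * norm v) \<and>
    (\<forall>y v. norm (\<phi> i (y + v) - \<phi> i y - (\<Sum>l\<in>UNIV. v $ l *\<^sub>R D l y)) \<le> L * norm v ^ 2)"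
    for i L and D :: "'d \<Rightarrow> real^'d \<Rightarrow> real^'e"
  have "\<exists>L D. P i L D" for i
  proof (rule C2_bounded_taylor[OF assms[of i]])
    fix L D
    assume *: "L \<ge> 0" "continuous_on UNIV (\<phi> i)" "\<And>l. continuous_on UNIV (D l)"
      "\<And>y. norm (\<phi> i y) \<le> L" "\<And>l y. norm (D l y) \<le> L"
      "\<And>y v. norm (\<phi> i (y + v) - \<phi> i y) \<le> L * norm v" "\<And>l y v. norm (D l (y + v) - D l y) \<le> L * norm v"
      "\<And>y v. norm (\<phi> i (y + v) - \<phi> i y - (\<Sum>l\<in>UNIV. v $ l *\<^sub>R D l y)) \<le> L * norm v ^ 2"
    have "P i L D" unfolding P_def by (intro conjI allI *)
    then show ?thesis by blast
  qed
  then obtain Li g where P: "\<And>i. P i (Li i) (g i)" by metis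
  note P = P[unfolded P_def]
  define L where "L = (\<Sum>i\<in>UNIV. Li i)"
  have Li: "Li i \<le> L" for i unfolding L_def using P by (intro member_le_sum) auto
  have L0: "L \<ge> 0" using Li[of undefined] P[of undefined] by linarith
  have scale: "Li i * s \<le> L * s" if "s \<ge> 0" for i s using Li that by (rule mult_right_mono)
  have comp: "\<bar>(z::real^'e) $ c\<bar> \<le> b" if "norm z \<le> b'" "b' \<le> b" for z c b b'
    using component_le_norm_cart[of z c] that by linarith
  show ?thesis
  proof (rule that[of L g])
    fix c
    show "regular_coeffs L (\<lambda>i y. \<phi> i y $ c) (\<lambda>i l y. g i l y $ c)"
      unfolding regular_coeffs_def
    proof (intro conjI allI)
      fix i l y v
      have "norm (\<phi> i y) \<le> Li i" "norm (g i l y) \<le> Li i"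
        "norm (\<phi> i (y + v) - \<phi> i y) \<le> Li i * norm v" "norm (g i l (y + v) - g i l y) \<le> Li i * norm v"
        "norm (\<phi> i (y + v) - \<phi> i y - (\<Sum>l\<in>UNIV. v $ l *\<^sub>R g i l y)) \<le> Li i * norm v ^ 2"
        using P[of i] by blast+
      note c1 = comp[OF this(1) Li] comp[OF this(2) Li] comp[OF this(3) scale] comp[OF this(4) scale] comp[OF this(5) scale]
      show "\<bar>\<phi> i y $ c\<bar> \<le> L" "\<bar>g i l y $ c\<bar> \<le> L" by (rule c1)+
      show "\<bar>\<phi> i (y + v) $ c - \<phi> i y $ c\<bar> \<le> L * norm v" using c1(3)[of c] by simp
      show "\<bar>g i l (y + v) $ c - g i l y $ c\<bar> \<le> L * norm v" using c1(4)[of c] by simp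
      show "\<bar>\<phi> i (y + v) $ c - \<phi> i y $ c - (\<Sum>l\<in>UNIV. v $ l * g i l y $ c)\<bar> \<le> L * norm v ^ 2"
        using c1(5)[of c] by simp
    next
      show "continuous_on UNIV (\<lambda>y. \<phi> i y $ c)" for i
        by (rule continuous_on_component) (use P[of i] in blast)
      show "continuous_on UNIV (\<lambda>y. g i l y $ c)" for i l
        by (rule continuous_on_component) (use P[of i] in blast)
    qed (rule L0)
  qed
qed

section \<open>Convergence of the integrals\<close>

text \<open>Turns closeness outside an event of small probability into closeness of expectations; on
  the event the two bounded variables differ by at most \<open>2 * C\<close>.\<close>

lemma (in prob_space) expectation_diff_off_event:
  fixes U V :: "'a \<Rightarrow> real"
  assumes U: "U \<in> borel_measurable M" "\<And>\<omega>. \<omega> \<in> space M \<Longrightarrow> \<bar>U \<omega>\<bar> \<le> C"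
    and V: "V \<in> borel_measurable M" "\<And>\<omega>. \<omega> \<in> space M \<Longrightarrow> \<bar>V \<omega>\<bar> \<le> C"
    and B: "B \<in> events" "\<And>\<omega>. \<omega> \<in> space M - B \<Longrightarrow> \<bar>U \<omega> - V \<omega>\<bar> \<le> a" and "a \<ge> 0" "prob B \<le> b"
  shows "\<bar>expectation U - expectation V\<bar> \<le> a + 2 * C * b"
proof -
  obtain \<omega> where "\<omega> \<in> space M" using not_empty by blast
  then have C: "C \<ge> 0" using U(2)[of \<omega>] by linarith
  have "\<bar>expectation U - expectation V\<bar> \<le> expectation (\<lambda>\<omega>. a + 2 * C * indicator B \<omega>)"
  proof (rule abs_integral_diff_le)
    show "integrable M U" "integrable M V"
      using U V by (auto intro!: integrable_const_bound[where B=C])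
    show "integrable M (\<lambda>\<omega>. a + 2 * C * indicator B \<omega>)"
      by (intro Bochner_Integration.integrable_add integrable_mult_right integrable_const integrable_real_indicator)
        (use B(1) in \<open>auto simp: emeasure_eq_measure\<close>)
    fix \<omega> assume \<omega>: "\<omega> \<in> space M"
    show "\<bar>U \<omega> - V \<omega>\<bar> \<le> a + 2 * C * indicator B \<omega>"
    proof (cases "\<omega> \<in> B")
      case True
      then show ?thesis using U(2)[OF \<omega>] V(2)[OF \<omega>] \<open>a \<ge> 0\<close> by simp
    next
      case False
      then show ?thesis using B(2)[of \<omega>] \<omega> by simp
    qed
  qed
  also have "\<dots> = a + 2 * C * prob B"
    using B(1) by (subst Bochner_Integration.integral_add) (auto simp: prob_space emeasure_eq_measure Int_absorb2 sets.sets_into_space)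
  also have "\<dots> \<le> a + 2 * C * b" using C \<open>prob B \<le> b\<close> by (intro add_left_mono mult_left_mono) auto
  finally show ?thesis .
qed

section \<open>Measurability and passage to components\<close>

lemma lipschitz_real_path_measurable:
  fixes Z :: "real \<Rightarrow> 'a \<Rightarrow> 'v::{real_normed_vector, second_countable_topology}"
  assumes "lipschitz_real C_unit k F"
    and "\<And>\<omega>. \<omega> \<in> space M \<Longrightarrow> continuous_on {0..1} (\<lambda>t. Z t \<omega>)"
    and "\<And>t. t \<in> {0..1} \<Longrightarrow> Z t \<in> borel_measurable M"
  shows "(\<lambda>\<omega>. F (restrict (\<lambda>t. Z t \<omega>) {0..1})) \<in> borel_measurable M"
  using measurable_compose[OF path_in_C_measurable[OF assms(2,3)]
      continuous_map_metric_borel_measurable[OF lipschitz_real_continuous_map[OF assms(1)]]]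
  by (simp add: path_in_C_def[abs_def])

text \<open>Unlike \<open>measurable_lipschitz_pl_C\<close>, this asks for measurability of the
  entries up to \<open>m\<close> only, which suits processes controlled on
  \<open>[0,1]\<close>.\<close>

lemma lipschitz_real_pl_measurable:
  fixes v :: "nat \<Rightarrow> 'a \<Rightarrow> 'v::{real_normed_vector, second_countable_topology}"
  assumes F: "lipschitz_real C_unit k F" and v: "\<And>j. j \<le> m \<Longrightarrow> v j \<in> borel_measurable M"
  shows "(\<lambda>\<omega>. F (pl_C m (\<lambda>j. v j \<omega>))) \<in> borel_measurable M"
proof (rule lipschitz_real_path_measurable[OF F continuous_on_pl])
  show "(\<lambda>\<omega>. pl m (\<lambda>j. v j \<omega>) t) \<in> borel_measurable M" for t
    unfolding pl_def
    by (intro borel_measurable_add borel_measurable_sum borel_measurable_scaleR borel_measurable_diff borel_measurable_const v) auto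
qed

lemma pl_component: "pl m v t $ c = pl m (\<lambda>j. v j $ c) t"
  by (simp add: pl_def)

lemma cell_mean_component:
  fixes f :: "'x::real_normed_vector \<Rightarrow> real^'e"
  assumes "continuous_on UNIV f"
  shows "cell_mean f n x k t $ c = cell_mean (\<lambda>y. f y $ c) n x k t"
proof -
  have "(\<lambda>s. f (pl n x s)) integrable_on {real k / real n..max (real k / real n) (min t (real (Suc k) / real n))}"
    by (intro integrable_continuous_interval pl_continuous_compose assms)
  then show ?thesis by (simp add: cell_mean_def)
qed

lemma pl_integral_component:
  fixes \<phi> :: "'d::finite \<Rightarrow> real^'d \<Rightarrow> real^'e"
  assumes "\<And>i. continuous_on UNIV (\<phi> i)"
  shows "pl_integral \<phi> n x t $ c = pl_integral (\<lambda>i y. \<phi> i y $ c) n x t"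
  by (simp add: pl_integral_def cell_mean_component[OF assms])

lemma trapezoid_component:
  fixes \<phi> :: "'d::finite \<Rightarrow> real^'d \<Rightarrow> real^'e"
  shows "trapezoid \<phi> w r $ c = trapezoid (\<lambda>i y. \<phi> i y $ c) w r"
  by (simp add: trapezoid_def)

lemma trapezoid_cong:
  assumes "\<And>j. j \<le> r \<Longrightarrow> w j = w' j"
  shows "trapezoid f w r = trapezoid f w' r"
  unfolding trapezoid_def using assms by (intro sum.cong) auto

context iid_walk
begin

text \<open>Over each cell the integral is a Lebesgue integral of a function that is jointly
  measurable in \<open>\<omega>\<close> and \<open>s\<close>, because the path is a finite sum of
  ramps with random coefficients.\<close>

lemma pl_integral_measurable:
  fixes \<phi> :: "'d \<Rightarrow> real^'d \<Rightarrow> 'v::euclidean_space"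
  assumes \<phi>: "\<And>i. continuous_on UNIV (\<phi> i)"
  shows "(\<lambda>\<omega>. pl_integral \<phi> n (\<lambda>k. walk n k \<omega>) t) \<in> borel_measurable M"
proof -
  have [measurable]: "ramp \<in> borel_measurable borel"
    by (intro borel_measurable_continuous_onI continuous_intros)
  have "(\<lambda>\<omega>. integral {a..b} (\<lambda>s. \<phi> i (pl n (\<lambda>k. walk n k \<omega>) s))) \<in> borel_measurable M" for i a b
  proof -
    have "integral {a..b} (\<lambda>s. \<phi> i (pl n (\<lambda>k. walk n k \<omega>) s))
        = (\<integral>s. indicator {a..b} s *\<^sub>R \<phi> i (pl n (\<lambda>k. walk n k \<omega>) s) \<partial>lborel)" for \<omega>
      using set_borel_integral_eq_integral(2)[OF borel_integrable_atLeastAtMost'[OF pl_continuous_compose[OF \<phi>]]]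
      by (simp add: set_lebesgue_integral_def)
    moreover have "(\<lambda>\<omega>. \<integral>s. indicator {a..b} s *\<^sub>R \<phi> i (pl n (\<lambda>k. walk n k \<omega>) s) \<partial>lborel) \<in> borel_measurable M"
    proof (rule lborel.borel_measurable_lebesgue_integral)
      have "(\<lambda>z. pl n (\<lambda>k. walk n k (fst z)) (snd z)) \<in> borel_measurable (M \<Otimes>\<^sub>M lborel)"
        unfolding pl_def by measurable
      note [measurable] = measurable_compose[OF this borel_measurable_continuous_onI[OF \<phi>]]
      show "(\<lambda>(\<omega>, s). indicator {a..b} s *\<^sub>R \<phi> i (pl n (\<lambda>k. walk n k \<omega>) s)) \<in> borel_measurable (M \<Otimes>\<^sub>M lborel)"
        unfolding case_prod_unfold by measurable
    qed
    ultimately show ?thesis by simp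
  qed
  note [measurable] = this
  show ?thesis
    unfolding pl_integral_def cell_mean_def vector_minus_component by measurable
qed

context
  fixes \<phi> :: "'d \<Rightarrow> real^'d \<Rightarrow> real^'e" and g :: "'d \<Rightarrow> 'd \<Rightarrow> real^'d \<Rightarrow> real^'e" and L :: real
  assumes reg: "\<And>c. regular_coeffs L (\<lambda>i y. \<phi> i y $ c) (\<lambda>i l y. g i l y $ c)"
    and cont: "\<And>i. continuous_on UNIV (\<phi> i)"
begin

text \<open>The error is shared equally among the components, and a union bound collects their bad
  events.\<close>

lemma coarse_approximation_vec:
  assumes "e > 0"
  obtains C where "\<And>n m r. \<lbrakk>0 < m; m \<le> n; r \<le> m\<rbrakk> \<Longrightarrow> \<exists>B\<in>events. prob B \<le> C / sqrt (real m) \<and>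
    (\<forall>\<omega>\<in>space M - B. norm (pl_integral \<phi> n (\<lambda>k. walk n k \<omega>) (real r / real m)
        - trapezoid \<phi> (\<lambda>j. walk n (n * j div m) \<omega>) r) \<le> e)"
proof (rule that[of "real CARD('e) * (approx_const L / (e / real CARD('e)))"])
  fix n m r :: nat assume m: "0 < m" "m \<le> n" "r \<le> m"
  let ?e = "e / real CARD('e)"
  have e: "?e > 0" using \<open>e > 0\<close> by simp
  have "\<exists>B. B \<in> events \<and> prob B \<le> approx_const L / (?e * sqrt (real m)) \<and>
     (\<forall>\<omega>\<in>space M - B. \<bar>(pl_integral \<phi> n (\<lambda>k. walk n k \<omega>) (real r / real m)
        - trapezoid \<phi> (\<lambda>j. walk n (n * j div m) \<omega>) r) $ c\<bar> \<le> ?e)" for c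
    by (rule coarse_approximation[OF reg[of c] m e])
      (auto simp: pl_integral_component[OF cont] trapezoid_component)
  then obtain B where B: "\<And>c. B c \<in> events" "\<And>c. prob (B c) \<le> approx_const L / (?e * sqrt (real m))"
    "\<And>c \<omega>. \<omega> \<in> space M - B c \<Longrightarrow> \<bar>(pl_integral \<phi> n (\<lambda>k. walk n k \<omega>) (real r / real m)
        - trapezoid \<phi> (\<lambda>j. walk n (n * j div m) \<omega>) r) $ c\<bar> \<le> ?e" by metis
  show "\<exists>B\<in>events. prob B \<le> real CARD('e) * (approx_const L / ?e) / sqrt (real m) \<and>
    (\<forall>\<omega>\<in>space M - B. norm (pl_integral \<phi> n (\<lambda>k. walk n k \<omega>) (real r / real m)
        - trapezoid \<phi> (\<lambda>j. walk n (n * j div m) \<omega>) r) \<le> e)"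
  proof (intro bexI[of _ "\<Union>c. B c"] conjI ballI)
    show "(\<Union>c. B c) \<in> events" using B(1) by auto
    have "prob (\<Union>c. B c) \<le> (\<Sum>c\<in>UNIV. prob (B c))" using B(1) by (intro measure_UNION_le) auto
    also have "\<dots> \<le> (\<Sum>c\<in>(UNIV::'e set). approx_const L / (?e * sqrt (real m)))" by (intro sum_mono B(2))
    finally show "prob (\<Union>c. B c) \<le> real CARD('e) * (approx_const L / ?e) / sqrt (real m)" by simp
    fix \<omega> assume \<omega>: "\<omega> \<in> space M - (\<Union>c. B c)"
    let ?v = "pl_integral \<phi> n (\<lambda>k. walk n k \<omega>) (real r / real m) - trapezoid \<phi> (\<lambda>j. walk n (n * j div m) \<omega>) r"
    have "norm ?v \<le> (\<Sum>c\<in>UNIV. \<bar>?v $ c\<bar>)" by (rule norm_le_l1_cart)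
    also have "\<dots> \<le> (\<Sum>c\<in>(UNIV::'e set). ?e)" by (intro sum_mono B(3)) (use \<omega> in auto)
    finally show "norm ?v \<le> e" by simp
  qed
qed

text \<open>Again componentwise, with the constants of the components added.\<close>

lemma oscillation_bound_vec:
  assumes "e > 0"
  obtains C where "\<And>n m. \<lbrakk>0 < m; m \<le> n\<rbrakk> \<Longrightarrow> \<exists>B\<in>events. prob B \<le> C / real m \<and>
    (\<forall>\<omega>\<in>space M - B. \<forall>t\<in>{0..1}. norm (pl_integral \<phi> n (\<lambda>k. walk n k \<omega>) t
        - pl m (\<lambda>j. pl_integral \<phi> n (\<lambda>k. walk n k \<omega>) (real j / real m)) t) \<le> e)"
proof -
  let ?e = "e / real CARD('e)"
  have e: "?e > 0" using \<open>e > 0\<close> by simp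
  let ?I = "\<lambda>n t \<omega>. pl_integral \<phi> n (\<lambda>k. walk n k \<omega>) t"
  have "\<exists>C. \<forall>n m. 0 < m \<longrightarrow> m \<le> n \<longrightarrow> (\<exists>B\<in>events. prob B \<le> C / real m \<and>
    (\<forall>\<omega>\<in>space M - B. \<forall>t\<in>{0..1}. \<bar>(?I n t \<omega> - pl m (\<lambda>j. ?I n (real j / real m) \<omega>) t) $ c\<bar> \<le> ?e))" for c
    by (rule oscillation_bound[OF reg[of c] e]) (auto simp: pl_integral_component[OF cont] pl_component)
  then obtain C where C: "\<And>c n m. \<lbrakk>0 < m; m \<le> n\<rbrakk> \<Longrightarrow> \<exists>B\<in>events. prob B \<le> C c / real m \<and>
    (\<forall>\<omega>\<in>space M - B. \<forall>t\<in>{0..1}. \<bar>(?I n t \<omega> - pl m (\<lambda>j. ?I n (real j / real m) \<omega>) t) $ c\<bar> \<le> ?e)"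
    by metis
  show ?thesis
  proof (rule that[of "\<Sum>c\<in>UNIV. C c"])
    fix n m :: nat assume m: "0 < m" "m \<le> n"
    obtain B where B: "\<And>c. B c \<in> events" "\<And>c. prob (B c) \<le> C c / real m"
      "\<And>c \<omega> t. \<omega> \<in> space M - B c \<Longrightarrow> t \<in> {0..1} \<Longrightarrow>
        \<bar>(?I n t \<omega> - pl m (\<lambda>j. ?I n (real j / real m) \<omega>) t) $ c\<bar> \<le> ?e"
      using C[OF m] by metis
    show "\<exists>B\<in>events. prob B \<le> (\<Sum>c\<in>UNIV. C c) / real m \<and>
      (\<forall>\<omega>\<in>space M - B. \<forall>t\<in>{0..1}. norm (?I n t \<omega> - pl m (\<lambda>j. ?I n (real j / real m) \<omega>) t) \<le> e)"
    proof (intro bexI[of _ "\<Union>c. B c"] conjI ballI)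
      show "(\<Union>c. B c) \<in> events" using B(1) by auto
      have "prob (\<Union>c. B c) \<le> (\<Sum>c\<in>UNIV. prob (B c))" using B(1) by (intro measure_UNION_le) auto
      also have "\<dots> \<le> (\<Sum>c\<in>UNIV. C c / real m)" by (intro sum_mono B(2))
      finally show "prob (\<Union>c. B c) \<le> (\<Sum>c\<in>UNIV. C c) / real m" by (simp add: sum_divide_distrib)
      fix \<omega> and t :: real assume \<omega>: "\<omega> \<in> space M - (\<Union>c. B c)" and t: "t \<in> {0..1}"
      let ?v = "?I n t \<omega> - pl m (\<lambda>j. ?I n (real j / real m) \<omega>) t"
      have "norm ?v \<le> (\<Sum>c\<in>UNIV. \<bar>?v $ c\<bar>)" by (rule norm_le_l1_cart)
      also have "\<dots> \<le> (\<Sum>c\<in>(UNIV::'e set). ?e)" by (intro sum_mono B(3) t) (use \<omega> in auto)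
      finally show "norm ?v \<le> e" by simp
    qed
  qed
qed

end

end

section \<open>Stratonovich sums on regular grids\<close>

lemma grid_division:
  assumes "0 < m" "0 < r"
  shows "(\<lambda>l. {real l / real m..real (Suc l) / real m}) ` {..<r} division_of {0..real r / real m}"
  using assms(2)
proof (induction r rule: nat_induct_non_zero)
  case 1
  have "{cbox 0 (1 / real m)} division_of cbox 0 (1 / real m)"
    using assms(1) by (intro division_of_self) simp
  then show ?case by (simp add: lessThan_Suc)
next
  case (Suc r)
  let ?c = "{real r / real m..real (Suc r) / real m}"
  have le: "real r / real m \<le> real (Suc r) / real m" by (simp add: divide_right_mono)
  have "{cbox (real r / real m) (real (Suc r) / real m)} division_of cbox (real r / real m) (real (Suc r) / real m)"
    using le by (intro division_of_self) simp
  then have "{?c} division_of ?c" by simp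
  from division_disjoint_union[OF Suc.IH this]
  have "(\<lambda>l. {real l / real m..real (Suc l) / real m}) ` {..<r} \<union> {?c} division_of {0..real r / real m} \<union> ?c"
    by (simp add: interior_atLeastAtMost_real disjoint_iff)
  moreover have "{0..real r / real m} \<union> ?c = {0..real (Suc r) / real m}"
    by (rule ivl_disj_un_two_touch) (use le in auto)
  ultimately show ?case by (simp add: lessThan_Suc Un_commute)
qed

text \<open>The sum of the definition runs over a set of intervals; as distinct indices give
  distinct intervals, it may be indexed by \<open>l\<close>.\<close>

lemma stratonovich_sum_grid:
  assumes "0 < m"
  shows "stratonovich_sum Y X ((\<lambda>l. {real l / real m..real (Suc l) / real m}) ` {..<r}) \<omega>
    = (\<Sum>l<r. (X (real (Suc l) / real m) \<omega> - X (real l / real m) \<omega>) *\<^sub>R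
        ((1 / 2) *\<^sub>R (Y (real l / real m) \<omega> + Y (real (Suc l) / real m) \<omega>)))"
proof -
  let ?c = "\<lambda>l. {real l / real m..real (Suc l) / real m}"
  have le: "real l / real m \<le> real (Suc l) / real m" for l by (simp add: divide_right_mono)
  have bounds: "Inf (?c l) = real l / real m" "Sup (?c l) = real (Suc l) / real m" for l
    using le[of l] by (simp_all del: of_nat_Suc)
  have "inj_on ?c {..<r}"
  proof (rule inj_onI)
    fix l l' assume "?c l = ?c l'"
    then have "real l / real m = real l' / real m" using bounds(1) by metis
    then show "l = l'" using assms by simp
  qed
  then show ?thesis unfolding stratonovich_sum_def by (simp add: sum.reindex bounds del: of_nat_Suc)
qed

text \<open>Refining the grid by a factor \<open>p\<close> keeps the times \<open>j / m\<close> as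
  grid points with index \<open>j * p\<close>, so a single grid serves all of them at once.\<close>

lemma stratonovich_integral_grid:
  assumes J: "stratonovich_integral N Y X J" and m: "0 < m" and j: "j \<le> m" and "\<epsilon> > 0" "\<eta> > 0"
  shows "\<forall>\<^sub>F p in sequentially. measure N {\<omega>\<in>space N.
    norm ((\<Sum>l<j * p. (X (real (Suc l) / real (m * p)) \<omega> - X (real l / real (m * p)) \<omega>) *\<^sub>R
        ((1 / 2) *\<^sub>R (Y (real l / real (m * p)) \<omega> + Y (real (Suc l) / real (m * p)) \<omega>))) - J (real j / real m) \<omega>) > \<epsilon>} < \<eta>"
proof -
  have t: "real j / real m \<in> {0..1}" using j m by simp
  then obtain \<delta> where \<delta>: "\<delta> > 0" "\<And>\<D>. \<D> division_of {0..real j / real m} \<Longrightarrow> \<forall>K\<in>\<D>. Sup K - Inf K < \<delta> \<Longrightarrow>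
      measure N {\<omega>\<in>space N. norm (stratonovich_sum Y X \<D> \<omega> - J (real j / real m) \<omega>) > \<epsilon>} < \<eta>"
    using J[unfolded stratonovich_integral_def, THEN conjunct2, rule_format, OF t, THEN conjunct2, rule_format, OF \<open>\<epsilon> > 0\<close> \<open>\<eta> > 0\<close>]
    by auto
  show ?thesis
  proof (cases "j = 0")
    case True
    \<comment> \<open>For \<open>j = 0\<close> the interval is a point, which is divided by itself
      and not by the empty set; its cell contributes 0, like the empty sum.\<close>
    have "{cbox 0 0} division_of cbox 0 (0::real)" by (rule division_of_self) simp
    then have "{{0}} division_of {0..real j / real m}" using True by simp
    from \<delta>(2)[OF this] have "measure N {\<omega>\<in>space N. norm (stratonovich_sum Y X {{0}} \<omega> - J (real j / real m) \<omega>) > \<epsilon>} < \<eta>"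
      using \<delta>(1) by simp
    then show ?thesis using True by (simp add: stratonovich_sum_def)
  next
    case False
    obtain p0 :: nat where p0: "1 / \<delta> < real p0" using reals_Archimedean2 by blast
    have "measure N {\<omega>\<in>space N.
      norm ((\<Sum>l<j * p. (X (real (Suc l) / real (m * p)) \<omega> - X (real l / real (m * p)) \<omega>) *\<^sub>R
        ((1 / 2) *\<^sub>R (Y (real l / real (m * p)) \<omega> + Y (real (Suc l) / real (m * p)) \<omega>))) - J (real j / real m) \<omega>) > \<epsilon>} < \<eta>"
      if p: "p \<ge> p0" for p
    proof -
      have "0 < real p0" using p0 \<delta>(1) by (meson less_trans zero_less_divide_1_iff)
      then have p_pos: "p > 0" using p by simp
      then have mp: "0 < m * p" using m by simp
      let ?D = "(\<lambda>l. {real l / real (m * p)..real (Suc l) / real (m * p)}) ` {..<j * p}"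
      have "real (j * p) / real (m * p) = real j / real m" using p_pos by simp
      then have D: "?D division_of {0..real j / real m}"
        using grid_division[OF mp, of "j * p"] False p_pos by simp
      have "real p \<le> real (m * p)" using m by (simp only: of_nat_le_iff) simp
      then have "1 / \<delta> < real (m * p)" using p0 p by linarith
      then have fine: "1 / real (m * p) < \<delta>" using \<delta>(1) mp by (simp add: field_simps)
      have "\<forall>K\<in>?D. Sup K - Inf K < \<delta>"
      proof
        fix K assume "K \<in> ?D"
        then obtain l where K: "K = {real l / real (m * p)..real (Suc l) / real (m * p)}" by blast
        have "real l / real (m * p) \<le> real (Suc l) / real (m * p)" by (intro divide_right_mono) auto
        then have "Sup K - Inf K = real (Suc l) / real (m * p) - real l / real (m * p)"
          unfolding K by (simp del: of_nat_Suc of_nat_mult)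
        also have "\<dots> = 1 / real (m * p)" by (simp add: diff_divide_distrib[symmetric])
        finally show "Sup K - Inf K < \<delta>" using fine by simp
      qed
      from \<delta>(2)[OF D this] show ?thesis unfolding stratonovich_sum_grid[OF mp] .
    qed
    then show ?thesis unfolding eventually_sequentially by blast
  qed
qed

context iid_walk
begin

text \<open>The comparison runs from the path of the walk to its interpolation
  (\<open>step1\<close>), to the interpolated trapezoidal sums of the walk (\<open>step2\<close>),
  to those of \<open>B\<close> (the limit theorem \<open>block_clt\<close>), to the interpolated
  Stratonovich integral (\<open>step4\<close>), and finally to its path.\<close>

lemma pl_integral_weak_limit:
  fixes \<phi> :: "'d \<Rightarrow> real^'d \<Rightarrow> real^'e" and B :: "real \<Rightarrow> 'b \<Rightarrow> real^'d"
  assumes reg: "\<And>c. regular_coeffs L (\<lambda>i y. \<phi> i y $ c) (\<lambda>i l y. g i l y $ c)"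
    and cont: "\<And>i. continuous_on UNIV (\<phi> i)"
    and B: "brownian_motion N {0..1} B"
    and J: "\<And>i. stratonovich_integral N (\<lambda>t \<omega>. \<phi> i (B t \<omega>)) (\<lambda>t \<omega>. B t \<omega> $ i) (J i)"
    and F: "lipschitz_real C_unit k F" "k \<ge> 0" "\<And>z. z \<in> mspace C_unit \<Longrightarrow> \<bar>F z\<bar> \<le> C"
  shows "(\<lambda>n. \<integral>\<omega>. F (restrict (pl_integral \<phi> n (\<lambda>k. walk n k \<omega>)) {0..1}) \<partial>M)
    \<longlonglongrightarrow> (\<integral>\<omega>. F (restrict (\<lambda>t. \<Sum>i\<in>UNIV. J i t \<omega>) {0..1}) \<partial>N)"
proof -
  interpret N: prob_space N using B by (simp add: brownian_motion_def)
  let ?d = "real CARD('d)"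
  define Jt where "Jt t \<omega> = (\<Sum>i\<in>UNIV. J i t \<omega>)" for t \<omega>
  define In where "In n t \<omega> = pl_integral \<phi> n (\<lambda>k. walk n k \<omega>) t" for n t \<omega>
  have J_meas: "J i t \<in> borel_measurable N" if "t \<in> {0..1}" for i t
    using J[of i] that by (simp add: stratonovich_integral_def)
  have Jt_meas: "Jt t \<in> borel_measurable N" if "t \<in> {0..1}" for t
    unfolding Jt_def[abs_def] using J_meas[OF that] by simp
  have Jt_cont: "continuous_on {0..1} (\<lambda>t. Jt t \<omega>)" if "\<omega> \<in> space N" for \<omega>
    unfolding Jt_def using J that by (intro continuous_on_sum) (simp add: stratonovich_integral_def)
  have B_meas: "B t \<in> borel_measurable N" if "t \<in> {0..1}" for t
    using B that by (simp add: brownian_motion_def)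
  have F_pl: "\<bar>F (pl_C m v)\<bar> \<le> C" for m v by (rule F(3)[OF C_unitI[OF continuous_on_pl]])
  have C: "C \<ge> 0" using F_pl[of 0 undefined] by linarith
  have F_close: "\<bar>F (restrict z {0..1}) - F (restrict w {0..1})\<bar> \<le> k * \<delta>"
    if "continuous_on {0..1} z" "continuous_on {0..1} w" "\<And>t. t \<in> {0..1} \<Longrightarrow> norm (z t - w t) \<le> \<delta>" for z w \<delta>
  proof -
    have "\<bar>F (restrict z {0..1}) - F (restrict w {0..1})\<bar> \<le> k * mdist C_unit (restrict z {0..1}) (restrict w {0..1})"
      using F(1) C_unitI[OF that(1)] C_unitI[OF that(2)] unfolding lipschitz_real_def by blast
    also have "\<dots> \<le> k * \<delta>" by (intro mult_left_mono C_unit_mdist_le that(3) F(2)) auto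
    finally show ?thesis .
  qed
  note F_path = lipschitz_real_path_measurable[OF F(1)]
  have In_cont: "continuous_on {0..1} (\<lambda>t. In n t \<omega>)" for n \<omega>
    unfolding In_def using continuous_on_pl_integral[OF cont] .
  have In_meas: "In n t \<in> borel_measurable M" for n t
    unfolding In_def[abs_def] by (rule pl_integral_measurable[OF cont])
  have FIn_meas: "(\<lambda>\<omega>. F (restrict (\<lambda>t. In n t \<omega>) {0..1})) \<in> borel_measurable M" for n
    by (rule F_path[OF In_cont In_meas])
  have grid: "real j / real m \<in> {0..1}" if "j \<le> m" for j m :: nat
    using that by (cases "m = 0") (simp_all add: divide_le_eq_1)
  have lim_m: "(\<lambda>m. \<integral>\<omega>. F (pl_C m (\<lambda>j. Jt (real j / real m) \<omega>)) \<partial>N)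
      \<longlonglongrightarrow> (\<integral>\<omega>. F (restrict (\<lambda>t. Jt t \<omega>) {0..1}) \<partial>N)"
  proof (rule integral_dominated_convergence[where w="\<lambda>_. C"])
    show "(\<lambda>\<omega>. F (restrict (\<lambda>t. Jt t \<omega>) {0..1})) \<in> borel_measurable N" by (rule F_path[OF Jt_cont Jt_meas])
    show "(\<lambda>\<omega>. F (pl_C m (\<lambda>j. Jt (real j / real m) \<omega>))) \<in> borel_measurable N" for m
      by (intro lipschitz_real_pl_measurable[OF F(1)] Jt_meas grid)
    show "AE \<omega> in N. (\<lambda>m. F (pl_C m (\<lambda>j. Jt (real j / real m) \<omega>))) \<longlonglongrightarrow> F (restrict (\<lambda>t. Jt t \<omega>) {0..1})"
      by (intro AE_I2 pl_C_lipschitz_tendsto[OF F(1,2)] Jt_cont)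
  qed (use F_pl in auto)
  show ?thesis
    unfolding In_def[symmetric] Jt_def[symmetric]
  proof (rule LIMSEQ_I)
    fix e :: real assume "e > 0"
    \<comment> \<open>The error \<open>e\<close> is split into eighths: two each for
      \<open>step1\<close>, \<open>step2\<close> and \<open>step4\<close>, one for
      \<open>block_clt\<close> and one for the choice of \<open>m\<close>. The added 1 admits
      \<open>k = 0\<close>.\<close>
    define \<delta> where "\<delta> = e / (8 * (k + 1))"
    have \<delta>: "\<delta> > 0" "k * \<delta> \<le> e / 8" using \<open>e > 0\<close> F(2) by (auto simp: \<delta>_def field_simps)
    have k\<delta>: "k * \<delta> \<ge> 0" using \<delta>(1) F(2) by simp
    obtain C1 where C1: "\<And>n m. \<lbrakk>0 < m; m \<le> n\<rbrakk> \<Longrightarrow> \<exists>A\<in>events. prob A \<le> C1 / real m \<and>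
        (\<forall>\<omega>\<in>space M - A. \<forall>t\<in>{0..1}. norm (In n t \<omega> - pl m (\<lambda>j. In n (real j / real m) \<omega>) t) \<le> \<delta>)"
      using oscillation_bound_vec[OF reg cont \<delta>(1)] unfolding In_def by metis
    obtain C2 where C2: "\<And>n m r. \<lbrakk>0 < m; m \<le> n; r \<le> m\<rbrakk> \<Longrightarrow> \<exists>A\<in>events. prob A \<le> C2 / sqrt (real m) \<and>
        (\<forall>\<omega>\<in>space M - A. norm (In n (real r / real m) \<omega> - trapezoid \<phi> (\<lambda>j. walk n (n * j div m) \<omega>) r) \<le> \<delta>)"
      using coarse_approximation_vec[OF reg cont \<delta>(1)] unfolding In_def by metis
    have "(\<lambda>m. 2 * C * (C1 / real m)) \<longlonglongrightarrow> 2 * C * 0"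
      by (intro tendsto_mult tendsto_const lim_const_over_n)
    then have "\<forall>\<^sub>F m in sequentially. 2 * C * (C1 / real m) < e / 8"
      using \<open>e > 0\<close> by (intro order_tendstoD(2)) auto
    moreover have "\<forall>\<^sub>F m in sequentially. dist (\<integral>\<omega>. F (pl_C m (\<lambda>j. Jt (real j / real m) \<omega>)) \<partial>N)
        (\<integral>\<omega>. F (restrict (\<lambda>t. Jt t \<omega>) {0..1}) \<partial>N) < e / 8"
      by (rule tendstoD[OF lim_m]) (use \<open>e > 0\<close> in simp)
    moreover have "\<forall>\<^sub>F m::nat in sequentially. m > 0" by (rule eventually_gt_at_top)
    ultimately have "\<forall>\<^sub>F m in sequentially. 2 * C * (C1 / real m) < e / 8 \<and>
        dist (\<integral>\<omega>. F (pl_C m (\<lambda>j. Jt (real j / real m) \<omega>)) \<partial>N) (\<integral>\<omega>. F (restrict (\<lambda>t. Jt t \<omega>) {0..1}) \<partial>N) < e / 8 \<and> m > 0"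
      by eventually_elim blast
    then obtain m :: nat where m: "m > 0" "2 * C * (C1 / real m) < e / 8"
        "\<bar>(\<integral>\<omega>. F (pl_C m (\<lambda>j. Jt (real j / real m) \<omega>)) \<partial>N) - (\<integral>\<omega>. F (restrict (\<lambda>t. Jt t \<omega>) {0..1}) \<partial>N)\<bar> < e / 8"
      using eventually_happens'[OF sequentially_bot] unfolding dist_real_def by blast
    \<comment> \<open>There are \<open>(m + 1) * d\<close> bad events, one for each grid time and
      each integrator. Together they weigh at most \<open>e / (16 * (C + 1))\<close>, and
      \<open>2 * C\<close> times this is at most \<open>e / 8\<close>.\<close>
    define \<eta> where "\<eta> = e / (16 * (C + 1)) / ((real m + 1) * ?d)"
    have \<eta>: "\<eta> > 0" using \<open>e > 0\<close> C by (simp add: \<eta>_def)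
    have \<delta>d: "\<delta> / ?d > 0" using \<delta>(1) by simp
    let ?S = "\<lambda>i j p \<omega>. (\<Sum>l<j * p. (B (real (Suc l) / real (m * p)) \<omega> $ i - B (real l / real (m * p)) \<omega> $ i) *\<^sub>R
        ((1 / 2) *\<^sub>R (\<phi> i (B (real l / real (m * p)) \<omega>) + \<phi> i (B (real (Suc l) / real (m * p)) \<omega>))))"
    let ?A = "\<lambda>i j p. {\<omega>\<in>space N. norm (?S i j p \<omega> - J i (real j / real m) \<omega>) > \<delta> / ?d}"
    have "\<forall>\<^sub>F p in sequentially. measure N (?A i j p) < \<eta>" if "j \<le> m" for i j
      by (rule stratonovich_integral_grid[OF J m(1) that \<delta>d \<eta>])
    then have "\<forall>\<^sub>F p in sequentially. \<forall>j\<in>{..m}. \<forall>i\<in>UNIV. measure N (?A i j p) < \<eta>"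
      by (intro eventually_ball_finite finite ballI finite_atMost) (simp only: atMost_iff)
    moreover have "\<forall>\<^sub>F p in sequentially. 2 * C * ((real m + 1) * (C2 / sqrt (real (m * p)))) < e / 8"
    proof -
      have "filterlim (\<lambda>p. sqrt (real (m * p))) at_top sequentially"
        by (intro filterlim_compose[OF sqrt_at_top] filterlim_compose[OF filterlim_real_sequentially]
            mult_nat_left_at_top m)
      then have "(\<lambda>p. C2 / sqrt (real (m * p))) \<longlonglongrightarrow> 0"
        by (intro tendsto_divide_0[OF tendsto_const] filterlim_at_top_imp_at_infinity)
      then have "(\<lambda>p. 2 * C * ((real m + 1) * (C2 / sqrt (real (m * p))))) \<longlonglongrightarrow> 2 * C * ((real m + 1) * 0)"
        by (intro tendsto_mult tendsto_const)
      then show ?thesis using \<open>e > 0\<close> by (intro order_tendstoD(2)) auto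
    qed
    moreover have "\<forall>\<^sub>F p::nat in sequentially. p > 0" by (rule eventually_gt_at_top)
    ultimately have "\<forall>\<^sub>F p in sequentially. (\<forall>j\<in>{..m}. \<forall>i\<in>UNIV. measure N (?A i j p) < \<eta>) \<and>
        2 * C * ((real m + 1) * (C2 / sqrt (real (m * p)))) < e / 8 \<and> p > 0"
      by eventually_elim blast
    from eventually_happens'[OF sequentially_bot this]
    obtain p :: nat where p: "p > 0" "2 * C * ((real m + 1) * (C2 / sqrt (real (m * p)))) < e / 8"
      and p_A: "\<forall>j\<in>{..m}. \<forall>i\<in>UNIV. measure N (?A i j p) < \<eta>"
      by (elim exE conjE)
    have p_A: "measure N (?A i j p) < \<eta>" if "j \<le> m" for i j
      by (rule p_A[THEN bspec, THEN bspec]) (use that in simp_all)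
    \<comment> \<open>The partial sums rebuild the values at the grid times from the increments,
      starting at 0, so the functional becomes a bounded continuous function \<open>G\<close> of
      finitely many increments.\<close>
    define T where "T v j = trapezoid \<phi> (\<lambda>i. \<Sum>l<i. v l) (j * p)" for v :: "nat \<Rightarrow> real^'d" and j
    define G where "G v = F (pl_C m (T v))" for v
    have G_cont: "continuous_on UNIV G"
    proof -
      have psum: "continuous_on UNIV (\<lambda>v::nat \<Rightarrow> real^'d. \<Sum>l<i. v l)" for i
        by (intro continuous_intros continuous_on_product_coordinates)
      have "continuous_on UNIV (\<lambda>v. T v j)" for j
        unfolding T_def trapezoid_def
        by (intro continuous_intros psum continuous_on_component continuous_on_compose2[OF cont psum] subset_UNIV)
      then have "continuous_on UNIV T" by (rule continuous_on_coordinatewise_then_product)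
      then show ?thesis
        unfolding G_def
        by (rule continuous_on_compose2[OF continuous_on_lipschitz_pl_C[OF F(1,2) m(1)] _ subset_UNIV])
    qed
    have G_le: "\<bar>G v\<bar> \<le> C" for v unfolding G_def by (rule F_pl)
    have mp: "m * p > 0" using m(1) p(1) by simp
    define Xn where "Xn n \<omega> = block_incr (m * p) (\<lambda>j. walk n (n * j div (m * p)) \<omega>)" for n \<omega>
    define Y where "Y \<omega> = block_incr (m * p) (\<lambda>j. B (real j / real (m * p)) \<omega>)" for \<omega>
    have T_block: "T (block_incr (m * p) w) j = trapezoid \<phi> (\<lambda>i. w i - w 0) (j * p)" if "j \<le> m" for w j
      unfolding T_def using that by (intro trapezoid_cong sum_block_incr) (meson le_trans mult_le_mono1)
    have GX_meas: "(\<lambda>\<omega>. G (Xn n \<omega>)) \<in> borel_measurable M" for n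
      unfolding Xn_def by (rule measurable_compose[OF block_incr_measurable borel_measurable_continuous_onI[OF G_cont]])
    have grid_mp: "real j / real m = real (j * p) / real (m * p)" for j using p(1) by simp
    have step2: "\<bar>(\<integral>\<omega>. F (pl_C m (\<lambda>j. In n (real j / real m) \<omega>)) \<partial>M) - (\<integral>\<omega>. G (Xn n \<omega>) \<partial>M)\<bar> \<le> e / 8 + e / 8"
      if n: "m * p \<le> n" for n
    proof -
      have "\<exists>A. A \<in> events \<and> prob A \<le> C2 / sqrt (real (m * p)) \<and> (\<forall>\<omega>\<in>space M - A.
          norm (In n (real j / real m) \<omega> - trapezoid \<phi> (\<lambda>i. walk n (n * i div (m * p)) \<omega>) (j * p)) \<le> \<delta>)" if "j \<le> m" for j
        using C2[OF mp n, of "j * p"] that unfolding grid_mp by auto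
      then obtain A where A: "\<And>j. j \<le> m \<Longrightarrow> A j \<in> events" "\<And>j. j \<le> m \<Longrightarrow> prob (A j) \<le> C2 / sqrt (real (m * p))"
        "\<And>j \<omega>. j \<le> m \<Longrightarrow> \<omega> \<in> space M - A j \<Longrightarrow>
          norm (In n (real j / real m) \<omega> - trapezoid \<phi> (\<lambda>i. walk n (n * i div (m * p)) \<omega>) (j * p)) \<le> \<delta>"
        by metis
      have "prob (\<Union>j\<le>m. A j) \<le> (\<Sum>j\<le>m. prob (A j))" using A(1) by (intro measure_UNION_le) auto
      also have "\<dots> \<le> (\<Sum>j\<le>m. C2 / sqrt (real (m * p)))" using A(2) by (intro sum_mono) auto
      also have "\<dots> = (real m + 1) * (C2 / sqrt (real (m * p)))" by (simp add: add.commute)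
      finally have prob_A: "prob (\<Union>j\<le>m. A j) \<le> (real m + 1) * (C2 / sqrt (real (m * p)))" .
      have "\<bar>(\<integral>\<omega>. F (pl_C m (\<lambda>j. In n (real j / real m) \<omega>)) \<partial>M) - (\<integral>\<omega>. G (Xn n \<omega>) \<partial>M)\<bar>
          \<le> k * \<delta> + 2 * C * ((real m + 1) * (C2 / sqrt (real (m * p))))"
      proof (rule expectation_diff_off_event[OF _ _ GX_meas _ _ _ k\<delta> prob_A])
        show "(\<lambda>\<omega>. F (pl_C m (\<lambda>j. In n (real j / real m) \<omega>))) \<in> borel_measurable M"
          by (rule measurable_lipschitz_pl_C[OF F(1,2) m(1)]) (use In_meas in simp)
        show "(\<Union>j\<le>m. A j) \<in> events" using A(1) by auto
        fix \<omega> assume \<omega>: "\<omega> \<in> space M - (\<Union>j\<le>m. A j)"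
        show "\<bar>F (pl_C m (\<lambda>j. In n (real j / real m) \<omega>)) - G (Xn n \<omega>)\<bar> \<le> k * \<delta>"
          unfolding G_def
        proof (rule F_close[OF continuous_on_pl continuous_on_pl], rule pl_norm_le[OF m(1)])
          fix j assume j: "j \<le> m"
          then have "T (Xn n \<omega>) j = trapezoid \<phi> (\<lambda>i. walk n (n * i div (m * p)) \<omega>) (j * p)"
            unfolding Xn_def by (simp add: T_block)
          then show "norm (In n (real j / real m) \<omega> - T (Xn n \<omega>) j) \<le> \<delta>" using A(3)[OF j] \<omega> j by auto
        qed auto
      qed (use F_pl G_le in auto)
      then show ?thesis using \<delta>(2) p(2) by linarith
    qed
    have step1: "\<bar>(\<integral>\<omega>. F (restrict (\<lambda>t. In n t \<omega>) {0..1}) \<partial>M) - (\<integral>\<omega>. F (pl_C m (\<lambda>j. In n (real j / real m) \<omega>)) \<partial>M)\<bar>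
        \<le> e / 8 + e / 8" if n: "m \<le> n" for n
    proof -
      obtain A where A: "A \<in> events" "prob A \<le> C1 / real m"
        "\<And>\<omega> t. \<omega> \<in> space M - A \<Longrightarrow> t \<in> {0..1} \<Longrightarrow> norm (In n t \<omega> - pl m (\<lambda>j. In n (real j / real m) \<omega>) t) \<le> \<delta>"
        using C1[OF m(1) n] by blast
      have "\<bar>(\<integral>\<omega>. F (restrict (\<lambda>t. In n t \<omega>) {0..1}) \<partial>M) - (\<integral>\<omega>. F (pl_C m (\<lambda>j. In n (real j / real m) \<omega>)) \<partial>M)\<bar>
          \<le> k * \<delta> + 2 * C * (C1 / real m)"
      proof (rule expectation_diff_off_event[OF FIn_meas _ _ _ A(1) _ k\<delta> A(2)])
        show "(\<lambda>\<omega>. F (pl_C m (\<lambda>j. In n (real j / real m) \<omega>))) \<in> borel_measurable M"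
          by (rule measurable_lipschitz_pl_C[OF F(1,2) m(1)]) (use In_meas in simp)
        show "\<bar>F (restrict (\<lambda>t. In n t \<omega>) {0..1}) - F (pl_C m (\<lambda>j. In n (real j / real m) \<omega>))\<bar> \<le> k * \<delta>"
          if "\<omega> \<in> space M - A" for \<omega>
          by (rule F_close[OF In_cont continuous_on_pl A(3)[OF that]])
      qed (use F_pl F(3)[OF C_unitI[OF In_cont]] in auto)
      then show ?thesis using \<delta>(2) m(2) by linarith
    qed
    have step4: "\<bar>(\<integral>\<omega>. G (Y \<omega>) \<partial>N) - (\<integral>\<omega>. F (pl_C m (\<lambda>j. Jt (real j / real m) \<omega>)) \<partial>N)\<bar> \<le> e / 8 + e / 8"
    proof -
      have unit: "real l / real (m * p) \<in> {0..1}" if "l \<le> m * p" for l using grid[OF that] .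
      have Y_meas: "Y \<in> borel_measurable N"
      proof (rule measurable_coordinatewise_then_product)
        show "(\<lambda>\<omega>. Y \<omega> j) \<in> borel_measurable N" for j
          unfolding Y_def block_incr_def
          by (cases "j < m * p") (auto intro!: borel_measurable_diff B_meas unit simp del: atLeastAtMost_iff of_nat_Suc of_nat_mult)
      qed
      define bad where "bad i j = ?A i j p" for i j
      have p_bad: "measure N (bad i j) < \<eta>" if "j \<le> m" for i j unfolding bad_def by (rule p_A[OF that])
      have A_meas: "bad i j \<in> sets N" if j: "j \<le> m" for i j
      proof -
        have jp: "j * p \<le> m * p" using j by simp
        have "?S i j p \<in> borel_measurable N"
        proof (intro borel_measurable_sum borel_measurable_scaleR borel_measurable_diff borel_measurable_add borel_measurable_const)
          fix l assume "l \<in> {..<j * p}"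
          then have "l < j * p" by simp
          with jp have l: "l \<le> m * p" "Suc l \<le> m * p" by linarith+
          note B' = B_meas[OF unit[OF l(1)]] B_meas[OF unit[OF l(2)]]
          show "(\<lambda>\<omega>. B (real (Suc l) / real (m * p)) \<omega> $ i) \<in> borel_measurable N"
            "(\<lambda>\<omega>. B (real l / real (m * p)) \<omega> $ i) \<in> borel_measurable N"
            by (rule measurable_compose[OF B'(2)], simp, rule measurable_compose[OF B'(1)], simp)
          show "(\<lambda>\<omega>. \<phi> i (B (real l / real (m * p)) \<omega>)) \<in> borel_measurable N"
            "(\<lambda>\<omega>. \<phi> i (B (real (Suc l) / real (m * p)) \<omega>)) \<in> borel_measurable N"
            using measurable_compose[OF _ borel_measurable_continuous_onI[OF cont]] B' by blast+
        qed
        note [measurable] = this J_meas[OF grid[OF j], of i]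
        show ?thesis unfolding bad_def by measurable
      qed
      \<comment> \<open>The starting value of \<open>B\<close> is 0 almost surely only, whereas
        \<open>T\<close> rebuilds paths that start at 0; the exceptional set joins the bad
        events.\<close>
      define Z where "Z = {\<omega>\<in>space N. B 0 \<omega> \<noteq> 0}"
      have B0 [measurable]: "B 0 \<in> borel_measurable N" by (rule B_meas) simp
      have Z: "Z \<in> sets N" unfolding Z_def by measurable
      have "AE \<omega> in N. B 0 \<omega> = 0" using B by (simp add: brownian_motion_def)
      then have Z0: "measure N Z = 0"
        using AE_iff_measurable[OF Z, of "\<lambda>\<omega>. B 0 \<omega> = 0"] by (simp add: Z_def measure_def)
      let ?U = "Z \<union> (\<Union>j\<le>m. \<Union>i. bad i j)"
      have U: "?U \<in> sets N" using Z A_meas by auto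
      have "measure N ?U \<le> measure N Z + measure N (\<Union>j\<le>m. \<Union>i. bad i j)"
        using Z A_meas by (intro measure_Un_le) auto
      also have "measure N (\<Union>j\<le>m. \<Union>i. bad i j) \<le> (\<Sum>j\<le>m. measure N (\<Union>i. bad i j))"
        using A_meas by (intro measure_UNION_le) auto
      also have "\<dots> \<le> (\<Sum>j\<le>m. \<Sum>i\<in>(UNIV::'d set). \<eta>)"
      proof (rule sum_mono)
        fix j assume j: "j \<in> {..m}"
        have "measure N (\<Union>i. bad i j) \<le> (\<Sum>i\<in>UNIV. measure N (bad i j))"
          using A_meas j by (intro measure_UNION_le) auto
        also have "\<dots> \<le> (\<Sum>i\<in>(UNIV::'d set). \<eta>)" by (intro sum_mono less_imp_le[OF p_bad]) (use j in simp)
        finally show "measure N (\<Union>i. bad i j) \<le> (\<Sum>i\<in>(UNIV::'d set). \<eta>)" .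
      qed
      also have "(\<Sum>j\<le>m. \<Sum>i\<in>(UNIV::'d set). \<eta>) = e / (16 * (C + 1))"
      proof -
        have "(\<Sum>j\<le>m. \<Sum>i\<in>(UNIV::'d set). \<eta>) = ((real m + 1) * ?d) * \<eta>" by (simp add: algebra_simps)
        also have "\<dots> = e / (16 * (C + 1))" unfolding \<eta>_def by (subst times_divide_eq_right, rule nonzero_mult_div_cancel_left) (simp add: add_nonneg_eq_0_iff)
        finally show ?thesis .
      qed
      finally have prob_U: "measure N ?U \<le> e / (16 * (C + 1))" using Z0 by simp
      have "\<bar>(\<integral>\<omega>. G (Y \<omega>) \<partial>N) - (\<integral>\<omega>. F (pl_C m (\<lambda>j. Jt (real j / real m) \<omega>)) \<partial>N)\<bar> \<le> k * \<delta> + 2 * C * (e / (16 * (C + 1)))"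
      proof (rule N.expectation_diff_off_event[OF _ _ _ _ U _ k\<delta> prob_U])
        show "(\<lambda>\<omega>. G (Y \<omega>)) \<in> borel_measurable N"
          by (rule measurable_compose[OF Y_meas borel_measurable_continuous_onI[OF G_cont]])
        show "(\<lambda>\<omega>. F (pl_C m (\<lambda>j. Jt (real j / real m) \<omega>))) \<in> borel_measurable N"
          by (intro lipschitz_real_pl_measurable[OF F(1)] Jt_meas grid)
        fix \<omega> assume \<omega>: "\<omega> \<in> space N - ?U"
        then have B0: "B 0 \<omega> = 0" by (auto simp: Z_def)
        show "\<bar>G (Y \<omega>) - F (pl_C m (\<lambda>j. Jt (real j / real m) \<omega>))\<bar> \<le> k * \<delta>"
          unfolding G_def
        proof (rule F_close[OF continuous_on_pl continuous_on_pl], rule pl_norm_le[OF m(1)])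
          fix j assume j: "j \<le> m"
          have "T (Y \<omega>) j = trapezoid \<phi> (\<lambda>l. B (real l / real (m * p)) \<omega>) (j * p)"
            unfolding Y_def T_block[OF j] using B0 by simp
          also have "\<dots> = (\<Sum>i\<in>UNIV. ?S i j p \<omega>)"
            unfolding trapezoid_def by (subst sum.swap) (simp del: of_nat_Suc of_nat_mult)
          finally have diff: "T (Y \<omega>) j - Jt (real j / real m) \<omega> = (\<Sum>i\<in>UNIV. ?S i j p \<omega> - J i (real j / real m) \<omega>)"
            by (simp add: Jt_def sum_subtractf)
          have "norm (\<Sum>i\<in>UNIV. ?S i j p \<omega> - J i (real j / real m) \<omega>) \<le> (\<Sum>i\<in>(UNIV::'d set). \<delta> / ?d)"
          proof (rule sum_norm_le)
            fix i
            have "\<omega> \<notin> bad i j" using \<omega> j by blast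
            then show "norm (?S i j p \<omega> - J i (real j / real m) \<omega>) \<le> \<delta> / ?d"
              using \<omega> by (simp add: bad_def)
          qed
          then show "norm (T (Y \<omega>) j - Jt (real j / real m) \<omega>) \<le> \<delta>" unfolding diff by simp
        qed auto
      qed (use F_pl G_le in auto)
      also have "2 * C * (e / (16 * (C + 1))) \<le> e / 8"
      proof -
        have "2 * C * (e / (16 * (C + 1))) = e / 8 * (C / (C + 1))"
          using C by (simp add: field_simps add_nonneg_eq_0_iff)
        also have "\<dots> \<le> e / 8 * 1" using C \<open>e > 0\<close> by (intro mult_left_mono) auto
        finally show ?thesis by simp
      qed
      finally show ?thesis using \<delta>(2) by linarith
    qed
    have "\<forall>\<^sub>F n in sequentially. dist (\<integral>\<omega>. G (Xn n \<omega>) \<partial>M) (\<integral>\<omega>. G (Y \<omega>) \<partial>N) < e / 8"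
      unfolding Xn_def Y_def by (rule tendstoD[OF block_clt[OF B mp G_cont G_le]]) (use \<open>e > 0\<close> in simp)
    moreover have "\<forall>\<^sub>F n in sequentially. n \<ge> m * p" by (rule eventually_ge_at_top)
    ultimately have "\<forall>\<^sub>F n in sequentially. norm ((\<integral>\<omega>. F (restrict (\<lambda>t. In n t \<omega>) {0..1}) \<partial>M)
        - (\<integral>\<omega>. F (restrict (\<lambda>t. Jt t \<omega>) {0..1}) \<partial>N)) < e"
    proof eventually_elim
      case (elim n)
      have "m * 1 \<le> m * p" using p(1) by (intro mult_le_mono) auto
      then have "m \<le> n" unfolding mult_1_right using elim(2) by (rule le_trans)
      then show ?case
        using step1[of n] step2[OF elim(2)] elim(1) step4 m(3) unfolding dist_real_def real_norm_def by linarith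
    qed
    then show "\<exists>no. \<forall>n\<ge>no. norm ((\<integral>\<omega>. F (restrict (\<lambda>t. In n t \<omega>) {0..1}) \<partial>M)
        - (\<integral>\<omega>. F (restrict (\<lambda>t. Jt t \<omega>) {0..1}) \<partial>N)) < e"
      by (simp add: eventually_sequentially)
  qed
qed

end

text \<open>Serves to shift the index from variables numbered from 1 to steps numbered from 0. A
  finite product over indices in \<open>I\<close> is carried to one over their images.\<close>

lemma (in prob_space) indep_vars_reindex:
  assumes inj: "inj_on h I" and X: "indep_vars M' X (h ` I)"
  shows "indep_vars (\<lambda>i. M' (h i)) (\<lambda>i. X (h i)) I"
  unfolding indep_vars_def2
proof
  show "\<forall>i\<in>I. random_variable (M' (h i)) (X (h i))"
    using X unfolding indep_vars_def2 by blast
  have sets: "indep_sets (\<lambda>i. {X i -` A \<inter> space M | A. A \<in> sets (M' i)}) (h ` I)"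
    using X unfolding indep_vars_def2 by blast
  show "indep_sets (\<lambda>i. {X (h i) -` A \<inter> space M | A. A \<in> sets (M' (h i))}) I"
  proof (rule indep_setsI)
    show "{X (h i) -` A \<inter> space M | A. A \<in> sets (M' (h i))} \<subseteq> events" if "i \<in> I" for i
      using sets that unfolding indep_sets_def by blast
    fix A J assume J: "J \<noteq> {}" "J \<subseteq> I" "finite J"
      and A: "\<forall>j\<in>J. A j \<in> {X (h j) -` A \<inter> space M | A. A \<in> sets (M' (h j))}"
    have inv: "inv_into I h (h j) = j" if "j \<in> J" for j
      using inv_into_f_f[OF inj] J(2) that by blast
    have "prob (\<Inter>i\<in>h ` J. A (inv_into I h i)) = (\<Prod>i\<in>h ` J. prob (A (inv_into I h i)))"
      by (rule indep_setsD[OF sets]) (use J A inv in auto)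
    then show "prob (\<Inter>j\<in>J. A j) = (\<Prod>j\<in>J. prob (A j))"
      by (simp add: prod.reindex[OF inj_on_subset[OF inj J(2)]] inv)
  qed
qed

theorem corollary2:
  fixes M :: "'a measure" and P :: "'c measure" and N :: "'b measure"
    and \<xi> :: "nat \<Rightarrow> 'a \<Rightarrow> real^'d" and X :: "'c \<Rightarrow> real^'d"
    and p :: real
    and \<phi> :: "'d \<Rightarrow> real^'d \<Rightarrow> real^'e"
    and B :: "real \<Rightarrow> 'b \<Rightarrow> real^'d"
    and J :: "'d \<Rightarrow> real \<Rightarrow> 'b \<Rightarrow> real^'e"
  assumes "prob_space M"
    and "prob_space.indep_vars M (\<lambda>_. borel) \<xi> {1..}"
    and "prob_space P"
    and "X \<in> borel_measurable P"
    and "\<And>i. i \<ge> 1 \<Longrightarrow> distr M borel (\<xi> i) = distr P borel X"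
    and "(\<integral>\<omega>. X \<omega> \<partial>P) = 0"
    and "covariance_matrix P X = mat 1"
    and "p \<ge> 4"
    and "integrable P (\<lambda>\<omega>. norm (X \<omega>) powr (2 * p))"
    and "\<And>i. C2_bounded (\<phi> i)"
    and "brownian_motion N {0..1} B"
    and "\<And>i. stratonovich_integral N (\<lambda>t \<omega>. \<phi> i (B t \<omega>)) (\<lambda>t \<omega>. B t \<omega> $ i) (J i)"
  shows "weakly_converges C_unit
    M (\<lambda>n. path_in_C (\<lambda>t \<omega>. \<Sum>i\<in>UNIV.
             RS_integral 0 t (\<lambda>s. \<phi> i (interpolated_walk \<xi> n s \<omega>))
                             (\<lambda>s. interpolated_walk \<xi> n s \<omega> $ i)))
    N (path_in_C (\<lambda>t \<omega>. \<Sum>i\<in>UNIV. J i t \<omega>))"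
proof -
  interpret M: prob_space M by fact
  interpret P: prob_space P by fact
  have N: "prob_space N" using assms(11) by (simp add: brownian_motion_def)
  note X [measurable] = assms(4)
  have \<xi>: "\<xi> i \<in> borel_measurable M" if "i \<ge> 1" for i
    using assms(2) that unfolding M.indep_vars_def2 by simp
  have transfer: "integrable M (\<lambda>\<omega>. f (\<xi> i \<omega>)) \<longleftrightarrow> integrable P (\<lambda>\<omega>. f (X \<omega>))"
      "(\<integral>\<omega>. f (\<xi> i \<omega>) \<partial>M) = (\<integral>\<omega>. f (X \<omega>) \<partial>P)"
    if "f \<in> borel_measurable borel" "i \<ge> 1" for f :: "real^'d \<Rightarrow> real" and i
    using integrable_distr_eq[OF \<xi>[OF that(2)] that(1)] integrable_distr_eq[OF X that(1)]
      integral_distr[OF \<xi>[OF that(2)] that(1)] integral_distr[OF X that(1)] assms(5)[OF that(2)]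
    by simp_all
  \<comment> \<open>Since \<open>2 * p \<ge> 8\<close>, the assumed moment dominates the fourth
    power outside the unit ball, and inside it the fourth power is at most 1.\<close>
  have X4: "integrable P (\<lambda>\<omega>. norm (X \<omega>) ^ 4)"
  proof (rule Bochner_Integration.integrable_bound)
    show "integrable P (\<lambda>\<omega>. 1 + norm (X \<omega>) powr (2 * p))" using assms(9) by simp
    have "norm x ^ 4 \<le> 1 + norm x powr (2 * p)" for x :: "real^'d"
    proof (cases "norm x \<le> 1")
      case True
      then have "norm x ^ 4 \<le> 1" by (simp add: power_le_one)
      then show ?thesis by (simp add: add_increasing2)
    next
      case False
      then have "norm x ^ 4 = norm x powr 4" by (subst powr_realpow[symmetric]) auto
      also have "\<dots> \<le> norm x powr (2 * p)" using False assms(8) by (intro powr_mono) auto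
      finally show ?thesis by simp
    qed
    then show "AE \<omega> in P. norm (norm (X \<omega>) ^ 4) \<le> norm (1 + norm (X \<omega>) powr (2 * p))"
      by (intro AE_I2) (simp add: abs_of_nonneg)
  qed measurable
  \<comment> \<open>Integrability gives the assumption on the mean its content, as the Bochner
    integral of a non-integrable function is 0 by convention, and allows it to be read
    componentwise.\<close>
  have X_int: "integrable P X"
  proof (rule Bochner_Integration.integrable_bound)
    show "integrable P (\<lambda>\<omega>. 1 + norm (X \<omega>) ^ 4)" using X4 by simp
    have "norm x \<le> 1 + norm x ^ 4" for x :: "real^'d"
      using power_increasing[of 1 4 "norm x"] by (cases "norm x \<le> 1") (auto intro: add_increasing2)
    then show "AE \<omega> in P. norm (X \<omega>) \<le> norm (1 + norm (X \<omega>) ^ 4)" by (intro AE_I2) (simp add: abs_of_nonneg)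
  qed measurable
  have X_mean: "(\<integral>\<omega>. X \<omega> $ i \<partial>P) = 0" for i
    using integral_bounded_linear[OF bounded_linear_vec_nth X_int, of i] assms(6) by simp
  have X_cov: "(\<integral>\<omega>. X \<omega> $ i * X \<omega> $ j \<partial>P) = (if i = j then 1 else 0)" for i j
  proof -
    have "covariance_matrix P X $ i $ j = mat 1 $ i $ j" by (simp only: assms(7))
    then show ?thesis by (simp add: covariance_matrix_def X_mean mat_def)
  qed
  interpret W: iid_walk M "\<lambda>k. \<xi> (Suc k)" "\<integral>\<omega>. norm (X \<omega>) ^ 4 \<partial>P"
  proof (unfold_locales, goal_cases)
    case 1
    have "{1..} = range Suc" by (auto simp: image_iff dest: Suc_le_D)
    then show ?case using M.indep_vars_reindex[of Suc UNIV "\<lambda>_. borel" \<xi>] assms(2) by simp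
  next
    case (2 k i)
    then show ?case using transfer(2)[of "\<lambda>x. x $ i" "Suc k"] by (simp add: X_mean)
  next
    case (3 k i j)
    then show ?case using transfer(2)[of "\<lambda>x. x $ i * x $ j" "Suc k"] by (simp add: X_cov)
  next
    case (4 k)
    then show ?case using transfer(1)[of "\<lambda>x. norm x ^ 4" "Suc k"] X4 by simp
  next
    case (5 k)
    then show ?case using transfer(2)[of "\<lambda>x. norm x ^ 4" "Suc k"] by simp
  qed
  have cont: "continuous_on UNIV (\<phi> i)" for i
    using C2_bounded_taylor[OF assms(10)] by metis
  have "\<exists>L g. \<forall>c. regular_coeffs L (\<lambda>i y. \<phi> i y $ c) (\<lambda>i l y. g i l y $ c)"
    by (rule C2_bounded_regular_coeffs[of \<phi>, OF assms(10)]) (intro exI allI)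
  then obtain L g where reg: "\<forall>c. regular_coeffs L (\<lambda>i y. \<phi> i y $ c) (\<lambda>i l y. g i l y $ c)"
    by (elim exE)
  let ?I = "\<lambda>n t \<omega>. pl_integral \<phi> n (\<lambda>k. W.walk n k \<omega>) t"
  have "(\<Sum>i\<in>UNIV. RS_integral 0 t (\<lambda>s. \<phi> i (interpolated_walk \<xi> n s \<omega>)) (\<lambda>s. interpolated_walk \<xi> n s \<omega> $ i))
      = ?I n t \<omega>" if "t \<in> {0..1}" for n t \<omega>
    using that by (intro RS_integral_pl cont) (auto simp: interpolated_walk_eq_pl W.walk_def)
  then have path: "path_in_C (\<lambda>t \<omega>. \<Sum>i\<in>UNIV.
      RS_integral 0 t (\<lambda>s. \<phi> i (interpolated_walk \<xi> n s \<omega>)) (\<lambda>s. interpolated_walk \<xi> n s \<omega> $ i))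
      = path_in_C (?I n)" for n
    unfolding path_in_C_def by (intro ext restrict_ext)
  show ?thesis
    unfolding path
  proof (rule weakly_converges_lipschitz[OF assms(1) N])
    show "path_in_C (?I n) \<in> measurable M (metric_borel C_unit)" for n
      by (intro path_in_C_measurable continuous_on_pl_integral cont W.pl_integral_measurable)
    show "path_in_C (\<lambda>t \<omega>. \<Sum>i\<in>UNIV. J i t \<omega>) \<in> measurable N (metric_borel C_unit)"
      using assms(12) unfolding stratonovich_integral_def
      by (intro path_in_C_measurable continuous_on_sum borel_measurable_sum) simp_all
    fix F :: "(real \<Rightarrow> real^'e) \<Rightarrow> real" and k C
    assume F: "lipschitz_real C_unit k F" "k \<ge> 0" "\<And>x. x \<in> mspace C_unit \<Longrightarrow> \<bar>F x\<bar> \<le> C"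
    show "(\<lambda>n. \<integral>\<omega>. F (path_in_C (?I n) \<omega>) \<partial>M) \<longlonglongrightarrow> (\<integral>\<omega>. F (path_in_C (\<lambda>t \<omega>. \<Sum>i\<in>UNIV. J i t \<omega>) \<omega>) \<partial>N)"
      unfolding path_in_C_def by (rule W.pl_integral_weak_limit[OF reg[THEN spec] cont assms(11,12) F])
  qed
qed

end
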